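(* For any given $\varepsilon>0$ there exist $0<\vartheta\ll1$, $\tilde\vartheta\in(0,1)$ and $C,c>0$ such that for every sufficiently small $T>0$ there exists $\Omega_T\subset\Omega$ with $\mathbb P(\Omega_T^c)<\exp(-cT^{-\tilde\vartheta})$ such that for every $\omega\in\Omega_T$ and all functions $v,B$ on $\mathbb R\times\mathbb T^d$, $$\left|\int_{\mathbb R\times\mathbb T^d}\psi^2\,\overline{(\chi_{I_T}e^{it\Delta}\phi^\omega)\,v}\,B\,dx\,dt\right|\le C\,T^{\vartheta}\,\|\phi\|_{H_x^{\varepsilon-\sigma}}\,\|v\|_{Z^0}\,\|B\|_{B^{\frac1{r_0}-\frac1{q_0}}_{t,r_0,r_0}B^{\theta}_{x,r_0,\infty}},$$ where $I_T=[-T,T]$.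
   Context: Setting: $d\ge1$, $\mathbb T^d=(\mathbb R/2\pi\mathbb Z)^d$, $a>4/d$, $s_c=\frac d2-\frac2a$, $0<s_c<1+a$. Random data: $\{g_n\}_{n\in\mathbb Z^d}$ independent standard complex Gaussians on a probability space $(\Omega,\mathbb P)$; for a fixed small $\delta>0$, $b_n=\langle n\rangle^{-d/2-s_c+\delta}$, $\phi=\sum_nb_ne^{in\cdot x}$, $\phi^\omega=\sum_nb_ng_n(\omega)e^{in\cdot x}$. Parameters: fix $0<\sigma\ll\sigma_1\ll\sigma_2\ll\sigma_3\ll\sigma_4\ll1$ and set $\frac1p=\frac{d/2-\sigma}{d+2}$, $\frac1{q_0}=\frac{2+\sigma_3}{d+2}$, $\frac1{r_0}=\frac{2+\sigma_3+\sigma_2}{d+2}$, $\theta=\frac2{q_0}+\frac d{r_0}-2$. Notation: $\psi$ is a fixed smooth bump function in $t$ supported in $[-1,1]$; $\chi_I$ is the sharp characteristic function of $I$. For dyadic $N\in2^{\mathbb N_0}$, $P_{\le N}$ is the sharp spatial Fourier projection onto $[-N,N]^d$, $P_N=P_{\le N}-P_{\le N/2}$ for $N\geq 2$, $P_1=P_{\le1}$, $u_N=P_Nu$. $P^t_L$ are smooth dyadic Littlewood–Paley projections in time frequency. For a Banach space $E$, $\|u\|_{B^s_{t,p,q}E}=\big(\sum_{L\ge2}L^{qs}\|P^t_Lu\|_{L^p_tE}^q\big)^{1/q}+\|P_1^tu\|_{L^p_tE}$ (usual modification for $q=\infty$), and $B^s_{x,p,q}$ is defined analogously in $x$ with the $P_N$.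 Galilean transform: $I_\xi u(t,x)=e^{ix\cdot\xi-it|\xi|^2}u(t,x-2t\xi)$. Space $Z^s$: $$\|u\|_{Z^s}=\max_{q\in[p,1/\sigma]}\Big(\sum_NN^{2(s-\sigma)}\|\psi'u_N\|_{L^q_tL^r_x}^2\Big)^{1/2}+\max_{\alpha\in[\sigma,\frac1p-\sigma]}\Big(\sum_NN^{2s}\Big[\max_{R\in2^{\mathbb N},R\le8N}R^{-(2\alpha+\sigma)}\Big(\sum_{k\in\mathbb Z^d}\|\psi P_{\le8R}I_{Rk}u_N\|_{B^\alpha_{t,p,1}L^p_x}^2\Big)^{1/2}\Big]^2\Big)^{1/2},$$ where in the first term $r$ is given by $\frac2q+\frac dr=\frac d2-\sigma$, and $\psi'$ is a fixed smooth compactly supported time cutoff equal to $1$ on $\operatorname{supp}\psi$. *)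

theory Defs
  imports "HOL-Probability.Probability"
begin

section \<open>Functions on the torus and on space-time\<close>

text \<open>
  The torus \<open>(\<real>/2\<pi>\<int>)^d\<close>, \<open>d = CARD('d)\<close>, is modelled by \<open>2\<pi>\<close>-periodic functions on
  \<open>real ^ 'd\<close>, integrated over the period cell \<open>[0, 2\<pi>]^d\<close> with unnormalised Lebesgue measure.
\<close>

abbreviation dimn :: "'d::finite itself \<Rightarrow> real" where
  "dimn _ \<equiv> real CARD('d)"

definition torus :: "(real ^ 'd) measure" where
  "torus = restrict_space lborel (cbox 0 (\<chi> i. 2 * pi))"

abbreviation spacetime :: "(real \<times> (real ^ 'd)) measure" where
  "spacetime \<equiv> lborel \<Otimes>\<^sub>M torus"

definition rvec :: "int ^ 'd \<Rightarrow> real ^ 'd" where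
  "rvec n = (\<chi> i. real_of_int (n $ i))"

definition japanese :: "int ^ 'd \<Rightarrow> real" where
  "japanese n = sqrt (1 + (norm (rvec n))\<^sup>2)"

definition spacetime_function :: "(real \<Rightarrow> real ^ 'd \<Rightarrow> complex) \<Rightarrow> bool" where
  "spacetime_function u \<longleftrightarrow>
     (\<lambda>(t, x). u t x) \<in> borel_measurable borel \<and>
     (\<forall>t x n. u t (x + (2 * pi) *\<^sub>R rvec n) = u t x)"

definition locally_integrable_in_time :: "(real \<Rightarrow> real ^ 'd \<Rightarrow> complex) \<Rightarrow> bool" where
  "locally_integrable_in_time u \<longleftrightarrow>
     (\<forall>K. set_integrable spacetime ({-K..K} \<times> UNIV) (\<lambda>(t, x). u t x))"

text \<open>
  Functions of this kind are tempered in time, so the Littlewood--Paley projections in the time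
  frequency are given by absolutely convergent convolution integrals (for a.e. \<open>x\<close>).
\<close>

definition tempered_in_time :: "(real \<Rightarrow> real ^ 'd \<Rightarrow> complex) \<Rightarrow> bool" where
  "tempered_in_time u \<longleftrightarrow>
     (\<exists>m::nat. integrable spacetime (\<lambda>(t, x). u t x / complex_of_real ((1 + t\<^sup>2) ^ m)))"


section \<open>Norms with values in the extended nonnegative reals\<close>

text \<open>Real powers; only used for exponents \<open>a > 0\<close>.\<close>

definition ennpow :: "ennreal \<Rightarrow> real \<Rightarrow> ennreal" where
  "ennpow x a = (if x = \<infinity> then \<infinity> else ennreal (enn2real x powr a))"

text \<open>\<open>L^p\<close> norm of a nonnegative function, for \<open>0 < p < \<infinity>\<close>.\<close>

definition Lnorm :: "real \<Rightarrow> 'a measure \<Rightarrow> ('a \<Rightarrow> ennreal) \<Rightarrow> ennreal" where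
  "Lnorm p M f = ennpow (\<integral>\<^sup>+ x. ennpow (f x) p \<partial>M) (1 / p)"

definition Lx :: "real \<Rightarrow> (real ^ 'd \<Rightarrow> complex) \<Rightarrow> ennreal" where
  "Lx r f = Lnorm r torus (\<lambda>x. ennreal (cmod (f x)))"

text \<open>Mixed norm \<open>L^q_t E\<close>, where \<open>E\<close> is the norm of a space of functions on the torus.\<close>

definition LtE :: "real \<Rightarrow> ((real ^ 'd \<Rightarrow> complex) \<Rightarrow> ennreal) \<Rightarrow>
    (real \<Rightarrow> real ^ 'd \<Rightarrow> complex) \<Rightarrow> ennreal" where
  "LtE q E u = Lnorm q lborel (\<lambda>t. E (u t))"

definition seqnorm :: "ennreal \<Rightarrow> (nat \<Rightarrow> ennreal) \<Rightarrow> ennreal" where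
  "seqnorm q f = (if q = \<infinity> then (SUP j. f j)
     else ennpow (\<Sum>j. ennpow (f j) (enn2real q)) (1 / enn2real q))"


section \<open>Frequency projections\<close>

definition fourier_coeff :: "(real ^ 'd \<Rightarrow> complex) \<Rightarrow> int ^ 'd \<Rightarrow> complex" where
  "fourier_coeff f n =
     (\<integral>x. f x * cis (- (x \<bullet> rvec n)) \<partial>torus) / complex_of_real ((2 * pi) ^ CARD('d))"

definition freq_cube :: "nat \<Rightarrow> (int ^ 'd) set" where
  "freq_cube N = {n. \<forall>i. \<bar>n $ i\<bar> \<le> int N}"

definition P_le :: "nat \<Rightarrow> (real ^ 'd \<Rightarrow> complex) \<Rightarrow> real ^ 'd \<Rightarrow> complex" where
  "P_le N f x = (\<Sum>n\<in>freq_cube N. fourier_coeff f n * cis (x \<bullet> rvec n))"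

text \<open>Dyadic numbers are indexed by their exponent: \<open>P_dy j\<close> is \<open>P_N\<close> with \<open>N = 2^j\<close>.\<close>

definition P_dy :: "nat \<Rightarrow> (real ^ 'd \<Rightarrow> complex) \<Rightarrow> real ^ 'd \<Rightarrow> complex" where
  "P_dy j f x = (if j = 0 then P_le 1 f x else P_le (2 ^ j) f x - P_le (2 ^ (j - 1)) f x)"

definition smooth :: "(real \<Rightarrow> real) \<Rightarrow> bool" where
  "smooth f \<longleftrightarrow> (\<forall>n. ((deriv ^^ n) f) differentiable_on UNIV)"

text \<open>A smooth cutoff generating the Littlewood--Paley decomposition in the time frequency.\<close>

definition LP_cutoff :: "(real \<Rightarrow> real) \<Rightarrow> bool" where
  "LP_cutoff \<eta> \<longleftrightarrow> smooth \<eta> \<and> (\<forall>\<tau>. 0 \<le> \<eta> \<tau> \<and> \<eta> \<tau> \<le> 1) \<and>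
     (\<forall>\<tau>. \<bar>\<tau>\<bar> \<le> 1 \<longrightarrow> \<eta> \<tau> = 1) \<and> (\<forall>\<tau>. \<bar>\<tau>\<bar> \<ge> 2 \<longrightarrow> \<eta> \<tau> = 0)"

definition LP_symbol :: "(real \<Rightarrow> real) \<Rightarrow> nat \<Rightarrow> real \<Rightarrow> real" where
  "LP_symbol \<eta> j \<tau> = (if j = 0 then \<eta> \<tau> else \<eta> (\<tau> / 2 ^ j) - \<eta> (\<tau> / 2 ^ (j - 1)))"

definition inverse_fourier :: "(real \<Rightarrow> real) \<Rightarrow> real \<Rightarrow> complex" where
  "inverse_fourier m t =
     (\<integral>\<tau>. complex_of_real (m \<tau>) * cis (t * \<tau>) \<partial>lborel) / complex_of_real (2 * pi)"

text \<open>\<open>Pt_dy \<eta> j\<close> is \<open>P^t_L\<close> with \<open>L = 2^j\<close>, written as a convolution in time.\<close>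

definition Pt_dy :: "(real \<Rightarrow> real) \<Rightarrow> nat \<Rightarrow> (real \<Rightarrow> real ^ 'd \<Rightarrow> complex) \<Rightarrow>
    real \<Rightarrow> real ^ 'd \<Rightarrow> complex" where
  "Pt_dy \<eta> j u t x = (\<integral>s. inverse_fourier (LP_symbol \<eta> j) (t - s) * u s x \<partial>lborel)"


section \<open>Besov norms\<close>

definition besov_x :: "real \<Rightarrow> real \<Rightarrow> ennreal \<Rightarrow> (real ^ 'd \<Rightarrow> complex) \<Rightarrow> ennreal" where
  "besov_x s p q f =
     seqnorm q (\<lambda>j. ennreal ((2 ^ Suc j) powr s) * Lx p (P_dy (Suc j) f)) + Lx p (P_dy 0 f)"

definition besov_t :: "(real \<Rightarrow> real) \<Rightarrow> real \<Rightarrow> real \<Rightarrow> ennreal \<Rightarrow>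
    ((real ^ 'd \<Rightarrow> complex) \<Rightarrow> ennreal) \<Rightarrow> (real \<Rightarrow> real ^ 'd \<Rightarrow> complex) \<Rightarrow> ennreal" where
  "besov_t \<eta> s p q E u =
     seqnorm q (\<lambda>j. ennreal ((2 ^ Suc j) powr s) * LtE p E (Pt_dy \<eta> (Suc j) u))
       + LtE p E (Pt_dy \<eta> 0 u)"


section \<open>The space \<open>Z^s\<close>\<close>

definition galilei :: "real ^ 'd \<Rightarrow> (real \<Rightarrow> real ^ 'd \<Rightarrow> complex) \<Rightarrow>
    real \<Rightarrow> real ^ 'd \<Rightarrow> complex" where
  "galilei \<xi> u t x = cis (x \<bullet> \<xi> - t * (norm \<xi>)\<^sup>2) * u t (x - (2 * t) *\<^sub>R \<xi>)"

definition p_exp :: "'d::finite itself \<Rightarrow> real \<Rightarrow> real" where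
  "p_exp D \<sigma> = (dimn D + 2) / (dimn D / 2 - \<sigma>)"

text \<open>The exponent \<open>r\<close> with \<open>2/q + d/r = d/2 - \<sigma>\<close>.\<close>

definition r_exp :: "'d::finite itself \<Rightarrow> real \<Rightarrow> real \<Rightarrow> real" where
  "r_exp D \<sigma> q = dimn D / (dimn D / 2 - \<sigma> - 2 / q)"

definition Z_strichartz :: "(real \<Rightarrow> real) \<Rightarrow> real \<Rightarrow> real \<Rightarrow>
    (real \<Rightarrow> real ^ 'd \<Rightarrow> complex) \<Rightarrow> ennreal" where
  "Z_strichartz \<psi>' \<sigma> s u =
     (SUP q\<in>{p_exp TYPE('d) \<sigma>..1 / \<sigma>}.
        ennpow (\<Sum>j. ennreal ((2 ^ j) powr (2 * (s - \<sigma>))) *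
          (LtE q (Lx (r_exp TYPE('d) \<sigma> q)) (\<lambda>t x. complex_of_real (\<psi>' t) * P_dy j (u t) x))\<^sup>2)
        (1 / 2))"

text \<open>Here \<open>N = 2^j\<close> and \<open>R = 2^i\<close>, with \<open>i \<ge> 1\<close>; the condition \<open>R \<le> 8 N\<close> reads \<open>i \<le> j + 3\<close>.\<close>

definition Z_galilei :: "(real \<Rightarrow> real) \<Rightarrow> (real \<Rightarrow> real) \<Rightarrow> real \<Rightarrow> real \<Rightarrow>
    (real \<Rightarrow> real ^ 'd \<Rightarrow> complex) \<Rightarrow> ennreal" where
  "Z_galilei \<eta> \<psi> \<sigma> s u =
     (SUP \<alpha>\<in>{\<sigma>..1 / p_exp TYPE('d) \<sigma> - \<sigma>}.
        ennpow (\<Sum>j. ennreal ((2 ^ j) powr (2 * s)) *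
          (SUP i\<in>{1..j + 3}. ennreal ((2 ^ i) powr (- (2 * \<alpha> + \<sigma>))) *
             ennpow (\<Sum>\<^sub>\<infinity>k\<in>UNIV.
               (besov_t \<eta> \<alpha> (p_exp TYPE('d) \<sigma>) 1 (Lx (p_exp TYPE('d) \<sigma>))
                 (\<lambda>t x. complex_of_real (\<psi> t) *
                    P_le (8 * 2 ^ i)
                      (galilei ((2 ^ i) *\<^sub>R rvec k) (\<lambda>t'. P_dy j (u t')) t) x))\<^sup>2)
             (1 / 2))\<^sup>2)
        (1 / 2))"

definition Z_norm :: "(real \<Rightarrow> real) \<Rightarrow> (real \<Rightarrow> real) \<Rightarrow> (real \<Rightarrow> real) \<Rightarrow> real \<Rightarrow> real \<Rightarrow>
    (real \<Rightarrow> real ^ 'd \<Rightarrow> complex) \<Rightarrow> ennreal" where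
  "Z_norm \<eta> \<psi> \<psi>' \<sigma> s u = Z_strichartz \<psi>' \<sigma> s u + Z_galilei \<eta> \<psi> \<sigma> s u"


section \<open>Random data\<close>

text \<open>Normalised by \<open>E|X|\<^sup>2 = 1\<close>; \<open>lborel\<close> is Lebesgue measure on the complex plane.\<close>

definition standard_complex_gaussian :: "'w measure \<Rightarrow> ('w \<Rightarrow> complex) \<Rightarrow> bool" where
  "standard_complex_gaussian M X \<longleftrightarrow>
     distributed M lborel X (\<lambda>z. ennreal (exp (- (cmod z)\<^sup>2) / pi))"

definition s_crit :: "'d::finite itself \<Rightarrow> real \<Rightarrow> real" where
  "s_crit D a = dimn D / 2 - 2 / a"

definition data_coeff :: "real \<Rightarrow> real \<Rightarrow> int ^ 'd \<Rightarrow> complex" where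
  "data_coeff a \<delta> n =
     complex_of_real (japanese n powr (- dimn TYPE('d) / 2 - s_crit TYPE('d) a + \<delta>))"

text \<open>The \<open>H^s\<close> norm of \<open>\<Sum>\<^sub>n c\<^sub>n e\<^sup>i\<^sup>n\<^sup>x\<close>, in terms of the coefficients \<open>c\<close>; possibly \<open>\<infinity>\<close>.\<close>

definition sobolev_norm :: "real \<Rightarrow> (int ^ 'd \<Rightarrow> complex) \<Rightarrow> ennreal" where
  "sobolev_norm s c =
     ennpow (\<Sum>\<^sub>\<infinity>n\<in>UNIV. ennreal (japanese n powr (2 * s) * (cmod (c n))\<^sup>2)) (1 / 2)"

text \<open>
  The function \<open>e\<^sup>i\<^sup>t\<^sup>\<Delta> f\<close> for \<open>f = \<Sum>\<^sub>n c\<^sub>n e\<^sup>i\<^sup>n\<^sup>x\<close>, as the pointwise limit of the partial sums over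
  the dyadic cubes \<open>[-2^j, 2^j]^d\<close>. If \<open>f \<in> H^s\<close> for some \<open>s > 0\<close> (which holds almost surely for the
  random data below the regularity \<open>s_crit - \<delta> > 0\<close>), the \<open>L\<^sup>2\<close> norms of the dyadic blocks are summable,
  so for every \<open>t\<close> the limit exists for a.e. \<open>x\<close> and represents the limit in \<open>L\<^sup>2\<close>.
\<close>

definition schroedinger :: "(int ^ 'd \<Rightarrow> complex) \<Rightarrow> real \<Rightarrow> real ^ 'd \<Rightarrow> complex" where
  "schroedinger c t x =
     lim (\<lambda>j. \<Sum>n\<in>freq_cube (2 ^ j). c n * cis (x \<bullet> rvec n - t * (norm (rvec n))\<^sup>2))"


section \<open>The remaining exponents\<close>

definition q0_exp :: "'d::finite itself \<Rightarrow> real \<Rightarrow> real" where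
  "q0_exp D \<sigma>3 = (dimn D + 2) / (2 + \<sigma>3)"

definition r0_exp :: "'d::finite itself \<Rightarrow> real \<Rightarrow> real \<Rightarrow> real" where
  "r0_exp D \<sigma>2 \<sigma>3 = (dimn D + 2) / (2 + \<sigma>3 + \<sigma>2)"

definition theta_exp :: "'d::finite itself \<Rightarrow> real \<Rightarrow> real \<Rightarrow> real" where
  "theta_exp D \<sigma>2 \<sigma>3 = 2 / q0_exp D \<sigma>3 + dimn D / r0_exp D \<sigma>2 \<sigma>3 - 2"

end

theory Submission
  imports Defs
begin

text \<open>
  The estimate is Hoelder's inequality for three factors whose regularities add up to something positive. Let \<open>F\<close> be the
  linear evolution of the random data, \<open>u = \<psi>\<^sup>2 v\<close>, and \<open>w = \<chi> F B*\<close>, where \<open>\<chi>\<close> is the indicator of \<open>[-T, T]\<close> and \<open>B*\<close> the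
  conjugate of \<open>B\<close>. The left-hand side is \<open>\<bar>\<integral> u w\<bar>\<close>.

  \<^item> The coefficients of the data are such that \<open>F\<close> has a fixed positive regularity in every space \<open>L\<^sup>m\<close>.
    Exponential moments of the Gaussians give this for all dyadic blocks at once, with a constant \<open>l\<close> off a
    set of probability of the order of \<open>exp(- l)\<close> (\<open>good_trig_blocks\<close>, \<open>measure_not_good\<close>).
  \<^item> \<open>B\<close> has positive regularity \<open>\<theta>\<close> in space and \<open>1/r\<^sub>0 - 1/q\<^sub>0\<close> in time, in \<open>L\<^sup>r\<^sup>0\<close>.
  \<^item> The Strichartz part of the norm of \<open>v\<close>, at \<open>q = p\<close>, bounds its blocks in \<open>L\<^sup>p\<close> of space-time at the price of \<open>\<sigma>\<close> derivatives
    (\<open>Lnorm_P_dy_windowed_le\<close>), and \<open>\<sigma>\<close> is small compared with the regularities of \<open>F\<close> and \<open>B\<close>.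

  Since \<open>1/p + 1/r\<^sub>0 < 1\<close>, there is a finite \<open>m\<close> with \<open>1/p + 1/m + 1/m + 1/r\<^sub>0 = 1\<close>. One exponent \<open>m\<close> is used for \<open>F\<close>, the
  other one for \<open>\<chi>\<close>, whose norm is of the order of \<open>T\<^sup>1\<^sup>/\<^sup>m\<close>. With the level \<open>l = T\<^sup>-\<^sup>1\<^sup>/\<^sup>(\<^sup>2\<^sup>m\<^sup>)\<close> for the exceptional set the factor \<open>T\<^sup>1\<^sup>/\<^sup>(\<^sup>2\<^sup>m\<^sup>)\<close>
  remains. The Sobolev norm of the data is at least one and may be added on the right.

  The loss of derivatives in \<open>v\<close> is moved to \<open>w\<close> without analysing the frequencies of a product
  (\<open>fourier_pairing.estimate\<close>). A dyadic block of \<open>u\<close> is orthogonal to the mollification of \<open>w\<close> with a Fejer kernel of lower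
  frequencies, so only differences \<open>w(x) - w(x + y)\<close> matter. By the product rule and Hoelder's inequality they are
  small like a power of \<open>\<bar>y\<bar>\<close> (\<open>two_series.weighted_w_diff\<close>), and the moments of the Fejer kernel turn this into a power of
  the frequency, which beats \<open>2\<^sup>j\<^sup>\<sigma>\<close>. Only the integrability of \<open>u\<close> and of \<open>u w\<close> is known, so \<open>w\<close> is truncated, and \<open>u\<close> is split according to its size,
  before limits are taken.

  For this argument \<open>F\<close> and \<open>B\<close> have to be sums of trigonometric polynomials of geometrically decreasing norms, so that even a crude
  Bernstein inequality gives their moduli of continuity (\<open>trig_blocks\<close>). For \<open>F\<close> this is its definition. For \<open>B\<close>
  one has to know that a tempered function is the sum of its joint Littlewood--Paley blocks
  (\<open>besov_function.AE_B_eq_series\<close>). This rests on the uniqueness of Fourier coefficients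
  (\<open>AE_zero_if_fourier_zero\<close>), itself an application of the pairing estimate. Uniqueness also covers the case that one of the norms is zero
  and the other one infinite.
\<close>

section \<open>Hoelder's inequality and summation of geometric series in Lebesgue norms\<close>

lemma ennpow_ennreal: "0 \<le> x \<Longrightarrow> ennpow (ennreal x) a = ennreal (x powr a)"
  by (simp add: ennpow_def)

lemma ennpow_top [simp]: "ennpow \<infinity> a = \<infinity>" "ennpow \<top> a = \<infinity>"
  by (simp_all add: ennpow_def)

lemma ennpow_0 [simp]: "ennpow 0 a = 0"
  by (simp add: ennpow_def)

lemma ennpow_1 [simp]: "ennpow x 1 = x"
  by (cases x) (simp_all add: ennpow_def)

lemma ennpow_eq_0_iff [simp]: "ennpow x a = 0 \<longleftrightarrow> x = 0"
  by (cases x) (auto simp: ennpow_def)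

lemma ennpow_eq_top_iff [simp]: "ennpow x a = \<infinity> \<longleftrightarrow> x = \<infinity>" "ennpow x a = \<top> \<longleftrightarrow> x = \<infinity>"
  by (cases x; simp add: ennpow_def)+

lemma ennpow_mono:
  assumes "x \<le> y" "0 \<le> a"
  shows "ennpow x a \<le> ennpow y a"
proof (cases y)
  case (real r)
  then obtain s where "x = ennreal s" "0 \<le> s" "s \<le> r"
    using assms(1) by (cases x) (auto simp: top_unique)
  then show ?thesis using real assms by (auto simp: ennpow_ennreal intro!: ennreal_leI powr_mono2)
qed simp

lemma ennpow_ennpow: "ennpow (ennpow x a) b = ennpow x (a * b)"
  by (cases x) (simp_all add: ennpow_def powr_powr)

lemma ennpow_inverse [simp]: "a \<noteq> 0 \<Longrightarrow> ennpow (ennpow x a) (1 / a) = x"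
  "a \<noteq> 0 \<Longrightarrow> ennpow (ennpow x (1 / a)) a = x"
  by (simp_all add: ennpow_ennpow)

lemma ennpow_mult: "ennpow (x * y) a = ennpow x a * ennpow y a"
proof (cases x; cases y)
  fix r s assume "x = ennreal r" "y = ennreal s" "0 \<le> r" "0 \<le> s"
  then show ?thesis by (simp add: ennreal_mult[symmetric] ennpow_ennreal powr_mult)
qed (auto simp: ennreal_mult_eq_top_iff ennreal_top_mult ennreal_mult_top ennpow_ennreal)

lemma ennpow_2: "ennpow x 2 = x\<^sup>2"
  by (cases x) (simp_all add: ennpow_ennreal ennreal_power top_power_ennreal)

lemma ennpow_measurable [measurable]:
  assumes [measurable]: "f \<in> borel_measurable M"
  shows "(\<lambda>x. ennpow (f x) a) \<in> borel_measurable M"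
  unfolding ennpow_def infinity_ennreal_def by measurable

lemma Lnorm_1: "Lnorm 1 M f = (\<integral>\<^sup>+x. f x \<partial>M)"
  by (simp add: Lnorm_def)

lemma ennpow_Lnorm: "0 < p \<Longrightarrow> ennpow (Lnorm p M f) p = (\<integral>\<^sup>+x. ennpow (f x) p \<partial>M)"
  by (simp add: Lnorm_def)

lemma Lnorm_mono_AE:
  assumes "0 < p" "AE x in M. f x \<le> g x"
  shows "Lnorm p M f \<le> Lnorm p M g"
  unfolding Lnorm_def using assms
  by (intro ennpow_mono nn_integral_mono_AE) (auto elim!: eventually_mono intro!: ennpow_mono)

lemma Lnorm_mono:
  assumes "0 < p" "\<And>x. x \<in> space M \<Longrightarrow> f x \<le> g x"
  shows "Lnorm p M f \<le> Lnorm p M g"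
  using assms by (intro Lnorm_mono_AE AE_I2) auto

lemma Lnorm_cmult:
  assumes "0 < p" "f \<in> borel_measurable M"
  shows "Lnorm p M (\<lambda>x. c * f x) = c * Lnorm p M f"
  using assms unfolding Lnorm_def
  by (simp add: ennpow_mult nn_integral_cmult del: nn_integral_const)

lemma Lnorm_eq_0_iff:
  assumes "0 < p" "f \<in> borel_measurable M"
  shows "Lnorm p M f = 0 \<longleftrightarrow> (AE x in M. f x = 0)"
  using assms unfolding Lnorm_def
  by (simp add: nn_integral_0_iff_AE)

text \<open>
  Young's inequality after normalising both factors by their norms \<open>A\<close> and
  \<open>B\<close>; integrating it gives Hoelder's inequality with constant one.
\<close>

lemma ennreal_Young:
  assumes "1 < p" "1 < q" "1 / p + 1 / q = 1" "0 < A" "0 < B"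
  shows "x * y \<le> ennreal (A * B) * (ennreal (1 / (p * A powr p)) * ennpow x p
            + ennreal (1 / (q * B powr q)) * ennpow y q)"
proof (cases x; cases y)
  fix r s assume xy: "x = ennreal r" "y = ennreal s" "0 \<le> r" "0 \<le> s"
  have "(r / A) * (s / B) \<le> (r / A) powr p / p + (s / B) powr q / q"
    using assms xy by (intro Youngs_inequality) auto
  then have "(A * B) * ((r / A) * (s / B)) \<le> (A * B) * ((r / A) powr p / p + (s / B) powr q / q)"
    using assms by (intro mult_left_mono) auto
  then have "r * s \<le> A * B * (1 / (p * A powr p) * r powr p + 1 / (q * B powr q) * s powr q)"
    using assms xy by (simp add: powr_divide mult.commute)
  then show ?thesis using xy assms
    by (simp add: ennpow_ennreal ennreal_mult[symmetric] ennreal_plus[symmetric] ennreal_leI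
        del: ennreal_plus)
qed (use assms in \<open>auto simp: ennreal_top_mult ennreal_mult_top ennpow_ennreal\<close>)

lemma nn_integral_Hoelder:
  assumes pq: "1 < p" "1 < q" "1 / p + 1 / q = 1"
    and [measurable]: "f \<in> borel_measurable M" "g \<in> borel_measurable M"
  shows "(\<integral>\<^sup>+x. f x * g x \<partial>M) \<le> Lnorm p M f * Lnorm q M g"
proof (cases "Lnorm p M f = 0 \<or> Lnorm q M g = 0")
  case True
  then have "AE x in M. f x * g x = 0"
    using pq by (auto simp: Lnorm_eq_0_iff)
  then have "(\<integral>\<^sup>+x. f x * g x \<partial>M) = 0"
    by (simp add: nn_integral_0_iff_AE)
  then show ?thesis by simp
next
  case nz: False
  show ?thesis
  proof (cases "Lnorm p M f = \<infinity> \<or> Lnorm q M g = \<infinity>")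
    case True
    with nz have "Lnorm p M f * Lnorm q M g = \<infinity>"
      by (auto simp: ennreal_mult_eq_top_iff)
    then show ?thesis by simp
  next
    case False
    with nz obtain A B where A: "Lnorm p M f = ennreal A" "0 < A" and B: "Lnorm q M g = ennreal B" "0 < B"
      by (cases "Lnorm p M f"; cases "Lnorm q M g") (auto simp: less_le)
    have If: "(\<integral>\<^sup>+x. ennpow (f x) p \<partial>M) = ennreal (A powr p)"
      using ennpow_Lnorm[of p M f] A pq by (simp add: ennpow_ennreal)
    have Ig: "(\<integral>\<^sup>+x. ennpow (g x) q \<partial>M) = ennreal (B powr q)"
      using ennpow_Lnorm[of q M g] B pq by (simp add: ennpow_ennreal)
    have "(\<integral>\<^sup>+x. f x * g x \<partial>M) \<le> (\<integral>\<^sup>+x. ennreal (A * B) * (ennreal (1 / (p * A powr p)) * ennpow (f x) p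
            + ennreal (1 / (q * B powr q)) * ennpow (g x) q) \<partial>M)"
      by (intro nn_integral_mono ennreal_Young pq A B)
    also have "\<dots> = ennreal (A * B) * (ennreal (1 / (p * A powr p)) * ennreal (A powr p)
            + ennreal (1 / (q * B powr q)) * ennreal (B powr q))"
      by (simp add: nn_integral_cmult nn_integral_add If Ig)
    also have "\<dots> = ennreal (A * B * (1 / p + 1 / q))"
      using pq A B by (simp add: ennreal_mult[symmetric] ennreal_plus[symmetric] del: ennreal_plus)
    also have "\<dots> = Lnorm p M f * Lnorm q M g"
      using pq A B by (simp add: ennreal_mult)
    finally show ?thesis .
  qed
qed

lemma Lnorm_Hoelder:
  assumes pq: "0 < p" "0 < q" "0 < r" "1 / p + 1 / q = 1 / r"
    and [measurable]: "f \<in> borel_measurable M" "g \<in> borel_measurable M"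
  shows "Lnorm r M (\<lambda>x. f x * g x) \<le> Lnorm p M f * Lnorm q M g"
proof -
  have 1: "1 < p / r" "1 < q / r" "1 / (p / r) + 1 / (q / r) = 1"
  proof -
    have "1 / p < 1 / r" "1 / q < 1 / r" using pq by (smt (verit) divide_pos_pos)+
    then show "1 < p / r" "1 < q / r" using pq by (simp_all add: field_simps)
    have "1 / (p / r) + 1 / (q / r) = r * (1 / p + 1 / q)" using pq by (simp add: field_simps)
    then show "1 / (p / r) + 1 / (q / r) = 1" using pq by simp
  qed
  have "(\<integral>\<^sup>+x. ennpow (f x * g x) r \<partial>M) = (\<integral>\<^sup>+x. ennpow (f x) r * ennpow (g x) r \<partial>M)"
    by (simp add: ennpow_mult)
  also have "\<dots> \<le> Lnorm (p / r) M (\<lambda>x. ennpow (f x) r) * Lnorm (q / r) M (\<lambda>x. ennpow (g x) r)"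
    by (intro nn_integral_Hoelder 1) auto
  also have "\<dots> = ennpow (Lnorm p M f * Lnorm q M g) r"
    using pq by (simp add: Lnorm_def ennpow_ennpow ennpow_mult)
  finally have "ennpow (\<integral>\<^sup>+x. ennpow (f x * g x) r \<partial>M) (1 / r) \<le>
      ennpow (ennpow (Lnorm p M f * Lnorm q M g) r) (1 / r)"
    using pq by (intro ennpow_mono) auto
  then show ?thesis using pq by (simp add: Lnorm_def)
qed

text \<open>
  The four factors will be a block of \<open>v\<close>, the time window, the random series and the
  Besov function; the window is the factor that produces a power of \<open>T\<close>.
\<close>

lemma nn_integral_Hoelder4:
  assumes pos: "0 < p1" "0 < p2" "0 < p3" "0 < p4" "1 / p1 + 1 / p2 + 1 / p3 + 1 / p4 = 1"
    and [measurable]: "f1 \<in> borel_measurable M" "f2 \<in> borel_measurable M"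
      "f3 \<in> borel_measurable M" "f4 \<in> borel_measurable M"
  shows "(\<integral>\<^sup>+x. f1 x * (f2 x * (f3 x * f4 x)) \<partial>M) \<le>
    Lnorm p1 M f1 * (Lnorm p2 M f2 * (Lnorm p3 M f3 * Lnorm p4 M f4))"
proof -
  define a where "a = 1 / (1 / p3 + 1 / p4)"
  define b where "b = 1 / (1 / p2 + 1 / a)"
  have a: "0 < a" "1 / p3 + 1 / p4 = 1 / a" using pos by (auto simp: a_def add_pos_pos)
  have b: "0 < b" "1 / p2 + 1 / a = 1 / b" using pos a by (auto simp: b_def add_pos_pos)
  have "(\<integral>\<^sup>+x. f1 x * (f2 x * (f3 x * f4 x)) \<partial>M) = Lnorm 1 M (\<lambda>x. f1 x * (f2 x * (f3 x * f4 x)))"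
    by (simp add: Lnorm_1)
  also have "\<dots> \<le> Lnorm p1 M f1 * Lnorm b M (\<lambda>x. f2 x * (f3 x * f4 x))"
    using pos a b by (intro Lnorm_Hoelder) auto
  also have "\<dots> \<le> Lnorm p1 M f1 * (Lnorm p2 M f2 * Lnorm a M (\<lambda>x. f3 x * f4 x))"
    using pos a b by (intro mult_left_mono Lnorm_Hoelder) auto
  also have "\<dots> \<le> Lnorm p1 M f1 * (Lnorm p2 M f2 * (Lnorm p3 M f3 * Lnorm p4 M f4))"
    using pos a b by (intro mult_left_mono Lnorm_Hoelder) auto
  finally show ?thesis .
qed

text \<open>
  The constant with which a series whose terms have norms \<open>\<le> A \<rho>\<^sup>k\<close>
  can be summed. It comes from the weights \<open>\<rho>\<^sup>k\<^sup>/\<^sup>2\<close>, which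
  split the geometric decay between the sum over \<open>k\<close> and the integral.
\<close>

definition geom_const :: "real \<Rightarrow> real \<Rightarrow> real" where
  "geom_const \<rho> q = 1 / (1 - sqrt \<rho>) * (1 / (1 - \<rho> powr (q / 2))) powr (1 / q)"

lemma geom_const_pos: "0 < \<rho> \<Longrightarrow> \<rho> < 1 \<Longrightarrow> 0 < q \<Longrightarrow> 0 < geom_const \<rho> q"
  using powr_less_mono2[of "q / 2" \<rho> 1] by (auto simp: geom_const_def intro!: mult_pos_pos)

text \<open>
  Minkowski's inequality is avoided: pointwise, \<open>\<Sum> f\<^sub>k \<le> (\<Sum>
  \<tau>\<^sup>k) sup\<^sub>k \<tau>\<^sup>-\<^sup>k f\<^sub>k\<close>, and the supremum is
  dominated by the \<open>l\<^sup>q\<close> sum of the weighted terms, which is integrated term by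
  term. This costs a constant and works for every \<open>q > 0\<close>.
\<close>

lemma Lnorm_suminf_geometric:
  fixes f :: "nat \<Rightarrow> 'a \<Rightarrow> ennreal"
  assumes q: "0 < q" and \<rho>: "0 < \<rho>" "\<rho> < 1" and A: "0 \<le> A"
    and [measurable]: "\<And>k. f k \<in> borel_measurable M"
    and bound: "\<And>k. Lnorm q M (f k) \<le> ennreal (A * \<rho> ^ k)"
  shows "Lnorm q M (\<lambda>x. \<Sum>k. f k x) \<le> ennreal (geom_const \<rho> q * A)"
proof -
  define \<tau> where "\<tau> = sqrt \<rho>"
  define w where "w k = ennreal (1 / \<tau> ^ k)" for k
  define c where "c = 1 / (1 - \<tau>)"
  have \<tau>: "0 < \<tau>" "\<tau> < 1" "\<tau> * \<tau> = \<rho>" using \<rho> by (auto simp: \<tau>_def)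
  have c: "0 < c" using \<tau> by (simp add: c_def)
  have gs: "(\<Sum>k. ennreal (\<tau> ^ k)) = ennreal c"
    using \<tau> unfolding c_def by (intro suminf_ennreal_eq geometric_sums) auto
  have pw: "(\<Sum>k. f k x) \<le> ennreal c * ennpow (\<Sum>k. ennpow (w k * f k x) q) (1 / q)" for x
  proof -
    have "f k x \<le> ennreal (\<tau> ^ k) * ennpow (\<Sum>k. ennpow (w k * f k x) q) (1 / q)" for k
    proof -
      have "ennpow (ennpow (w k * f k x) q) (1 / q) \<le> ennpow (\<Sum>k. ennpow (w k * f k x) q) (1 / q)"
        using q sum_le_suminf[of "\<lambda>k. ennpow (w k * f k x) q" "{k}"] by (intro ennpow_mono) auto
      then have "ennreal (\<tau> ^ k) * (w k * f k x) \<le> ennreal (\<tau> ^ k) * ennpow (\<Sum>k. ennpow (w k * f k x) q) (1 / q)"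
        using q by (intro mult_left_mono) auto
      moreover have "ennreal (\<tau> ^ k) * (w k * f k x) = f k x"
        using \<tau> by (simp add: w_def mult.assoc[symmetric] ennreal_mult[symmetric])
      ultimately show ?thesis by simp
    qed
    then have "(\<Sum>k. f k x) \<le> (\<Sum>k. ennreal (\<tau> ^ k) * ennpow (\<Sum>k. ennpow (w k * f k x) q) (1 / q))"
      by (intro suminf_le) auto
    also have "\<dots> = ennreal c * ennpow (\<Sum>k. ennpow (w k * f k x) q) (1 / q)"
      by (simp add: gs)
    finally show ?thesis .
  qed
  have q2: "0 < \<rho> powr (q / 2)" "\<rho> powr (q / 2) < 1" using \<rho> q powr_less_mono2[of "q / 2" \<rho> 1] by auto
  have "(\<integral>\<^sup>+x. ennpow (ennpow (\<Sum>k. ennpow (w k * f k x) q) (1 / q)) q \<partial>M)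
      = (\<integral>\<^sup>+x. (\<Sum>k. ennpow (w k * f k x) q) \<partial>M)"
    using q by simp
  also have "\<dots> = (\<Sum>k. \<integral>\<^sup>+x. ennpow (w k * f k x) q \<partial>M)"
    by (intro nn_integral_suminf) auto
  also have "\<dots> \<le> (\<Sum>k. ennreal (A powr q * (\<rho> powr (q / 2)) ^ k))"
  proof (intro suminf_le)
    fix k
    have "(\<integral>\<^sup>+x. ennpow (w k * f k x) q \<partial>M) = ennpow (w k * Lnorm q M (f k)) q"
      using q by (simp add: ennpow_mult nn_integral_cmult Lnorm_def)
    also have "\<dots> \<le> ennpow (w k * ennreal (A * \<rho> ^ k)) q"
      using q by (intro ennpow_mono mult_left_mono bound) auto
    also have "w k * ennreal (A * \<rho> ^ k) = ennreal (A * \<tau> ^ k)"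
      using \<tau>(1) A by (simp add: w_def \<tau>(3)[symmetric] ennreal_mult[symmetric] power_mult_distrib)
    also have "ennpow (ennreal (A * \<tau> ^ k)) q = ennreal (A powr q * (\<tau> ^ k) powr q)"
      using A \<tau> by (simp add: ennpow_ennreal powr_mult)
    also have "(\<tau> ^ k) powr q = (\<rho> powr (q / 2)) ^ k"
      using \<tau>(1) \<rho> by (simp add: \<tau>_def powr_half_sqrt[symmetric] powr_powr powr_realpow[symmetric] mult_ac)
    finally show "(\<integral>\<^sup>+x. ennpow (w k * f k x) q \<partial>M) \<le> ennreal (A powr q * (\<rho> powr (q / 2)) ^ k)" .
  qed auto
  also have "\<dots> = ennreal (A powr q * (1 / (1 - \<rho> powr (q / 2))))"
    using q2 by (intro suminf_ennreal_eq sums_mult geometric_sums) auto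
  finally have *: "(\<integral>\<^sup>+x. ennpow (ennpow (\<Sum>k. ennpow (w k * f k x) q) (1 / q)) q \<partial>M)
      \<le> ennreal (A powr q * (1 / (1 - \<rho> powr (q / 2))))" .
  have "Lnorm q M (\<lambda>x. \<Sum>k. f k x) \<le> Lnorm q M (\<lambda>x. ennreal c * ennpow (\<Sum>k. ennpow (w k * f k x) q) (1 / q))"
    using q pw by (intro Lnorm_mono)
  also have "\<dots> = ennreal c * Lnorm q M (\<lambda>x. ennpow (\<Sum>k. ennpow (w k * f k x) q) (1 / q))"
    using q by (intro Lnorm_cmult) auto
  also have "\<dots> \<le> ennreal c * ennpow (ennreal (A powr q * (1 / (1 - \<rho> powr (q / 2))))) (1 / q)"
    unfolding Lnorm_def using q by (intro mult_left_mono ennpow_mono *) auto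
  also have "\<dots> = ennreal (geom_const \<rho> q * A)"
    using q q2 A c by (simp add: ennpow_ennreal powr_mult powr_powr geom_const_def ennreal_mult[symmetric] c_def \<tau>_def mult_ac powr_divide)
  finally show ?thesis .
qed

text \<open>
  The same replacement of Minkowski's inequality for finite sums. The loss is a power of the
  number of terms, which is harmless where the terms decay geometrically.
\<close>

lemma Lnorm_sum_le:
  fixes f :: "'i \<Rightarrow> 'a \<Rightarrow> ennreal"
  assumes "finite I" and q: "0 < q" and "0 \<le> A"
    and [measurable]: "\<And>k. k \<in> I \<Longrightarrow> f k \<in> borel_measurable M"
    and bound: "\<And>k. k \<in> I \<Longrightarrow> Lnorm q M (f k) \<le> ennreal A"
  shows "Lnorm q M (\<lambda>x. \<Sum>k\<in>I. f k x) \<le> ennreal (real (card I) powr (1 + 1 / q) * A)"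
proof -
  let ?n = "real (card I)"
  have pw: "(\<Sum>k\<in>I. f k x) \<le> ennreal ?n * ennpow (\<Sum>k\<in>I. ennpow (f k x) q) (1 / q)" for x
  proof -
    have "f k x \<le> ennpow (\<Sum>k\<in>I. ennpow (f k x) q) (1 / q)" if "k \<in> I" for k
    proof -
      have "ennpow (ennpow (f k x) q) (1 / q) \<le> ennpow (\<Sum>k\<in>I. ennpow (f k x) q) (1 / q)"
        using q that assms(1) by (intro ennpow_mono member_le_sum) auto
      then show ?thesis using q by simp
    qed
    then have "(\<Sum>k\<in>I. f k x) \<le> (\<Sum>k\<in>I. ennpow (\<Sum>k\<in>I. ennpow (f k x) q) (1 / q))"
      by (rule sum_mono)
    then show ?thesis by (simp add: ennreal_of_nat_eq_real_of_nat)
  qed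
  have "(\<integral>\<^sup>+x. (\<Sum>k\<in>I. ennpow (f k x) q) \<partial>M) = (\<Sum>k\<in>I. ennpow (Lnorm q M (f k)) q)"
    using q by (subst nn_integral_sum) (auto simp: ennpow_Lnorm)
  also have "\<dots> \<le> (\<Sum>k\<in>I. ennpow (ennreal A) q)"
    using q by (intro sum_mono ennpow_mono bound) auto
  also have "\<dots> = ennreal (?n * A powr q)"
    using assms by (simp add: ennpow_ennreal ennreal_mult ennreal_of_nat_eq_real_of_nat)
  finally have *: "(\<integral>\<^sup>+x. (\<Sum>k\<in>I. ennpow (f k x) q) \<partial>M) \<le> ennreal (?n * A powr q)" .
  have "Lnorm q M (\<lambda>x. \<Sum>k\<in>I. f k x) \<le> Lnorm q M (\<lambda>x. ennreal ?n * ennpow (\<Sum>k\<in>I. ennpow (f k x) q) (1 / q))"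
    using q pw by (intro Lnorm_mono)
  also have "\<dots> = ennreal ?n * Lnorm q M (\<lambda>x. ennpow (\<Sum>k\<in>I. ennpow (f k x) q) (1 / q))"
    using q by (intro Lnorm_cmult ennpow_measurable borel_measurable_sum) auto
  also have "\<dots> \<le> ennreal ?n * ennpow (ennreal (?n * A powr q)) (1 / q)"
    unfolding Lnorm_def using q * by (intro mult_left_mono ennpow_mono) auto
  also have "\<dots> = ennreal (?n powr (1 + 1 / q) * A)"
    using q assms(3) by (simp add: ennpow_ennreal powr_mult powr_powr ennreal_mult[symmetric] powr_add mult_ac)
  finally show ?thesis .
qed

section \<open>Periodic functions and characters on the torus\<close>

definition x_periodic :: "(real ^ 'd \<Rightarrow> 'b) \<Rightarrow> bool" where
  "x_periodic f \<longleftrightarrow> (\<forall>x n. f (x + (2 * pi) *\<^sub>R rvec n) = f x)"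

lemma x_periodicD: "x_periodic f \<Longrightarrow> f (x + (2 * pi) *\<^sub>R rvec n) = f x"
  by (simp add: x_periodic_def)

lemma x_periodic_shift: "x_periodic f \<Longrightarrow> x_periodic (\<lambda>x. f (x + z))"
  unfolding x_periodic_def by (metis add.assoc add.commute)

lemma rvec_add: "rvec (m + n) = rvec m + rvec n" and rvec_diff: "rvec (m - n) = rvec m - rvec n"
  and rvec_0 [simp]: "rvec 0 = 0" and rvec_minus: "rvec (- m) = - rvec m"
  by (simp_all add: rvec_def vec_eq_iff)

text \<open>
  A fundamental domain without double points; it differs from the closed cell by a null set.
\<close>

definition half_cell :: "(real ^ 'd) set" where
  "half_cell = {x. \<forall>i. 0 \<le> x $ i \<and> x $ i < 2 * pi}"

definition wrap :: "real ^ 'd \<Rightarrow> real ^ 'd" where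
  "wrap x = (\<chi> i. x $ i - 2 * pi * of_int \<lfloor>x $ i / (2 * pi)\<rfloor>)"

lemma borel_measurable_vec_nth [measurable]: "(\<lambda>x::real^'d. x $ i) \<in> borel_measurable borel"
  by (intro borel_measurable_continuous_onI continuous_intros)

lemma borel_measurable_vec_lambda:
  fixes f :: "'a \<Rightarrow> 'd::finite \<Rightarrow> real"
  assumes "\<And>i. (\<lambda>x. f x i) \<in> borel_measurable M"
  shows "(\<lambda>x. (\<chi> i. f x i) :: real ^ 'd) \<in> borel_measurable M"
proof (subst borel_measurable_euclidean_space, intro ballI)
  fix b :: "real ^ 'd" assume "b \<in> Basis"
  then obtain i where "b = axis i 1" by (auto simp: Basis_vec_def)
  then show "(\<lambda>x. (\<chi> i. f x i) \<bullet> b) \<in> borel_measurable M"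
    using assms[of i] by (simp add: inner_axis)
qed

lemma half_cell_sets [measurable]: "half_cell \<in> sets borel"
  unfolding half_cell_def by measurable

lemma wrap_measurable [measurable]: "wrap \<in> borel_measurable borel"
  unfolding wrap_def by (intro borel_measurable_vec_lambda) measurable

lemma wrap_eq: "wrap x = x + (2 * pi) *\<^sub>R rvec (\<chi> i. - \<lfloor>x $ i / (2 * pi)\<rfloor>)"
  by (simp add: wrap_def rvec_def vec_eq_iff)

lemma wrap_in_half_cell: "wrap x \<in> half_cell"
proof -
  have "0 \<le> x $ i - 2 * pi * of_int \<lfloor>x $ i / (2 * pi)\<rfloor> \<and>
      x $ i - 2 * pi * of_int \<lfloor>x $ i / (2 * pi)\<rfloor> < 2 * pi" for i
  proof -
    define r where "r = x $ i / (2 * pi)"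
    have "x $ i - 2 * pi * of_int \<lfloor>r\<rfloor> = 2 * pi * frac r"
      by (simp add: r_def frac_def right_diff_distrib)
    then show ?thesis using frac_ge_0[of r] frac_lt_1[of r] by (simp add: r_def)
  qed
  then show ?thesis by (simp add: half_cell_def wrap_def)
qed

lemma wrap_half_cell: "x \<in> half_cell \<Longrightarrow> wrap x = x"
proof -
  assume "x \<in> half_cell"
  then have "\<lfloor>x $ i / (2 * pi)\<rfloor> = 0" for i
    by (intro floor_unique) (auto simp: half_cell_def field_simps)
  then show ?thesis by (simp add: wrap_def vec_eq_iff)
qed

lemma x_periodic_wrap: "x_periodic (wrap :: real ^ 'd \<Rightarrow> _)"
proof -
  have *: "\<lfloor>(x $ i + 2 * pi * of_int k) / (2 * pi)\<rfloor> = \<lfloor>x $ i / (2 * pi)\<rfloor> + k" for x :: "real^'d" and i k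
    by (simp add: add_divide_distrib)
  have "wrap (x + (2 * pi) *\<^sub>R rvec n) = wrap x" for x :: "real^'d" and n
    unfolding wrap_def rvec_def vec_eq_iff
    by (simp only: vec_lambda_beta vector_add_component vector_scaleR_component real_scaleR_def * of_int_add) (simp add: distrib_left)
  then show ?thesis by (simp add: x_periodic_def)
qed

lemma periodic_wrap: "x_periodic f \<Longrightarrow> f (wrap x) = f x"
  by (simp add: wrap_eq x_periodicD)

text \<open>
  Every point has exactly one lattice translate in the fundamental domain. This makes the pieces
  in the translation argument below disjoint and exhaustive.
\<close>

lemma half_cell_translates:
  "x + (2 * pi) *\<^sub>R rvec n \<in> half_cell \<longleftrightarrow> n = (\<chi> i. - \<lfloor>x $ i / (2 * pi)\<rfloor>)"
proof
  assume *: "x + (2 * pi) *\<^sub>R rvec n \<in> half_cell"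
  have "- (n $ i) = \<lfloor>x $ i / (2 * pi)\<rfloor>" for i
  proof -
    have "0 \<le> x $ i + 2 * pi * of_int (n $ i)" "x $ i + 2 * pi * of_int (n $ i) < 2 * pi"
      using * by (auto simp: half_cell_def rvec_def)
    then have "0 \<le> (x $ i + 2 * pi * of_int (n $ i)) / (2 * pi)" "(x $ i + 2 * pi * of_int (n $ i)) / (2 * pi) < 1"
      by (simp_all add: pos_divide_less_eq)
    then have "0 \<le> x $ i / (2 * pi) + of_int (n $ i)" "x $ i / (2 * pi) + of_int (n $ i) < 1"
      by (simp_all only: add_divide_distrib nonzero_mult_div_cancel_left) simp_all
    then show ?thesis
      by (intro floor_unique[symmetric]) simp_all
  qed
  then show "n = (\<chi> i. - \<lfloor>x $ i / (2 * pi)\<rfloor>)" by (simp add: vec_eq_iff minus_equation_iff[of "n $ _"])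
next
  assume "n = (\<chi> i. - \<lfloor>x $ i / (2 * pi)\<rfloor>)"
  then show "x + (2 * pi) *\<^sub>R rvec n \<in> half_cell" using wrap_in_half_cell[of x] by (simp add: wrap_eq)
qed

lemma nn_integral_lborel_shift:
  fixes f :: "real ^ 'd \<Rightarrow> ennreal"
  assumes [measurable]: "f \<in> borel_measurable borel"
  shows "(\<integral>\<^sup>+x. f (x + a) \<partial>lborel) = (\<integral>\<^sup>+x. f x \<partial>lborel)"
proof -
  have "(\<integral>\<^sup>+x. f x \<partial>lborel) = (\<integral>\<^sup>+x. f x \<partial>(distr lborel borel ((+) a)))"
    by (simp add: lborel_distr_plus)
  also have "\<dots> = (\<integral>\<^sup>+x. f (x + a) \<partial>lborel)"
    by (subst nn_integral_distr) (auto simp: add.commute)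
  finally show ?thesis ..
qed

lemma space_torus: "space torus = cbox 0 (\<chi> i. 2 * pi)"
  by (simp add: torus_def space_restrict_space)

lemma sets_torus: "sets torus = sets (restrict_space borel (cbox 0 (\<chi> i. 2 * pi)))"
  by (simp add: torus_def sets_restrict_space)

lemma measurable_torus: "f \<in> measurable borel N \<Longrightarrow> f \<in> measurable torus N"
  unfolding torus_def by (intro measurable_restrict_space1) simp

lemma measurable_pair_torus:
  fixes f :: "'a \<times> (real ^ 'd) \<Rightarrow> 'b"
  assumes "f \<in> measurable (K \<Otimes>\<^sub>M borel) N"
  shows "f \<in> measurable (K \<Otimes>\<^sub>M torus) N"
proof -
  have [measurable]: "(\<lambda>x. x) \<in> measurable (torus :: (real ^ 'd) measure) borel"
    by (rule measurable_torus) simp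
  have "(\<lambda>p. (fst p, snd p)) \<in> measurable (K \<Otimes>\<^sub>M (torus :: (real ^ 'd) measure)) (K \<Otimes>\<^sub>M borel)"
    by (intro measurable_Pair) (auto intro: measurable_compose[OF measurable_snd] simp: measurable_torus)
  from measurable_compose[OF this assms] show ?thesis by simp
qed

lemma measurable_spacetime:
  fixes f :: "real \<times> (real ^ 'd) \<Rightarrow> 'b"
  assumes "f \<in> measurable borel N"
  shows "f \<in> measurable spacetime N"
proof (rule measurable_pair_torus)
  show "f \<in> measurable (lborel \<Otimes>\<^sub>M borel) N"
    using assms by (simp add: borel_prod[symmetric] cong: measurable_cong_sets)
qed

lemma AE_half_cell: "AE x in (torus :: (real ^ 'd) measure). x \<in> half_cell"
proof -
  define c :: "real ^ 'd" where "c = (\<chi> i. 2 * pi)"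
  have fin: "emeasure lborel (box 0 c) \<noteq> \<infinity>"
    using emeasure_lborel_box_finite[of 0 c] by (simp add: less_imp_neq)
  have "emeasure lborel (cbox 0 c - box 0 c) = emeasure lborel (cbox 0 c) - emeasure lborel (box 0 c)"
    by (rule emeasure_Diff[OF fin]) (simp_all only: sets_lborel cbox_borel box_borel box_subset_cbox)
  also have "emeasure lborel (cbox 0 c) = emeasure lborel (box 0 c)"
    by (simp only: emeasure_lborel_cbox_eq emeasure_lborel_box_eq)
  finally have *: "cbox 0 (\<chi> i. 2 * pi) - box 0 (\<chi> i. 2 * pi) \<in> null_sets (lborel :: (real^'d) measure)"
    using fin unfolding c_def by (intro null_setsI sets.Diff) (simp_all only: sets_lborel cbox_borel box_borel infinity_ennreal_def ennreal_minus_cancel_iff diff_self, simp)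
  have "AE x in lborel. x \<notin> cbox 0 (\<chi> i. 2 * pi) - box 0 (\<chi> i. 2 * pi::real^'d)"
    by (rule AE_not_in[OF *])
  then have "AE x in lborel. x \<in> cbox 0 (\<chi> i. 2 * pi) \<longrightarrow> (x::real^'d) \<in> half_cell"
  proof eventually_elim
    case (elim x)
    then show ?case by (auto simp: half_cell_def mem_box_cart less_imp_le)
  qed
  then show ?thesis
    unfolding torus_def
    by (subst AE_restrict_space_iff) (simp_all only: space_lborel space_borel sets_lborel Int_UNIV_left Int_UNIV_right cbox_borel)
qed

lemma nn_integral_torus:
  assumes [measurable]: "f \<in> borel_measurable borel"
  shows "(\<integral>\<^sup>+x. f x \<partial>torus) = (\<integral>\<^sup>+x. f x * indicator half_cell x \<partial>lborel)"
proof -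
  have "(\<integral>\<^sup>+x. f x \<partial>torus) = (\<integral>\<^sup>+x. f x * indicator half_cell x \<partial>torus)"
    using AE_half_cell by (intro nn_integral_cong_AE) (auto elim!: eventually_mono)
  also have "\<dots> = (\<integral>\<^sup>+x. f x * indicator half_cell x * indicator (cbox 0 (\<chi> i. 2 * pi)) x \<partial>lborel)"
    unfolding torus_def by (subst nn_integral_restrict_space) (simp_all only: space_lborel space_borel sets_lborel Int_UNIV_left Int_UNIV_right cbox_borel)
  also have "\<dots> = (\<integral>\<^sup>+x. f x * indicator half_cell x \<partial>lborel)"
    by (intro nn_integral_cong) (auto simp: indicator_def half_cell_def mem_box_cart less_imp_le)
  finally show ?thesis .
qed

text \<open>
  Both cells \<open>Q\<close> and \<open>Q - a\<close> are cut into the countably many pieces on which a lattice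
  translation carries the one into the other.
\<close>

lemma nn_integral_torus_shift:
  fixes f :: "real ^ 'd \<Rightarrow> ennreal"
  assumes [measurable]: "f \<in> borel_measurable borel" and per: "x_periodic f"
  shows "(\<integral>\<^sup>+x. f (x + a) \<partial>torus) = (\<integral>\<^sup>+x. f x \<partial>torus)"
proof -
  let ?Q = "half_cell :: (real^'d) set"
  let ?i = "\<lambda>x. indicator ?Q x :: ennreal"
  let ?p = "\<lambda>n. (2 * pi) *\<^sub>R rvec n :: real ^ 'd"
  have one: "(\<integral>\<^sup>+n. ?i (x + ?p n) \<partial>count_space UNIV) = 1" for x
  proof -
    have "(\<lambda>n. ?i (x + ?p n)) = indicator {\<chi> i. - \<lfloor>x $ i / (2 * pi)\<rfloor>}"
      by (auto simp: indicator_def half_cell_translates fun_eq_iff)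
    then show ?thesis by (simp add: one_ennreal_def[symmetric])
  qed
  have "(\<integral>\<^sup>+x. f (x + a) \<partial>torus) = (\<integral>\<^sup>+x. f (x + a) * ?i x \<partial>lborel)"
    by (rule nn_integral_torus) measurable
  also have "\<dots> = (\<integral>\<^sup>+x. f (x + - a + a) * ?i (x + - a) \<partial>lborel)"
    by (rule nn_integral_lborel_shift[symmetric]) measurable
  also have "\<dots> = (\<integral>\<^sup>+x. f x * ?i (x - a) * (\<integral>\<^sup>+n. ?i (x + ?p n) \<partial>count_space UNIV) \<partial>lborel)"
    by (simp add: one)
  also have "\<dots> = (\<integral>\<^sup>+x. \<integral>\<^sup>+n. f x * ?i (x - a) * ?i (x + ?p n) \<partial>count_space UNIV \<partial>lborel)"
    by (simp add: nn_integral_cmult)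
  also have "\<dots> = (\<integral>\<^sup>+n. \<integral>\<^sup>+x. f x * ?i (x - a) * ?i (x + ?p n) \<partial>lborel \<partial>count_space UNIV)"
    by (subst nn_integral_count_space_nn_integral[symmetric]) auto
  also have "\<dots> = (\<integral>\<^sup>+n. \<integral>\<^sup>+x. f x * ?i (x - ?p n - a) * ?i x \<partial>lborel \<partial>count_space UNIV)"
  proof (rule nn_integral_cong)
    fix n :: "int^'d"
    have "(\<integral>\<^sup>+x. f x * ?i (x - ?p n - a) * ?i x \<partial>lborel) = 
      (\<integral>\<^sup>+x. f (x + ?p n) * ?i (x + ?p n - ?p n - a) * ?i (x + ?p n) \<partial>lborel)"
      by (subst nn_integral_lborel_shift) auto
    then show "(\<integral>\<^sup>+x. f x * ?i (x - a) * ?i (x + ?p n) \<partial>lborel) = (\<integral>\<^sup>+x. f x * ?i (x - ?p n - a) * ?i x \<partial>lborel)"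
      by (simp add: x_periodicD[OF per])
  qed
  also have "\<dots> = (\<integral>\<^sup>+x. \<integral>\<^sup>+n. f x * ?i (x - ?p n - a) * ?i x \<partial>count_space UNIV \<partial>lborel)"
    by (subst nn_integral_count_space_nn_integral) auto
  also have "\<dots> = (\<integral>\<^sup>+x. f x * ?i x * (\<integral>\<^sup>+n. ?i ((x - a) + ?p (- n)) \<partial>count_space UNIV) \<partial>lborel)"
  proof (rule nn_integral_cong)
    fix x
    have "(\<integral>\<^sup>+n. f x * ?i (x - ?p n - a) * ?i x \<partial>count_space UNIV)
        = (\<integral>\<^sup>+n. (f x * ?i x) * ?i ((x - a) + ?p (- n)) \<partial>count_space UNIV)"
      by (simp add: rvec_minus mult_ac diff_diff_eq add_ac flip: diff_conv_add_uminus)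
    also have "\<dots> = f x * ?i x * (\<integral>\<^sup>+n. ?i ((x - a) + ?p (- n)) \<partial>count_space UNIV)"
      by (rule nn_integral_cmult) simp
    finally show "(\<integral>\<^sup>+n. f x * ?i (x - ?p n - a) * ?i x \<partial>count_space UNIV)
        = f x * ?i x * (\<integral>\<^sup>+n. ?i ((x - a) + ?p (- n)) \<partial>count_space UNIV)" .
  qed
  also have "\<dots> = (\<integral>\<^sup>+x. f x * ?i x * (\<integral>\<^sup>+n. ?i ((x - a) + ?p n) \<partial>count_space UNIV) \<partial>lborel)"
    by (subst nn_integral_bij_count_space[where g=uminus and A=UNIV]) (auto intro: bij_uminus)
  also have "\<dots> = (\<integral>\<^sup>+x. f x \<partial>torus)"
    by (simp add: one nn_integral_torus)
  finally show ?thesis .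
qed

lemma emeasure_torus: "emeasure torus (space (torus :: (real^'d) measure)) = ennreal ((2 * pi) ^ CARD('d))"
proof -
  have "emeasure torus (space (torus :: (real^'d) measure)) = emeasure lborel (cbox 0 (\<chi> i. 2 * pi) :: (real^'d) set)"
    unfolding torus_def
    by (subst emeasure_restrict_space) (simp_all only: space_restrict_space space_lborel sets_lborel Int_UNIV_left Int_UNIV_right cbox_borel space_borel subset_UNIV order_refl)
  also have "\<dots> = ennreal ((2 * pi) ^ CARD('d))"
  proof -
    have "(\<Prod>b\<in>Basis. ((\<chi> i. 2 * pi) - 0 :: real^'d) \<bullet> b) = (\<Prod>b\<in>(Basis :: (real^'d) set). 2 * pi)"
      by (intro prod.cong) (auto simp: Basis_vec_def inner_axis)
    also have "\<dots> = (2 * pi) ^ CARD('d)"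
      by (simp only: prod_constant) (simp add: DIM_cart)
    finally have *: "(\<Prod>b\<in>Basis. ((\<chi> i. 2 * pi) - 0 :: real^'d) \<bullet> b) = (2 * pi) ^ CARD('d)" .
    have "0 \<bullet> b \<le> (\<chi> i. 2 * pi) \<bullet> b" if "b \<in> Basis" for b :: "real^'d"
      using that by (auto simp: Basis_vec_def inner_axis)
    then show ?thesis
      by (subst emeasure_lborel_cbox) (simp_all only: *)
  qed
  finally show ?thesis .
qed

interpretation torus: finite_measure "torus :: (real^'d) measure"
  by standard (simp add: emeasure_torus)

lemma measure_torus: "measure torus (space (torus :: (real^'d) measure)) = (2 * pi) ^ CARD('d)"
  by (simp add: measure_def emeasure_torus)

lemma half_cell_subset_space: "half_cell \<subseteq> space torus"
  by (auto simp: half_cell_def space_torus mem_box_cart less_imp_le)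

lemma wrap_shift_measurable: "(\<lambda>x. wrap (x + a)) \<in> measurable torus (torus :: (real ^ 'd) measure)"
proof -
  have "(\<lambda>x. wrap (x + a)) \<in> measurable torus (borel :: (real ^ 'd) measure)"
    by (rule measurable_torus) measurable
  then show ?thesis
    using half_cell_subset_space wrap_in_half_cell
    unfolding measurable_cong_sets[OF refl sets_torus]
    by (intro measurable_restrict_space2) (auto simp: space_torus)
qed

text \<open>
  Translation invariance as an invariance of measure. In this form it transfers from nonnegative
  integrands to Bochner integrals with values in a Banach space.
\<close>

lemma distr_torus_wrap: "distr torus torus (\<lambda>x. wrap (x + a)) = (torus :: (real^'d) measure)"
proof (rule measure_eqI)
  fix A :: "(real^'d) set" assume A: "A \<in> sets (distr torus torus (\<lambda>x. wrap (x + a)))"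
  then have A' [measurable]: "A \<in> sets torus" by simp
  then have [measurable]: "A \<in> sets borel"
    by (simp add: sets_torus sets_restrict_space_iff)
  have per: "x_periodic (\<lambda>x. indicator A (wrap x) :: ennreal)"
    by (simp add: x_periodic_def x_periodicD[OF x_periodic_wrap])
  have "emeasure (distr torus torus (\<lambda>x. wrap (x + a))) A = (\<integral>\<^sup>+x. indicator A x \<partial>distr torus torus (\<lambda>x. wrap (x + a)))"
    by (rule nn_integral_indicator[OF A, symmetric])
  also have "\<dots> = (\<integral>\<^sup>+x. indicator A (wrap (x + a)) \<partial>torus)"
    by (rule nn_integral_distr[OF wrap_shift_measurable borel_measurable_indicator[OF A]])
  also have "\<dots> = (\<integral>\<^sup>+x. indicator A (wrap x) \<partial>torus)"
    by (rule nn_integral_torus_shift[OF _ per]) measurable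
  also have "\<dots> = (\<integral>\<^sup>+x. indicator A x \<partial>torus)"
    using AE_half_cell by (intro nn_integral_cong_AE) (auto elim!: eventually_mono simp: wrap_half_cell)
  also have "\<dots> = emeasure torus A" by simp
  finally show "emeasure (distr torus torus (\<lambda>x. wrap (x + a))) A = emeasure torus A" .
qed simp

lemma integral_torus_shift:
  fixes f :: "real ^ 'd \<Rightarrow> 'b :: {banach, second_countable_topology}"
  assumes [measurable]: "f \<in> borel_measurable borel" and per: "x_periodic f"
  shows "(\<integral>x. f (x + a) \<partial>torus) = (\<integral>x. f x \<partial>torus)"
proof -
  have "(\<integral>x. f x \<partial>torus) = (\<integral>x. f x \<partial>distr torus torus (\<lambda>x. wrap (x + a)))"
    by (simp add: distr_torus_wrap)
  also have "\<dots> = (\<integral>x. f (wrap (x + a)) \<partial>torus)"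
    by (intro integral_distr wrap_shift_measurable measurable_torus assms)
  finally show ?thesis by (simp add: periodic_wrap[OF per])
qed

definition ch :: "int ^ 'd \<Rightarrow> real ^ 'd \<Rightarrow> complex" where
  "ch n x = cis (x \<bullet> rvec n)"

lemma inner_rvec: "x \<bullet> rvec n = (\<Sum>i\<in>UNIV. x $ i * of_int (n $ i))"
  by (simp add: inner_vec_def rvec_def)

lemma ch_add: "ch n (x + y) = ch n x * ch n y"
  by (simp add: ch_def inner_add_left cis_mult)

lemma ch_mult: "ch m x * ch n x = ch (m + n) x"
  by (simp add: ch_def rvec_add inner_add_right cis_mult)

lemma cnj_ch: "cnj (ch n x) = ch (- n) x"
  by (simp add: ch_def rvec_minus cis_cnj)

lemma ch_0 [simp]: "ch 0 x = 1" by (simp add: ch_def)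

lemma norm_ch [simp]: "norm (ch n x) = 1" by (simp add: ch_def)

lemma ch_measurable [measurable]: "ch n \<in> borel_measurable borel"
  unfolding ch_def[abs_def] cis_conv_exp by measurable

lemma x_periodic_ch: "x_periodic (ch n)"
proof -
  have "ch n ((2 * pi) *\<^sub>R rvec m) = 1" for m
  proof -
    have "((2 * pi) *\<^sub>R rvec m) \<bullet> rvec n = 2 * pi * of_int (\<Sum>i\<in>UNIV. m $ i * n $ i)"
      by (simp add: inner_rvec sum_distrib_left) (simp add: rvec_def mult_ac)
    then show ?thesis unfolding ch_def by (simp only:) (intro cis_multiple_2pi, simp only: Ints_of_int)
  qed
  then show ?thesis by (simp add: x_periodic_def ch_add)
qed

lemma integral_ch: "(\<integral>x. ch n x \<partial>(torus :: (real^'d) measure)) = (if n = 0 then (2 * pi) ^ CARD('d) else 0)"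
proof (cases "n = 0")
  case True
  then show ?thesis by (simp add: measure_torus scaleR_conv_of_real)
next
  case False
  then obtain i where i: "n $ i \<noteq> 0" by (auto simp: vec_eq_iff)
  define y :: "real^'d" where "y = axis i (pi / of_int (n $ i))"
  have "ch n y = -1"
    using i by (simp add: ch_def y_def inner_axis' rvec_def)
  then have "(\<integral>x. ch n (x + y) \<partial>torus) = - (\<integral>x. ch n x \<partial>torus)"
    by (simp add: ch_add)
  moreover have "(\<integral>x. ch n (x + y) \<partial>torus) = (\<integral>x. ch n x \<partial>torus)"
    by (intro integral_torus_shift x_periodic_ch) auto
  ultimately show ?thesis using False by simp
qed

lemma integrable_torus_bounded:
  fixes f :: "real ^ 'd \<Rightarrow> 'b :: {banach, second_countable_topology}"
  assumes [measurable]: "f \<in> borel_measurable borel" and "\<And>x. norm (f x) \<le> B"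
  shows "integrable torus f"
  using assms by (intro torus.integrable_const_bound[where B=B] measurable_torus) auto

lemma fourier_coeff_alt: "fourier_coeff f n = (\<integral>x. f x * ch (- n) x \<partial>torus) / complex_of_real ((2 * pi) ^ CARD('d))"
  for f :: "real^'d \<Rightarrow> complex"
  by (simp add: fourier_coeff_def ch_def rvec_minus)

lemma bij_betw_vec_PiE: "bij_betw vec_nth {n :: 'b ^ 'd. \<forall>i. n $ i \<in> A i} (Pi\<^sub>E UNIV A)"
proof (rule bij_betw_byWitness[where f' = vec_lambda])
  show "vec_nth ` {n :: 'b ^ 'd. \<forall>i. n $ i \<in> A i} \<subseteq> Pi\<^sub>E UNIV A" by auto
  show "vec_lambda ` Pi\<^sub>E UNIV A \<subseteq> {n :: 'b ^ 'd. \<forall>i. n $ i \<in> A i}" by (auto simp: PiE_iff)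
qed (auto simp: vec_lambda_inverse)

lemma card_vec_PiE: "card {n :: 'b ^ 'd. \<forall>i. n $ i \<in> A i} = (\<Prod>i\<in>UNIV. card (A i))"
  using bij_betw_same_card[OF bij_betw_vec_PiE, of A] by (simp add: card_PiE)

lemma finite_vec_PiE:
  assumes "\<And>i. finite (A i)"
  shows "finite {n :: 'b ^ 'd. \<forall>i. n $ i \<in> A i}"
  using bij_betw_finite[OF bij_betw_vec_PiE, of A] assms by (simp add: finite_PiE)

lemma freq_cube_alt: "freq_cube N = {n. \<forall>i. n $ i \<in> {- int N..int N}}"
proof -
  have "\<bar>k\<bar> \<le> int N \<longleftrightarrow> k \<in> {- int N..int N}" for k by auto
  then show ?thesis by (simp add: freq_cube_def)
qed

lemma finite_freq_cube [simp]: "finite (freq_cube N)"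
  unfolding freq_cube_alt by (rule finite_vec_PiE) simp

lemma card_freq_cube: "card (freq_cube N :: (int ^ 'd) set) = (2 * N + 1) ^ CARD('d)"
  unfolding freq_cube_alt card_vec_PiE by (simp add: nat_add_distrib nat_mult_distrib)

section \<open>The Fejer kernel\<close>

text \<open>
  A translation distance on the torus. It is periodic, and the first difference of a character of
  frequency at most \<open>N\<close> is at most \<open>N\<close> times this distance, so it plays
  the role of \<open>\<bar>y\<bar>\<close>.
\<close>

definition phase_dist :: "real ^ 'd \<Rightarrow> real" where
  "phase_dist y = (\<Sum>i\<in>UNIV. cmod (cis (y $ i) - 1))"

lemma phase_dist_nonneg [simp]: "0 \<le> phase_dist y"
  by (simp add: phase_dist_def sum_nonneg)

lemma cis_nth_measurable [measurable]: "(\<lambda>y::real^'d. cis (y $ i)) \<in> borel_measurable borel"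
  unfolding cis_conv_exp using borel_measurable_vec_nth by measurable

lemma phase_dist_measurable [measurable]: "phase_dist \<in> borel_measurable borel"
  unfolding phase_dist_def[abs_def] by measurable

lemma cmod_cis_int_mult: "cmod (cis (of_int k * t) - 1) \<le> \<bar>of_int k\<bar> * cmod (cis t - 1)"
proof -
  have nat: "cmod (cis (real n * t) - 1) \<le> real n * cmod (cis t - 1)" for n
    using norm_power_diff[of "cis t" 1 n] by (simp add: Complex.DeMoivre)
  show ?thesis
  proof (cases "0 \<le> k")
    case True
    then show ?thesis using nat[of "nat k"] by simp
  next
    case False
    have "cmod (cis (of_int k * t) - 1) = cmod (cnj (cis (of_int k * t) - 1))"
      by (simp only: complex_mod_cnj)
    also have "\<dots> = cmod (cis (real (nat (- k)) * t) - 1)"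
      using False by (simp add: cis_cnj)
    also have "\<dots> \<le> \<bar>of_int k\<bar> * cmod (cis t - 1)"
      using nat[of "nat (- k)"] False by simp
    finally show ?thesis .
  qed
qed

lemma ch_conv_prod: "ch n y = (\<Prod>i\<in>UNIV. cis (of_int (n $ i) * (y $ i)))"
proof -
  have "cis (\<Sum>i\<in>I. f i) = (\<Prod>i\<in>I. cis (f i))" if "finite I" for I and f :: "'a \<Rightarrow> real"
    using that by induction (simp_all add: cis_mult[symmetric])
  then show ?thesis by (simp add: ch_def inner_rvec mult.commute)
qed

text \<open>
  The telescoping bound for a difference of products of unimodular numbers, one factor for each
  coordinate.
\<close>

lemma cmod_ch_minus_1:
  assumes "n \<in> freq_cube N"
  shows "cmod (ch n y - 1) \<le> real N * phase_dist y"
proof -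
  have "cmod ((\<Prod>i\<in>UNIV. cis (of_int (n $ i) * (y $ i))) - (\<Prod>i\<in>(UNIV::'a set). 1))
      \<le> (\<Sum>i\<in>UNIV. cmod (cis (of_int (n $ i) * (y $ i)) - 1))"
    by (rule norm_prod_diff) auto
  also have "\<dots> \<le> (\<Sum>i\<in>UNIV. real N * cmod (cis (y $ i) - 1))"
  proof (intro sum_mono)
    fix i
    have "\<bar>n $ i\<bar> \<le> int N" using assms by (simp add: freq_cube_def)
    then have "\<bar>real_of_int (n $ i)\<bar> \<le> real N" by linarith
    then show "cmod (cis (of_int (n $ i) * (y $ i)) - 1) \<le> real N * cmod (cis (y $ i) - 1)"
      by (intro order_trans[OF cmod_cis_int_mult] mult_right_mono) auto
  qed
  finally show ?thesis by (simp add: ch_conv_prod phase_dist_def sum_distrib_left)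
qed

lemma integrable_ch: "integrable torus (\<lambda>x. c * ch n x)"
  by (rule integrable_torus_bounded[where B="cmod c"]) (auto simp: norm_mult)

lemma integral_trig_square:
  fixes A :: "(int ^ 'd) set"
  assumes "finite A"
  shows "(\<integral>x. (cmod (\<Sum>n\<in>A. c n * ch n x))\<^sup>2 \<partial>torus) = (2 * pi) ^ CARD('d) * (\<Sum>n\<in>A. (cmod (c n))\<^sup>2)"
proof -
  have "complex_of_real ((cmod (\<Sum>n\<in>A. c n * ch n x))\<^sup>2) = (\<Sum>n\<in>A. \<Sum>m\<in>A. (c n * cnj (c m)) * ch (n - m) x)" for x
    unfolding complex_norm_square
    by (simp add: sum_product cnj_ch ch_mult[of _ _ "- _"] mult_ac flip: ch_mult)
  then have "complex_of_real (\<integral>x. (cmod (\<Sum>n\<in>A. c n * ch n x))\<^sup>2 \<partial>torus)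
      = (\<integral>x. (\<Sum>n\<in>A. \<Sum>m\<in>A. (c n * cnj (c m)) * ch (n - m) x) \<partial>torus)"
    by (simp only: integral_complex_of_real[symmetric])
  also have "\<dots> = (\<Sum>n\<in>A. \<Sum>m\<in>A. if n = m then (c n * cnj (c m)) * complex_of_real ((2 * pi) ^ CARD('d)) else 0)"
    by (subst Bochner_Integration.integral_sum)
       (auto simp: integrable_ch Bochner_Integration.integral_sum integral_ch intro!: sum.cong)
  also have "\<dots> = (\<Sum>n\<in>A. (c n * cnj (c n)) * (2 * pi) ^ CARD('d))"
    using assms by (simp add: sum.delta)
  also have "\<dots> = complex_of_real ((2 * pi) ^ CARD('d) * (\<Sum>n\<in>A. (cmod (c n))\<^sup>2))"
    by (simp add: complex_norm_square sum_distrib_left mult_ac del: of_real_power) 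
  finally show ?thesis by (simp only: of_real_eq_iff)
qed

definition fbox :: "nat \<Rightarrow> (int ^ 'd) set" where
  "fbox M = {n. \<forall>i. n $ i \<in> {0..<int M}}"

lemma finite_fbox [simp]: "finite (fbox M)"
  unfolding fbox_def by (rule finite_vec_PiE) simp

lemma card_fbox: "card (fbox M :: (int ^ 'd) set) = M ^ CARD('d)"
  unfolding fbox_def card_vec_PiE by simp

text \<open>
  The tensor product of one-dimensional Fejer kernels, written as the normalised square of a
  Dirichlet kernel over a box. The square makes it nonnegative, while its frequencies stay below
  \<open>M\<close> in each coordinate.
\<close>

definition fejer :: "nat \<Rightarrow> real ^ 'd \<Rightarrow> real" where
  "fejer M y = (cmod (\<Sum>n\<in>fbox M. ch n y))\<^sup>2 / ((2 * pi) ^ CARD('d) * real M ^ CARD('d))"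

lemma fejer_nonneg [simp]: "0 \<le> fejer M y"
  by (simp add: fejer_def)

lemma fejer_measurable [measurable]: "fejer M \<in> borel_measurable borel"
  unfolding fejer_def[abs_def] by measurable

lemma fejer_bounded: "fejer M (y :: real ^ 'd) \<le> (real M ^ CARD('d))\<^sup>2 / ((2 * pi) ^ CARD('d) * real M ^ CARD('d))"
proof -
  have "cmod (\<Sum>n\<in>fbox M. ch n y) \<le> (\<Sum>n\<in>(fbox M :: (int ^ 'd) set). 1)"
    by (rule sum_norm_le) simp
  then have "cmod (\<Sum>n\<in>fbox M. ch n y) \<le> real M ^ CARD('d)" by (simp add: card_fbox)
  then show ?thesis unfolding fejer_def by (intro divide_right_mono power_mono) auto
qed

lemma integrable_fejer: "integrable torus (fejer M)"
  using fejer_bounded by (intro integrable_torus_bounded) auto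

lemma integral_fejer:
  assumes "0 < M"
  shows "(\<integral>y. fejer M y \<partial>(torus :: (real ^ 'd) measure)) = 1"
  using integral_trig_square[of "fbox M :: (int ^ 'd) set" "\<lambda>_. 1"] assms
  by (simp add: fejer_def card_fbox)

lemma fbox_diff: "n \<in> fbox M \<Longrightarrow> m \<in> fbox M \<Longrightarrow> n - m \<in> freq_cube (M - 1)"
proof -
  assume *: "n \<in> fbox M" "m \<in> fbox M"
  have "\<bar>n $ i - m $ i\<bar> \<le> int (M - 1)" for i
    using *[unfolded fbox_def, simplified, THEN spec[of _ i]] by auto
  then show ?thesis by (simp add: freq_cube_def)
qed

lemma uminus_freq_cube [simp]: "- n \<in> freq_cube M \<longleftrightarrow> n \<in> freq_cube M"
  by (simp add: freq_cube_def)

lemma fejer_conv_sum: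
  "\<exists>K. \<forall>y :: real ^ 'd. complex_of_real (fejer M y) = (\<Sum>n\<in>fbox M. \<Sum>m\<in>fbox M. K * ch (n - m) y)"
proof (intro exI allI)
  fix y :: "real ^ 'd"
  let ?K = "complex_of_real (1 / ((2 * pi) ^ CARD('d) * real M ^ CARD('d)))"
  have "complex_of_real ((cmod (\<Sum>n\<in>fbox M. ch n y))\<^sup>2) = (\<Sum>n\<in>fbox M. \<Sum>m\<in>fbox M. ch (n - m) y)"
    unfolding complex_norm_square
    by (simp add: sum_product cnj_ch ch_mult)
  then have "?K * complex_of_real ((cmod (\<Sum>n\<in>fbox M. ch n y))\<^sup>2) = (\<Sum>n\<in>fbox M. \<Sum>m\<in>fbox M. ?K * ch (n - m) y)"
    by (simp only: sum_distrib_left)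
  moreover have "complex_of_real (fejer M y) = ?K * complex_of_real ((cmod (\<Sum>n\<in>fbox M. ch n y))\<^sup>2)"
    unfolding fejer_def by simp
  ultimately show "complex_of_real (fejer M y) = (\<Sum>n\<in>fbox M. \<Sum>m\<in>fbox M. ?K * ch (n - m) y)"
    by (simp only:)
qed

text \<open>
  Multiplying the Dirichlet kernel by \<open>e\<^sup>i\<^sup>y\<^sub>i - 1\<close> cancels
  everything except the two faces of the box orthogonal to the direction \<open>i\<close>, so
  Parseval's identity gives the moment exactly.
\<close>

lemma fejer_second_moment:
  fixes i :: "'d::finite"
  assumes "0 < M"
  shows "(\<integral>y. fejer M y * (cmod (cis (y $ i) - 1))\<^sup>2 \<partial>(torus :: (real ^ 'd) measure)) = 2 / real M"
proof -
  define R where "R n \<longleftrightarrow> (\<forall>j. j \<noteq> i \<longrightarrow> 0 \<le> n $ j \<and> n $ j < int M)" for n :: "int ^ 'd"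
  define S0 :: "(int ^ 'd) set" where "S0 = {n. n $ i = 0 \<and> R n}"
  define S1 :: "(int ^ 'd) set" where "S1 = {n. n $ i = int M \<and> R n}"
  define S :: "(int ^ 'd) set" where "S = {n. 0 \<le> n $ i \<and> n $ i \<le> int M \<and> R n}"
  let ?e = "axis i 1 :: int ^ 'd"
  have split_all: "(\<forall>j. P j) \<longleftrightarrow> P i \<and> (\<forall>j. j \<noteq> i \<longrightarrow> P j)" for P :: "'d \<Rightarrow> bool"
    by metis
  have fbox: "fbox M = {n. 0 \<le> n $ i \<and> n $ i < int M \<and> R n}"
    unfolding fbox_def R_def by (subst split_all) simp
  have vec: "{n. n $ i \<in> X \<and> R n} = {n. \<forall>j. n $ j \<in> (if j = i then X else {0..<int M})}" for X
    unfolding R_def by (subst split_all) simp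
  have card_vec: "card {n. n $ i \<in> X \<and> R n} = card X * M ^ (CARD('d) - 1)" for X
    unfolding vec card_vec_PiE
    by (subst prod.remove[of _ i]) (simp_all add: card_Diff_singleton)
  have cards: "card S0 = M ^ (CARD('d) - 1)" "card S1 = M ^ (CARD('d) - 1)"
    using card_vec[of "{0}"] card_vec[of "{int M}"] by (simp_all add: S0_def S1_def)
  have "S = {n. n $ i \<in> {0..int M} \<and> R n}" by (auto simp: S_def)
  also have "finite \<dots>" unfolding vec by (rule finite_vec_PiE) simp
  finally have fin: "finite S" .
  have S: "S = fbox M \<union> S1" "fbox M \<inter> S1 = {}"
    unfolding fbox S_def S1_def by auto
  have Re: "R (n - ?e) = R n" for n
    by (simp add: R_def axis_def)
  have im: "(\<lambda>n. n + ?e) ` fbox M = {n. 1 \<le> n $ i \<and> n $ i < int M + 1 \<and> R n}"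
  proof (intro set_eqI iffI)
    fix n assume n: "n \<in> {n. 1 \<le> n $ i \<and> n $ i < int M + 1 \<and> R n}"
    then have "n - ?e \<in> fbox M" unfolding fbox using Re[of n] by simp
    then show "n \<in> (\<lambda>n. n + ?e) ` fbox M" by (intro image_eqI[of _ _ "n - ?e"]) simp_all
  next
    fix n assume "n \<in> (\<lambda>n. n + ?e) ` fbox M"
    then obtain m where "n = m + ?e" "m \<in> fbox M" by blast
    then show "n \<in> {n. 1 \<le> n $ i \<and> n $ i < int M + 1 \<and> R n}"
      using Re[of n] unfolding fbox by simp
  qed
  have e_im: "(\<lambda>n. n + ?e) ` fbox M \<union> S0 = S" "(\<lambda>n. n + ?e) ` fbox M \<inter> S0 = {}"
    unfolding im S_def S0_def by auto
  \<comment> \<open>The coefficients of the product of the Dirichlet kernel and \<open>e\<^sup>i\<^sup>y\<^sub>i - 1\<close>.\<close>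
  define c where "c n = (if n \<in> S0 then - 1 else 0) + (if n \<in> S1 then 1 else (0::complex))" for n
  have c: "(\<Sum>n\<in>S. c n * ch n y) = (\<Sum>n\<in>fbox M. ch n y) * (cis (y $ i) - 1)" for y :: "real ^ 'd"
  proof -
    have "cis (y $ i) = ch ?e y"
      by (simp add: ch_def inner_rvec axis_def if_distrib[of "\<lambda>z. _ * of_int z"] cong: if_cong)
    then have 1: "(\<Sum>n\<in>fbox M. ch n y) * cis (y $ i) = (\<Sum>n\<in>(\<lambda>n. n + ?e) ` fbox M. ch n y)"
      by (subst sum.reindex) (auto simp: inj_on_def sum_distrib_right ch_mult)
    have fS: "finite S0" "finite S1" using fin S e_im by (metis finite_Un)+
    have "(\<Sum>n\<in>S. ch n y) = (\<Sum>n\<in>(\<lambda>n. n + ?e) ` fbox M. ch n y) + (\<Sum>n\<in>S0. ch n y)"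
      unfolding e_im(1)[symmetric] using fS by (intro sum.union_disjoint e_im(2)) auto
    moreover have "(\<Sum>n\<in>S. ch n y) = (\<Sum>n\<in>fbox M. ch n y) + (\<Sum>n\<in>S1. ch n y)"
      unfolding S(1) using fS by (intro sum.union_disjoint S(2)) auto
    moreover have "(\<Sum>n\<in>S. c n * ch n y) = - (\<Sum>n\<in>S0. ch n y) + (\<Sum>n\<in>S1. ch n y)"
    proof -
      have "(\<Sum>n\<in>S. c n * ch n y) = (\<Sum>n\<in>S. (if n \<in> S0 then - ch n y else 0)) + (\<Sum>n\<in>S. (if n \<in> S1 then ch n y else 0))"
        unfolding sum.distrib[symmetric] by (intro sum.cong) (auto simp: c_def)
      also have "\<dots> = (\<Sum>n\<in>S \<inter> S0. - ch n y) + (\<Sum>n\<in>S \<inter> S1. ch n y)"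
        using fin by (simp add: sum.inter_restrict)
      also have "S \<inter> S0 = S0" using e_im by auto
      also have "S \<inter> S1 = S1" using S by auto
      finally show ?thesis by (simp add: sum_negf)
    qed
    ultimately show ?thesis using 1 by algebra
  qed
  have disj: "S0 \<inter> S1 = {}" using assms by (auto simp: S0_def S1_def)
  have "(\<Sum>n\<in>S. (cmod (c n))\<^sup>2) = (\<Sum>n\<in>S. (if n \<in> S0 then 1 else 0) + (if n \<in> S1 then 1 else 0))"
    using disj by (intro sum.cong) (auto simp: c_def)
  also have "\<dots> = real (card (S \<inter> S0)) + real (card (S \<inter> S1))"
    using fin by (simp add: sum.distrib sum.If_cases)
  also have "S \<inter> S0 = S0" using e_im by auto
  also have "S \<inter> S1 = S1" using S by auto
  finally have sq: "(\<Sum>n\<in>S. (cmod (c n))\<^sup>2) = 2 * real M ^ (CARD('d) - 1)"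
    by (simp add: cards)
  have "(\<integral>y. fejer M y * (cmod (cis (y $ i) - 1))\<^sup>2 \<partial>(torus :: (real ^ 'd) measure))
      = (\<integral>y. (cmod (\<Sum>n\<in>S. c n * ch n y))\<^sup>2 / ((2 * pi) ^ CARD('d) * real M ^ CARD('d)) \<partial>torus)"
    by (simp add: c fejer_def norm_mult power_mult_distrib)
  also have "\<dots> = 2 * real M ^ (CARD('d) - 1) / real M ^ CARD('d)"
    by (simp add: integral_trig_square[OF fin] sq)
  also have "real M ^ CARD('d) = real M * real M ^ (CARD('d) - 1)"
    by (metis Suc_diff_1 power_Suc zero_less_card_finite)
  finally show ?thesis using assms by simp
qed

text \<open>
  The constant of the Jackson-type inequality below: mollifying a function with modulus of
  continuity \<open>m\<^sup>s\<close> at frequency scale \<open>M\<close> moves it by at most this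
  constant times \<open>M\<^sup>-\<^sup>s\<^sup>/\<^sup>2\<close>.
\<close>

definition jackson_const :: "'d::finite itself \<Rightarrow> real" where
  "jackson_const _ = 1 + 2 * (real CARD('d))\<^sup>2"

lemma jackson_const_pos: "0 < jackson_const TYPE('d::finite)"
  by (simp add: jackson_const_def add_pos_nonneg)

text \<open>
  Only the second moment of the kernel is at hand, and it decays like \<open>1 / M\<close>. The
  bound \<open>z\<^sup>s \<le> 1 + z\<^sup>2\<close> at \<open>z = M\<^sup>1\<^sup>/\<^sup>2
  m(y)\<close> turns it into the rate \<open>M\<^sup>-\<^sup>s\<^sup>/\<^sup>2\<close>, half of
  what smoother kernels would give; this is enough because \<open>\<sigma>\<close> is taken below
  \<open>s / 2\<close>.
\<close>

lemma fejer_moment: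
  assumes "0 < M" and s: "0 < s" "s \<le> 2"
  shows "(\<integral>\<^sup>+y. ennreal (fejer M y) * ennreal (phase_dist y powr s) \<partial>(torus :: (real ^ 'd) measure))
    \<le> ennreal (jackson_const TYPE('d) * real M powr (- s / 2))"
proof -
  have pw: "phase_dist y powr s \<le> real M powr (- s / 2) * (1 + real M * real CARD('d) * (\<Sum>i\<in>UNIV. (cmod (cis (y $ i) - 1))\<^sup>2))"
    for y :: "real ^ 'd"
  proof -
    define z where "z = sqrt (real M) * phase_dist y"
    have z: "0 \<le> z" by (simp add: z_def)
    have "z powr s \<le> 1 + z\<^sup>2"
    proof (cases "z \<le> 1")
      case True
      then have "z powr s \<le> 1" using z s by (intro powr_le1) auto
      then show ?thesis by (smt (verit) zero_le_power2)
    next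
      case False
      then have "z powr s \<le> z powr 2" using s by (intro powr_mono) auto
      then show ?thesis using z by simp
    qed
    moreover have "z\<^sup>2 \<le> real M * (real CARD('d) * (\<Sum>i\<in>UNIV. (cmod (cis (y $ i) - 1))\<^sup>2))"
    proof -
      have "(phase_dist y)\<^sup>2 \<le> real CARD('d) * (\<Sum>i\<in>UNIV. (cmod (cis (y $ i) - 1))\<^sup>2)"
        using Cauchy_Schwarz_ineq_sum[of "\<lambda>_. 1" "\<lambda>i. cmod (cis (y $ i) - 1)" UNIV]
        by (simp add: phase_dist_def)
      then show ?thesis by (simp add: z_def power_mult_distrib mult_left_mono)
    qed
    moreover have "phase_dist y powr s = real M powr (- s / 2) * z powr s"
      using assms by (simp add: z_def powr_mult powr_half_sqrt[symmetric] powr_powr powr_add[symmetric] mult.assoc[symmetric])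
    ultimately show ?thesis by (smt (verit) mult.assoc mult_left_mono powr_ge_zero)
  qed
  let ?g = "\<lambda>y::real^'d. fejer M y * (real M powr (- s / 2) * (1 + real M * real CARD('d) * (\<Sum>i\<in>UNIV. (cmod (cis (y $ i) - 1))\<^sup>2)))"
  have int1: "integrable torus (\<lambda>y::real^'d. fejer M y * (cmod (cis (y $ i) - 1))\<^sup>2)" for i
  proof (rule integrable_torus_bounded)
    fix y :: "real ^ 'd"
    have "(cmod (cis (y $ i) - 1))\<^sup>2 \<le> 2\<^sup>2"
      using norm_triangle_ineq4[of "cis (y $ i)" 1] by (intro power_mono) auto
    then show "norm (fejer M y * (cmod (cis (y $ i) - 1))\<^sup>2) \<le> (real M ^ CARD('d))\<^sup>2 / ((2 * pi) ^ CARD('d) * real M ^ CARD('d)) * 2\<^sup>2"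
      unfolding norm_mult by (intro mult_mono) (use fejer_bounded[of M y] in auto)
  qed measurable
  have g: "?g y = real M powr (- s / 2) * (fejer M y + real M * real CARD('d) * (\<Sum>i\<in>UNIV. fejer M y * (cmod (cis (y $ i) - 1))\<^sup>2))" for y
    by (simp add: algebra_simps sum_distrib_left)
  have int: "integrable torus ?g"
    unfolding g by (intro integrable_mult_right Bochner_Integration.integrable_add integrable_fejer Bochner_Integration.integrable_sum int1)
  have "(\<integral>\<^sup>+y. ennreal (fejer M y) * ennreal (phase_dist y powr s) \<partial>(torus :: (real ^ 'd) measure)) \<le> (\<integral>\<^sup>+y. ennreal (?g y) \<partial>torus)"
    unfolding ennreal_mult[OF fejer_nonneg powr_ge_zero, symmetric]
    by (intro nn_integral_mono ennreal_leI mult_left_mono pw fejer_nonneg)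
  also have "\<dots> = ennreal (\<integral>y. ?g y \<partial>torus)"
    by (intro nn_integral_eq_integral int AE_I2) (auto intro!: mult_nonneg_nonneg add_nonneg_nonneg sum_nonneg)
  also have "(\<integral>y. ?g y \<partial>torus) = real M powr (- s / 2) * (1 + real M * real CARD('d) * (\<Sum>i\<in>(UNIV::'d set). 2 / real M))"
    unfolding g using assms
    by (simp add: integral_fejer fejer_second_moment int1 integrable_fejer Bochner_Integration.integral_add
        Bochner_Integration.integral_sum del: sum_constant)
  also have "\<dots> = jackson_const TYPE('d) * real M powr (- s / 2)"
    using assms by (simp add: jackson_const_def power2_eq_square)
  finally show ?thesis .
qed

section \<open>Dyadic frequency blocks in space\<close>

abbreviation jointly_measurable :: "(real \<Rightarrow> real ^ 'd \<Rightarrow> complex) \<Rightarrow> bool" where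
  "jointly_measurable u \<equiv> (\<lambda>(t, x). u t x) \<in> borel_measurable borel"

lemma jointly_measurableD: "jointly_measurable u \<Longrightarrow> (\<lambda>(t, x). u t x) \<in> borel_measurable (borel \<Otimes>\<^sub>M borel)"
  unfolding borel_prod .

interpretation ST: pair_sigma_finite lborel "torus :: (real ^ 'd) measure"
  by unfold_locales

interpretation torus_ST: pair_sigma_finite "torus :: (real ^ 'd) measure" "spacetime :: (real \<times> (real ^ 'd)) measure"
  by (intro pair_sigma_finite.intro ST.sigma_finite_measure_axioms torus.sigma_finite_measure_axioms)

lemma torus_ST_id: "(\<lambda>q. q) \<in> measurable ((torus :: (real ^ 'd) measure) \<Otimes>\<^sub>M (spacetime :: (real \<times> (real ^ 'd)) measure)) (borel \<Otimes>\<^sub>M (borel \<Otimes>\<^sub>M borel))"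
proof -
  have t: "(\<lambda>x. x) \<in> measurable (torus :: (real ^ 'd) measure) borel"
    by (rule measurable_torus) simp
  have "(\<lambda>p. (fst p, snd p)) \<in> measurable (spacetime :: (real \<times> (real ^ 'd)) measure) (borel \<Otimes>\<^sub>M borel)"
    by (intro measurable_Pair measurable_compose[OF measurable_snd t] measurable_compose[OF measurable_fst]) simp
  then have p: "(\<lambda>p. p) \<in> measurable (spacetime :: (real \<times> (real ^ 'd)) measure) (borel \<Otimes>\<^sub>M borel)" by simp
  have "fst \<in> measurable ((torus :: (real ^ 'd) measure) \<Otimes>\<^sub>M (spacetime :: (real \<times> (real ^ 'd)) measure)) borel"
    by (rule measurable_compose[OF measurable_fst t])
  moreover have "snd \<in> measurable ((torus :: (real ^ 'd) measure) \<Otimes>\<^sub>M (spacetime :: (real \<times> (real ^ 'd)) measure)) (borel \<Otimes>\<^sub>M borel)"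
    by (rule measurable_compose[OF measurable_snd p])
  ultimately have "(\<lambda>q. (fst q, snd q)) \<in> measurable ((torus :: (real ^ 'd) measure) \<Otimes>\<^sub>M (spacetime :: (real \<times> (real ^ 'd)) measure)) (borel \<Otimes>\<^sub>M (borel \<Otimes>\<^sub>M borel))"
    by (rule measurable_Pair)
  then show ?thesis by simp
qed

lemma measurable_torus_ST:
  fixes f :: "real ^ 'd \<Rightarrow> real \<Rightarrow> real ^ 'd \<Rightarrow> 'b :: topological_space"
  assumes "(\<lambda>(z, t, x). f z t x) \<in> borel_measurable (borel \<Otimes>\<^sub>M (borel \<Otimes>\<^sub>M borel))"
  shows "(\<lambda>(z, t, x). f z t x) \<in> borel_measurable (torus \<Otimes>\<^sub>M spacetime)"
  using measurable_compose[OF torus_ST_id assms] .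

text \<open>
  The cell carries the restricted sigma-algebra, so a function that is measurable on all of
  space-time is measurable on the cell. Measurability is therefore always proved for the plain
  Borel algebras first.
\<close>

lemma measurable_ST:
  fixes f :: "real \<Rightarrow> real ^ 'd \<Rightarrow> 'b :: topological_space"
  assumes "(\<lambda>(t, x). f t x) \<in> borel_measurable (borel \<Otimes>\<^sub>M borel)"
  shows "(\<lambda>(t, x). f t x) \<in> borel_measurable spacetime"
  by (rule measurable_spacetime) (rule assms[unfolded borel_prod])

lemma nn_integral_ST:
  fixes f :: "real \<Rightarrow> real ^ 'd \<Rightarrow> ennreal"
  assumes "(\<lambda>(t, x). f t x) \<in> borel_measurable (borel \<Otimes>\<^sub>M borel)"
  shows "(\<integral>\<^sup>+(t, x). f t x \<partial>spacetime) = (\<integral>\<^sup>+t. \<integral>\<^sup>+x. f t x \<partial>torus \<partial>lborel)"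
  using torus.nn_integral_fst[OF measurable_ST[OF assms]] by simp

lemma norm_integral_le_nn_integral:
  fixes f :: "'a \<Rightarrow> 'b :: {banach, second_countable_topology}"
  shows "ennreal (norm (\<integral>x. f x \<partial>M)) \<le> (\<integral>\<^sup>+x. ennreal (norm (f x)) \<partial>M)"
proof (cases "integrable M f")
  case True
  then show ?thesis by (rule integral_norm_bound_ennreal)
qed (simp add: not_integrable_integral_eq)

lemma cmod_mult_le: "cmod w \<le> b \<Longrightarrow> cmod (u * w) \<le> b * cmod u"
  using mult_left_mono[of "cmod w" b "cmod u"] by (simp add: norm_mult mult.commute)

lemma fourier_coeff_measurable:
  assumes "jointly_measurable u"
  shows "(\<lambda>t. fourier_coeff (u t) n) \<in> borel_measurable borel"
proof -
  note jointly_measurableD[OF assms, measurable]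
  have "(\<lambda>(t, x). u t x * ch (- n) x) \<in> borel_measurable (borel \<Otimes>\<^sub>M torus)"
    by (rule measurable_pair_torus) measurable
  then show ?thesis unfolding fourier_coeff_alt
    by (intro borel_measurable_divide borel_measurable_const torus.borel_measurable_lebesgue_integral) simp
qed

definition shell :: "nat \<Rightarrow> (int ^ 'd) set" where
  "shell j = (if j = 0 then freq_cube 1 else freq_cube (2 ^ j) - freq_cube (2 ^ (j - 1)))"

lemma finite_shell [simp]: "finite (shell j)"
  by (simp add: shell_def)

lemma freq_cube_mono: "M \<le> N \<Longrightarrow> freq_cube M \<subseteq> freq_cube N"
  by (auto simp: freq_cube_def intro: order_trans)

lemma shell_subset:
  assumes "j \<le> k"
  shows "shell j \<subseteq> freq_cube (2 ^ k)"
proof -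
  have "(2::nat) ^ j \<le> 2 ^ k" using assms by (intro power_increasing) auto
  then have "freq_cube (2 ^ j) \<subseteq> freq_cube (2 ^ k)" by (rule freq_cube_mono)
  moreover have "shell j \<subseteq> freq_cube (2 ^ j)" by (auto simp: shell_def)
  ultimately show ?thesis by blast
qed

lemma P_le_eq: "P_le N f x = (\<Sum>n\<in>freq_cube N. fourier_coeff f n * ch n x)"
  by (simp add: P_le_def ch_def)

lemma P_dy_eq: "P_dy j f x = (\<Sum>n\<in>shell j. fourier_coeff f n * ch n x)"
proof (cases "j = 0")
  case False
  have "freq_cube (2 ^ (j - 1)) \<subseteq> (freq_cube (2 ^ j) :: (int ^ 'a) set)"
    by (rule freq_cube_mono) (simp add: power_increasing)
  then show ?thesis using False
    by (simp add: P_dy_def P_le_eq shell_def sum_diff)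
qed (simp add: P_dy_def P_le_eq shell_def)

lemma sum_P_dy: "(\<Sum>j\<le>J. P_dy j f x) = P_le (2 ^ J) f x"
  by (induction J) (simp_all add: P_dy_def)

lemma jointly_measurable_trig:
  assumes [measurable]: "\<And>n. c n \<in> borel_measurable borel"
  shows "jointly_measurable (\<lambda>t x. \<Sum>n\<in>A. c n t * ch n x)"
  unfolding borel_prod[symmetric] by measurable

lemma jointly_measurable_P_dy:
  assumes "jointly_measurable u"
  shows "jointly_measurable (\<lambda>t. P_dy j (u t))"
  unfolding P_dy_eq by (intro jointly_measurable_trig fourier_coeff_measurable assms)

lemma jointly_measurable_P_le:
  assumes "jointly_measurable u"
  shows "jointly_measurable (\<lambda>t. P_le N (u t))"
  unfolding P_le_eq by (intro jointly_measurable_trig fourier_coeff_measurable assms)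

lemma fourier_coeff_trig:
  fixes A :: "(int ^ 'd) set"
  assumes "finite A"
  shows "fourier_coeff (\<lambda>x. \<Sum>n\<in>A. c n * ch n x) k = (if k \<in> A then c k else 0)"
proof -
  have "(\<integral>x. (\<Sum>n\<in>A. c n * ch n x) * ch (- k) x \<partial>torus) = (\<integral>x. (\<Sum>n\<in>A. c n * ch (n - k) x) \<partial>torus)"
    by (simp add: sum_distrib_right mult.assoc ch_mult)
  also have "\<dots> = (\<Sum>n\<in>A. if n = k then c n * (2 * pi) ^ CARD('d) else 0)"
    by (subst Bochner_Integration.integral_sum) (auto simp: integrable_ch integral_ch intro!: sum.cong)
  also have "\<dots> = (if k \<in> A then c k * (2 * pi) ^ CARD('d) else 0)"
    using assms by (simp add: sum.delta)
  finally show ?thesis by (simp add: fourier_coeff_alt)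
qed

lemma cmod_fourier_coeff_le:
  fixes f :: "real ^ 'd \<Rightarrow> complex"
  shows "ennreal (cmod (fourier_coeff f n)) \<le> (\<integral>\<^sup>+x. ennreal (cmod (f x)) \<partial>torus)"
proof -
  have 1: "1 \<le> (2 * pi) ^ CARD('d)" using pi_ge_two by (intro one_le_power) simp
  have "cmod (fourier_coeff f n) = cmod (\<integral>x. f x * ch (- n) x \<partial>torus) / (2 * pi) ^ CARD('d)"
    unfolding fourier_coeff_alt norm_divide by (simp add: norm_power norm_mult)
  also have "\<dots> \<le> cmod (\<integral>x. f x * ch (- n) x \<partial>torus)"
    using 1 mult_left_mono[OF 1, of "cmod (\<integral>x. f x * ch (- n) x \<partial>torus)"] by (simp add: divide_le_eq)
  finally have "ennreal (cmod (fourier_coeff f n)) \<le> ennreal (cmod (\<integral>x. f x * ch (- n) x \<partial>torus))"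
    by (rule ennreal_leI)
  also have "\<dots> \<le> (\<integral>\<^sup>+x. ennreal (cmod (f x * ch (- n) x)) \<partial>torus)"
    by (rule norm_integral_le_nn_integral)
  finally show ?thesis by (simp add: norm_mult)
qed

lemma nn_integral_ST_finite:
  fixes u :: "real \<Rightarrow> real ^ 'd \<Rightarrow> complex"
  assumes "integrable spacetime (\<lambda>(t, x). u t x)"
  shows "(\<integral>\<^sup>+(t, x). ennreal (cmod (u t x)) \<partial>spacetime) < \<infinity>"
proof -
  have "(\<lambda>p. ennreal (norm (case p of (t, x) \<Rightarrow> u t x))) = (\<lambda>(t, x). ennreal (cmod (u t x)))"
    by (auto simp: fun_eq_iff)
  then show ?thesis using assms unfolding integrable_iff_bounded by simp
qed

lemma integrable_ST_trig_term:
  fixes u :: "real \<Rightarrow> real ^ 'd \<Rightarrow> complex"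
  assumes u: "jointly_measurable u" "integrable spacetime (\<lambda>(t, x). u t x)"
  shows "integrable spacetime (\<lambda>(t, x). fourier_coeff (u t) n * ch n x)"
proof (rule integrableI_bounded)
  note fourier_coeff_measurable[OF u(1), measurable] jointly_measurableD[OF u(1), measurable]
  show "(\<lambda>(t, x). fourier_coeff (u t) n * ch n x) \<in> borel_measurable spacetime"
    by (rule measurable_ST) measurable
  have "(\<integral>\<^sup>+p. ennreal (norm (case p of (t, x) \<Rightarrow> fourier_coeff (u t) n * ch n x)) \<partial>spacetime)
      = (\<integral>\<^sup>+(t, x). ennreal (cmod (fourier_coeff (u t) n)) \<partial>(spacetime :: (real \<times> (real ^ 'd)) measure))"
    by (intro nn_integral_cong) (auto simp: norm_mult)
  also have "\<dots> = (\<integral>\<^sup>+t. \<integral>\<^sup>+x. ennreal (cmod (fourier_coeff (u t) n)) \<partial>(torus :: (real ^ 'd) measure) \<partial>lborel)"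
    by (rule nn_integral_ST) measurable
  also have "\<dots> \<le> (\<integral>\<^sup>+t. (\<integral>\<^sup>+x. ennreal (cmod (u t x)) \<partial>torus) * emeasure torus (space (torus :: (real^'d) measure)) \<partial>lborel)"
    by (intro nn_integral_mono) (auto intro!: mult_right_mono cmod_fourier_coeff_le)
  also have "\<dots> = (\<integral>\<^sup>+t. (\<integral>\<^sup>+x. ennreal (cmod (u t x)) \<partial>torus) \<partial>lborel) * emeasure torus (space (torus :: (real^'d) measure))"
  proof (rule nn_integral_multc)
    have "(\<lambda>(t, x). ennreal (cmod (u t x))) \<in> borel_measurable (lborel \<Otimes>\<^sub>M torus)"
      by (rule measurable_ST) measurable
    then show "(\<lambda>t. \<integral>\<^sup>+x. ennreal (cmod (u t x)) \<partial>torus) \<in> borel_measurable lborel"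
      by (rule torus.borel_measurable_nn_integral)
  qed
  also have "(\<integral>\<^sup>+t. (\<integral>\<^sup>+x. ennreal (cmod (u t x)) \<partial>torus) \<partial>lborel) = (\<integral>\<^sup>+(t, x). ennreal (cmod (u t x)) \<partial>spacetime)"
    by (rule nn_integral_ST[symmetric]) measurable
  finally have "(\<integral>\<^sup>+p. ennreal (norm (case p of (t, x) \<Rightarrow> fourier_coeff (u t) n * ch n x)) \<partial>spacetime)
      \<le> (\<integral>\<^sup>+(t, x). ennreal (cmod (u t x)) \<partial>spacetime) * emeasure torus (space (torus :: (real^'d) measure))" .
  also have "\<dots> < \<infinity>"
    unfolding emeasure_torus infinity_ennreal_def
    by (rule ennreal_mult_less_top[THEN iffD2]) (use nn_integral_ST_finite[OF u(2)] in simp)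
  finally show "(\<integral>\<^sup>+p. ennreal (norm (case p of (t, x) \<Rightarrow> fourier_coeff (u t) n * ch n x)) \<partial>spacetime) < \<infinity>" .
qed

lemma integrable_ST_P_dy:
  assumes "jointly_measurable u" "integrable spacetime (\<lambda>(t, x). u t x)"
  shows "integrable spacetime (\<lambda>(t, x). P_dy j (u t) x)"
  unfolding P_dy_eq case_prod_beta'
  using integrable_ST_trig_term[OF assms] by (intro Bochner_Integration.integrable_sum) (simp add: case_prod_beta')

lemma integrable_ST_P_le:
  assumes "jointly_measurable u" "integrable spacetime (\<lambda>(t, x). u t x)"
  shows "integrable spacetime (\<lambda>(t, x). P_le N (u t) x)"
  unfolding P_le_eq case_prod_beta'
  using integrable_ST_trig_term[OF assms] by (intro Bochner_Integration.integrable_sum) (simp add: case_prod_beta')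

section \<open>Pairings with translates\<close>

text \<open>
  Averaging the pairing over translations \<open>z\<close> of the second factor against a kernel
  mollifies that factor in space only.
\<close>

definition shift_pairing :: "(real \<Rightarrow> real ^ 'd \<Rightarrow> complex) \<Rightarrow> (real \<Rightarrow> real ^ 'd \<Rightarrow> complex) \<Rightarrow> real ^ 'd \<Rightarrow> complex" where
  "shift_pairing u w z = (\<integral>(t, x). u t x * w t (x + z) \<partial>spacetime)"

context
  fixes w :: "real \<Rightarrow> real ^ 'd \<Rightarrow> complex" and b :: real
  assumes w: "jointly_measurable w" and wb: "\<And>t x. cmod (w t x) \<le> b"
begin

lemma joint_shift_measurable:
  assumes "jointly_measurable u"
  shows "(\<lambda>(z, t, x). u t x * w t (x + z)) \<in> borel_measurable (torus \<Otimes>\<^sub>M spacetime)"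
proof (rule measurable_torus_ST)
  note jointly_measurableD[OF assms, measurable] jointly_measurableD[OF w, measurable]
  show "(\<lambda>(z, t, x). u t x * w t (x + z)) \<in> borel_measurable (borel \<Otimes>\<^sub>M borel \<Otimes>\<^sub>M borel)"
    by measurable
qed

lemma integrable_shift:
  assumes u: "jointly_measurable u" "integrable spacetime (\<lambda>(t, x). u t x)"
  shows "integrable spacetime (\<lambda>(t, x). u t x * w t (x + z))"
proof (rule Bochner_Integration.integrable_bound)
  show "integrable spacetime (\<lambda>(t, x). b *\<^sub>R u t x)"
    using u(2) by (auto simp: case_prod_beta')
  note jointly_measurableD[OF u(1), measurable] jointly_measurableD[OF w, measurable]
  show "(\<lambda>(t, x). u t x * w t (x + z)) \<in> borel_measurable spacetime"
    by (rule measurable_ST) measurable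
  have "cmod (u t x * w t (x + z)) \<le> \<bar>b\<bar> * cmod (u t x)" for t x
    using wb[of t "x + z"] by (intro cmod_mult_le) simp
  then show "AE p in spacetime. norm (case p of (t, x) \<Rightarrow> u t x * w t (x + z)) \<le> norm (case p of (t, x) \<Rightarrow> b *\<^sub>R u t x)"
    by (intro AE_I2) auto
qed

lemma shift_pairing_measurable:
  assumes "jointly_measurable u"
  shows "shift_pairing u w \<in> borel_measurable torus"
  using ST.borel_measurable_lebesgue_integral[of "\<lambda>z (t, x). u t x * w t (x + z)" torus] joint_shift_measurable[OF assms]
  by (simp add: shift_pairing_def[abs_def] case_prod_beta')

lemma shift_pairing_bounded:
  assumes u: "jointly_measurable u" "integrable spacetime (\<lambda>(t, x). u t x)"
  shows "cmod (shift_pairing u w z) \<le> (\<integral>(t, x). b * cmod (u t x) \<partial>spacetime)"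
proof -
  have "cmod (shift_pairing u w z) \<le> (\<integral>p. norm (case p of (t, x) \<Rightarrow> u t x * w t (x + z)) \<partial>spacetime)"
    unfolding shift_pairing_def by (rule integral_norm_bound)
  also have "\<dots> \<le> (\<integral>(t, x). b * cmod (u t x) \<partial>spacetime)"
  proof (rule integral_mono)
    show "integrable spacetime (\<lambda>p. norm (case p of (t, x) \<Rightarrow> u t x * w t (x + z)))"
      by (intro integrable_norm integrable_shift u)
    show "integrable spacetime (\<lambda>(t, x). b * cmod (u t x))"
      using u(2) by (auto simp: case_prod_beta')
  qed (auto intro!: cmod_mult_le wb)
  finally show ?thesis .
qed

lemma integrable_fejer_shift_pairing:
  assumes u: "jointly_measurable u" "integrable spacetime (\<lambda>(t, x). u t x)"
  shows "integrable torus (\<lambda>z. complex_of_real (fejer M z) * shift_pairing u w z)"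
proof (rule torus.integrable_const_bound)
  let ?F = "(real M ^ CARD('d))\<^sup>2 / ((2 * pi) ^ CARD('d) * real M ^ CARD('d))"
  show "AE z in torus. norm (complex_of_real (fejer M z) * shift_pairing u w z) \<le> ?F * (\<integral>(t, x). b * cmod (u t x) \<partial>spacetime)"
    unfolding norm_mult norm_of_real abs_of_nonneg[OF fejer_nonneg]
    by (intro AE_I2 mult_mono shift_pairing_bounded u fejer_bounded) auto
  show "(\<lambda>z. complex_of_real (fejer M z) * shift_pairing u w z) \<in> borel_measurable torus"
    by (intro borel_measurable_times shift_pairing_measurable u measurable_torus) measurable
qed

lemma shift_pairing_add:
  assumes "jointly_measurable u" "integrable spacetime (\<lambda>(t, x). u t x)"
    and "jointly_measurable v" "integrable spacetime (\<lambda>(t, x). v t x)"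
  shows "shift_pairing (\<lambda>t x. u t x + v t x) w z = shift_pairing u w z + shift_pairing v w z"
  using Bochner_Integration.integral_add[OF integrable_shift[OF assms(1,2), of z] integrable_shift[OF assms(3,4), of z]]
  by (simp add: shift_pairing_def case_prod_beta' distrib_right)

lemma shift_pairing_sum:
  assumes "\<And>i. i \<in> I \<Longrightarrow> jointly_measurable (u i)" "\<And>i. i \<in> I \<Longrightarrow> integrable spacetime (\<lambda>(t, x). u i t x)"
  shows "shift_pairing (\<lambda>t x. \<Sum>i\<in>I. u i t x) w z = (\<Sum>i\<in>I. shift_pairing (u i) w z)"
  using Bochner_Integration.integral_sum[of I spacetime "\<lambda>i (t, x). u i t x * w t (x + z)"] integrable_shift[OF assms]
  by (simp add: shift_pairing_def case_prod_beta' sum_distrib_right)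

text \<open>
  By Fubini and the substitution \<open>z \<mapsto> z - x\<close>, averaging against a character
  pulls out \<open>\<integral> r(t, x) e\<^sup>-\<^sup>i\<^sup>k\<^sup>x dx\<close>, a multiple of
  a Fourier coefficient of \<open>r(t)\<close>.
\<close>

lemma integral_ch_shift_pairing:
  assumes per: "\<And>t. x_periodic (w t)"
    and r: "jointly_measurable r" "integrable spacetime (\<lambda>(t, x). r t x)"
    and zero: "AE t in lborel. fourier_coeff (r t) k = 0"
  shows "(\<integral>z. ch k z * shift_pairing r w z \<partial>torus) = 0"
proof -
  note jointly_measurableD[OF r(1), measurable] jointly_measurableD[OF w, measurable]
  let ?f = "\<lambda>z (t, x). ch k z * (r t x * w t (x + z))"
  let ?W = "\<lambda>t. \<integral>z. ch k z * w t z \<partial>torus"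
  have W: "(\<integral>z. ch k z * w t (x + z) \<partial>torus) = ch (- k) x * ?W t" for t x
  proof -
    have [measurable]: "w t \<in> borel_measurable borel" by measurable
    have "(\<integral>z. ch k z * w t (x + z) \<partial>torus) = (\<integral>z. ch (- k) x * (ch k (z + x) * w t (z + x)) \<partial>torus)"
      by (simp add: ch_add add.commute mult_ac) (simp add: mult.assoc[symmetric] ch_mult)
    also have "\<dots> = ch (- k) x * (\<integral>z. ch k (z + x) * w t (z + x) \<partial>torus)"
      by simp
    also have "(\<integral>z. ch k (z + x) * w t (z + x) \<partial>torus) = ?W t"
      using x_periodic_ch[of k] per[of t]
      by (intro integral_torus_shift[of "\<lambda>z. ch k z * w t z"]) (auto simp: x_periodic_def)
    finally show ?thesis .
  qed
  have Wb: "cmod (?W t) \<le> b * (2 * pi) ^ CARD('d)" for t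
  proof -
    have "cmod (?W t) \<le> (\<integral>z. cmod (ch k z * w t z) \<partial>torus)" by (rule integral_norm_bound)
    also have "\<dots> \<le> (\<integral>z. b \<partial>(torus :: (real ^ 'd) measure))"
    proof (rule integral_mono)
      have [measurable]: "w t \<in> borel_measurable borel" by measurable
      show "integrable torus (\<lambda>z. cmod (ch k z * w t z))"
        using wb by (intro integrable_torus_bounded[where B=b]) (auto simp: norm_mult)
    qed (auto simp: norm_mult wb)
    finally show ?thesis by (simp add: measure_torus mult.commute)
  qed
  have Wm [measurable]: "?W \<in> borel_measurable borel"
  proof -
    have "(\<lambda>(t, z). ch k z * w t z) \<in> borel_measurable (borel \<Otimes>\<^sub>M torus)"
      by (rule measurable_pair_torus) measurable
    then show ?thesis by (rule torus.borel_measurable_lebesgue_integral)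
  qed
  have meas: "(\<lambda>(z, p). ?f z p) \<in> borel_measurable (torus \<Otimes>\<^sub>M spacetime)"
    using measurable_torus_ST[of "\<lambda>z t x. ch k z * (r t x * w t (x + z))"] by (simp add: case_prod_beta')
  have int: "integrable (torus \<Otimes>\<^sub>M spacetime) (\<lambda>(z, p). ?f z p)"
  proof (rule integrableI_bounded[OF meas])
    have "(\<integral>\<^sup>+q. ennreal (norm (case q of (z, p) \<Rightarrow> ?f z p)) \<partial>(torus \<Otimes>\<^sub>M spacetime))
        = (\<integral>\<^sup>+z. \<integral>\<^sup>+p. ennreal (norm (?f z p)) \<partial>spacetime \<partial>torus)"
      using ST.nn_integral_fst[OF measurable_compose[OF meas, of "\<lambda>z. ennreal (norm z)" borel]] by (simp add: case_prod_beta')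
    also have "\<dots> \<le> (\<integral>\<^sup>+z. \<integral>\<^sup>+p. ennreal (b * norm (case p of (t, x) \<Rightarrow> r t x)) \<partial>spacetime \<partial>(torus :: (real ^ 'd) measure))"
      by (intro nn_integral_mono ennreal_leI) (auto simp: norm_mult[of "ch k _"] intro!: cmod_mult_le wb)
    also have "\<dots> < \<infinity>"
    proof -
      have b0: "0 \<le> b" using order_trans[OF norm_ge_zero wb[of 0 0]] .
      have "integrable spacetime (\<lambda>p. b * norm (case p of (t, x) \<Rightarrow> r t x))"
        by (intro integrable_mult_right integrable_norm r)
      then have *: "(\<integral>\<^sup>+p. ennreal (b * norm (case p of (t, x) \<Rightarrow> r t x)) \<partial>spacetime)
          = ennreal (\<integral>p. b * norm (case p of (t, x) \<Rightarrow> r t x) \<partial>spacetime)"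
        using b0 by (intro nn_integral_eq_integral) auto
      show ?thesis unfolding * by (simp add: emeasure_torus ennreal_mult_less_top del: of_real_power)
    qed
    finally show "(\<integral>\<^sup>+q. ennreal (norm (case q of (z, p) \<Rightarrow> ?f z p)) \<partial>(torus \<Otimes>\<^sub>M spacetime)) < \<infinity>" .
  qed
  have "(\<integral>z. ch k z * shift_pairing r w z \<partial>torus) = (\<integral>z. \<integral>p. ?f z p \<partial>spacetime \<partial>torus)"
    unfolding shift_pairing_def integral_mult_right_zero[symmetric] by (simp add: case_prod_beta')
  also have "\<dots> = (\<integral>p. \<integral>z. ?f z p \<partial>torus \<partial>spacetime)"
    using torus_ST.Fubini_integral[OF int] by simp
  also have "\<dots> = (\<integral>(t, x). r t x * ch (- k) x * ?W t \<partial>spacetime)"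
  proof (intro Bochner_Integration.integral_cong refl)
    fix p :: "real \<times> (real ^ 'd)"
    obtain t x where p: "p = (t, x)" by (cases p)
    have "(\<integral>z. ?f z p \<partial>torus) = (\<integral>z. r t x * (ch k z * w t (x + z)) \<partial>torus)"
      by (simp add: p mult_ac)
    also have "\<dots> = r t x * ch (- k) x * ?W t" by (simp add: W mult.assoc)
    finally show "(\<integral>z. ?f z p \<partial>torus) = (case p of (t, x) \<Rightarrow> r t x * ch (- k) x * ?W t)" by (simp add: p)
  qed
  also have "\<dots> = (\<integral>t. \<integral>x. r t x * ch (- k) x * ?W t \<partial>torus \<partial>lborel)"
  proof -
    have "integrable spacetime (\<lambda>(t, x). r t x * ch (- k) x * ?W t)"
    proof (rule Bochner_Integration.integrable_bound)
      show "integrable spacetime (\<lambda>(t, x). (b * (2 * pi) ^ CARD('d)) *\<^sub>R r t x)"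
        using r(2) by (auto simp: case_prod_beta')
      show "(\<lambda>(t, x). r t x * ch (- k) x * ?W t) \<in> borel_measurable spacetime"
        by (rule measurable_ST) measurable
      have "0 \<le> b" using order_trans[OF norm_ge_zero wb[of 0 0]] .
      then have "cmod (r t x * ch (- k) x * ?W t) \<le> norm ((b * (2 * pi) ^ CARD('d)) *\<^sub>R r t x)" for t x
        using mult_left_mono[OF Wb[of t], of "cmod (r t x)"] by (simp add: norm_mult mult_ac)
      then show "AE p in spacetime. norm (case p of (t, x) \<Rightarrow> r t x * ch (- k) x * ?W t) \<le> norm (case p of (t, x) \<Rightarrow> (b * (2 * pi) ^ CARD('d)) *\<^sub>R r t x)"
        by (intro AE_I2) (auto simp del: norm_scaleR)
    qed
    from ST.integral_fst'[OF this] show ?thesis by simp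
  qed
  also have "\<dots> = (\<integral>t. 0 \<partial>(lborel :: real measure))"
  proof (rule Bochner_Integration.integral_cong_AE)
    show "AE t in lborel. (\<integral>x. r t x * ch (- k) x * ?W t \<partial>torus) = 0"
      using zero by eventually_elim (simp add: fourier_coeff_alt)
    have "(\<lambda>(t, x). r t x * ch (- k) x * ?W t) \<in> borel_measurable (lborel \<Otimes>\<^sub>M torus)"
      by (rule measurable_ST) measurable
    then show "(\<lambda>t. \<integral>x. r t x * ch (- k) x * ?W t \<partial>torus) \<in> borel_measurable lborel"
      by (rule torus.borel_measurable_lebesgue_integral)
  qed simp
  finally show ?thesis by simp
qed

text \<open>
  A function without low frequencies is orthogonal to every mollification at a lower scale. This
  produces the cancellation in the pairing estimate.
\<close>

lemma fejer_shift_pairing_zero: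
  assumes per: "\<And>t. x_periodic (w t)"
    and r: "jointly_measurable r" "integrable spacetime (\<lambda>(t, x). r t x)"
    and zero: "\<And>k. k \<in> freq_cube (M - 1) \<Longrightarrow> AE t in lborel. fourier_coeff (r t) k = 0"
  shows "(\<integral>z. complex_of_real (fejer M z) * shift_pairing r w z \<partial>torus) = 0"
proof -
  obtain K where K: "\<And>y :: real ^ 'd. complex_of_real (fejer M y) = (\<Sum>n\<in>fbox M. \<Sum>m\<in>fbox M. K * ch (n - m) y)"
    using fejer_conv_sum by blast
  have int: "integrable torus (\<lambda>z. K * ch k z * shift_pairing r w z)" for k
  proof (rule torus.integrable_const_bound)
    show "AE z in torus. norm (K * ch k z * shift_pairing r w z) \<le> cmod K * (\<integral>(t, x). b * cmod (r t x) \<partial>spacetime)"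
      unfolding norm_mult by (intro AE_I2 mult_mono shift_pairing_bounded r) auto
    show "(\<lambda>z. K * ch k z * shift_pairing r w z) \<in> borel_measurable torus"
      by (intro borel_measurable_times borel_measurable_const shift_pairing_measurable r measurable_torus ch_measurable)
  qed
  have z: "(\<integral>z. K * ch (n - m) z * shift_pairing r w z \<partial>torus) = 0" if "n \<in> fbox M" "m \<in> fbox M" for n m
    using integral_ch_shift_pairing[OF per r zero[OF fbox_diff[OF that]]] by (simp add: mult.assoc)
  show ?thesis
    unfolding K sum_distrib_right
    by (subst Bochner_Integration.integral_sum)
       (auto simp: int z Bochner_Integration.integral_sum intro!: sum.neutral Bochner_Integration.integrable_sum)
qed

end

section \<open>Pairing a rough function with a regular one\<close>

lemma fourier_coeff_minus_P_le:
  fixes f :: "real ^ 'd \<Rightarrow> complex"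
  assumes f: "integrable torus f" and k: "k \<in> freq_cube N"
  shows "fourier_coeff (\<lambda>x. f x - P_le N f x) k = 0"
proof -
  have int1: "integrable torus (\<lambda>x. f x * ch (- k) x)"
  proof (rule Bochner_Integration.integrable_bound[OF f])
    show "(\<lambda>x. f x * ch (- k) x) \<in> borel_measurable torus"
      by (intro borel_measurable_times borel_measurable_integrable f measurable_torus ch_measurable)
  qed (simp add: norm_mult)
  have int2: "integrable torus (\<lambda>x. P_le N f x * ch (- k) x)"
    unfolding P_le_eq sum_distrib_right mult.assoc ch_mult
    by (intro Bochner_Integration.integrable_sum integrable_ch)
  have "fourier_coeff (\<lambda>x. f x - P_le N f x) k = fourier_coeff f k - fourier_coeff (P_le N f) k"
    unfolding fourier_coeff_alt left_diff_distrib
    by (subst Bochner_Integration.integral_diff[OF int1 int2]) (simp add: diff_divide_distrib)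
  also have "fourier_coeff (P_le N f) k = fourier_coeff f k"
    unfolding P_le_eq[abs_def] using k by (simp add: fourier_coeff_trig)
  finally show ?thesis by simp
qed

lemma AE_integrable_torus:
  fixes u :: "real \<Rightarrow> real ^ 'd \<Rightarrow> complex"
  assumes "integrable spacetime (\<lambda>(t, x). u t x)"
  shows "AE t in lborel. integrable torus (u t)"
  using ST.AE_integrable_fst[OF assms] by simp

lemma jointly_measurable_diff:
  "jointly_measurable u \<Longrightarrow> jointly_measurable v \<Longrightarrow> jointly_measurable (\<lambda>t x. u t x - v t x)"
  by (simp add: case_prod_beta')

lemma jointly_measurable_shift:
  assumes "jointly_measurable w"
  shows "jointly_measurable (\<lambda>t x. w t (x + z))"
  using jointly_measurableD[OF assms] unfolding borel_prod[symmetric] by measurable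

text \<open>
  Uniform integrability of a single integrable function; it allows the rough factor to be replaced
  by a bounded one when a mollification is removed.
\<close>

lemma integral_tail_tendsto_0:
  fixes f :: "'a \<Rightarrow> 'b :: {banach, second_countable_topology}"
  assumes "integrable M f"
  shows "((\<lambda>R. \<integral>x. (if norm (f x) > real R then norm (f x) else 0) \<partial>M) \<longlonglongrightarrow> 0)"
proof -
  have "((\<lambda>R. \<integral>x. (if norm (f x) > real R then norm (f x) else 0) \<partial>M) \<longlonglongrightarrow> (\<integral>x. 0 \<partial>M))"
  proof (rule integral_dominated_convergence)
    have [measurable]: "f \<in> borel_measurable M" using assms by simp
    show "(\<lambda>x. if norm (f x) > real R then norm (f x) else 0) \<in> borel_measurable M" for R by measurable
    show "integrable M (\<lambda>x. norm (f x))" using assms by (rule integrable_norm)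
    show "AE x in M. (\<lambda>R. if norm (f x) > real R then norm (f x) else 0) \<longlonglongrightarrow> 0"
    proof (intro AE_I2 tendsto_eventually)
      fix x
      obtain n where "norm (f x) \<le> real n" using real_arch_simple by blast
      then have "\<forall>R\<ge>n. (if norm (f x) > real R then norm (f x) else 0) = 0"
        by (auto simp: not_less intro: order_trans)
      then show "\<forall>\<^sub>F R in sequentially. (if norm (f x) > real R then norm (f x) else 0) = 0"
        unfolding eventually_sequentially by blast
    qed
  qed auto
  then show ?thesis by simp
qed

text \<open>
  The low block contributes \<open>1\<close> and the others the geometric series of ratio
  \<open>2\<^sup>\<sigma>\<^sup>-\<^sup>s\<^sup>/\<^sup>2\<close>.
\<close>

definition pairing_const :: "'d::finite itself \<Rightarrow> real \<Rightarrow> real \<Rightarrow> real" where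
  "pairing_const D s \<sigma> = 1 + jackson_const D * 2 powr (s / 2) * (1 / (1 - 2 powr (\<sigma> - s / 2)))"

text \<open>
  The factor \<open>u\<close> loses \<open>\<sigma>\<close> derivatives and the factor
  \<open>w\<close> has \<open>s\<close> derivatives, in a form that only compares translates of
  \<open>w\<close>, weighted with the modulus of a block of \<open>u\<close>. Such bounds follow
  from Hoelder's inequality for a product \<open>w\<close> without any frequency analysis of the
  product. The bound with the constant \<open>A'\<close> is only qualitative: it serves to remove
  a mollification in the limit.
\<close>

locale fourier_pairing =
  fixes u w :: "real \<Rightarrow> real ^ 'd \<Rightarrow> complex" and A A' s \<sigma> :: real
  assumes u: "jointly_measurable u" "integrable spacetime (\<lambda>(t, x). u t x)"
    and w: "jointly_measurable w" "\<And>t. x_periodic (w t)"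
    and s: "0 < s" "s \<le> 2" "\<sigma> < s / 2" and A: "0 \<le> A" "0 \<le> A'"
    and low: "\<And>z. (\<integral>\<^sup>+(t, x). ennreal (cmod (P_dy 0 (u t) x)) * ennreal (cmod (w t (x + z))) \<partial>spacetime) \<le> ennreal A"
    and high: "\<And>j z y. 0 < j \<Longrightarrow>
      (\<integral>\<^sup>+(t, x). ennreal (cmod (P_dy j (u t) x)) * ennreal (cmod (w t (x + z) - w t (x + y + z))) \<partial>spacetime)
        \<le> ennreal (A * 2 powr (real j * \<sigma>) * phase_dist y powr s)"
    and mod: "\<And>z. (\<integral>\<^sup>+(t, x). ennreal (cmod (w t x - w t (x + z))) \<partial>(spacetime :: (real \<times> (real ^ 'd)) measure)) \<le> ennreal (A' * phase_dist z powr s)"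
begin

lemma integral_fejer_bound:
  assumes f: "\<And>z. cmod (f z) \<le> B * phase_dist z powr s" and "0 \<le> B" "0 < M"
  shows "cmod (\<integral>z. complex_of_real (fejer M z) * f z \<partial>(torus :: (real ^ 'd) measure))
    \<le> B * jackson_const TYPE('d) * real M powr (- s / 2)"
proof -
  have "ennreal (cmod (\<integral>z. complex_of_real (fejer M z) * f z \<partial>(torus :: (real ^ 'd) measure)))
      \<le> (\<integral>\<^sup>+z. ennreal (cmod (complex_of_real (fejer M z) * f z)) \<partial>(torus :: (real ^ 'd) measure))"
    by (rule norm_integral_le_nn_integral)
  also have "\<dots> \<le> (\<integral>\<^sup>+z. ennreal B * (ennreal (fejer M z) * ennreal (phase_dist z powr s)) \<partial>(torus :: (real ^ 'd) measure))"
  proof (intro nn_integral_mono)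
    fix z :: "real ^ 'd"
    have "cmod (complex_of_real (fejer M z) * f z) \<le> B * (fejer M z * phase_dist z powr s)"
      using mult_left_mono[OF f[of z], of "fejer M z"] by (simp add: norm_mult mult_ac)
    then show "ennreal (cmod (complex_of_real (fejer M z) * f z)) \<le> ennreal B * (ennreal (fejer M z) * ennreal (phase_dist z powr s))"
      using \<open>0 \<le> B\<close> by (simp add: ennreal_mult[symmetric] ennreal_leI)
  qed
  also have "\<dots> = ennreal B * (\<integral>\<^sup>+z. ennreal (fejer M z) * ennreal (phase_dist z powr s) \<partial>(torus :: (real ^ 'd) measure))"
    by (intro nn_integral_cmult measurable_torus) measurable
  also have "\<dots> \<le> ennreal B * ennreal (jackson_const TYPE('d) * real M powr (- s / 2))"
    by (intro mult_left_mono fejer_moment assms s) auto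
  finally show ?thesis
    using assms(2) jackson_const_pos[where 'd='d] by (simp add: ennreal_mult[symmetric] mult.assoc)
qed

text \<open>
  On the block number \<open>j\<close> the kernel at scale
  \<open>2\<^sup>j\<^sup>-\<^sup>1\<close> is invisible, so \<open>w\<close> may be replaced by
  \<open>w\<close> minus its mollification. This gains
  \<open>2\<^sup>-\<^sup>j\<^sup>s\<^sup>/\<^sup>2\<close> against the loss
  \<open>2\<^sup>j\<^sup>\<sigma>\<close>. The series of blocks of \<open>u\<close> need not
  converge to \<open>u\<close> in a norm dual to that of \<open>w\<close>; instead the whole
  pairing is mollified, which leaves finitely many blocks, and the mollification is removed at the
  end.
\<close>

lemma bounded_estimate:
  assumes wb: "\<And>t x. cmod (w t x) \<le> b"
  shows "cmod (\<integral>(t, x). u t x * w t x \<partial>spacetime) \<le> pairing_const TYPE('d) s \<sigma> * A"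
proof (rule field_le_epsilon)
  note um = integrable_ST_P_dy[OF u] jointly_measurable_P_dy[OF u(1)]
  have b: "0 \<le> b" using order_trans[OF norm_ge_zero wb[of 0 0]] .
  let ?I = "shift_pairing u w" and ?Ij = "\<lambda>j. shift_pairing (\<lambda>t. P_dy j (u t)) w"
  have I0: "(\<integral>(t, x). u t x * w t x \<partial>spacetime) = ?I 0" by (simp add: shift_pairing_def)

  have lowI: "cmod (?Ij 0 z) \<le> A" for z
  proof -
    have "ennreal (cmod (?Ij 0 z)) \<le> (\<integral>\<^sup>+p. ennreal (norm (case p of (t, x) \<Rightarrow> P_dy 0 (u t) x * w t (x + z))) \<partial>spacetime)"
      unfolding shift_pairing_def by (rule norm_integral_le_nn_integral)
    also have "\<dots> = (\<integral>\<^sup>+(t, x). ennreal (cmod (P_dy 0 (u t) x)) * ennreal (cmod (w t (x + z))) \<partial>spacetime)"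
      by (intro nn_integral_cong) (auto simp: norm_mult ennreal_mult)
    also have "\<dots> \<le> ennreal A" by (rule low)
    finally show ?thesis using A by simp
  qed
  define a where "a j = A * (jackson_const TYPE('d) * 2 powr (s / 2)) * (2 powr (\<sigma> - s / 2)) ^ j" for j :: nat
  have highI: "cmod (?Ij j z) \<le> a j" if j: "0 < j" for j z
  proof -
    \<comment> \<open>A dyadic scale at which the kernel has no frequency in the shell \<open>j\<close>.\<close>
    define M :: nat where "M = 2 ^ (j - 1)"
    have M: "0 < M" by (simp add: M_def)
    let ?w = "\<lambda>t x. w t (x + z)"
    have w': "jointly_measurable ?w" "\<And>t. x_periodic (?w t)" "\<And>t x. cmod (?w t x) \<le> b"
      using jointly_measurable_shift[OF w(1)] x_periodic_shift[OF w(2)] wb by auto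
    have zero: "(\<integral>y. complex_of_real (fejer M y) * shift_pairing (\<lambda>t. P_dy j (u t)) ?w y \<partial>torus) = 0"
    proof (rule fejer_shift_pairing_zero[OF w'(1,3,2) um(2,1)])
      fix k :: "int ^ 'd" assume "k \<in> freq_cube (M - 1)"
      then have "k \<in> freq_cube (2 ^ (j - 1))"
        using freq_cube_mono[of "M - 1" "2 ^ (j - 1)"] by (auto simp: M_def)
      then have "k \<notin> shell j" using j by (simp add: shell_def)
      then show "AE t in lborel. fourier_coeff (P_dy j (u t)) k = 0"
        by (simp add: P_dy_eq[abs_def] fourier_coeff_trig)
    qed
    have int: "integrable torus (\<lambda>y. complex_of_real (fejer M y) * shift_pairing (\<lambda>t. P_dy j (u t)) ?w y)"
      by (rule integrable_fejer_shift_pairing[OF w'(1,3) um(2,1)])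
    have "?Ij j z = (\<integral>y. complex_of_real (fejer M y) * (?Ij j z - shift_pairing (\<lambda>t. P_dy j (u t)) ?w y) \<partial>torus)"
      unfolding right_diff_distrib
      using Bochner_Integration.integral_diff[OF integrable_mult_left[OF integrable_of_real[OF integrable_fejer[of M]], of "?Ij j z"] int]
      by (simp add: zero integral_fejer[OF M])
    also have "cmod \<dots> \<le> (A * 2 powr (real j * \<sigma>)) * jackson_const TYPE('d) * real M powr (- s / 2)"
    proof (rule integral_fejer_bound)
      fix y :: "real ^ 'd"
      have "?Ij j z - shift_pairing (\<lambda>t. P_dy j (u t)) ?w y
          = (\<integral>p. (case p of (t, x) \<Rightarrow> P_dy j (u t) x * w t (x + z)) - (case p of (t, x) \<Rightarrow> P_dy j (u t) x * w t (x + y + z)) \<partial>spacetime)"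
        unfolding shift_pairing_def
        by (subst Bochner_Integration.integral_diff[OF integrable_shift[OF w(1) wb um(2,1)] integrable_shift[OF w'(1,3) um(2,1)]]) (rule refl)
      then have "ennreal (cmod (?Ij j z - shift_pairing (\<lambda>t. P_dy j (u t)) ?w y))
          \<le> (\<integral>\<^sup>+p. ennreal (cmod ((case p of (t, x) \<Rightarrow> P_dy j (u t) x * w t (x + z)) - (case p of (t, x) \<Rightarrow> P_dy j (u t) x * w t (x + y + z)))) \<partial>spacetime)"
        by (simp only: norm_integral_le_nn_integral)
      also have "\<dots> = (\<integral>\<^sup>+(t, x). ennreal (cmod (P_dy j (u t) x)) * ennreal (cmod (w t (x + z) - w t (x + y + z))) \<partial>spacetime)"
        by (intro nn_integral_cong) (auto simp: norm_mult ennreal_mult[symmetric] right_diff_distrib[symmetric])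
      also have "\<dots> \<le> ennreal (A * 2 powr (real j * \<sigma>) * phase_dist y powr s)"
        by (rule high[OF j])
      finally show "cmod (?Ij j z - shift_pairing (\<lambda>t. P_dy j (u t)) ?w y) \<le> A * 2 powr (real j * \<sigma>) * phase_dist y powr s"
        using A by simp
    qed (use A M in auto)
    also have "\<dots> = a j"
    proof -
      have "real M = 2 powr (real j - 1)" using j by (cases j) (simp_all add: M_def powr_realpow)
      moreover have "(real j - 1) * (- s / 2) = s / 2 + - (real j * (s / 2))" by (simp add: field_simps)
      ultimately have "real M powr (- s / 2) = 2 powr (s / 2) * 2 powr (- (real j * (s / 2)))"
        by (simp only: powr_powr powr_add[symmetric])
      moreover have "(2 powr (\<sigma> - s / 2)) ^ j = 2 powr (real j * \<sigma>) * 2 powr (- (real j * (s / 2)))"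
        by (simp add: powr_realpow[symmetric] powr_powr powr_add[symmetric] algebra_simps)
      ultimately show ?thesis by (simp add: a_def mult_ac)
    qed
    finally show ?thesis .
  qed
  have ratio: "0 \<le> 2 powr (\<sigma> - s / 2)" "2 powr (\<sigma> - s / 2) < 1"
    using s powr_less_mono[of "\<sigma> - s / 2" 0 2] by auto
  have sum_a: "A + (\<Sum>j\<in>{1..J}. a j) \<le> pairing_const TYPE('d) s \<sigma> * A" for J
  proof -
    have "(\<Sum>j\<in>{1..J}. a j) \<le> (\<Sum>j. a j)"
      unfolding a_def using ratio A jackson_const_pos[where 'd='d]
      by (intro sum_le_suminf summable_mult summable_geometric) auto
    also have "\<dots> = A * (jackson_const TYPE('d) * 2 powr (s / 2)) * (1 / (1 - 2 powr (\<sigma> - s / 2)))"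
      unfolding a_def using ratio by (subst suminf_mult) (auto simp: suminf_geometric)
    finally show ?thesis by (simp add: pairing_const_def algebra_simps)
  qed

  \<comment> \<open>The kernel at scale \<open>2\<^sup>J\<close> does not see \<open>u\<close> minus its blocks up to \<open>J\<close>.\<close>
  have mollified: "cmod (\<integral>z. complex_of_real (fejer (2 ^ J) z) * ?I z \<partial>torus) \<le> pairing_const TYPE('d) s \<sigma> * A" for J
  proof -
    let ?M = "2 ^ J :: nat"
    let ?r = "\<lambda>t x. u t x - P_le ?M (u t) x"
    note ule = jointly_measurable_P_le[OF u(1)] integrable_ST_P_le[OF u]
    have r: "jointly_measurable ?r" "integrable spacetime (\<lambda>(t, x). ?r t x)"
      using jointly_measurable_diff[OF u(1) ule(1)] Bochner_Integration.integrable_diff[OF u(2) ule(2)]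
      by (simp_all add: case_prod_beta')
    have rz: "(\<integral>z. complex_of_real (fejer ?M z) * shift_pairing ?r w z \<partial>torus) = 0"
    proof (rule fejer_shift_pairing_zero[OF w(1) wb w(2) r])
      fix k :: "int ^ 'd" assume "k \<in> freq_cube (?M - 1)"
      then have "k \<in> freq_cube ?M" using freq_cube_mono[of "?M - 1" ?M] by auto
      then show "AE t in lborel. fourier_coeff (\<lambda>x. ?r t x) k = 0"
        using AE_integrable_torus[OF u(2)] by (auto elim!: eventually_mono intro: fourier_coeff_minus_P_le)
    qed
    have "?I z = shift_pairing ?r w z + (\<Sum>j\<le>J. ?Ij j z)" for z
    proof -
      have "?I z = shift_pairing (\<lambda>t x. ?r t x + P_le ?M (u t) x) w z" by simp
      also have "\<dots> = shift_pairing ?r w z + shift_pairing (\<lambda>t. P_le ?M (u t)) w z"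
        by (rule shift_pairing_add[OF w(1) wb r ule])
      also have "shift_pairing (\<lambda>t. P_le ?M (u t)) w z = shift_pairing (\<lambda>t x. \<Sum>j\<le>J. P_dy j (u t) x) w z"
        by (simp only: sum_P_dy)
      also have "\<dots> = (\<Sum>j\<le>J. ?Ij j z)"
        by (rule shift_pairing_sum[OF w(1) wb um(2,1)])
      finally show ?thesis .
    qed
    then have "(\<integral>z. complex_of_real (fejer ?M z) * ?I z \<partial>torus)
        = (\<integral>z. complex_of_real (fejer ?M z) * shift_pairing ?r w z + (\<Sum>j\<le>J. complex_of_real (fejer ?M z) * ?Ij j z) \<partial>torus)"
      by (simp add: distrib_left sum_distrib_left)
    also have "\<dots> = (\<Sum>j\<le>J. (\<integral>z. complex_of_real (fejer ?M z) * ?Ij j z \<partial>torus))"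
      using integrable_fejer_shift_pairing[OF w(1) wb r] integrable_fejer_shift_pairing[OF w(1) wb um(2,1)]
      by (simp add: Bochner_Integration.integral_add Bochner_Integration.integrable_sum Bochner_Integration.integral_sum rz)
    also have "cmod \<dots> \<le> (\<Sum>j\<le>J. if j = 0 then A else a j)"
    proof (rule sum_norm_le)
      fix j
      let ?c = "if j = 0 then A else a j"
      have c: "cmod (?Ij j z) \<le> ?c" for z using lowI highI[of j] by simp
      have "cmod (\<integral>z. complex_of_real (fejer ?M z) * ?Ij j z \<partial>torus) \<le> (\<integral>z. cmod (complex_of_real (fejer ?M z) * ?Ij j z) \<partial>torus)"
        by (rule integral_norm_bound)
      also have "\<dots> \<le> (\<integral>z. fejer ?M z * ?c \<partial>(torus :: (real ^ 'd) measure))"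
      proof (rule integral_mono)
        show "integrable torus (\<lambda>z. cmod (complex_of_real (fejer ?M z) * ?Ij j z))"
          by (intro integrable_norm integrable_fejer_shift_pairing[OF w(1) wb um(2,1)])
        show "integrable (torus :: (real ^ 'd) measure) (\<lambda>z. fejer ?M z * ?c)" by (intro integrable_mult_left integrable_fejer)
      qed (unfold norm_mult norm_of_real abs_of_nonneg[OF fejer_nonneg], intro mult_left_mono c, simp)
      also have "\<dots> = ?c" by (simp add: integral_fejer)
      finally show "cmod (\<integral>z. complex_of_real (fejer ?M z) * ?Ij j z \<partial>torus) \<le> ?c" .
    qed
    also have "(\<Sum>j\<le>J. if j = 0 then A else a j) = A + (\<Sum>j\<in>{1..J}. a j)"
      by (simp add: atMost_atLeast0 sum.atLeast_Suc_atMost)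
    also have "\<dots> \<le> pairing_const TYPE('d) s \<sigma> * A" by (rule sum_a)
    finally show ?thesis .
  qed

  \<comment> \<open>The mollification is removed by splitting \<open>u\<close> at a level \<open>R\<close>: the bounded part sees the modulus of continuity of \<open>w\<close>, the rest is small since \<open>w\<close> is bounded.\<close>
  define tail where "tail R = (\<integral>(t, x). (if cmod (u t x) > real R then cmod (u t x) else 0) \<partial>spacetime)" for R :: nat
  have tail0: "tail \<longlonglongrightarrow> 0"
  proof -
    have "(\<lambda>p. if norm (case p of (t, x) \<Rightarrow> u t x) > real R then norm (case p of (t, x) \<Rightarrow> u t x) else 0)
        = (\<lambda>(t, x). (if cmod (u t x) > real R then cmod (u t x) else 0))" for R
      by (auto simp: fun_eq_iff)
    then show ?thesis
      using integral_tail_tendsto_0[OF u(2)] unfolding tail_def[abs_def] by simp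
  qed
  have tail_nn: "0 \<le> tail R" for R unfolding tail_def by (intro integral_nonneg_AE) auto
  have diff: "cmod (?I 0 - ?I z) \<le> real R * A' * phase_dist z powr s + 2 * b * tail R" for z R
  proof -
    note jointly_measurableD[OF u(1), measurable] jointly_measurableD[OF w(1), measurable]
    let ?tl = "\<lambda>t x. if cmod (u t x) > real R then cmod (u t x) else 0"
    have tl_int: "integrable spacetime (\<lambda>(t, x). ?tl t x)"
    proof (rule Bochner_Integration.integrable_bound[OF u(2)])
      show "(\<lambda>(t, x). ?tl t x) \<in> borel_measurable spacetime" by (rule measurable_ST) measurable
    qed auto
    have "?I 0 - ?I z = (\<integral>p. (case p of (t, x) \<Rightarrow> u t x * w t (x + 0)) - (case p of (t, x) \<Rightarrow> u t x * w t (x + z)) \<partial>spacetime)"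
      unfolding shift_pairing_def
      by (subst Bochner_Integration.integral_diff[OF integrable_shift[OF w(1) wb u] integrable_shift[OF w(1) wb u]]) (rule refl)
    then have "ennreal (cmod (?I 0 - ?I z)) \<le> (\<integral>\<^sup>+p. ennreal (cmod ((case p of (t, x) \<Rightarrow> u t x * w t (x + 0)) - (case p of (t, x) \<Rightarrow> u t x * w t (x + z)))) \<partial>spacetime)"
      by (simp only: norm_integral_le_nn_integral)
    also have "\<dots> \<le> (\<integral>\<^sup>+p. ennreal (real R) * (case p of (t, x) \<Rightarrow> ennreal (cmod (w t x - w t (x + z)))) + ennreal (2 * b) * (case p of (t, x) \<Rightarrow> ennreal (?tl t x)) \<partial>spacetime)"
    proof (intro nn_integral_mono, clarify)
      fix t x
      have 1: "cmod (w t x - w t (x + z)) \<le> 2 * b"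
        using norm_triangle_ineq4[of "w t x" "w t (x + z)"] wb[of t x] wb[of t "x + z"] by linarith
      have "cmod (u t x * w t (x + 0) - u t x * w t (x + z)) = cmod (u t x) * cmod (w t x - w t (x + z))"
        by (simp add: right_diff_distrib[symmetric] norm_mult)
      also have "\<dots> \<le> real R * cmod (w t x - w t (x + z)) + 2 * b * ?tl t x"
      proof (cases "cmod (u t x) > real R")
        case True
        then show ?thesis using mult_left_mono[OF 1, of "cmod (u t x)"] by (simp add: mult.commute add_increasing)
      next
        case False
        then show ?thesis by (simp add: mult_right_mono)
      qed
      finally show "ennreal (cmod (u t x * w t (x + 0) - u t x * w t (x + z))) \<le> ennreal (real R) * ennreal (cmod (w t x - w t (x + z))) + ennreal (2 * b) * ennreal (?tl t x)"
        using b by (simp add: ennreal_mult[symmetric] ennreal_plus[symmetric] ennreal_leI del: ennreal_plus)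
    qed
    also have "\<dots> = ennreal (real R) * (\<integral>\<^sup>+(t, x). ennreal (cmod (w t x - w t (x + z))) \<partial>(spacetime :: (real \<times> (real ^ 'd)) measure)) + ennreal (2 * b) * (\<integral>\<^sup>+p. ennreal (case p of (t, x) \<Rightarrow> ?tl t x) \<partial>spacetime)"
    proof -
      have "(\<lambda>(t, x). ennreal (cmod (w t x - w t (x + z)))) \<in> borel_measurable spacetime" by (rule measurable_ST) measurable
      moreover have "(\<lambda>(t, x). ennreal (?tl t x)) \<in> borel_measurable spacetime" by (rule measurable_ST) measurable
      ultimately show ?thesis
        by (subst nn_integral_add) (auto simp: nn_integral_cmult case_prod_beta')
    qed
    also have "(\<integral>\<^sup>+p. ennreal (case p of (t, x) \<Rightarrow> ?tl t x) \<partial>spacetime) = ennreal (tail R)"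
      unfolding tail_def by (intro nn_integral_eq_integral tl_int) auto
    also have "ennreal (real R) * (\<integral>\<^sup>+(t, x). ennreal (cmod (w t x - w t (x + z))) \<partial>(spacetime :: (real \<times> (real ^ 'd)) measure)) + ennreal (2 * b) * ennreal (tail R)
        \<le> ennreal (real R) * ennreal (A' * phase_dist z powr s) + ennreal (2 * b) * ennreal (tail R)"
      by (intro add_mono mult_left_mono mod) auto
    also have "\<dots> = ennreal (real R * A' * phase_dist z powr s + 2 * b * tail R)"
      using A b tail_nn[of R] by (simp add: ennreal_mult[symmetric] ennreal_plus[symmetric] mult.assoc del: ennreal_plus)
    finally show ?thesis using A b tail_nn[of R] by (subst (asm) ennreal_le_iff) auto
  qed
  fix e :: real assume e: "0 < e"
  have "\<forall>\<^sub>F R in sequentially. 2 * b * tail R < e / 2"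
  proof -
    have "(\<lambda>R. 2 * b * tail R) \<longlonglongrightarrow> 2 * b * 0" by (intro tendsto_intros tail0)
    then show ?thesis using e by (intro order_tendstoD(2)) auto
  qed
  then obtain R where R: "2 * b * tail R < e / 2" by (auto simp: eventually_sequentially)
  have "((\<lambda>J. real R * A' * jackson_const TYPE('d) * real (2 ^ J) powr (- s / 2)) \<longlonglongrightarrow> 0)"
  proof -
    have "real (2 ^ J) powr (- s / 2) = (2 powr (- s / 2)) ^ J" for J
      by (simp add: powr_realpow[symmetric] powr_powr mult.commute)
    moreover have "(\<lambda>J. (2 powr (- s / 2)) ^ J) \<longlonglongrightarrow> 0"
      using s powr_less_mono[of "- s / 2" 0 2] by (intro LIMSEQ_power_zero) auto
    ultimately show ?thesis by (auto intro: tendsto_mult_right_zero)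
  qed
  then have "\<forall>\<^sub>F J in sequentially. real R * A' * jackson_const TYPE('d) * real (2 ^ J) powr (- s / 2) < e / 2"
    using e by (intro order_tendstoD(2)) auto
  then obtain J where J: "real R * A' * jackson_const TYPE('d) * real (2 ^ J) powr (- s / 2) < e / 2"
    by (auto simp: eventually_sequentially)
  let ?M = "2 ^ J :: nat"
  let ?c = "2 * b * tail R"
  have c: "0 \<le> ?c" using b tail_nn by simp
  have "cmod (?I 0 - (\<integral>z. complex_of_real (fejer ?M z) * ?I z \<partial>torus)) \<le> real R * A' * jackson_const TYPE('d) * real ?M powr (- s / 2) + ?c"
  proof -
    have "?I 0 - (\<integral>z. complex_of_real (fejer ?M z) * ?I z \<partial>torus) = (\<integral>z. complex_of_real (fejer ?M z) * (?I 0 - ?I z) \<partial>torus)"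
      unfolding right_diff_distrib
      using Bochner_Integration.integral_diff[OF integrable_mult_left[OF integrable_of_real[OF integrable_fejer[of ?M]], of "?I 0"] integrable_fejer_shift_pairing[OF w(1) wb u, of ?M]]
      by (simp add: integral_fejer)
    then have "ennreal (cmod (?I 0 - (\<integral>z. complex_of_real (fejer ?M z) * ?I z \<partial>torus)))
        \<le> (\<integral>\<^sup>+z. ennreal (cmod (complex_of_real (fejer ?M z) * (?I 0 - ?I z))) \<partial>torus)"
      by (simp only: norm_integral_le_nn_integral)
    also have "\<dots> \<le> (\<integral>\<^sup>+z. ennreal (real R * A') * (ennreal (fejer ?M z) * ennreal (phase_dist z powr s)) + ennreal ?c * ennreal (fejer ?M z) \<partial>(torus :: (real ^ 'd) measure))"
    proof (intro nn_integral_mono)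
      fix z :: "real ^ 'd"
      have "cmod (complex_of_real (fejer ?M z) * (?I 0 - ?I z)) = fejer ?M z * cmod (?I 0 - ?I z)"
        unfolding norm_mult norm_of_real abs_of_nonneg[OF fejer_nonneg] ..
      also have "\<dots> \<le> fejer ?M z * (real R * A' * phase_dist z powr s + ?c)"
        by (intro mult_left_mono diff) simp
      finally have le: "cmod (complex_of_real (fejer ?M z) * (?I 0 - ?I z)) \<le> fejer ?M z * (real R * A' * phase_dist z powr s + ?c)" .
      show "ennreal (cmod (complex_of_real (fejer ?M z) * (?I 0 - ?I z))) \<le> ennreal (real R * A') * (ennreal (fejer ?M z) * ennreal (phase_dist z powr s)) + ennreal ?c * ennreal (fejer ?M z)"
      proof -
        have comb: "ennreal a * (ennreal f * ennreal q) + ennreal c * ennreal f = ennreal (f * (a * q + c))"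
          if "0 \<le> a" "0 \<le> f" "0 \<le> q" "0 \<le> c" for a f q c :: real
          using that by (simp add: ennreal_mult[symmetric] ennreal_plus[symmetric] algebra_simps del: ennreal_plus)
        show ?thesis
          by (subst comb) (use A c le in \<open>auto intro!: ennreal_leI\<close>)
      qed
    qed
    also have "\<dots> = ennreal (real R * A') * (\<integral>\<^sup>+z. ennreal (fejer ?M z) * ennreal (phase_dist z powr s) \<partial>(torus :: (real ^ 'd) measure)) + ennreal ?c * (\<integral>\<^sup>+z. ennreal (fejer ?M z) \<partial>(torus :: (real ^ 'd) measure))"
    proof -
      have 1: "(\<lambda>z::real^'d. ennreal (fejer ?M z) * ennreal (phase_dist z powr s)) \<in> borel_measurable torus" "(\<lambda>z::real^'d. ennreal (fejer ?M z)) \<in> borel_measurable torus"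
        by (intro measurable_torus, measurable)+
      then show ?thesis by (simp add: nn_integral_add nn_integral_cmult)
    qed
    also have "(\<integral>\<^sup>+z. ennreal (fejer ?M z) \<partial>(torus :: (real ^ 'd) measure)) = 1"
      by (subst nn_integral_eq_integral[OF integrable_fejer]) (auto simp: integral_fejer)
    also have "ennreal (real R * A') * (\<integral>\<^sup>+z. ennreal (fejer ?M z) * ennreal (phase_dist z powr s) \<partial>(torus :: (real ^ 'd) measure)) + ennreal ?c * 1
        \<le> ennreal (real R * A') * ennreal (jackson_const TYPE('d) * real ?M powr (- s / 2)) + ennreal ?c * 1"
      by (intro add_mono mult_left_mono fejer_moment s) auto
    also have "\<dots> = ennreal (real R * A' * jackson_const TYPE('d) * real ?M powr (- s / 2) + ?c)"
      using A c jackson_const_pos[where 'd='d] by (simp add: ennreal_mult[symmetric] ennreal_plus[symmetric] mult.assoc del: ennreal_plus)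
    finally show ?thesis
      using A c jackson_const_pos[where 'd='d] by (subst (asm) ennreal_le_iff) auto
  qed
  also have "\<dots> < e" using R J by linarith
  finally have "cmod (?I 0 - (\<integral>z. complex_of_real (fejer ?M z) * ?I z \<partial>torus)) < e" .
  then show "cmod (\<integral>(t, x). u t x * w t x \<partial>spacetime) \<le> pairing_const TYPE('d) s \<sigma> * A + e"
    unfolding I0 using mollified[of J] norm_triangle_ineq2[of "?I 0" "\<integral>z. complex_of_real (fejer ?M z) * ?I z \<partial>torus"]
    by linarith
qed

end

text \<open>
  Truncation of the real and imaginary parts. It is a contraction, so it preserves the moduli of
  continuity.
\<close>

definition clip :: "nat \<Rightarrow> complex \<Rightarrow> complex" where
  "clip R z = Complex (max (- real R) (min (real R) (Re z))) (max (- real R) (min (real R) (Im z)))"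

lemma cmod_mono: "\<bar>Re z\<bar> \<le> \<bar>Re z'\<bar> \<Longrightarrow> \<bar>Im z\<bar> \<le> \<bar>Im z'\<bar> \<Longrightarrow> cmod z \<le> cmod z'"
  unfolding cmod_def by (intro real_sqrt_le_mono add_mono) (auto simp: abs_le_square_iff)

lemma clip_Lipschitz: "cmod (clip R z - clip R z') \<le> cmod (z - z')"
  by (rule cmod_mono) (auto simp: clip_def)

lemma cmod_clip_le: "cmod (clip R z) \<le> cmod z"
  by (rule cmod_mono) (auto simp: clip_def)

lemma cmod_clip_bound: "cmod (clip R z) \<le> 2 * real R"
  by (rule order_trans[OF cmod_le]) (auto simp: clip_def)

lemma clip_eq: "cmod z \<le> real R \<Longrightarrow> clip R z = z"
  using abs_Re_le_cmod[of z] abs_Im_le_cmod[of z] by (auto simp: clip_def complex_eq_iff)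

lemma clip_measurable [measurable]: "clip R \<in> borel_measurable borel"
  unfolding clip_def[abs_def] Complex_eq by measurable

context fourier_pairing begin

theorem estimate:
  assumes uw: "integrable spacetime (\<lambda>(t, x). u t x * w t x)"
  shows "cmod (\<integral>(t, x). u t x * w t x \<partial>spacetime) \<le> pairing_const TYPE('d) s \<sigma> * A"
proof -
  note jointly_measurableD[OF u(1), measurable] jointly_measurableD[OF w(1), measurable]
  \<comment> \<open>Truncating \<open>w\<close> keeps all assumptions with the same constants.\<close>
  have est: "cmod (\<integral>(t, x). u t x * clip R (w t x) \<partial>spacetime) \<le> pairing_const TYPE('d) s \<sigma> * A" for R
  proof -
    interpret clip: fourier_pairing u "\<lambda>t x. clip R (w t x)" A A' s \<sigma>
    proof
      show "jointly_measurable (\<lambda>t x. clip R (w t x))" unfolding borel_prod[symmetric] by measurable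
      show "x_periodic (\<lambda>x. clip R (w t x))" for t using w(2)[of t] by (simp add: x_periodic_def)
      show "(\<integral>\<^sup>+(t, x). ennreal (cmod (P_dy 0 (u t) x)) * ennreal (cmod (clip R (w t (x + z)))) \<partial>spacetime) \<le> ennreal A" for z
        by (rule order_trans[OF nn_integral_mono low[of z]]) (auto intro!: mult_left_mono ennreal_leI cmod_clip_le)
      show "(\<integral>\<^sup>+(t, x). ennreal (cmod (P_dy j (u t) x)) * ennreal (cmod (clip R (w t (x + z)) - clip R (w t (x + y + z)))) \<partial>spacetime)
        \<le> ennreal (A * 2 powr (real j * \<sigma>) * phase_dist y powr s)" if "0 < j" for j z y
        by (rule order_trans[OF nn_integral_mono high[OF that, of z y]]) (auto intro!: mult_left_mono ennreal_leI clip_Lipschitz)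
      show "(\<integral>\<^sup>+(t, x). ennreal (cmod (clip R (w t x) - clip R (w t (x + z)))) \<partial>(spacetime :: (real \<times> (real ^ 'd)) measure)) \<le> ennreal (A' * phase_dist z powr s)" for z
        by (rule order_trans[OF nn_integral_mono mod[of z]]) (auto intro!: ennreal_leI clip_Lipschitz)
    qed (use u s A in auto)
    show ?thesis by (rule clip.bounded_estimate) (rule cmod_clip_bound)
  qed
  have "(\<lambda>R. \<integral>(t, x). u t x * clip R (w t x) \<partial>spacetime) \<longlonglongrightarrow> (\<integral>(t, x). u t x * w t x \<partial>spacetime)"
  proof (rule integral_dominated_convergence)
    show "(\<lambda>(t, x). u t x * clip R (w t x)) \<in> borel_measurable spacetime" for R by (rule measurable_ST) measurable
    show "integrable spacetime (\<lambda>p. norm (case p of (t, x) \<Rightarrow> u t x * w t x))" by (rule integrable_norm[OF uw])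
    show "AE p in spacetime. norm (case p of (t, x) \<Rightarrow> u t x * clip R (w t x)) \<le> norm (case p of (t, x) \<Rightarrow> u t x * w t x)" for R
      by (intro AE_I2) (auto simp: norm_mult intro!: mult_left_mono cmod_clip_le)
    show "AE p in spacetime. (\<lambda>R. case p of (t, x) \<Rightarrow> u t x * clip R (w t x)) \<longlonglongrightarrow> (case p of (t, x) \<Rightarrow> u t x * w t x)"
    proof (intro AE_I2, clarify)
      fix t x
      obtain n where "cmod (w t x) \<le> real n" using real_arch_simple by blast
      then have "\<forall>R\<ge>n. u t x * clip R (w t x) = u t x * w t x" by (auto intro: clip_eq order_trans)
      then show "(\<lambda>R. u t x * clip R (w t x)) \<longlonglongrightarrow> u t x * w t x"
        by (intro tendsto_eventually) (auto simp: eventually_sequentially)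
    qed
    show "(\<lambda>(t, x). u t x * w t x) \<in> borel_measurable spacetime" by (rule measurable_ST) measurable
  qed
  then show ?thesis by (rule LIMSEQ_le_const2[OF tendsto_norm]) (use est in auto)
qed

end

section \<open>Uniqueness of Fourier coefficients\<close>

text \<open>
  The embedding of the torus into \<open>\<complex>\<^sup>d\<close>. Lipschitz functions of it are
  periodic test functions with a modulus of continuity given by the translation distance.
\<close>

definition torus_embedding :: "real ^ 'd \<Rightarrow> complex ^ 'd" where
  "torus_embedding x = (\<chi> i. cis (x $ i))"

definition torus_inverse :: "complex ^ 'd \<Rightarrow> real ^ 'd" where
  "torus_inverse z = (\<chi> i. let a = arccos (max (- 1) (min 1 (Re (z $ i)))) in if 0 \<le> Im (z $ i) then a else 2 * pi - a)"

lemma torus_inverse_embedding: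
  assumes "x \<in> half_cell"
  shows "torus_inverse (torus_embedding x) = x"
proof -
  have "torus_inverse (torus_embedding x) $ i = x $ i" for i
  proof (cases "x $ i \<le> pi")
    case True
    then have "0 \<le> sin (x $ i)" "arccos (cos (x $ i)) = x $ i"
      using assms by (auto simp: half_cell_def intro!: sin_ge_zero arccos_cos)
    then show ?thesis by (simp add: torus_inverse_def torus_embedding_def)
  next
    case False
    then have b: "pi < x $ i" "x $ i < 2 * pi" using assms by (auto simp: half_cell_def)
    have "arccos (cos (2 * pi - x $ i)) = 2 * pi - x $ i" using b by (intro arccos_cos) auto
    moreover have "cos (2 * pi - x $ i) = cos (x $ i)" by (simp add: cos_diff)
    moreover have "sin (x $ i) < 0" using b by (intro sin_lt_zero) auto
    ultimately show ?thesis by (simp add: torus_inverse_def torus_embedding_def)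
  qed
  then show ?thesis by (simp add: vec_eq_iff)
qed

lemma torus_inverse_measurable: "torus_inverse \<in> borel_measurable borel"
proof -
  have [measurable]: "(\<lambda>z::complex^'a. z $ i) \<in> borel_measurable borel" for i
    by (intro borel_measurable_continuous_onI continuous_intros)
  have "continuous_on UNIV (\<lambda>r::real. arccos (max (- 1) (min 1 r)))"
    by (rule continuous_on_compose2[OF continuous_on_arccos']) (auto intro!: continuous_intros)
  from borel_measurable_continuous_onI[OF this]
  have [measurable]: "(\<lambda>r::real. arccos (max (- 1) (min 1 r))) \<in> borel_measurable borel" .
  show ?thesis
    unfolding torus_inverse_def[abs_def] Let_def
    by (intro borel_measurable_vec_lambda) measurable
qed

lemma dist_torus_embedding: "dist (torus_embedding x) (torus_embedding (x + z)) \<le> phase_dist z"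
proof -
  have "dist (torus_embedding x) (torus_embedding (x + z)) \<le> (\<Sum>i\<in>UNIV. dist (torus_embedding x $ i) (torus_embedding (x + z) $ i))"
    unfolding dist_vec_def by (rule L2_set_le_sum) simp
  also have "\<dots> = phase_dist z"
    unfolding phase_dist_def
  proof (intro sum.cong refl)
    fix i
    have "cis (x $ i) - cis (x $ i + z $ i) = - (cis (x $ i) * (cis (z $ i) - 1))"
      by (simp add: cis_mult[symmetric] algebra_simps)
    then show "dist (torus_embedding x $ i) (torus_embedding (x + z) $ i) = cmod (cis (z $ i) - 1)"
      by (simp add: torus_embedding_def dist_norm norm_mult)
  qed
  finally show ?thesis .
qed

lemma continuous_torus_embedding: "continuous_on UNIV torus_embedding"
  unfolding torus_embedding_def[abs_def] cis_conv_exp by (intro continuous_intros)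

lemma torus_embedding_measurable [measurable]: "torus_embedding \<in> borel_measurable borel"
  by (intro borel_measurable_continuous_onI continuous_torus_embedding)

lemma x_periodic_torus_embedding: "x_periodic torus_embedding"
proof -
  have "cis (a + 2 * pi * of_int k) = cis a" for a k
    by (metis Ints_of_int cis_mult cis_multiple_2pi mult.right_neutral)
  then show ?thesis by (simp add: x_periodic_def torus_embedding_def rvec_def vec_eq_iff)
qed

lemma sets_spacetime_borel:
  assumes "P \<in> sets (borel \<Otimes>\<^sub>M borel)"
  shows "P \<inter> space spacetime \<in> sets (spacetime :: (real \<times> (real ^ 'd)) measure)"
proof -
  have "(\<lambda>p. p) \<in> measurable (spacetime :: (real \<times> (real ^ 'd)) measure) borel"
    by (rule measurable_spacetime) simp
  then have "(\<lambda>p. p) -` P \<inter> space spacetime \<in> sets (spacetime :: (real \<times> (real ^ 'd)) measure)"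
    using assms unfolding borel_prod by (rule measurable_sets)
  then show ?thesis by simp
qed

lemma AE_spacetime_half_cell: "AE p in (spacetime :: (real \<times> (real ^ 'd)) measure). snd p \<in> half_cell"
proof (rule ST.AE_pair_measure)
  have "snd -` half_cell \<inter> space (borel \<Otimes>\<^sub>M borel) \<in> sets (borel \<Otimes>\<^sub>M (borel :: (real ^ 'd) measure))"
    by measurable
  from sets_spacetime_borel[OF this] show "{x \<in> space (spacetime :: (real \<times> (real ^ 'd)) measure). snd x \<in> half_cell} \<in> sets spacetime"
    by (simp add: Int_def vimage_def space_pair_measure conj_commute)
qed (simp add: AE_half_cell)

lemma measurable_norm_shift:
  assumes "jointly_measurable w"
  shows "(\<lambda>(t, x). ennreal (cmod (w t (x + z)))) \<in> borel_measurable (borel \<Otimes>\<^sub>M borel)"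
    and "(\<lambda>(t, x). ennreal (cmod (w t (x + z) - w t (x + y + z)))) \<in> borel_measurable (borel \<Otimes>\<^sub>M borel)"
proof -
  note jointly_measurableD[OF assms, measurable]
  show "(\<lambda>(t, x). ennreal (cmod (w t (x + z)))) \<in> borel_measurable (borel \<Otimes>\<^sub>M borel)"
    by measurable
  show "(\<lambda>(t, x). ennreal (cmod (w t (x + z) - w t (x + y + z)))) \<in> borel_measurable (borel \<Otimes>\<^sub>M borel)"
    by measurable
qed

lemma set_integral_disjoint_union_zero:
  fixes f :: "'a \<Rightarrow> complex" and A :: "nat \<Rightarrow> 'a set"
  assumes f: "integrable M f" and A: "\<And>i. A i \<in> sets M" "disjoint_family A"
    and z: "\<And>i. set_lebesgue_integral M (A i) f = 0"
  shows "set_lebesgue_integral M (\<Union>i. A i) f = 0"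
proof -
  have "set_integrable M (\<Union>i. A i) f"
    unfolding set_integrable_def by (intro integrable_mult_indicator f sets.countable_UN) (use A in auto)
  then have "set_lebesgue_integral M (\<Union>i. A i) f = (\<Sum>i. set_lebesgue_integral M (A i) f)"
    using A by (intro lebesgue_integral_countable_add) (auto simp: disjoint_family_on_def)
  then show ?thesis by (simp add: z)
qed

lemma set_integral_compl_zero:
  fixes f :: "'a \<Rightarrow> complex"
  assumes f: "integrable M f" and A: "A \<in> sets M" "B \<in> sets M" "A \<subseteq> B"
    and z: "set_lebesgue_integral M A f = 0" "set_lebesgue_integral M B f = 0"
  shows "set_lebesgue_integral M (B - A) f = 0"
proof -
  have int: "set_integrable M C f" if "C \<in> sets M" for C
    unfolding set_integrable_def by (intro integrable_mult_indicator f that)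
  have "set_lebesgue_integral M (A \<union> (B - A)) f = set_lebesgue_integral M A f + set_lebesgue_integral M (B - A) f"
    by (intro set_integral_Un int) (use A in auto)
  moreover have "A \<union> (B - A) = B" using A by auto
  ultimately show ?thesis using z by simp
qed

context
  fixes u :: "real \<Rightarrow> real ^ 'd \<Rightarrow> complex" and K :: real
  assumes u: "jointly_measurable u" "integrable spacetime (\<lambda>(t, x). u t x)"
    and supp: "\<And>t x. K < \<bar>t\<bar> \<Longrightarrow> u t x = 0" and K: "0 < K"
    and zero: "\<And>n. AE t in lborel. fourier_coeff (u t) n = 0"
begin

lemma P_dy_zero: "AE t in lborel. \<forall>j x. P_dy j (u t) x = 0"
proof -
  have "AE t in lborel. \<forall>n. fourier_coeff (u t) n = 0"
    using zero by (simp add: AE_all_countable)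
  then show ?thesis by eventually_elim (simp add: P_dy_eq)
qed

lemma nn_integral_P_dy_zero:
  assumes [measurable]: "(\<lambda>(t, x). g t x) \<in> borel_measurable (borel \<Otimes>\<^sub>M borel)"
  shows "(\<integral>\<^sup>+(t, x). ennreal (cmod (P_dy j (u t) x)) * g t x \<partial>spacetime) = 0"
proof -
  note jointly_measurableD[OF jointly_measurable_P_dy[OF u(1)], measurable]
  have "(\<integral>\<^sup>+(t, x). ennreal (cmod (P_dy j (u t) x)) * g t x \<partial>spacetime)
      = (\<integral>\<^sup>+t. \<integral>\<^sup>+x. ennreal (cmod (P_dy j (u t) x)) * g t x \<partial>torus \<partial>lborel)"
    by (rule nn_integral_ST) measurable
  also have "\<dots> = (\<integral>\<^sup>+t. 0 \<partial>(lborel :: real measure))"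
    using P_dy_zero by (intro nn_integral_cong_AE) (auto elim!: eventually_mono)
  finally show ?thesis by simp
qed

text \<open>
  All dyadic blocks vanish, so the pairing estimate holds with \<open>A = 0\<close> and \<open>s =
  1\<close>. In this way uniqueness follows from the pairing estimate, without a density theorem
  for trigonometric polynomials.
\<close>

lemma integral_Lipschitz_test_zero:
  fixes h :: "complex ^ 'd \<Rightarrow> real"
  assumes S: "S \<in> sets borel" and h: "\<And>a b. \<bar>h a - h b\<bar> \<le> L * dist a b" "\<And>a. \<bar>h a\<bar> \<le> 1" and L: "0 \<le> L"
  shows "(\<integral>(t, x). u t x * (indicator (S \<inter> {-K..K}) t * complex_of_real (h (torus_embedding x))) \<partial>spacetime) = 0"
proof -
  define S' where "S' = S \<inter> {-K..K}"
  have [measurable]: "S' \<in> sets borel" using S by (simp add: S'_def)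
  have "continuous_on UNIV h"
  proof (rule lipschitz_on_continuous_on)
    show "L-lipschitz_on UNIV h"
      using h(1) L by (intro lipschitz_onI) (auto simp: dist_real_def)
  qed
  from borel_measurable_continuous_onI[OF this] have [measurable]: "h \<in> borel_measurable borel" .
  define w where "w t x = indicator S' t * complex_of_real (h (torus_embedding x))" for t and x :: "real ^ 'd"
  have wm [measurable]: "(\<lambda>(t, x). w t x) \<in> borel_measurable (borel \<Otimes>\<^sub>M borel)"
    unfolding w_def by measurable
  have wm': "jointly_measurable w" using wm by (simp only: borel_prod)
  have wper: "x_periodic (w t)" for t
    by (simp add: w_def x_periodic_def x_periodicD[OF x_periodic_torus_embedding])
  have wb: "cmod (w t x) \<le> 1" for t x
    using h(2) by (auto simp: w_def norm_mult indicator_def)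
  interpret fourier_pairing u w 0 "L * (2 * K * (2 * pi) ^ CARD('d))" 1 0
  proof
    show "(\<integral>\<^sup>+(t, x). ennreal (cmod (P_dy 0 (u t) x)) * ennreal (cmod (w t (x + z))) \<partial>spacetime) \<le> ennreal 0" for z
      by (simp add: nn_integral_P_dy_zero[OF measurable_norm_shift(1)[OF wm']])
    show "(\<integral>\<^sup>+(t, x). ennreal (cmod (P_dy j (u t) x)) * ennreal (cmod (w t (x + z) - w t (x + y + z))) \<partial>spacetime)
      \<le> ennreal (0 * 2 powr (real j * 0) * phase_dist y powr 1)" for j z y
      by (simp add: nn_integral_P_dy_zero[OF measurable_norm_shift(2)[OF wm']])
    show "(\<integral>\<^sup>+(t, x). ennreal (cmod (w t x - w t (x + z))) \<partial>(spacetime :: (real \<times> (real ^ 'd)) measure))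
      \<le> ennreal (L * (2 * K * (2 * pi) ^ CARD('d)) * phase_dist z powr 1)" for z
    proof -
      have pw: "ennreal (cmod (w t x - w t (x + z))) \<le> ennreal (L * phase_dist z) * indicator {-K..K} t" for t x
      proof (cases "t \<in> S'")
        case True
        then have "cmod (w t x - w t (x + z)) = \<bar>h (torus_embedding x) - h (torus_embedding (x + z))\<bar>"
          by (simp add: w_def flip: of_real_diff)
        also have "\<dots> \<le> L * phase_dist z"
          using h(1) mult_left_mono[OF dist_torus_embedding L] by (rule order_trans)
        finally show ?thesis using True by (simp add: S'_def ennreal_leI)
      qed (simp add: w_def)
      have "(\<integral>\<^sup>+(t, x). ennreal (cmod (w t x - w t (x + z))) \<partial>(spacetime :: (real \<times> (real ^ 'd)) measure))
        \<le> (\<integral>\<^sup>+(t, x). ennreal (L * phase_dist z) * indicator {-K..K} t \<partial>(spacetime :: (real \<times> (real ^ 'd)) measure))"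
        by (intro nn_integral_mono) (auto intro!: pw)
      also have "\<dots> = (\<integral>\<^sup>+t. \<integral>\<^sup>+x. ennreal (L * phase_dist z) * indicator {-K..K} t \<partial>(torus :: (real ^ 'd) measure) \<partial>lborel)"
        by (rule nn_integral_ST) measurable
      also have "\<dots> = ennreal (L * phase_dist z) * ennreal ((2 * pi) ^ CARD('d)) * ennreal (2 * K)"
      proof -
        have "(\<integral>\<^sup>+x. ennreal (L * phase_dist z) * indicator {-K..K} t \<partial>(torus :: (real ^ 'd) measure))
            = (ennreal (L * phase_dist z) * ennreal ((2 * pi) ^ CARD('d))) * indicator {-K..K} t" for t
          unfolding nn_integral_const emeasure_torus by (simp only: mult_ac)
        then have "(\<integral>\<^sup>+t. \<integral>\<^sup>+x. ennreal (L * phase_dist z) * indicator {-K..K} t \<partial>(torus :: (real ^ 'd) measure) \<partial>lborel)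
            = (\<integral>\<^sup>+t. (ennreal (L * phase_dist z) * ennreal ((2 * pi) ^ CARD('d))) * indicator {-K..K} t \<partial>lborel)"
          by (simp only:)
        also have "\<dots> = (ennreal (L * phase_dist z) * ennreal ((2 * pi) ^ CARD('d))) * emeasure lborel {-K..K}"
          by (rule nn_integral_cmult_indicator) simp
        finally show ?thesis using K by simp
      qed
      also have "\<dots> = ennreal (L * (2 * K * (2 * pi) ^ CARD('d)) * phase_dist z powr 1)"
        using K L by (simp add: ennreal_mult[symmetric] mult_ac)
      finally show ?thesis .
    qed
  qed (use u wm' wper K L in auto)
  have "cmod (\<integral>(t, x). u t x * w t x \<partial>spacetime) \<le> pairing_const TYPE('d) 1 0 * 0"
    by (rule bounded_estimate[OF wb])
  then show ?thesis by (simp add: w_def S'_def)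
qed

text \<open>
  The indicator of a closed set is the limit of the Lipschitz functions \<open>max 0 (1 - k
  dist(z, C))\<close>.
\<close>

lemma integral_closed_test_zero:
  assumes S: "S \<in> sets borel" and C: "closed C" "C \<noteq> {}"
  shows "(\<integral>(t, x). u t x * (indicator (S \<inter> {-K..K}) t * indicator C (torus_embedding x)) \<partial>spacetime) = 0"
proof -
  let ?h = "\<lambda>k z. max 0 (1 - real k * infdist z C)"
  let ?f = "\<lambda>k. \<lambda>(t, x). u t x * (indicator (S \<inter> {-K..K}) t * complex_of_real (?h k (torus_embedding x)))"
  note S[measurable] jointly_measurableD[OF u(1), measurable]
  have [measurable]: "(\<lambda>z. infdist z C) \<in> borel_measurable borel"
    by (intro borel_measurable_continuous_onI continuous_intros)
  have [measurable]: "C \<in> sets borel" using C by simp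
  have 0: "integral\<^sup>L spacetime (?f k) = 0" for k
  proof (rule integral_Lipschitz_test_zero[OF S, of _ "real k"])
    fix a b :: "complex ^ 'd"
    have "\<bar>infdist a C - infdist b C\<bar> \<le> dist a b"
      using infdist_triangle[of a C b] infdist_triangle[of b C a] by (simp add: dist_commute abs_le_iff)
    then have "real k * \<bar>infdist a C - infdist b C\<bar> \<le> real k * dist a b" by (intro mult_left_mono) auto
    then have "\<bar>real k * infdist a C - real k * infdist b C\<bar> \<le> real k * dist a b"
      by (simp add: abs_mult flip: right_diff_distrib)
    then show "\<bar>?h k a - ?h k b\<bar> \<le> real k * dist a b" by linarith
  next
    fix a :: "complex ^ 'd"
    show "\<bar>?h k a\<bar> \<le> 1" using infdist_nonneg[of a C] by (simp add: max_def)
  qed simp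
  have "(\<lambda>k. integral\<^sup>L spacetime (?f k)) \<longlonglongrightarrow> (\<integral>(t, x). u t x * (indicator (S \<inter> {-K..K}) t * indicator C (torus_embedding x)) \<partial>spacetime)"
  proof (rule integral_dominated_convergence)
    show "?f k \<in> borel_measurable spacetime" for k by (rule measurable_ST) measurable
    show "(\<lambda>(t, x). u t x * (indicator (S \<inter> {-K..K}) t * indicator C (torus_embedding x))) \<in> borel_measurable spacetime"
      by (rule measurable_ST) measurable
    show "integrable spacetime (\<lambda>p. norm (case p of (t, x) \<Rightarrow> u t x))" by (rule integrable_norm[OF u(2)])
    have "cmod (u t x * (indicator (S \<inter> {-K..K}) t * complex_of_real (?h k z))) \<le> cmod (u t x) * (1 * 1)" for k t x z
      unfolding norm_mult using infdist_nonneg[of z C] by (intro mult_left_mono mult_mono) (auto simp: indicator_def max_def)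
    then show "AE p in spacetime. norm (?f k p) \<le> norm (case p of (t, x) \<Rightarrow> u t x)" for k
      by (intro AE_I2) auto
    show "AE p in spacetime. (\<lambda>k. ?f k p) \<longlonglongrightarrow> (case p of (t, x) \<Rightarrow> u t x * (indicator (S \<inter> {-K..K}) t * indicator C (torus_embedding x)))"
    proof (intro AE_I2, clarify)
      fix t :: real and x :: "real ^ 'd"
      let ?z = "torus_embedding x"
      have "(\<lambda>k. complex_of_real (?h k ?z)) \<longlonglongrightarrow> indicator C ?z"
      proof (cases "?z \<in> C")
        case True
        then show ?thesis by simp
      next
        case False
        then have pos: "0 < infdist ?z C"
          using C in_closed_iff_infdist_zero[of C ?z] infdist_nonneg[of ?z C] by (simp add: less_le)
        obtain n where n: "1 / infdist ?z C \<le> real n" using real_arch_simple by blast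
        have "?h k ?z = 0" if "n \<le> k" for k
        proof -
          have "1 / infdist ?z C \<le> real k" using n that by linarith
          then have "1 \<le> real k * infdist ?z C" using pos by (simp add: divide_le_eq)
          then show ?thesis by simp
        qed
        then show ?thesis using False
          by (intro tendsto_eventually) (auto simp: eventually_sequentially)
      qed
      then show "(\<lambda>k. u t x * (indicator (S \<inter> {-K..K}) t * complex_of_real (?h k ?z))) \<longlonglongrightarrow> u t x * (indicator (S \<inter> {-K..K}) t * indicator C ?z)"
        by (intro tendsto_intros)
    qed
  qed
  then show ?thesis unfolding 0 by (simp add: LIMSEQ_const_iff)
qed

text \<open>
  Closed sets are stable under intersection and generate the Borel sets, so the vanishing passes
  to cylinders over Borel sets by Dynkin's argument.
\<close>

lemma set_integral_cylinder_zero: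
  assumes S: "S \<in> sets borel" and C: "C \<in> sets borel"
  shows "set_lebesgue_integral spacetime ({p. fst p \<in> S \<inter> {-K..K} \<and> torus_embedding (snd p) \<in> C} \<inter> space spacetime) (\<lambda>(t, x). u t x) = 0"
proof -
  define Cy where "Cy C = {p. fst p \<in> S \<inter> {-K..K} \<and> torus_embedding (snd p) \<in> C} \<inter> space (spacetime :: (real \<times> (real ^ 'd)) measure)" for C
  note S[measurable]
  have meas: "Cy C \<in> sets spacetime" if [measurable]: "C \<in> sets borel" for C
  proof -
    have "{p \<in> space (borel \<Otimes>\<^sub>M borel). fst p \<in> S \<inter> {-K..K} \<and> torus_embedding (snd p) \<in> C} \<in> sets (borel \<Otimes>\<^sub>M (borel :: (real ^ 'd) measure))"
      by measurable
    from sets_spacetime_borel[OF this] show ?thesis by (simp add: Cy_def space_pair_measure)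
  qed
  have "C \<in> sigma_sets UNIV {C. closed C \<and> C \<noteq> {}}"
  proof -
    have "C \<in> sigma_sets UNIV (Collect closed)"
      using C by (simp add: borel_eq_closed)
    then show ?thesis
    proof (rule rev_subsetD, intro sigma_sets_mono subsetI)
      fix C :: "(complex ^ 'd) set" assume "C \<in> Collect closed"
      then show "C \<in> sigma_sets UNIV {C. closed C \<and> C \<noteq> {}}"
        by (cases "C = {}") (auto intro: sigma_sets.Empty sigma_sets.Basic)
    qed
  qed
  moreover have "sigma_sets UNIV {C :: (complex ^ 'd) set. closed C \<and> C \<noteq> {}} = sigma_sets UNIV (insert {} {C. closed C \<and> C \<noteq> {}})"
    by (intro sigma_sets_eqI) (auto intro: sigma_sets.Empty)
  ultimately have C': "C \<in> sigma_sets UNIV (insert {} {C :: (complex ^ 'd) set. closed C \<and> C \<noteq> {}})" by simp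
  have "Int_stable (insert {} {C :: (complex ^ 'd) set. closed C \<and> C \<noteq> {}})"
    by (auto simp: Int_stable_def)
  moreover have "insert {} {C :: (complex ^ 'd) set. closed C \<and> C \<noteq> {}} \<subseteq> Pow UNIV" by simp
  moreover note C'
  ultimately have "set_lebesgue_integral spacetime (Cy C) (\<lambda>(t, x). u t x) = 0 \<and> C \<in> sets borel"
  proof (induction rule: sigma_sets_induct_disjoint)
    case (basic C)
    then consider "C = {}" | "closed C" "C \<noteq> {}" by auto
    then show ?case
    proof cases
      case 2
      have "set_lebesgue_integral spacetime (Cy C) (\<lambda>(t, x). u t x) = (\<integral>(t, x). u t x * (indicator (S \<inter> {-K..K}) t * indicator C (torus_embedding x)) \<partial>spacetime)"
        unfolding set_lebesgue_integral_def
        by (intro Bochner_Integration.integral_cong) (auto simp: Cy_def indicator_def)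
      then show ?thesis using integral_closed_test_zero[OF S 2] 2 by simp
    qed (simp add: Cy_def set_lebesgue_integral_def)
  next
    case empty
    then show ?case by (simp add: Cy_def set_lebesgue_integral_def)
  next
    case (compl C)
    have "set_lebesgue_integral spacetime (Cy UNIV) (\<lambda>(t, x). u t x) = (\<integral>(t, x). u t x * (indicator (S \<inter> {-K..K}) t * indicator UNIV (torus_embedding x)) \<partial>spacetime)"
      unfolding set_lebesgue_integral_def
      by (intro Bochner_Integration.integral_cong) (auto simp: Cy_def indicator_def)
    then have "set_lebesgue_integral spacetime (Cy UNIV - Cy C) (\<lambda>(t, x). u t x) = 0"
      using compl integral_closed_test_zero[OF S closed_UNIV UNIV_not_empty]
      by (intro set_integral_compl_zero u meas) (auto simp: Cy_def)
    moreover have "Cy UNIV - Cy C = Cy (UNIV - C)" by (auto simp: Cy_def)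
    ultimately show ?case using compl by auto
  next
    case (union C)
    have "set_lebesgue_integral spacetime (\<Union>i. Cy (C i)) (\<lambda>(t, x). u t x) = 0"
    proof (rule set_integral_disjoint_union_zero[OF u(2)])
      show "Cy (C i) \<in> sets spacetime" for i using union by (intro meas) auto
      show "disjoint_family (\<lambda>i. Cy (C i))" using union(1) by (fastforce simp: disjoint_family_on_def Cy_def)
      show "set_lebesgue_integral spacetime (Cy (C i)) (\<lambda>(t, x). u t x) = 0" for i using union by auto
    qed
    moreover have "(\<Union>i. Cy (C i)) = Cy (\<Union>i. C i)" by (auto simp: Cy_def)
    ultimately show ?case using union by auto
  qed
  then show ?thesis by (simp add: Cy_def)
qed

text \<open>
  On the half-open cell the embedding is injective with a Borel inverse, so every measurable
  subset of the cell is, up to a null set, the preimage of a Borel set.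
\<close>

lemma set_integral_rectangle_zero:
  assumes S: "S \<in> sets lborel" and B: "B \<in> sets torus"
  shows "set_lebesgue_integral spacetime (S \<times> B) (\<lambda>(t, x). u t x) = 0"
proof -
  have B': "B \<in> sets borel" "B \<subseteq> space torus"
    using B sets.sets_into_space[OF B] by (simp_all add: sets_torus sets_restrict_space_iff)
  define C where "C = torus_inverse -` B"
  have C: "C \<in> sets borel"
    using measurable_sets[OF torus_inverse_measurable B'(1)] by (simp add: C_def)
  have S': "S \<in> sets borel" using S by simp
  let ?Cy = "{p. fst p \<in> S \<inter> {-K..K} \<and> torus_embedding (snd p) \<in> C} \<inter> space (spacetime :: (real \<times> (real ^ 'd)) measure)"
  have Cym: "?Cy \<in> sets spacetime"
  proof -
    note S'[measurable] C[measurable]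
    have "{p \<in> space (borel \<Otimes>\<^sub>M borel). fst p \<in> S \<inter> {-K..K} \<and> torus_embedding (snd p) \<in> C} \<in> sets (borel \<Otimes>\<^sub>M (borel :: (real ^ 'd) measure))"
      by measurable
    from sets_spacetime_borel[OF this] show ?thesis by (simp add: space_pair_measure)
  qed
  have "set_lebesgue_integral spacetime (S \<times> B) (\<lambda>(t, x). u t x) = set_lebesgue_integral spacetime ?Cy (\<lambda>(t, x). u t x)"
    unfolding set_lebesgue_integral_def
  proof (rule Bochner_Integration.integral_cong_AE)
    show "(\<lambda>p. indicator (S \<times> B) p *\<^sub>R (case p of (t, x) \<Rightarrow> u t x)) \<in> borel_measurable spacetime"
      using S B u(2) by (intro borel_measurable_scaleR borel_measurable_indicator borel_measurable_integrable) auto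
    show "(\<lambda>p. indicator ?Cy p *\<^sub>R (case p of (t, x) \<Rightarrow> u t x)) \<in> borel_measurable spacetime"
      using Cym u(2) by (intro borel_measurable_scaleR borel_measurable_indicator borel_measurable_integrable) auto
    show "AE p in spacetime. indicator (S \<times> B) p *\<^sub>R (case p of (t, x) \<Rightarrow> u t x) = indicator ?Cy p *\<^sub>R (case p of (t, x) \<Rightarrow> u t x)"
      using AE_spacetime_half_cell
    proof eventually_elim
      case (elim p)
      obtain t x where p: "p = (t, x)" by (cases p)
      have "x \<in> half_cell" using elim by (simp add: p)
      then have "x \<in> space torus" "torus_embedding x \<in> C \<longleftrightarrow> x \<in> B"
        using half_cell_subset_space by (auto simp: C_def torus_inverse_embedding)
      moreover have "u t x = 0" if "t \<notin> {-K..K}" using that by (intro supp) auto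
      ultimately show ?case by (auto simp: p indicator_def space_pair_measure)
    qed
  qed
  also have "\<dots> = 0" by (rule set_integral_cylinder_zero[OF S' C])
  finally show ?thesis .
qed

text \<open>
  Rectangles are stable under intersection and generate the product algebra, so \<open>u\<close>
  integrates to zero over every measurable set.
\<close>

lemma AE_zero_if_fourier_zero: "AE p in spacetime. (case p of (t, x) \<Rightarrow> u t x) = 0"
proof (rule ST.density_zero[OF u(2)])
  fix A :: "(real \<times> (real ^ 'd)) set" assume A: "A \<in> sets spacetime"
  let ?G = "{S \<times> B | S B. S \<in> sets lborel \<and> B \<in> sets (torus :: (real ^ 'd) measure)}"
  have "Int_stable ?G" by (rule Int_stable_pair_measure_generator)
  moreover have "?G \<subseteq> Pow (space lborel \<times> space torus)"
    by (rule pair_measure_closed)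
  moreover have "A \<in> sigma_sets (space lborel \<times> space torus) ?G"
    using A by (simp add: sets_pair_measure)
  ultimately show "set_lebesgue_integral spacetime A (\<lambda>(t, x). u t x) = 0"
  proof (induction A rule: sigma_sets_induct_disjoint)
    case (basic A)
    then show ?case using set_integral_rectangle_zero by auto
  next
    case (compl A)
    have "set_lebesgue_integral spacetime (UNIV \<times> space torus) (\<lambda>(t, x). u t x) = 0"
      by (rule set_integral_rectangle_zero) auto
    moreover have "A \<in> sets spacetime" using compl by (simp add: sets_pair_measure)
    ultimately show ?case
      using compl sets.sets_into_space[of A spacetime] by (intro set_integral_compl_zero[OF u(2)]) (auto simp: space_pair_measure)
  next
    case (union A)
    then show ?case by (intro set_integral_disjoint_union_zero[OF u(2)]) (auto simp: sets_pair_measure)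
  qed (simp add: set_lebesgue_integral_def)
qed

end

section \<open>Series of trigonometric polynomials with geometric decay\<close>

lemma Lnorm_ST:
  fixes f :: "real \<Rightarrow> real ^ 'd \<Rightarrow> ennreal"
  assumes [measurable]: "(\<lambda>(t, x). f t x) \<in> borel_measurable (borel \<Otimes>\<^sub>M borel)" and q: "0 < q"
  shows "Lnorm q spacetime (\<lambda>(t, x). f t x) = Lnorm q lborel (\<lambda>t. Lnorm q torus (f t))"
proof -
  have "(\<integral>\<^sup>+p. ennpow (case p of (t, x) \<Rightarrow> f t x) q \<partial>spacetime) = (\<integral>\<^sup>+(t, x). ennpow (f t x) q \<partial>spacetime)"
    by (intro nn_integral_cong) auto
  also have "\<dots> = (\<integral>\<^sup>+t. \<integral>\<^sup>+x. ennpow (f t x) q \<partial>torus \<partial>lborel)"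
    by (rule nn_integral_ST) measurable
  finally show ?thesis using q by (simp add: Lnorm_def)
qed

lemma LtE_Lx_eq:
  assumes "jointly_measurable u" "0 < q"
  shows "LtE q (Lx q) u = Lnorm q spacetime (\<lambda>(t, x). ennreal (cmod (u t x)))"
proof -
  note jointly_measurableD[OF assms(1), measurable]
  show ?thesis
    unfolding LtE_def Lx_def by (rule Lnorm_ST[symmetric]) (measurable, rule assms)
qed

lemma Lnorm_ST_shift:
  fixes f :: "real \<Rightarrow> real ^ 'd \<Rightarrow> ennreal"
  assumes [measurable]: "(\<lambda>(t, x). f t x) \<in> borel_measurable (borel \<Otimes>\<^sub>M borel)" and q: "0 < q"
    and per: "\<And>t. x_periodic (f t)"
  shows "Lnorm q spacetime (\<lambda>(t, x). f t (x + z)) = Lnorm q spacetime (\<lambda>(t, x). f t x)"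
proof -
  have "Lnorm q torus (\<lambda>x. f t (x + z)) = Lnorm q torus (f t)" for t
  proof -
    have [measurable]: "f t \<in> borel_measurable borel" by measurable
    have "(\<integral>\<^sup>+x. ennpow (f t (x + z)) q \<partial>torus) = (\<integral>\<^sup>+x. ennpow (f t x) q \<partial>torus)"
      by (rule nn_integral_torus_shift[of "\<lambda>x. ennpow (f t x) q"]) (measurable, use per[of t] in \<open>simp add: x_periodic_def\<close>)
    then show ?thesis by (simp add: Lnorm_def)
  qed
  moreover have "(\<lambda>(t, x). f t (x + z)) \<in> borel_measurable (borel \<Otimes>\<^sub>M borel)" by measurable
  ultimately show ?thesis by (simp add: Lnorm_ST[OF _ q] assms(1))
qed

definition torus_volume :: "'d::finite itself \<Rightarrow> real" where
  "torus_volume _ = (2 * pi) ^ CARD('d)"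

lemma torus_volume_ge_1: "1 \<le> torus_volume TYPE('d::finite)"
  unfolding torus_volume_def using pi_ge_two by (intro one_le_power) simp

lemma emeasure_torus_volume: "emeasure torus (space (torus :: (real ^ 'd) measure)) = ennreal (torus_volume TYPE('d))"
  by (simp only: emeasure_torus torus_volume_def)

lemma Lnorm_torus_const_le:
  assumes "1 \<le> q"
  shows "Lnorm q (torus :: (real ^ 'd) measure) (\<lambda>_. c) \<le> ennreal (torus_volume TYPE('d)) * c"
proof -
  have "Lnorm q (torus :: (real ^ 'd) measure) (\<lambda>_. c) = c * ennreal (torus_volume TYPE('d) powr (1 / q))"
    using assms torus_volume_ge_1[where 'd='d]
    by (simp add: Lnorm_def emeasure_torus_volume ennpow_mult ennpow_ennreal)
  also have "\<dots> \<le> c * ennreal (torus_volume TYPE('d))"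
    using assms torus_volume_ge_1[where 'd='d] powr_mono[of "1 / q" 1 "torus_volume TYPE('d)"]
    by (intro mult_left_mono ennreal_leI) auto
  finally show ?thesis by (simp add: mult.commute)
qed

lemma nn_integral_torus_le_Lnorm:
  assumes q: "1 < q" and f: "f \<in> borel_measurable borel"
  shows "(\<integral>\<^sup>+x. f x \<partial>(torus :: (real ^ 'd) measure)) \<le> ennreal (torus_volume TYPE('d)) * Lnorm q torus f"
proof -
  define r where "r = q / (q - 1)"
  have r: "1 < r" "1 / q + 1 / r = 1" using q by (auto simp: r_def field_simps)
  have "(\<integral>\<^sup>+x. f x \<partial>(torus :: (real ^ 'd) measure)) = (\<integral>\<^sup>+x. f x * 1 \<partial>torus)" by simp
  also have "\<dots> \<le> Lnorm q torus f * Lnorm r torus (\<lambda>_::real ^ 'd. 1)"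
    by (intro nn_integral_Hoelder q r measurable_torus f) simp
  also have "\<dots> \<le> Lnorm q torus f * (ennreal (torus_volume TYPE('d)) * 1)"
    using r by (intro mult_left_mono Lnorm_torus_const_le) auto
  finally show ?thesis by (simp add: mult.commute)
qed

text \<open>
  Interpolation between the trivial bound and the Lipschitz bound for the difference of a block
  and its translate.
\<close>

lemma powr_interpolation:
  fixes K z s :: real
  assumes "1 \<le> K" "0 \<le> z" "0 < s" "s \<le> 1"
  shows "min 1 (K * z) \<le> K * z powr s"
proof (cases "z \<le> 1")
  case True
  have "z \<le> z powr s"
  proof (cases "z = 0")
    case False
    then show ?thesis using powr_mono'[of s 1 z] assms True by simp
  qed simp
  then have "K * z \<le> K * z powr s" using assms by (intro mult_left_mono) auto
  then show ?thesis by simp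
next
  case False
  then have "1 \<le> z powr s" using assms by (intro ge_one_powr_ge_zero) auto
  then have "1 * 1 \<le> K * z powr s" using assms by (intro mult_mono) auto
  then show ?thesis by simp
qed

text \<open>
  The volume enters once to bound an \<open>L\<^sup>1\<close> norm by an \<open>L\<^sup>q\<close>
  norm and once to bound an \<open>L\<^sup>q\<close> norm by a supremum; the power of three comes
  from the number of frequencies in a cube.
\<close>

definition bernstein_const :: "'d::finite itself \<Rightarrow> real" where
  "bernstein_const D = (torus_volume D)\<^sup>2 * 3 ^ CARD('d)"

definition block_const :: "'d::finite itself \<Rightarrow> real \<Rightarrow> real \<Rightarrow> real \<Rightarrow> real" where
  "block_const D q \<theta> s = 4 * bernstein_const D * geom_const (2 powr ((real CARD('d) + 1) * s - \<theta>)) q + geom_const (2 powr (- \<theta>)) q"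

text \<open>
  A series whose term number \<open>k\<close> is a trigonometric polynomial of degree at most
  \<open>2\<^sup>k\<close>, with norms decaying like
  \<open>2\<^sup>-\<^sup>\<theta>\<^sup>k\<close>: the shape of a function of positive regularity.
  Both the random function and the Besov function are brought into it.
\<close>

locale trig_blocks =
  fixes U :: "nat \<Rightarrow> real \<Rightarrow> real ^ 'd \<Rightarrow> complex" and c :: "nat \<Rightarrow> int ^ 'd \<Rightarrow> real \<Rightarrow> complex"
    and q A \<theta> :: real
  assumes U: "\<And>k t x. U k t x = (\<Sum>n\<in>freq_cube (2 ^ k). c k n t * ch n x)"
    and c: "\<And>k n. c k n \<in> borel_measurable borel"
    and q: "1 < q" and A: "0 \<le> A" and \<theta>: "0 < \<theta>"
    and bound: "\<And>k. Lnorm q spacetime (\<lambda>(t, x). ennreal (cmod (U k t x))) \<le> ennreal (A * (2 powr (- \<theta>)) ^ k)"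
begin

lemma jointly_measurable_U: "jointly_measurable (U k)"
  using jointly_measurable_trig[of "c k" "freq_cube (2 ^ k)", OF c] by (simp add: U)

lemmas U_meas [measurable] = jointly_measurableD[OF jointly_measurable_U]

lemma x_periodic_U: "x_periodic (U k t)"
  by (simp add: x_periodic_def U x_periodicD[OF x_periodic_ch])

definition major :: "real \<Rightarrow> real ^ 'd \<Rightarrow> ennreal" where
  "major t x = (\<Sum>k. ennreal (cmod (U k t x)))"

definition major_diff :: "real ^ 'd \<Rightarrow> real \<Rightarrow> real ^ 'd \<Rightarrow> ennreal" where
  "major_diff y t x = (\<Sum>k. ennreal (cmod (U k t x - U k t (x + y))))"

text \<open>
  The value zero off the set of absolute convergence makes the series a function defined
  everywhere, and keeps its differences dominated everywhere by the sum of the differences of the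
  blocks.
\<close>

definition series :: "real \<Rightarrow> real ^ 'd \<Rightarrow> complex" where
  "series t x = (if major t x < \<infinity> then (\<Sum>k. U k t x) else 0)"

lemma major_meas [measurable]: "(\<lambda>(t, x). major t x) \<in> borel_measurable (borel \<Otimes>\<^sub>M borel)"
  unfolding major_def by measurable

lemma major_diff_meas [measurable]: "(\<lambda>(t, x). major_diff y t x) \<in> borel_measurable (borel \<Otimes>\<^sub>M borel)"
  unfolding major_diff_def by measurable

lemma series_meas [measurable]: "(\<lambda>(t, x). series t x) \<in> borel_measurable (borel \<Otimes>\<^sub>M borel)"
proof -
  have "(\<lambda>(t, x). if major t x < \<infinity> then (\<Sum>k. U k t x) else 0) \<in> borel_measurable (borel \<Otimes>\<^sub>M borel)"
    by measurable
  then show ?thesis by (simp add: series_def)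
qed

lemma x_periodic_major: "x_periodic (major t)"
  by (simp add: x_periodic_def major_def x_periodicD[OF x_periodic_U])

lemma x_periodic_series: "x_periodic (series t)"
  by (simp add: x_periodic_def series_def x_periodicD[OF x_periodic_U] x_periodicD[OF x_periodic_major])

lemma x_periodic_major_diff: "x_periodic (major_diff y t)"
proof -
  have "U k t (x + (2 * pi) *\<^sub>R rvec n + y) = U k t (x + y)" for k x n
    using x_periodicD[OF x_periodic_U, of k t "x + y" n] by (simp add: add_ac)
  then show ?thesis by (simp add: x_periodic_def major_diff_def x_periodicD[OF x_periodic_U])
qed

lemma summable_if_major_finite: "major t x < \<infinity> \<Longrightarrow> summable (\<lambda>k. cmod (U k t x))"
  unfolding major_def by (intro summable_suminf_not_top) (auto simp: less_top)

lemma suminf_le_nn: "summable (\<lambda>k. cmod (f k)) \<Longrightarrow> ennreal (cmod (\<Sum>k. f k)) \<le> (\<Sum>k. ennreal (cmod (f k)))"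
  by (subst suminf_ennreal2) (auto intro!: ennreal_leI summable_norm)

lemma series_le_major: "ennreal (cmod (series t x)) \<le> major t x"
  using suminf_le_nn[OF summable_if_major_finite, of t x] by (auto simp: series_def major_def)

text \<open>
  If the sum of the block differences is finite, then the series converges absolutely at both
  points or at neither, and in the second case both values are zero.
\<close>

lemma series_diff_le: "ennreal (cmod (series t x - series t x')) \<le> (\<Sum>k. ennreal (cmod (U k t x - U k t x')))"
proof -
  have tri: "major t a \<le> (\<Sum>k. ennreal (cmod (U k t a - U k t b))) + major t b" for a b
  proof -
    have "major t a \<le> (\<Sum>k. ennreal (cmod (U k t a - U k t b)) + ennreal (cmod (U k t b)))"
      unfolding major_def
    proof (intro suminf_le allI)
      fix k
      have "cmod (U k t a) \<le> cmod (U k t a - U k t b) + cmod (U k t b)"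
        using norm_triangle_ineq[of "U k t a - U k t b" "U k t b"] by simp
      then show "ennreal (cmod (U k t a)) \<le> ennreal (cmod (U k t a - U k t b)) + ennreal (cmod (U k t b))"
        by (simp add: ennreal_plus[symmetric] ennreal_leI del: ennreal_plus)
    qed auto
    then show ?thesis by (simp add: major_def suminf_add)
  qed
  show ?thesis
  proof (cases "(\<Sum>k. ennreal (cmod (U k t x - U k t x'))) = \<infinity>")
    case False
    then have D: "(\<Sum>k. ennreal (cmod (U k t x - U k t x'))) < \<infinity>" by (simp add: less_top)
    have D': "(\<Sum>k. ennreal (cmod (U k t x' - U k t x))) < \<infinity>" using D by (simp add: norm_minus_commute)
    show ?thesis
    proof (cases "major t x < \<infinity>")
      case True
      then have "(\<Sum>k. ennreal (cmod (U k t x' - U k t x))) + major t x < \<infinity>"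
        using D' by (simp only: infinity_ennreal_def ennreal_add_less_top)
      then have "major t x' < \<infinity>" by (rule le_less_trans[OF tri[of x' x]])
      then have s: "summable (\<lambda>k. U k t x)" "summable (\<lambda>k. U k t x')"
        using summable_norm_cancel[OF summable_if_major_finite[OF True]]
          summable_norm_cancel[OF summable_if_major_finite[of t x']] by simp_all
      have "series t x - series t x' = (\<Sum>k. U k t x - U k t x')"
        using True \<open>major t x' < \<infinity>\<close> s by (simp add: series_def suminf_diff)
      moreover have "summable (\<lambda>k. cmod (U k t x - U k t x'))"
        using D by (intro summable_suminf_not_top) (auto simp: less_top)
      ultimately show ?thesis using suminf_le_nn by simp
    next
      case False
      have "\<not> major t x' < \<infinity>"
      proof
        assume "major t x' < \<infinity>"
        then have "(\<Sum>k. ennreal (cmod (U k t x - U k t x'))) + major t x' < \<infinity>"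
          using D by (simp only: infinity_ennreal_def ennreal_add_less_top)
        from le_less_trans[OF tri[of x x'] this] False show False by blast
      qed
      then show ?thesis using False by (simp add: series_def)
    qed
  qed simp
qed

lemma series_shift_diff_le: "ennreal (cmod (series t x - series t (x + y))) \<le> major_diff y t x"
  unfolding major_diff_def by (rule series_diff_le)

lemma ratio: "0 < 2 powr (- \<theta>)" "2 powr (- \<theta>) < (1::real)"
  using \<theta> powr_less_mono[of "- \<theta>" 0 2] by auto

lemma Lnorm_major: "Lnorm q spacetime (\<lambda>(t, x). major t x) \<le> ennreal (geom_const (2 powr (- \<theta>)) q * A)"
proof -
  have "(\<lambda>(t, x). ennreal (cmod (U k t x))) \<in> borel_measurable spacetime" for k
    by (rule measurable_ST) measurable
  then have "Lnorm q spacetime (\<lambda>p. \<Sum>k. (\<lambda>(t, x). ennreal (cmod (U k t x))) p) \<le> ennreal (geom_const (2 powr (- \<theta>)) q * A)"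
    using q A ratio bound by (intro Lnorm_suminf_geometric) auto
  then show ?thesis by (simp add: major_def case_prod_beta')
qed

lemma AE_major_finite: "AE p in spacetime. (case p of (t, x) \<Rightarrow> major t x) < \<infinity>"
proof -
  have m: "(\<lambda>(t, x). major t x) \<in> borel_measurable spacetime" by (rule measurable_ST) measurable
  have "ennpow (Lnorm q spacetime (\<lambda>(t, x). major t x)) q < \<infinity>"
    using Lnorm_major by (auto simp: less_top[symmetric] top_unique)
  then have "(\<integral>\<^sup>+p. ennpow (case p of (t, x) \<Rightarrow> major t x) q \<partial>spacetime) \<noteq> \<infinity>"
    using q by (simp add: ennpow_Lnorm)
  moreover have "(\<lambda>p. ennpow (case p of (t, x) \<Rightarrow> major t x) q) \<in> borel_measurable spacetime"
    by (intro ennpow_measurable m)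
  ultimately have "AE p in spacetime. ennpow (case p of (t, x) \<Rightarrow> major t x) q \<noteq> \<infinity>"
    by (intro nn_integral_PInf_AE) auto
  then show ?thesis by eventually_elim (simp add: less_top)
qed

lemma AE_series_sums: "AE p in spacetime. (\<lambda>k. U k (fst p) (snd p)) sums series (fst p) (snd p)"
  using AE_major_finite
proof eventually_elim
  case (elim p)
  then have "major (fst p) (snd p) < \<infinity>" by (simp add: case_prod_beta')
  then show ?case
    using summable_norm_cancel[OF summable_if_major_finite] by (auto simp: series_def intro: summable_sums)
qed

lemma Lnorm_block_diff_trivial:
  "Lnorm q spacetime (\<lambda>(t, x). ennreal (cmod (U k t x - U k t (x + y)))) \<le> ennreal (4 * (A * (2 powr (- \<theta>)) ^ k))"
proof -
  let ?B = "A * (2 powr (- \<theta>)) ^ k"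
  let ?f = "\<lambda>i::bool. \<lambda>(t, x). ennreal (cmod (U k t (if i then x else x + y)))"
  have per: "x_periodic (\<lambda>x. ennreal (cmod (U k t x)))" for t
    using x_periodic_U[of k t] by (simp add: x_periodic_def)
  have B: "0 \<le> ?B" using A by simp
  have m: "?f i \<in> borel_measurable spacetime" for i
    by (cases i; simp only: if_True if_False; rule measurable_ST; measurable)
  have b: "Lnorm q spacetime (?f i) \<le> ennreal ?B" for i
  proof (cases i)
    case True
    then show ?thesis using bound[of k] by simp
  next
    case False
    have "Lnorm q spacetime (\<lambda>(t, x). ennreal (cmod (U k t (x + y)))) = Lnorm q spacetime (\<lambda>(t, x). ennreal (cmod (U k t x)))"
    proof (rule Lnorm_ST_shift[of "\<lambda>t x. ennreal (cmod (U k t x))", OF _ _ per])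
      show "(\<lambda>(t, x). ennreal (cmod (U k t x))) \<in> borel_measurable (borel \<Otimes>\<^sub>M borel)" by measurable
    qed (use q in simp)
    then show ?thesis using False bound[of k] by simp
  qed
  have "Lnorm q spacetime (\<lambda>(t, x). ennreal (cmod (U k t x - U k t (x + y)))) \<le> Lnorm q spacetime (\<lambda>p. \<Sum>i\<in>UNIV. ?f i p)"
  proof (intro Lnorm_mono)
    fix p :: "real \<times> (real ^ 'd)"
    show "(case p of (t, x) \<Rightarrow> ennreal (cmod (U k t x - U k t (x + y)))) \<le> (\<Sum>i\<in>UNIV. ?f i p)"
      using norm_triangle_ineq4[of "U k (fst p) (snd p)" "U k (fst p) (snd p + y)"]
      by (auto simp: UNIV_bool case_prod_beta' ennreal_plus[symmetric] add.commute intro!: ennreal_leI simp del: ennreal_plus)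
  qed (use q in auto)
  also have "\<dots> \<le> ennreal (real (card (UNIV :: bool set)) powr (1 + 1 / q) * ?B)"
    using q B m b by (intro Lnorm_sum_le) auto
  also have "\<dots> \<le> ennreal (4 * ?B)"
  proof (intro ennreal_leI mult_right_mono B)
    have "(2::real) powr (1 + 1 / q) \<le> 2 powr 2" using q by (intro powr_mono) (auto simp: field_simps)
    then show "real (card (UNIV :: bool set)) powr (1 + 1 / q) \<le> 4" by simp
  qed
  finally show ?thesis .
qed

text \<open>
  A crude Bernstein inequality: each Fourier coefficient is bounded by the norm of the block in
  \<open>x\<close>, and the number of frequencies costs \<open>2\<^sup>k\<^sup>d\<close>. The loss
  of \<open>d\<close> derivatives is made up for by taking \<open>s\<close> small compared with
  \<open>\<theta>\<close>.
\<close>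

lemma Lnorm_block_diff_Bernstein:
  "Lnorm q spacetime (\<lambda>(t, x). ennreal (cmod (U k t x - U k t (x + y))))
     \<le> ennreal (bernstein_const TYPE('d) * (2 ^ k) ^ (CARD('d) + 1) * phase_dist y * (A * (2 powr (- \<theta>)) ^ k))"
proof -
  let ?B = "A * (2 powr (- \<theta>)) ^ k" and ?V = "torus_volume TYPE('d)"
  define G where "G = 3 ^ CARD('d) * (2 ^ k) ^ (CARD('d) + 1) * phase_dist y"
  have G: "0 \<le> G" by (simp add: G_def)
  have V: "1 \<le> ?V" by (rule torus_volume_ge_1)
  have q0: "0 < q" using q by simp
  let ?L = "\<lambda>t. Lnorm q torus (\<lambda>x. ennreal (cmod (U k t x)))"
  have pw: "ennreal (cmod (U k t x - U k t (x + y))) \<le> ennreal G * (ennreal ?V * ?L t)" for t x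
  proof -
    have coeff: "ennreal (cmod (c k n t)) \<le> ennreal ?V * ?L t" if "n \<in> freq_cube (2 ^ k)" for n
    proof -
      have "c k n t = fourier_coeff (U k t) n"
        unfolding U[abs_def] using that by (simp add: fourier_coeff_trig)
      then have "ennreal (cmod (c k n t)) \<le> (\<integral>\<^sup>+x. ennreal (cmod (U k t x)) \<partial>torus)"
        by (simp add: cmod_fourier_coeff_le)
      also have "\<dots> \<le> ennreal ?V * ?L t"
        by (intro nn_integral_torus_le_Lnorm q) measurable
      finally show ?thesis .
    qed
    have "cmod (U k t x - U k t (x + y)) = cmod (\<Sum>n\<in>freq_cube (2 ^ k). c k n t * ch n x * (1 - ch n y))"
      unfolding U by (simp add: sum_subtractf[symmetric] ch_add right_diff_distrib mult.assoc)
    also have "\<dots> \<le> (\<Sum>n\<in>freq_cube (2 ^ k). cmod (c k n t) * (real (2 ^ k) * phase_dist y))"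
      by (rule sum_norm_le) (use cmod_ch_minus_1[of _ "2 ^ k" y] in \<open>auto simp: norm_mult norm_minus_commute[of 1] intro!: mult_left_mono\<close>)
    finally have "ennreal (cmod (U k t x - U k t (x + y))) \<le> ennreal (\<Sum>n\<in>freq_cube (2 ^ k). cmod (c k n t) * (real (2 ^ k) * phase_dist y))"
      by (rule ennreal_leI)
    also have "\<dots> = (\<Sum>n\<in>freq_cube (2 ^ k). ennreal (cmod (c k n t)) * ennreal (real (2 ^ k) * phase_dist y))"
      by (simp add: ennreal_mult flip: sum_ennreal)
    also have "\<dots> \<le> (\<Sum>n\<in>(freq_cube (2 ^ k) :: (int ^ 'd) set). (ennreal ?V * ?L t) * ennreal (real (2 ^ k) * phase_dist y))"
      by (intro sum_mono mult_right_mono coeff) auto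
    also have "\<dots> = ennreal (real ((2 * 2 ^ k + 1) ^ CARD('d))) * ((ennreal ?V * ?L t) * ennreal (real (2 ^ k) * phase_dist y))"
      by (simp only: sum_constant card_freq_cube ennreal_of_nat_eq_real_of_nat)
    also have "\<dots> \<le> ennreal (3 ^ CARD('d) * (2 ^ k) ^ CARD('d)) * ((ennreal ?V * ?L t) * ennreal (real (2 ^ k) * phase_dist y))"
    proof (intro mult_right_mono ennreal_leI)
      have "(2 * 2 ^ k + 1 :: real) \<le> 3 * 2 ^ k" using one_le_power[of "2::real" k] by simp
      then have "(2 * 2 ^ k + 1 :: real) ^ CARD('d) \<le> (3 * 2 ^ k) ^ CARD('d)" by (intro power_mono) auto
      then show "real ((2 * 2 ^ k + 1) ^ CARD('d)) \<le> 3 ^ CARD('d) * (2 ^ k) ^ CARD('d)"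
        by (simp add: power_mult_distrib add.commute)
    qed auto
    also have "\<dots> = ennreal G * (ennreal ?V * ?L t)"
    proof -
      have "ennreal (3 ^ CARD('d) * (2 ^ k) ^ CARD('d)) * ennreal (real (2 ^ k) * phase_dist y) = ennreal G"
        by (subst ennreal_mult[symmetric]) (auto simp: G_def mult_ac)
      moreover have "a * (b * e) = (a * e) * b" for a b e :: ennreal by (simp only: mult_ac)
      ultimately show ?thesis by (simp only:)
    qed
    finally show ?thesis .
  qed
  have Lm: "?L \<in> borel_measurable lborel"
  proof -
    have "(\<lambda>(t, x). ennpow (ennreal (cmod (U k t x))) q) \<in> borel_measurable (lborel \<Otimes>\<^sub>M torus)"
      by (rule measurable_ST) measurable
    then show ?thesis unfolding Lnorm_def by (intro ennpow_measurable torus.borel_measurable_nn_integral)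
  qed
  have "Lnorm q spacetime (\<lambda>(t, x). ennreal (cmod (U k t x - U k t (x + y))))
      = Lnorm q lborel (\<lambda>t. Lnorm q torus (\<lambda>x. ennreal (cmod (U k t x - U k t (x + y)))))"
    by (rule Lnorm_ST[OF _ q0]) measurable
  also have "\<dots> \<le> Lnorm q lborel (\<lambda>t. ennreal ?V * (ennreal G * (ennreal ?V * ?L t)))"
  proof (intro Lnorm_mono)
    fix t
    have "Lnorm q torus (\<lambda>x. ennreal (cmod (U k t x - U k t (x + y)))) \<le> Lnorm q (torus :: (real ^ 'd) measure) (\<lambda>_. ennreal G * (ennreal ?V * ?L t))"
      using q by (intro Lnorm_mono pw) auto
    also have "\<dots> \<le> ennreal ?V * (ennreal G * (ennreal ?V * ?L t))"
      using q by (intro Lnorm_torus_const_le) auto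
    finally show "Lnorm q torus (\<lambda>x. ennreal (cmod (U k t x - U k t (x + y)))) \<le> ennreal ?V * (ennreal G * (ennreal ?V * ?L t))" .
  qed (use q in auto)
  also have "\<dots> = ennreal ?V * (ennreal G * (ennreal ?V * Lnorm q lborel ?L))"
    using Lm q0 by (simp add: Lnorm_cmult)
  also have "Lnorm q lborel ?L = Lnorm q spacetime (\<lambda>(t, x). ennreal (cmod (U k t x)))"
    by (rule Lnorm_ST[OF _ q0, symmetric]) measurable
  also have "ennreal ?V * (ennreal G * (ennreal ?V * \<dots>)) \<le> ennreal ?V * (ennreal G * (ennreal ?V * ennreal ?B))"
    by (intro mult_left_mono bound) auto
  also have "\<dots> = ennreal (?V * (G * (?V * ?B)))"
    using V G A by (simp add: ennreal_mult)
  also have "?V * (G * (?V * ?B)) = bernstein_const TYPE('d) * (2 ^ k) ^ (CARD('d) + 1) * phase_dist y * ?B"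
    by (simp add: G_def bernstein_const_def power2_eq_square mult_ac)
  finally show ?thesis .
qed

text \<open>
  Interpolation gives the difference of block \<open>k\<close> the size
  \<open>2\<^sup>k\<^sup>(\<^sup>d\<^sup>+\<^sup>1\<^sup>)\<^sup>s\<^sup>-\<^sup>k\<^sup>\<theta>\<close>
  times the translation distance to the power \<open>s\<close>, which is summable in
  \<open>k\<close> under the last assumption.
\<close>

lemma Lnorm_major_diff:
  assumes s: "0 < s" "s \<le> 1" "(real CARD('d) + 1) * s < \<theta>"
  shows "Lnorm q spacetime (\<lambda>(t, x). major_diff y t x) \<le> ennreal (block_const TYPE('d) q \<theta> s * A * phase_dist y powr s)"
proof -
  let ?K = "bernstein_const TYPE('d)"
  let ?\<rho> = "2 powr ((real CARD('d) + 1) * s - \<theta>) :: real"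
  have \<rho>: "0 < ?\<rho>" "?\<rho> < 1" using s powr_less_mono[of "(real CARD('d) + 1) * s - \<theta>" 0 2] by auto
  have K: "1 \<le> ?K"
    unfolding bernstein_const_def using torus_volume_ge_1[where 'd='d]
    by (intro order_trans[OF _ mult_mono[of 1 "(torus_volume TYPE('d))\<^sup>2" 1 "3 ^ CARD('d)"]]) (auto simp: one_le_power)
  have b: "Lnorm q spacetime (\<lambda>(t, x). ennreal (cmod (U k t x - U k t (x + y)))) \<le> ennreal ((4 * ?K * A * phase_dist y powr s) * ?\<rho> ^ k)" for k
  proof -
    let ?B = "A * (2 powr (- \<theta>)) ^ k"
    have B: "0 \<le> ?B" using A by simp
    define z where "z = (2 ^ k) ^ (CARD('d) + 1) * phase_dist y"
    have z: "0 \<le> z" by (simp add: z_def)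
    have "Lnorm q spacetime (\<lambda>(t, x). ennreal (cmod (U k t x - U k t (x + y)))) \<le> min (ennreal (4 * ?B)) (ennreal (?K * z * ?B))"
      using Lnorm_block_diff_trivial[of k y] Lnorm_block_diff_Bernstein[of k y] by (simp add: z_def mult.assoc)
    also have "\<dots> = ennreal (min (4 * ?B) (?K * z * ?B))" using A K z by (simp add: min_def)
    also have "\<dots> \<le> ennreal (4 * ?B * (?K * z powr s))"
    proof (rule ennreal_leI)
      have "min (4 * ?B) (?K * z * ?B) \<le> 4 * ?B * min 1 (?K * z)"
      proof -
        have mm: "min (4 * b) (r * b) \<le> 4 * b * min 1 r" if "0 \<le> b" "0 \<le> r" for b r :: real
        proof (cases "1 \<le> r")
          case False
          have "r * b \<le> 4 * (r * b)" using that by simp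
          then have "min (4 * b) (r * b) \<le> 4 * (r * b)" by linarith
          then show ?thesis using False by (simp add: min_def mult_ac)
        qed (simp add: min_def)
        show ?thesis using B K z by (intro mm) auto
      qed
      also have "\<dots> \<le> 4 * ?B * (?K * z powr s)"
        using B by (intro mult_left_mono powr_interpolation K z s) auto
      finally show "min (4 * ?B) (?K * z * ?B) \<le> 4 * ?B * (?K * z powr s)" .
    qed
    also have "z powr s = (2 powr ((real CARD('d) + 1) * s)) ^ k * phase_dist y powr s"
    proof -
      have "(2 ^ k) ^ (CARD('d) + 1) = (2::real) powr (real k * (real CARD('d) + 1))"
        by (simp add: powr_realpow[symmetric] powr_powr power_mult[symmetric] add.commute del: power_Suc)
      then show ?thesis
        by (simp add: z_def powr_mult powr_powr powr_realpow[symmetric] mult_ac)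
    qed
    also have "4 * ?B * (?K * ((2 powr ((real CARD('d) + 1) * s)) ^ k * phase_dist y powr s)) = (4 * ?K * A * phase_dist y powr s) * ?\<rho> ^ k"
      by (simp add: powr_diff powr_minus power_divide divide_inverse power_inverse power_mult_distrib mult_ac)
    finally show ?thesis .
  qed
  have "(\<lambda>(t, x). ennreal (cmod (U k t x - U k t (x + y)))) \<in> borel_measurable spacetime" for k
    by (rule measurable_ST) measurable
  then have "Lnorm q spacetime (\<lambda>p. \<Sum>k. (\<lambda>(t, x). ennreal (cmod (U k t x - U k t (x + y)))) p) \<le> ennreal (geom_const ?\<rho> q * (4 * ?K * A * phase_dist y powr s))"
    using q A K \<rho> b by (intro Lnorm_suminf_geometric) auto
  also have "\<dots> \<le> ennreal (block_const TYPE('d) q \<theta> s * A * phase_dist y powr s)"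
  proof (rule ennreal_leI)
    have "0 \<le> geom_const (2 powr (- \<theta>)) q" using geom_const_pos[OF ratio, of q] q by simp
    then have "0 \<le> geom_const (2 powr (- \<theta>)) q * (A * phase_dist y powr s)" using A by simp
    then show "geom_const ?\<rho> q * (4 * ?K * A * phase_dist y powr s) \<le> block_const TYPE('d) q \<theta> s * A * phase_dist y powr s"
      by (simp add: block_const_def algebra_simps)
  qed
  finally show ?thesis by (simp add: major_diff_def case_prod_beta')
qed

lemma Lnorm_major_le_block_const:
  assumes s: "0 < s" "s \<le> 1" "(real CARD('d) + 1) * s < \<theta>"
  shows "Lnorm q spacetime (\<lambda>(t, x). major t x) \<le> ennreal (block_const TYPE('d) q \<theta> s * A)"
proof -
  let ?\<rho> = "2 powr ((real CARD('d) + 1) * s - \<theta>) :: real"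
  have \<rho>: "0 < ?\<rho>" "?\<rho> < 1" using s powr_less_mono[of "(real CARD('d) + 1) * s - \<theta>" 0 2] by auto
  have "0 \<le> bernstein_const TYPE('d)" by (simp add: bernstein_const_def)
  then have "geom_const (2 powr (- \<theta>)) q \<le> block_const TYPE('d) q \<theta> s"
    using geom_const_pos[OF \<rho>, of q] q by (simp add: block_const_def)
  then show ?thesis using A by (intro order_trans[OF Lnorm_major] ennreal_leI mult_right_mono) auto
qed

end

section \<open>Littlewood--Paley kernels in time\<close>

definition fourier_int :: "(real \<Rightarrow> real) \<Rightarrow> real \<Rightarrow> complex" where
  "fourier_int f t = (\<integral>\<tau>. complex_of_real (f \<tau>) * cis (t * \<tau>) \<partial>lborel)"

lemma inverse_fourier_eq: "inverse_fourier f t = fourier_int f t / complex_of_real (2 * pi)"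
  by (simp add: inverse_fourier_def fourier_int_def)

lemma fourier_int_measurable:
  assumes [measurable]: "f \<in> borel_measurable borel"
  shows "fourier_int f \<in> borel_measurable borel"
  unfolding fourier_int_def[abs_def] cis_conv_exp
  by (intro lborel.borel_measurable_lebesgue_integral) measurable

lemma cis_has_vector_derivative:
  "((\<lambda>\<tau>. cis (t * \<tau>)) has_vector_derivative (\<i> * complex_of_real t * cis (t * \<tau>))) (at \<tau> within S)"
proof -
  have "((\<lambda>\<tau>. exp (\<i> * complex_of_real t * complex_of_real \<tau>)) has_vector_derivative (\<i> * complex_of_real t * exp (\<i> * complex_of_real t * complex_of_real \<tau>))) (at \<tau> within S)"
  proof -
    have "((\<lambda>z. exp (\<i> * complex_of_real t * z)) has_field_derivative (\<i> * complex_of_real t * exp (\<i> * complex_of_real t * complex_of_real \<tau>))) (at (complex_of_real \<tau>))"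
      by (auto intro!: derivative_eq_intros)
    then have "((\<lambda>\<tau>. exp (\<i> * complex_of_real t * complex_of_real \<tau>)) has_vector_derivative (\<i> * complex_of_real t * exp (\<i> * complex_of_real t * complex_of_real \<tau>))) (at \<tau>)"
      by (rule has_vector_derivative_real_field)
    then show ?thesis by (rule has_vector_derivative_at_within)
  qed
  then show ?thesis by (simp add: cis_conv_exp mult.assoc)
qed

lemma continuous_cis_mult: "continuous_on S (\<lambda>\<tau>. cis (t * \<tau>))"
  unfolding cis_conv_exp by (intro continuous_intros)

lemma integrable_compact_support:
  fixes f :: "real \<Rightarrow> 'b :: {banach, second_countable_topology}"
  assumes "continuous_on UNIV f" "\<And>\<tau>. R < \<bar>\<tau>\<bar> \<Longrightarrow> f \<tau> = 0"
  shows "integrable lborel f"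
proof -
  have "integrable lborel (\<lambda>x. indicator {-R..R} x *\<^sub>R f x)"
    using assms(1) by (intro borel_integrable_compact continuous_on_subset[OF assms(1)]) auto
  moreover have "(\<lambda>x. indicator {-R..R} x *\<^sub>R f x) = f"
    using assms(2) by (force simp: fun_eq_iff indicator_def)
  ultimately show ?thesis by simp
qed

lemma integral_compact_support:
  fixes f :: "real \<Rightarrow> complex"
  assumes "continuous_on UNIV f" "\<And>\<tau>. R < \<bar>\<tau>\<bar> \<Longrightarrow> f \<tau> = 0" "0 < R"
  shows "(\<integral>x. f x \<partial>lborel) = (LBINT x=ereal (- R)..ereal R. f x)"
proof -
  have "(LBINT x=ereal (- R)..ereal R. f x) = (LBINT x:{-R..R}. f x)"
    using assms(3) by (intro interval_integral_Icc) simp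
  also have "\<dots> = (\<integral>x. f x \<partial>lborel)"
    unfolding set_lebesgue_integral_def using assms(2)
    by (intro Bochner_Integration.integral_cong) (force simp: indicator_def)+
  finally show ?thesis ..
qed

lemma fourier_int_deriv:
  assumes f: "\<And>\<tau>. (f has_real_derivative f' \<tau>) (at \<tau>)" and f': "continuous_on UNIV f'"
    and supp: "\<And>\<tau>. 2 < \<bar>\<tau>\<bar> \<Longrightarrow> f \<tau> = 0" "\<And>\<tau>. 2 < \<bar>\<tau>\<bar> \<Longrightarrow> f' \<tau> = 0"
  shows "fourier_int f' t = - (\<i> * complex_of_real t) * fourier_int f t"
proof -
  have fc: "continuous_on UNIV f" using f by (auto intro!: continuous_at_imp_continuous_on DERIV_isCont)
  let ?G = "\<lambda>\<tau>. complex_of_real (f \<tau>) * cis (t * \<tau>)"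
  let ?g = "\<lambda>\<tau>. complex_of_real (f' \<tau>) * cis (t * \<tau>) + (\<i> * complex_of_real t) * (complex_of_real (f \<tau>) * cis (t * \<tau>))"
  have c1: "continuous_on UNIV (\<lambda>\<tau>. complex_of_real (f' \<tau>) * cis (t * \<tau>))"
    by (intro continuous_intros f' continuous_cis_mult)
  have c2: "continuous_on UNIV (\<lambda>\<tau>. (\<i> * complex_of_real t) * (complex_of_real (f \<tau>) * cis (t * \<tau>)))"
    by (intro continuous_intros fc continuous_cis_mult)
  have "(?G has_vector_derivative ?g \<tau>) (at \<tau> within S)" for \<tau> S
  proof -
    have "((\<lambda>\<tau>. complex_of_real (f \<tau>)) has_vector_derivative complex_of_real (f' \<tau>)) (at \<tau> within S)"
      using f by (intro has_vector_derivative_of_real has_vector_derivative_at_within)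
         (simp add: has_real_derivative_iff_has_vector_derivative)
    from has_vector_derivative_mult[OF this cis_has_vector_derivative[of t \<tau> S]]
    show ?thesis by (simp add: algebra_simps)
  qed
  then have "(LBINT \<tau>=ereal (- 3)..ereal 3. ?g \<tau>) = ?G 3 - ?G (-3)"
    by (intro interval_integral_FTC_finite continuous_on_subset[OF continuous_on_add[OF c1 c2]]) auto
  then have "(\<integral>\<tau>. ?g \<tau> \<partial>lborel) = 0"
    using integral_compact_support[OF continuous_on_add[OF c1 c2], of 3] supp by simp
  moreover have "(\<integral>\<tau>. ?g \<tau> \<partial>lborel) = fourier_int f' t + (\<i> * complex_of_real t) * fourier_int f t"
    unfolding fourier_int_def using supp
    by (subst Bochner_Integration.integral_add)
       (auto intro!: integrable_compact_support[where R=2] c1 c2)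
  ultimately show ?thesis by (simp add: eq_neg_iff_add_eq_0)
qed

locale lp_cutoff =
  fixes \<eta> :: "real \<Rightarrow> real"
  assumes cutoff: "LP_cutoff \<eta>"
begin

lemma eta_1: "\<bar>\<tau>\<bar> \<le> 1 \<Longrightarrow> \<eta> \<tau> = 1" and eta_0: "2 \<le> \<bar>\<tau>\<bar> \<Longrightarrow> \<eta> \<tau> = 0" and eta_bounds: "0 \<le> \<eta> \<tau>" "\<eta> \<tau> \<le> 1"
  using cutoff by (auto simp: LP_cutoff_def)

lemma eta_deriv: "((deriv ^^ n) \<eta> has_real_derivative (deriv ^^ Suc n) \<eta> \<tau>) (at \<tau>)"
proof -
  have "(deriv ^^ n) \<eta> differentiable (at \<tau>)"
    using cutoff unfolding LP_cutoff_def smooth_def by (simp add: differentiable_on_def)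
  then show ?thesis by (simp add: DERIV_deriv_iff_real_differentiable)
qed

lemma eta_deriv_cont: "continuous_on UNIV ((deriv ^^ n) \<eta>)"
  using eta_deriv by (auto intro!: continuous_at_imp_continuous_on DERIV_isCont)

lemma eta_deriv_supp: "2 < \<bar>\<tau>\<bar> \<Longrightarrow> (deriv ^^ n) \<eta> \<tau> = 0"
proof (induction n arbitrary: \<tau>)
  case (Suc n)
  have "open {\<tau>::real. 2 < \<bar>\<tau>\<bar>}" by (intro open_Collect_less continuous_intros)
  then have "\<forall>\<^sub>F x in nhds \<tau>. 2 < \<bar>x\<bar>" using Suc.prems eventually_nhds_in_open[of "{\<tau>. 2 < \<bar>\<tau>\<bar>}" \<tau>] by simp
  then have "\<forall>\<^sub>F x in nhds \<tau>. (deriv ^^ n) \<eta> x = 0" by eventually_elim (rule Suc.IH)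
  then have "deriv ((deriv ^^ n) \<eta>) \<tau> = deriv (\<lambda>_. 0) \<tau>" by (intro deriv_cong_ev) auto
  then show ?case by simp
qed (simp add: eta_0)

lemma eta_cont: "continuous_on UNIV \<eta>" using eta_deriv_cont[of 0] by simp

lemma eta_meas [measurable]: "\<eta> \<in> borel_measurable borel"
  by (intro borel_measurable_continuous_onI eta_cont)

definition kernel :: "real \<Rightarrow> complex" where
  "kernel = inverse_fourier \<eta>"

lemma kernel_meas [measurable]: "kernel \<in> borel_measurable borel"
  unfolding kernel_def inverse_fourier_eq[abs_def]
  by (intro borel_measurable_divide fourier_int_measurable borel_measurable_const eta_meas)

lemma fourier_int_iterated: "fourier_int ((deriv ^^ n) \<eta>) t = (- (\<i> * complex_of_real t)) ^ n * fourier_int \<eta> t"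
proof (induction n)
  case (Suc n)
  have "fourier_int ((deriv ^^ Suc n) \<eta>) t = - (\<i> * complex_of_real t) * fourier_int ((deriv ^^ n) \<eta>) t"
    by (intro fourier_int_deriv eta_deriv eta_deriv_cont eta_deriv_supp)
  then show ?case using Suc by simp
qed simp

text \<open>
  Integrating by parts \<open>n\<close> times, which is where the smoothness of the cutoff is
  used.
\<close>

lemma kernel_decay: "\<exists>C\<ge>0. \<forall>t. \<bar>t\<bar> ^ n * cmod (kernel t) \<le> C"
proof (intro exI conjI allI)
  let ?C = "\<integral>\<tau>. \<bar>(deriv ^^ n) \<eta> \<tau>\<bar> \<partial>lborel"
  show "0 \<le> ?C" by (intro integral_nonneg_AE) auto
  fix t
  have "\<bar>t\<bar> ^ n * cmod (fourier_int \<eta> t) = cmod (fourier_int ((deriv ^^ n) \<eta>) t)"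
    unfolding fourier_int_iterated by (simp add: norm_mult norm_power)
  also have "\<dots> \<le> (\<integral>\<tau>. cmod (complex_of_real ((deriv ^^ n) \<eta> \<tau>) * cis (t * \<tau>)) \<partial>lborel)"
    unfolding fourier_int_def by (rule integral_norm_bound)
  also have "\<dots> = ?C" by (simp add: norm_mult)
  finally have 1: "\<bar>t\<bar> ^ n * cmod (fourier_int \<eta> t) \<le> ?C" .
  have "cmod (kernel t) = cmod (fourier_int \<eta> t) / (2 * pi)"
    unfolding kernel_def inverse_fourier_eq norm_divide norm_of_real by simp
  also have "\<dots> \<le> cmod (fourier_int \<eta> t)"
    using pi_ge_two mult_left_mono[of 1 "2 * pi" "cmod (fourier_int \<eta> t)"] by (simp add: divide_le_eq)
  finally have "\<bar>t\<bar> ^ n * cmod (kernel t) \<le> \<bar>t\<bar> ^ n * cmod (fourier_int \<eta> t)" by (intro mult_left_mono) auto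
  then show "\<bar>t\<bar> ^ n * cmod (kernel t) \<le> ?C" using 1 by linarith
qed

lemma kernel_integrable: "integrable lborel kernel"
proof -
  obtain C0 where C0: "\<And>t. \<bar>t\<bar> ^ 0 * cmod (kernel t) \<le> C0" using kernel_decay[of 0] by blast
  obtain C2 where C2: "\<And>t. \<bar>t\<bar> ^ 2 * cmod (kernel t) \<le> C2" using kernel_decay[of 2] by blast
  have "integrable lborel (\<lambda>t::real. inverse (1 + t\<^sup>2))"
    using integrable_inverse_1_plus_square by (simp add: set_integrable_def)
  then have "integrable lborel (\<lambda>t::real. (C0 + C2) * inverse (1 + t\<^sup>2))" by simp
  then show ?thesis
  proof (rule Bochner_Integration.integrable_bound)
    have "cmod (kernel t) \<le> norm ((C0 + C2) * inverse (1 + t\<^sup>2))" for t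
    proof -
      have "(1 + t\<^sup>2) * cmod (kernel t) \<le> C0 + C2" using C0[of t] C2[of t] by (simp add: distrib_right)
      moreover have "0 < 1 + t\<^sup>2" by (simp add: add_pos_nonneg)
      ultimately have "cmod (kernel t) \<le> (C0 + C2) / (1 + t\<^sup>2)" by (simp add: pos_le_divide_eq mult.commute)
      also have "\<dots> \<le> norm ((C0 + C2) * inverse (1 + t\<^sup>2))" by (simp add: divide_inverse)
      finally show ?thesis .
    qed
    then show "AE t in lborel. norm (kernel t) \<le> norm ((C0 + C2) * inverse (1 + t\<^sup>2))" by simp
  qed simp
qed

lemma gauss_cis:
  assumes "0 < n"
  shows "(\<integral>t. complex_of_real (std_normal_density (t / n)) * cis (t * \<tau>) \<partial>lborel) = complex_of_real (n * exp (- (n * \<tau>)\<^sup>2 / 2))"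
proof -
  have "(\<integral>t. complex_of_real (std_normal_density (t / n)) * cis (t * \<tau>) \<partial>lborel)
      = \<bar>n\<bar> *\<^sub>R (\<integral>s. complex_of_real (std_normal_density ((0 + n * s) / n)) * cis ((0 + n * s) * \<tau>) \<partial>lborel)"
    using assms by (intro lborel_integral_real_affine) simp
  also have "(\<integral>s. complex_of_real (std_normal_density ((0 + n * s) / n)) * cis ((0 + n * s) * \<tau>) \<partial>lborel)
      = (\<integral>s. std_normal_density s *\<^sub>R iexp ((n * \<tau>) * s) \<partial>lborel)"
    using assms by (intro Bochner_Integration.integral_cong) (auto simp: scaleR_conv_of_real cis_conv_exp mult_ac)
  also have "\<dots> = char std_normal_distribution (n * \<tau>)"
    unfolding char_def by (subst integral_density) auto
  finally show ?thesis using assms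
    by (simp add: char_std_normal_distribution scaleR_conv_of_real)
qed

lemma integrable_std_normal_density: "integrable lborel std_normal_density"
  using integrable_normal_moment[of 1 0 0] by simp

text \<open>
  The double integral of \<open>\<eta>(\<tau>) e\<^sup>i\<^sup>t\<^sup>\<tau>\<close> does not
  converge absolutely, so its order cannot be exchanged. The Gaussian weight repairs this.
\<close>

lemma gauss_kernel:
  assumes n: "0 < n"
  shows "(\<integral>t. complex_of_real (std_normal_density (t / n)) * kernel t \<partial>lborel)
    = complex_of_real ((\<integral>u. \<eta> (u / n) * exp (- u\<^sup>2 / 2) \<partial>lborel) / (2 * pi))"
proof -
  let ?f = "\<lambda>t \<tau>. complex_of_real (std_normal_density (t / n)) * (complex_of_real (\<eta> \<tau>) * cis (t * \<tau>))"
  have gi: "integrable lborel (\<lambda>t. std_normal_density (t / n))"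
    using lborel_integrable_real_affine[OF integrable_std_normal_density, of "1 / n" 0] n by simp
  have ei: "integrable lborel \<eta>" by (rule integrable_compact_support[OF eta_cont, of 2]) (simp add: eta_0)
  have [measurable]: "(\<lambda>(t, \<tau>). ?f t \<tau>) \<in> borel_measurable (lborel \<Otimes>\<^sub>M lborel)"
    unfolding cis_conv_exp by measurable
  have int: "integrable (lborel \<Otimes>\<^sub>M lborel) (\<lambda>(t, \<tau>). ?f t \<tau>)"
  proof (rule integrableI_bounded)
    have "(\<integral>\<^sup>+p. ennreal (norm (case p of (t, \<tau>) \<Rightarrow> ?f t \<tau>)) \<partial>(lborel \<Otimes>\<^sub>M lborel))
        = (\<integral>\<^sup>+t. \<integral>\<^sup>+\<tau>. ennreal (norm (?f t \<tau>)) \<partial>lborel \<partial>lborel)"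
      by (subst lborel.nn_integral_fst[symmetric]) auto
    also have "\<dots> = (\<integral>\<^sup>+t. ennreal (norm (std_normal_density (t / n))) * (\<integral>\<^sup>+\<tau>. ennreal (norm (\<eta> \<tau>)) \<partial>lborel) \<partial>lborel)"
      by (simp add: norm_mult ennreal_mult nn_integral_cmult)
    also have "\<dots> = (\<integral>\<^sup>+t. ennreal (norm (std_normal_density (t / n))) \<partial>lborel) * (\<integral>\<^sup>+\<tau>. ennreal (norm (\<eta> \<tau>)) \<partial>lborel)"
      by (rule nn_integral_multc) simp
    also have "\<dots> < \<infinity>"
      using gi ei unfolding integrable_iff_bounded by (simp add: ennreal_mult_less_top)
    finally show "(\<integral>\<^sup>+p. ennreal (norm (case p of (t, \<tau>) \<Rightarrow> ?f t \<tau>)) \<partial>(lborel \<Otimes>\<^sub>M lborel)) < \<infinity>" .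
  qed simp
  have "(\<integral>t. complex_of_real (std_normal_density (t / n)) * kernel t \<partial>lborel)
      = (\<integral>t. \<integral>\<tau>. ?f t \<tau> \<partial>lborel \<partial>lborel) / complex_of_real (2 * pi)"
    by (simp add: kernel_def inverse_fourier_def)
  also have "(\<integral>t. \<integral>\<tau>. ?f t \<tau> \<partial>lborel \<partial>lborel) = (\<integral>\<tau>. \<integral>t. ?f t \<tau> \<partial>lborel \<partial>lborel)"
    by (rule lborel_pair.Fubini_integral[OF int, symmetric])
  also have "\<dots> = (\<integral>\<tau>. complex_of_real (\<eta> \<tau>) * (\<integral>t. complex_of_real (std_normal_density (t / n)) * cis (t * \<tau>) \<partial>lborel) \<partial>lborel)"
    by (intro Bochner_Integration.integral_cong) (auto simp: mult.left_commute simp flip: integral_mult_right_zero)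
  also have "\<dots> = complex_of_real (\<integral>\<tau>. \<eta> \<tau> * (n * exp (- (n * \<tau>)\<^sup>2 / 2)) \<partial>lborel)"
    unfolding gauss_cis[OF n] by (subst integral_complex_of_real[symmetric]) simp
  also have "(\<integral>\<tau>. \<eta> \<tau> * (n * exp (- (n * \<tau>)\<^sup>2 / 2)) \<partial>lborel) =
      \<bar>1 / n\<bar> *\<^sub>R (\<integral>u. \<eta> (0 + 1 / n * u) * (n * exp (- (n * (0 + 1 / n * u))\<^sup>2 / 2)) \<partial>lborel)"
    using n by (intro lborel_integral_real_affine) simp
  also have "\<dots> = (\<integral>u. \<eta> (u / n) * exp (- u\<^sup>2 / 2) \<partial>lborel)"
    using n by (simp flip: integral_mult_right_zero)
  finally show ?thesis by simp
qed

text \<open>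
  Fourier inversion at the frequency zero, where the cutoff is one: the Gaussian weight of the
  preceding lemma is spread out to a constant, and the Gaussian on the frequency side concentrates
  at zero.
\<close>

lemma integral_kernel: "(\<integral>t. kernel t \<partial>lborel) = 1"
proof -
  have phi: "std_normal_density x = exp (- x\<^sup>2 / 2) / sqrt (2 * pi)" for x
    by (simp add: std_normal_density_def)
  have isc: "isCont std_normal_density 0"
    unfolding std_normal_density_def[abs_def] by (intro continuous_intros) auto
  have phi_le: "std_normal_density x \<le> 1 / sqrt (2 * pi)" "0 \<le> std_normal_density x" for x
    unfolding phi by (auto intro!: divide_right_mono)
  have inv0: "(\<lambda>n. c / real (Suc n)) \<longlonglongrightarrow> 0" for c :: real
    by (rule LIMSEQ_Suc[OF lim_const_over_n])
  have lhs: "(\<lambda>n. \<integral>t. complex_of_real (std_normal_density (t / real (Suc n))) * kernel t \<partial>lborel)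
      \<longlonglongrightarrow> (\<integral>t. complex_of_real (std_normal_density 0) * kernel t \<partial>lborel)"
  proof (rule integral_dominated_convergence)
    show "integrable lborel (\<lambda>t. cmod (kernel t) / sqrt (2 * pi))"
      using integrable_norm[OF kernel_integrable] by simp
    show "AE t in lborel. norm (complex_of_real (std_normal_density (t / real (Suc n))) * kernel t) \<le> cmod (kernel t) / sqrt (2 * pi)" for n
    proof (intro AE_I2)
      fix t
      have "norm (complex_of_real (std_normal_density (t / real (Suc n))) * kernel t) = std_normal_density (t / real (Suc n)) * cmod (kernel t)"
        unfolding norm_mult norm_of_real using phi_le(2) by simp
      also have "\<dots> \<le> 1 / sqrt (2 * pi) * cmod (kernel t)" by (intro mult_right_mono phi_le) simp
      finally show "norm (complex_of_real (std_normal_density (t / real (Suc n))) * kernel t) \<le> cmod (kernel t) / sqrt (2 * pi)" by simp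
    qed
    show "AE t in lborel. (\<lambda>n. complex_of_real (std_normal_density (t / real (Suc n))) * kernel t) \<longlonglongrightarrow> complex_of_real (std_normal_density 0) * kernel t"
    proof (intro AE_I2 tendsto_intros)
      fix t show "(\<lambda>n. std_normal_density (t / real (Suc n))) \<longlonglongrightarrow> std_normal_density 0"
        by (rule isCont_tendsto_compose[OF isc inv0])
    qed
  qed auto
  have rhs: "(\<lambda>n. (\<integral>u. \<eta> (u / real (Suc n)) * exp (- u\<^sup>2 / 2) \<partial>lborel)) \<longlonglongrightarrow> (\<integral>u. exp (- u\<^sup>2 / 2) \<partial>lborel)"
  proof (rule integral_dominated_convergence)
    have e: "exp (- u\<^sup>2 / 2) = sqrt (2 * pi) * std_normal_density u" for u by (simp add: phi)
    show "integrable lborel (\<lambda>u::real. exp (- u\<^sup>2 / 2))"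
      unfolding e using integrable_std_normal_density by simp
    show "AE u in lborel. norm (\<eta> (u / real (Suc n)) * exp (- u\<^sup>2 / 2)) \<le> exp (- u\<^sup>2 / 2)" for n
      using eta_bounds by (simp add: abs_mult mult_left_le_one_le)
    show "AE u in lborel. (\<lambda>n. \<eta> (u / real (Suc n)) * exp (- u\<^sup>2 / 2)) \<longlonglongrightarrow> exp (- u\<^sup>2 / 2)"
    proof (intro AE_I2)
      fix u :: real
      have "isCont \<eta> 0" using eta_cont by (simp add: continuous_on_eq_continuous_at)
      from isCont_tendsto_compose[OF this inv0[of u]] have "(\<lambda>n. \<eta> (u / real (Suc n))) \<longlonglongrightarrow> 1" by (simp add: eta_1)
      from tendsto_mult[OF this tendsto_const[of "exp (- u\<^sup>2 / 2)"]] show "(\<lambda>n. \<eta> (u / real (Suc n)) * exp (- u\<^sup>2 / 2)) \<longlonglongrightarrow> exp (- u\<^sup>2 / 2)" by simp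
    qed
  qed auto
  have gi: "(\<integral>u. exp (- u\<^sup>2 / 2) \<partial>lborel) = sqrt (2 * pi)"
  proof -
    have "(\<integral>u. exp (- u\<^sup>2 / 2) \<partial>lborel) = (\<integral>u. sqrt (2 * pi) * std_normal_density u \<partial>lborel)" by (simp add: phi)
    also have "\<dots> = sqrt (2 * pi) * (\<integral>u. std_normal_density u \<partial>lborel)" by simp
    also have "(\<integral>u. std_normal_density u \<partial>lborel) = 1" using integral_normal_density[of 1 0] by simp
    finally show ?thesis by simp
  qed
  have "(\<lambda>n. complex_of_real ((\<integral>u. \<eta> (u / real (Suc n)) * exp (- u\<^sup>2 / 2) \<partial>lborel) / (2 * pi))) \<longlonglongrightarrow> complex_of_real (sqrt (2 * pi) / (2 * pi))"
    using rhs unfolding gi by (intro tendsto_of_real tendsto_divide tendsto_const) auto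
  moreover have "(\<lambda>n. complex_of_real ((\<integral>u. \<eta> (u / real (Suc n)) * exp (- u\<^sup>2 / 2) \<partial>lborel) / (2 * pi)))
      = (\<lambda>n. \<integral>t. complex_of_real (std_normal_density (t / real (Suc n))) * kernel t \<partial>lborel)"
    by (intro ext gauss_kernel[symmetric]) simp
  ultimately have "(\<integral>t. complex_of_real (std_normal_density 0) * kernel t \<partial>lborel) = complex_of_real (sqrt (2 * pi) / (2 * pi))"
    using lhs LIMSEQ_unique by simp
  also have "sqrt (2 * pi) / (2 * pi) = 1 / sqrt (2 * pi)"
    by (metis pi_ge_zero real_div_sqrt divide_divide_eq_right mult_nonneg_nonneg real_sqrt_ge_zero zero_le_numeral divide_self_if real_sqrt_divide divide_inverse inverse_eq_divide nonzero_divide_eq_eq mult.commute real_sqrt_mult_self real_sqrt_eq_zero_cancel_iff abs_of_nonneg)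
  finally have "complex_of_real (1 / sqrt (2 * pi)) * (\<integral>t. kernel t \<partial>lborel) = complex_of_real (1 / sqrt (2 * pi)) * 1"
    by (simp add: phi)
  then show ?thesis by (subst (asm) mult_left_cancel) auto
qed

text \<open>
  The kernel of the projection to time frequencies up to about \<open>2\<^sup>N\<close>. The
  symbols of the dyadic projections telescope to it.
\<close>

definition kernel_at :: "nat \<Rightarrow> real \<Rightarrow> complex" where
  "kernel_at N t = complex_of_real (2 ^ N) * kernel (2 ^ N * t)"

lemma kernel_at_meas [measurable]: "kernel_at N \<in> borel_measurable borel"
  unfolding kernel_at_def[abs_def] by measurable

lemma inverse_fourier_dilated: "inverse_fourier (\<lambda>\<tau>. \<eta> (\<tau> / 2 ^ N)) t = kernel_at N t"
proof -
  have "(\<integral>\<tau>. complex_of_real (\<eta> (\<tau> / 2 ^ N)) * cis (t * \<tau>) \<partial>lborel)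
      = \<bar>2 ^ N\<bar> *\<^sub>R (\<integral>\<tau>. complex_of_real (\<eta> ((0 + 2 ^ N * \<tau>) / 2 ^ N)) * cis (t * (0 + 2 ^ N * \<tau>)) \<partial>lborel)"
    by (intro lborel_integral_real_affine) simp
  then show ?thesis by (simp add: inverse_fourier_def kernel_at_def kernel_def scaleR_conv_of_real mult_ac)
qed

lemma inverse_fourier_symbol:
  "inverse_fourier (LP_symbol \<eta> 0) t = kernel_at 0 t"
  "inverse_fourier (LP_symbol \<eta> (Suc L)) t = kernel_at (Suc L) t - kernel_at L t"
proof -
  show "inverse_fourier (LP_symbol \<eta> 0) t = kernel_at 0 t"
    using inverse_fourier_dilated[of 0 t] by (simp add: LP_symbol_def[abs_def])
  have int: "integrable lborel (\<lambda>\<tau>. complex_of_real (\<eta> (\<tau> / 2 ^ N)) * cis (t * \<tau>))" for N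
  proof (rule integrable_compact_support)
    show "continuous_on UNIV (\<lambda>\<tau>. complex_of_real (\<eta> (\<tau> / 2 ^ N)) * cis (t * \<tau>))"
      by (intro continuous_intros continuous_cis_mult continuous_on_compose2[OF eta_cont]) auto
    show "complex_of_real (\<eta> (\<tau> / 2 ^ N)) * cis (t * \<tau>) = 0" if "2 * 2 ^ N < \<bar>\<tau>\<bar>" for \<tau>
    proof -
      have "2 \<le> \<bar>\<tau> / 2 ^ N\<bar>" using that by (simp add: abs_divide pos_le_divide_eq)
      then show ?thesis by (simp add: eta_0)
    qed
  qed
  have "inverse_fourier (LP_symbol \<eta> (Suc L)) t
      = (\<integral>\<tau>. complex_of_real (\<eta> (\<tau> / 2 ^ Suc L)) * cis (t * \<tau>) - complex_of_real (\<eta> (\<tau> / 2 ^ L)) * cis (t * \<tau>) \<partial>lborel) / complex_of_real (2 * pi)"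
    by (simp add: inverse_fourier_def LP_symbol_def left_diff_distrib)
  also have "\<dots> = inverse_fourier (\<lambda>\<tau>. \<eta> (\<tau> / 2 ^ Suc L)) t - inverse_fourier (\<lambda>\<tau>. \<eta> (\<tau> / 2 ^ L)) t"
    by (simp only: Bochner_Integration.integral_diff[OF int int] inverse_fourier_def diff_divide_distrib)
  finally show "inverse_fourier (LP_symbol \<eta> (Suc L)) t = kernel_at (Suc L) t - kernel_at L t"
    by (simp only: inverse_fourier_dilated)
qed

lemma sum_inverse_fourier_symbol: "(\<Sum>L\<le>N. inverse_fourier (LP_symbol \<eta> L) t) = kernel_at N t"
  by (induction N) (simp_all add: inverse_fourier_symbol)

lemma inverse_fourier_symbol_meas [measurable]: "inverse_fourier (LP_symbol \<eta> L) \<in> borel_measurable borel"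
proof (cases L)
  case 0
  then show ?thesis by (simp add: inverse_fourier_symbol(1)[abs_def])
next
  case (Suc n)
  then show ?thesis by (simp add: inverse_fourier_symbol(2)[abs_def])
qed

lemma kernel_at_affine:
  fixes g :: "real \<Rightarrow> complex"
  shows "(\<integral>t. g t * kernel_at N (t - s) \<partial>lborel) = (\<integral>u. g (s + u / 2 ^ N) * kernel u \<partial>lborel)"
proof -
  have "(\<integral>t. g t * kernel_at N (t - s) \<partial>lborel) = \<bar>1 / 2 ^ N\<bar> *\<^sub>R (\<integral>u. g (s + 1 / 2 ^ N * u) * kernel_at N (s + 1 / 2 ^ N * u - s) \<partial>lborel)"
    by (intro lborel_integral_real_affine) simp
  also have "\<dots> = (\<integral>u. g (s + u / 2 ^ N) * kernel u \<partial>lborel)"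
    unfolding scaleR_conv_of_real integral_mult_right_zero[symmetric]
    by (intro Bochner_Integration.integral_cong) (auto simp: kernel_at_def)
  finally show ?thesis .
qed

text \<open>
  An approximate identity applied to the indicator of an interval. At an endpoint the limit would
  be the integral of the kernel over a half-line.
\<close>

lemma kernel_at_window_tendsto:
  assumes "s \<noteq> a" "s \<noteq> b"
  shows "(\<lambda>N. \<integral>t. indicator {a<..b} t * kernel_at N (t - s) \<partial>lborel) \<longlonglongrightarrow> indicator {a<..b} s"
proof -
  have "(\<lambda>N. \<integral>u. indicator {a<..b} (s + u / 2 ^ N) * kernel u \<partial>lborel) \<longlonglongrightarrow> (\<integral>u. indicator {a<..b} s * kernel u \<partial>lborel)"
  proof (rule integral_dominated_convergence)
    show "integrable lborel (\<lambda>u. cmod (kernel u))" by (rule integrable_norm[OF kernel_integrable])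
    show "AE u in lborel. norm (indicator {a<..b} (s + u / 2 ^ N) * kernel u) \<le> cmod (kernel u)" for N
      by (auto simp: norm_mult indicator_def)
    show "AE u in lborel. (\<lambda>N. indicator {a<..b} (s + u / 2 ^ N) * kernel u) \<longlonglongrightarrow> indicator {a<..b} s * kernel u"
    proof (intro AE_I2 tendsto_mult tendsto_const)
      fix u :: real
      have "(\<lambda>N. u * (1 / 2) ^ N) \<longlonglongrightarrow> u * 0" by (intro tendsto_intros LIMSEQ_power_zero) auto
      then have lim: "(\<lambda>N. s + u / 2 ^ N) \<longlonglongrightarrow> s" using tendsto_add[OF tendsto_const[of s]] by (fastforce simp: power_divide)
      have "\<forall>\<^sub>F N in sequentially. (s + u / 2 ^ N \<in> {a<..b}) = (s \<in> {a<..b})"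
      proof (cases "a < s \<and> s < b")
        case True
        have "\<forall>\<^sub>F N in sequentially. a < s + u / 2 ^ N" "\<forall>\<^sub>F N in sequentially. s + u / 2 ^ N < b"
          using True by (auto intro: order_tendstoD[OF lim])
        then show ?thesis by eventually_elim (use True in auto)
      next
        case False
        then consider "s < a" | "b < s" using assms by linarith
        then show ?thesis
        proof cases
          case 1
          then have "\<forall>\<^sub>F N in sequentially. s + u / 2 ^ N < a" by (rule order_tendstoD[OF lim])
          then show ?thesis by eventually_elim (use 1 in auto)
        next
          case 2
          then have "\<forall>\<^sub>F N in sequentially. b < s + u / 2 ^ N" by (rule order_tendstoD[OF lim])
          then show ?thesis by eventually_elim (use 2 in auto)
        qed
      qed
      then show "(\<lambda>N. indicator {a<..b} (s + u / 2 ^ N) :: complex) \<longlonglongrightarrow> indicator {a<..b} s"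
        by (intro tendsto_eventually) (auto elim!: eventually_mono simp: indicator_def)
    qed
  qed auto
  then show ?thesis unfolding kernel_at_affine by (simp add: integral_kernel)
qed

text \<open>
  For \<open>s\<close> far from the interval the decay of the kernel pays for the weight; one spare power of \<open>\<bar>t - s\<bar>\<close> absorbs
  the factor \<open>2\<^sup>N\<close> in front of the dilated kernel, so that the bound is uniform in \<open>N\<close>.
\<close>

lemma kernel_at_window_bound:
  "\<exists>C\<ge>0. \<forall>N s. (\<integral>\<^sup>+t. indicator {a<..b} t * ennreal (cmod (kernel_at N (t - s))) \<partial>lborel) \<le> ennreal (C / (1 + s\<^sup>2) ^ m)"
proof -
  define I where "I = (\<integral>u. cmod (kernel u) \<partial>lborel)"
  have I: "0 \<le> I" unfolding I_def by (intro integral_nonneg_AE) auto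
  obtain D where D: "0 \<le> D" "\<And>t. \<bar>t\<bar> ^ (2 * m + 1) * cmod (kernel t) \<le> D" using kernel_decay[of "2 * m + 1"] by blast
  \<comment> \<open>Beyond \<open>2 * c\<close> the distance of \<open>s\<close> to the interval is at least \<open>\<bar>s\<bar> / 2\<close>.\<close>
  define c where "c = \<bar>a\<bar> + \<bar>b\<bar> + 1"
  define E where "E = I * (1 + (2 * c)\<^sup>2) ^ m + \<bar>b - a\<bar> * D * 2 ^ (2 * m + 1) * 2 ^ m"
  have c: "1 \<le> c" by (simp add: c_def)
  have whole: "(\<integral>\<^sup>+t. indicator {a<..b} t * ennreal (cmod (kernel_at N (t - s))) \<partial>lborel) \<le> ennreal I" for N s
  proof -
    have "(\<integral>\<^sup>+t. indicator {a<..b} t * ennreal (cmod (kernel_at N (t - s))) \<partial>lborel) \<le> (\<integral>\<^sup>+t. ennreal (cmod (kernel_at N (t - s))) \<partial>lborel)"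
      by (intro nn_integral_mono) (auto simp: indicator_def)
    also have "\<dots> = ennreal \<bar>1 / 2 ^ N\<bar> * (\<integral>\<^sup>+u. ennreal (cmod (kernel_at N (s + 1 / 2 ^ N * u - s))) \<partial>lborel)"
      by (intro nn_integral_real_affine) auto
    also have "\<dots> = (\<integral>\<^sup>+u. ennreal (cmod (kernel u)) \<partial>lborel)"
      by (subst nn_integral_cmult[symmetric]) (auto simp: kernel_at_def norm_mult norm_power ennreal_mult[symmetric] intro!: nn_integral_cong)
    also have "\<dots> = ennreal I"
      unfolding I_def by (intro nn_integral_eq_integral integrable_norm kernel_integrable) auto
    finally show ?thesis .
  qed
  have "(\<integral>\<^sup>+t. indicator {a<..b} t * ennreal (cmod (kernel_at N (t - s))) \<partial>lborel) \<le> ennreal (E / (1 + s\<^sup>2) ^ m)" for N s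
  proof (cases "\<bar>s\<bar> \<le> 2 * c")
    case True
    have "s\<^sup>2 \<le> (2 * c)\<^sup>2" using power_mono[OF True abs_ge_zero, of 2] by simp
    then have "(1 + s\<^sup>2) ^ m \<le> (1 + (2 * c)\<^sup>2) ^ m" by (intro power_mono[of "1 + s\<^sup>2"]) auto
    then have "I * (1 + s\<^sup>2) ^ m \<le> I * (1 + (2 * c)\<^sup>2) ^ m" using I by (intro mult_left_mono)
    also have "\<dots> \<le> E" using D(1) by (simp add: E_def)
    finally have "I \<le> E / (1 + s\<^sup>2) ^ m" by (subst pos_le_divide_eq) (auto intro!: zero_less_power add_pos_nonneg)
    then show ?thesis using whole[of N s] by (meson ennreal_leI order_trans)
  next
    case False
    have pw: "indicator {a<..b} t * ennreal (cmod (kernel_at N (t - s))) \<le> ennreal (D * 2 ^ (2 * m + 1) * 2 ^ m / (1 + s\<^sup>2) ^ m) * indicator {a<..b} t" for t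
    proof (cases "t \<in> {a<..b}")
      case True
      then have "\<bar>t\<bar> \<le> c" by (auto simp: c_def)
      then have r: "\<bar>s\<bar> / 2 \<le> \<bar>t - s\<bar>" "0 < \<bar>s\<bar>" "1 \<le> \<bar>s\<bar>" using False c by linarith+
      have "2 ^ N * ((\<bar>s\<bar> / 2) ^ (2 * m + 1)) * cmod (kernel (2 ^ N * (t - s))) \<le> \<bar>2 ^ N * (t - s)\<bar> ^ (2 * m + 1) * cmod (kernel (2 ^ N * (t - s)))"
      proof (intro mult_right_mono)
        have "(2::real) ^ N \<le> (2 ^ N) ^ (2 * m + 1)" by (rule self_le_power) auto
        then have "2 ^ N * ((\<bar>s\<bar> / 2) ^ (2 * m + 1)) \<le> (2 ^ N) ^ (2 * m + 1) * \<bar>t - s\<bar> ^ (2 * m + 1)"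
          using r by (intro mult_mono power_mono) auto
        then show "2 ^ N * ((\<bar>s\<bar> / 2) ^ (2 * m + 1)) \<le> \<bar>2 ^ N * (t - s)\<bar> ^ (2 * m + 1)"
          by (simp only: abs_mult power_abs[of "2 :: real"] abs_numeral) (simp only: power_mult_distrib)
      qed simp
      also have "\<dots> \<le> D" by (rule D)
      finally have "cmod (kernel_at N (t - s)) * (\<bar>s\<bar> / 2) ^ (2 * m + 1) \<le> D"
        by (simp add: kernel_at_def norm_mult norm_power mult_ac)
      then have 1: "cmod (kernel_at N (t - s)) * \<bar>s\<bar> ^ (2 * m + 1) \<le> D * 2 ^ (2 * m + 1)"
        by (simp add: power_divide pos_divide_le_eq)
      have "1 \<le> s\<^sup>2" using power_mono[of 1 "\<bar>s\<bar>" 2] r by simp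
      then have "(1 + s\<^sup>2) ^ m \<le> (2 * s\<^sup>2) ^ m" by (intro power_mono[of "1 + s\<^sup>2"]) auto
      also have "\<dots> = 2 ^ m * \<bar>s\<bar> ^ (2 * m)" by (simp add: power_mult_distrib power_mult)
      also have "\<dots> \<le> 2 ^ m * \<bar>s\<bar> ^ (2 * m + 1)" using r by (intro mult_left_mono power_increasing) auto
      finally have "cmod (kernel_at N (t - s)) * (1 + s\<^sup>2) ^ m \<le> cmod (kernel_at N (t - s)) * (2 ^ m * \<bar>s\<bar> ^ (2 * m + 1))"
        by (intro mult_left_mono) auto
      also have "\<dots> \<le> D * 2 ^ (2 * m + 1) * 2 ^ m" using mult_right_mono[OF 1, of "2 ^ m"] by (simp add: mult_ac)
      finally have "cmod (kernel_at N (t - s)) \<le> D * 2 ^ (2 * m + 1) * 2 ^ m / (1 + s\<^sup>2) ^ m"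
        by (subst pos_le_divide_eq) (auto intro!: zero_less_power add_pos_nonneg)
      then show ?thesis using True by (simp add: ennreal_leI)
    qed simp
    have "(\<integral>\<^sup>+t. indicator {a<..b} t * ennreal (cmod (kernel_at N (t - s))) \<partial>lborel) \<le> (\<integral>\<^sup>+t. ennreal (D * 2 ^ (2 * m + 1) * 2 ^ m / (1 + s\<^sup>2) ^ m) * indicator {a<..b} t \<partial>lborel)"
      by (intro nn_integral_mono pw)
    also have "\<dots> = ennreal (D * 2 ^ (2 * m + 1) * 2 ^ m / (1 + s\<^sup>2) ^ m) * emeasure lborel {a<..b}"
      by (rule nn_integral_cmult_indicator) simp
    also have "\<dots> \<le> ennreal (D * 2 ^ (2 * m + 1) * 2 ^ m / (1 + s\<^sup>2) ^ m) * ennreal \<bar>b - a\<bar>"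
      by (intro mult_left_mono) (cases "a \<le> b", auto)
    also have "\<dots> = ennreal (\<bar>b - a\<bar> * D * 2 ^ (2 * m + 1) * 2 ^ m / (1 + s\<^sup>2) ^ m)"
      using D(1) by (subst ennreal_mult[symmetric]) (auto simp: mult_ac intro!: divide_nonneg_nonneg zero_le_power)
    also have "\<dots> \<le> ennreal (E / (1 + s\<^sup>2) ^ m)"
      using I c by (intro ennreal_leI divide_right_mono) (auto simp: E_def)
    finally show ?thesis .
  qed
  moreover have "0 \<le> E" using I D by (simp add: E_def)
  ultimately show ?thesis by blast
qed

text \<open>
  The projections of a tempered function are given by absolutely convergent integrals because the
  kernel beats every polynomial weight.
\<close>

lemma kernel_at_weight_bound: "\<exists>C\<ge>0. \<forall>s. cmod (kernel_at N (t - s)) \<le> C / (1 + s\<^sup>2) ^ m"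
proof -
  obtain D where D: "0 \<le> D" "\<And>r. \<bar>r\<bar> ^ (2 * m) * cmod (kernel r) \<le> D" using kernel_decay[of "2 * m"] by blast
  obtain D0 where D0: "0 \<le> D0" "\<And>r. \<bar>r\<bar> ^ 0 * cmod (kernel r) \<le> D0" using kernel_decay[of 0] by blast
  define E where "E = 2 ^ N * (1 + 2 * t\<^sup>2 + 2) ^ m * (D0 + D) * 2 ^ m"
  have "cmod (kernel_at N (t - s)) \<le> E / (1 + s\<^sup>2) ^ m" for s
  proof -
    define r where "r = 2 ^ N * (t - s)"
    have "\<bar>t - s\<bar> \<le> \<bar>r\<bar>" unfolding r_def abs_mult using mult_right_mono[of 1 "2 ^ N" "\<bar>t - s\<bar>"] by simp
    then have rr: "(t - s)\<^sup>2 \<le> r\<^sup>2" by (simp add: abs_le_square_iff)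
    have "s\<^sup>2 \<le> 2 * t\<^sup>2 + 2 * (t - s)\<^sup>2"
      using sum_squares_bound[of t "s - t"] by (simp add: power2_eq_square algebra_simps)
    then have "1 + s\<^sup>2 \<le> 1 + 2 * t\<^sup>2 + 2 * r\<^sup>2" using rr by linarith
    also have "\<dots> \<le> (1 + 2 * t\<^sup>2 + 2) * max 1 (r\<^sup>2)"
    proof -
      have "1 + 2 * t\<^sup>2 \<le> (1 + 2 * t\<^sup>2) * max 1 (r\<^sup>2)" using mult_left_mono[of 1 "max 1 (r\<^sup>2)" "1 + 2 * t\<^sup>2"] by simp
      then show ?thesis by (simp add: distrib_right max.coboundedI2)
    qed
    finally have "(1 + s\<^sup>2) ^ m \<le> ((1 + 2 * t\<^sup>2 + 2) * max 1 (r\<^sup>2)) ^ m" by (intro power_mono) auto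
    also have "\<dots> = (1 + 2 * t\<^sup>2 + 2) ^ m * (max 1 (r\<^sup>2)) ^ m" by (rule power_mult_distrib)
    also have "\<dots> \<le> (1 + 2 * t\<^sup>2 + 2) ^ m * (1 + \<bar>r\<bar> ^ (2 * m))"
    proof (rule mult_left_mono)
      show "(max 1 (r\<^sup>2)) ^ m \<le> 1 + \<bar>r\<bar> ^ (2 * m)"
        by (cases "1 \<le> r\<^sup>2") (auto simp: max_def power_mult power_even_abs)
    qed auto
    finally have "cmod (kernel r) * (1 + s\<^sup>2) ^ m \<le> cmod (kernel r) * ((1 + 2 * t\<^sup>2 + 2) ^ m * (1 + \<bar>r\<bar> ^ (2 * m)))"
      by (intro mult_left_mono) auto
    also have "\<dots> = (1 + 2 * t\<^sup>2 + 2) ^ m * (cmod (kernel r) + \<bar>r\<bar> ^ (2 * m) * cmod (kernel r))" by (simp add: algebra_simps)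
    also have "\<dots> \<le> (1 + 2 * t\<^sup>2 + 2) ^ m * (D0 + D)"
      using D(2)[of r] D0(2)[of r] by (intro mult_left_mono add_mono) auto
    finally have "2 ^ N * (cmod (kernel r) * (1 + s\<^sup>2) ^ m) \<le> 2 ^ N * ((1 + 2 * t\<^sup>2 + 2) ^ m * (D0 + D))"
      by (intro mult_left_mono) auto
    also have "\<dots> \<le> E"
      using D D0 mult_left_mono[of 1 "2 ^ m" "2 ^ N * ((1 + 2 * t\<^sup>2 + 2) ^ m * (D0 + D))"] by (simp add: E_def mult_ac)
    finally have "cmod (kernel_at N (t - s)) * (1 + s\<^sup>2) ^ m \<le> E"
      by (simp add: kernel_at_def norm_mult norm_power r_def mult_ac)
    then show ?thesis by (subst pos_le_divide_eq) (auto intro!: zero_less_power add_pos_nonneg)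
  qed
  moreover have "0 \<le> E" using D D0 by (simp add: E_def)
  ultimately show ?thesis by blast
qed

end

section \<open>Reconstruction of a Besov function from its blocks\<close>

lemma ennreal_enn2real_le: "ennreal (enn2real x) \<le> x"
  by (cases x) auto

lemma AE_zero_if_interval_integrals_zero:
  fixes f :: "real \<Rightarrow> complex"
  assumes f: "integrable lborel f" and supp: "\<And>t. K < \<bar>t\<bar> \<Longrightarrow> f t = 0"
    and z: "\<And>a b. (\<integral>t. indicator {a<..b} t * f t \<partial>lborel) = 0"
  shows "AE t in lborel. f t = 0"
proof (rule sigma_finite_measure.density_zero[OF lborel.sigma_finite_measure_axioms f])
  fix A :: "real set" assume A: "A \<in> sets lborel"
  have ind: "set_lebesgue_integral lborel {a<..b} f = 0" for a b
  proof -
    have "set_lebesgue_integral lborel {a<..b} f = (\<integral>t. indicator {a<..b} t * f t \<partial>lborel)"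
      unfolding set_lebesgue_integral_def
      by (intro Bochner_Integration.integral_cong refl) (auto simp: indicator_def)
    then show ?thesis by (simp only: z)
  qed
  have total: "set_lebesgue_integral lborel UNIV f = 0"
  proof -
    have "set_lebesgue_integral lborel UNIV f = set_lebesgue_integral lborel {-K-1<..K} f"
      unfolding set_lebesgue_integral_def
      by (intro Bochner_Integration.integral_cong refl) (use supp in \<open>force simp: indicator_def\<close>)
    then show ?thesis by (simp add: ind)
  qed
  have "Int_stable (range (\<lambda>(a, b). {a<..b::real}))"
    by (auto simp: Int_stable_def Int_greaterThanAtMost)
  moreover have "range (\<lambda>(a, b). {a<..b::real}) \<subseteq> Pow UNIV" by simp
  moreover have "A \<in> sigma_sets UNIV (range (\<lambda>(a, b). {a<..b::real}))"
    using A by (simp add: borel_sigma_sets_Ioc)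
  ultimately show "set_lebesgue_integral lborel A f = 0"
  proof (induction A rule: sigma_sets_induct_disjoint)
    case (basic A)
    then show ?case using ind by auto
  next
    case (compl A)
    have "A \<in> sets lborel" using compl by (simp add: borel_sigma_sets_Ioc)
    then show ?case using compl total by (intro set_integral_compl_zero[OF f]) auto
  next
    case (union A)
    then show ?case by (intro set_integral_disjoint_union_zero[OF f]) (auto simp: borel_sigma_sets_Ioc)
  qed (simp add: set_lebesgue_integral_def)
qed

interpretation lborel_ST: pair_sigma_finite "lborel :: real measure" "spacetime :: (real \<times> (real ^ 'd)) measure"
  by (intro pair_sigma_finite.intro ST.sigma_finite_measure_axioms lborel.sigma_finite_measure_axioms)

lemma measurable_lborel_ST:
  fixes f :: "real \<Rightarrow> real \<Rightarrow> real ^ 'd \<Rightarrow> 'b :: topological_space"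
  assumes "(\<lambda>(t, s, x). f t s x) \<in> borel_measurable (borel \<Otimes>\<^sub>M (borel \<Otimes>\<^sub>M borel))"
  shows "(\<lambda>(t, s, x). f t s x) \<in> borel_measurable (lborel \<Otimes>\<^sub>M spacetime)"
proof -
  have p: "(\<lambda>p. p) \<in> measurable (spacetime :: (real \<times> (real ^ 'd)) measure) (borel \<Otimes>\<^sub>M borel)"
    unfolding borel_prod by (rule measurable_spacetime) simp
  have "fst \<in> measurable ((lborel :: real measure) \<Otimes>\<^sub>M (spacetime :: (real \<times> (real ^ 'd)) measure)) (borel :: real measure)"
    by (rule measurable_compose[OF measurable_fst]) simp
  moreover have "snd \<in> measurable ((lborel :: real measure) \<Otimes>\<^sub>M (spacetime :: (real \<times> (real ^ 'd)) measure)) (borel \<Otimes>\<^sub>M borel)"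
    by (rule measurable_compose[OF measurable_snd p])
  ultimately have "(\<lambda>q. (fst q, snd q)) \<in> measurable ((lborel :: real measure) \<Otimes>\<^sub>M (spacetime :: (real \<times> (real ^ 'd)) measure)) (borel \<Otimes>\<^sub>M (borel \<Otimes>\<^sub>M borel))"
    by (rule measurable_Pair)
  from measurable_compose[OF this assms] show ?thesis by simp
qed

lemma AE_ST_fst_neq: "AE p in (spacetime :: (real \<times> (real ^ 'd)) measure). fst p \<noteq> a"
proof (rule ST.AE_pair_measure)
  have "{p \<in> space (borel \<Otimes>\<^sub>M borel). fst p \<noteq> a} \<in> sets (borel \<Otimes>\<^sub>M (borel :: (real ^ 'd) measure))"
    by measurable
  from sets_spacetime_borel[OF this] show "{x \<in> space (spacetime :: (real \<times> (real ^ 'd)) measure). fst x \<noteq> a} \<in> sets spacetime"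
    by (simp add: Int_def space_pair_measure conj_commute)
  show "AE s in lborel. AE x in (torus :: (real ^ 'd) measure). fst (s, x) \<noteq> a"
    using AE_lborel_singleton[of a] by eventually_elim simp
qed

definition poly_exp_const :: "real \<Rightarrow> real" where
  "poly_exp_const s = (1 / min 1 (2 powr (s / 8) - 1)) ^ 4"

lemma poly_exp_const_pos: "0 < s \<Longrightarrow> 0 < poly_exp_const s"
  using powr_less_mono[of 0 "s / 8" 2] by (simp add: poly_exp_const_def min_def)

text \<open>
  Half of the exponential decay absorbs any fixed power of the index; the fourth power is what
  counting the pairs of dyadic indices will require.
\<close>

lemma poly_exp_bound:
  assumes s: "0 < s"
  shows "real (k + 1) ^ 4 * (2 powr (- s)) ^ k \<le> poly_exp_const s * (2 powr (- (s / 2))) ^ k"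
proof -
  define y where "y = (2::real) powr (s / 8)"
  define e where "e = min 1 (y - 1)"
  have e: "0 < e" "e \<le> 1" "1 + e \<le> y" using s powr_less_mono[of 0 "s / 8" 2] by (auto simp: e_def y_def)
  have "real (k + 1) * e \<le> 1 + real k * e" using e by (simp add: algebra_simps)
  also have "\<dots> \<le> (1 + e) ^ k" using e Bernoulli_inequality[of e k] by simp
  also have "\<dots> \<le> y ^ k" using e by (intro power_mono) auto
  finally have "real (k + 1) \<le> (1 / e) * y ^ k" using e by (simp add: pos_le_divide_eq)
  then have "real (k + 1) ^ 4 \<le> ((1 / e) * y ^ k) ^ 4" by (intro power_mono) auto
  then have "real (k + 1) ^ 4 * (2 powr (- s)) ^ k \<le> ((1 / e) * y ^ k) ^ 4 * (2 powr (- s)) ^ k"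
    by (intro mult_right_mono) auto
  also have "\<dots> = poly_exp_const s * ((y ^ k) ^ 4 * (2 powr (- s)) ^ k)"
    by (simp add: poly_exp_const_def e_def y_def power_mult_distrib power_divide)
  also have "(y ^ k) ^ 4 * (2 powr (- s)) ^ k = (2 powr (- (s / 2))) ^ k"
    by (simp add: y_def powr_realpow[symmetric] powr_powr powr_add[symmetric] field_simps)
  finally show ?thesis .
qed

text \<open>
  The information that a Besov norm gives about the joint blocks in space frequency
  \<open>2\<^sup>j\<close> and time frequency \<open>2\<^sup>L\<close>.
\<close>

locale besov_function = lp_cutoff \<eta> for \<eta> :: "real \<Rightarrow> real" +
  fixes B :: "real \<Rightarrow> real ^ 'd \<Rightarrow> complex" and r \<theta> s \<beta> :: real
  assumes B: "jointly_measurable B" "tempered_in_time B"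
    and r: "1 < r" and \<theta>: "0 < \<theta>" and s: "0 < s" and \<beta>: "0 \<le> \<beta>"
    and blocks: "\<And>j L. Lnorm r spacetime (\<lambda>(t, x). ennreal (cmod (P_dy j (Pt_dy \<eta> L B t) x)))
      \<le> ennreal (\<beta> * (2 powr (- \<theta>)) ^ j * (2 powr (- s)) ^ L)"
begin

abbreviation "LP \<equiv> Pt_dy \<eta>"
abbreviation "\<kappa> L \<equiv> inverse_fourier (LP_symbol \<eta> L)"

lemmas B_meas [measurable] = jointly_measurableD[OF B(1)]

lemma jointly_measurable_LP: "jointly_measurable (LP L B)"
proof -
  have "(\<lambda>(p, s). \<kappa> L (fst p - s) * B s (snd p)) \<in> borel_measurable ((borel \<Otimes>\<^sub>M borel) \<Otimes>\<^sub>M lborel)"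
    by measurable
  then have "(\<lambda>p. \<integral>s. \<kappa> L (fst p - s) * B s (snd p) \<partial>lborel) \<in> borel_measurable (borel \<Otimes>\<^sub>M borel)"
    by (rule lborel.borel_measurable_lebesgue_integral)
  then show ?thesis unfolding borel_prod by (simp add: Pt_dy_def[abs_def] case_prod_beta')
qed

definition m :: nat where
  "m = (SOME m. integrable spacetime (\<lambda>(t, x). B t x / complex_of_real ((1 + t\<^sup>2) ^ m)))"

lemma B_weighted: "integrable spacetime (\<lambda>(t, x). B t x / complex_of_real ((1 + t\<^sup>2) ^ m))"
  unfolding m_def by (rule someI_ex) (use B(2) in \<open>simp add: tempered_in_time_def\<close>)

lemma norm_weight: "cmod (complex_of_real ((1 + t\<^sup>2) ^ m)) = (1 + t\<^sup>2) ^ m"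
  by (subst norm_of_real) (simp add: zero_le_power add_nonneg_nonneg)

lemma weight_pos: "0 < (1 + t\<^sup>2) ^ m" for t :: real
  by (intro zero_less_power add_pos_nonneg) auto

lemma integrable_B_times:
  assumes g: "(\<lambda>(t, x). g t x) \<in> borel_measurable (borel \<Otimes>\<^sub>M borel)" "\<And>t x. cmod (g t x) \<le> C / (1 + t\<^sup>2) ^ m"
  shows "integrable spacetime (\<lambda>(t, x). g t x * B t x)"
proof (rule Bochner_Integration.integrable_bound)
  show "integrable spacetime (\<lambda>p. C *\<^sub>R (case p of (t, x) \<Rightarrow> B t x / complex_of_real ((1 + t\<^sup>2) ^ m)))"
    by (intro integrable_scaleR_right B_weighted)
  note g(1)[measurable]
  show "(\<lambda>(t, x). g t x * B t x) \<in> borel_measurable spacetime"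
    by (rule measurable_ST) measurable
  have "cmod (g t x * B t x) \<le> norm (C *\<^sub>R (B t x / complex_of_real ((1 + t\<^sup>2) ^ m)))" for t x
  proof -
    have "cmod (g t x) * cmod (B t x) \<le> C / (1 + t\<^sup>2) ^ m * cmod (B t x)" by (intro mult_right_mono g) auto
    also have "\<dots> \<le> \<bar>C\<bar> * (cmod (B t x) / (1 + t\<^sup>2) ^ m)"
      using weight_pos[of t] by (simp add: divide_simps mult_right_mono)
    finally show ?thesis by (simp only: norm_mult norm_scaleR norm_divide norm_weight)
  qed
  then show "AE p in spacetime. norm (case p of (t, x) \<Rightarrow> g t x * B t x) \<le> norm (C *\<^sub>R (case p of (t, x) \<Rightarrow> B t x / complex_of_real ((1 + t\<^sup>2) ^ m)))"
    by (intro AE_I2) auto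
qed

lemma integrable_B_window: "integrable spacetime (\<lambda>(t, x). (indicator {-K..K} t * ch n x) * B t x)"
proof (rule integrable_B_times)
  fix t x
  show "cmod (indicator {-K..K} t * ch n x) \<le> (1 + K\<^sup>2) ^ m / (1 + t\<^sup>2) ^ m"
  proof (cases "t \<in> {-K..K}")
    case True
    then have "t\<^sup>2 \<le> K\<^sup>2" using abs_le_square_iff[of t K] by auto
    then have "(1 + t\<^sup>2) ^ m \<le> (1 + K\<^sup>2) ^ m" by (intro power_mono[of "1 + t\<^sup>2"]) auto
    then show ?thesis using True weight_pos[of t] by (simp add: norm_mult)
  next
    case False
    then show ?thesis using weight_pos[of t] weight_pos[of K] by (simp add: less_imp_le)
  qed
qed measurable

lemma kernel_B_integrable: "integrable spacetime (\<lambda>(s, x). (kernel_at N (t - s) * ch n x) * B s x)"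
proof -
  obtain C where "\<And>s. cmod (kernel_at N (t - s)) \<le> C / (1 + s\<^sup>2) ^ m" using kernel_at_weight_bound[of N t m] by blast
  then show ?thesis by (intro integrable_B_times[of _ C]) (measurable, simp add: norm_mult)
qed

lemma symbol_B_integrable: "integrable spacetime (\<lambda>(s, x). (\<kappa> L (t - s) * ch n x) * B s x)"
proof (cases L)
  case 0
  then show ?thesis using kernel_B_integrable[of 0 t n] by (simp add: inverse_fourier_symbol)
next
  case (Suc M)
  show ?thesis
    using Bochner_Integration.integrable_diff[OF kernel_B_integrable[of "Suc M" t n] kernel_B_integrable[of M t n]]
    by (simp add: Suc inverse_fourier_symbol case_prod_beta' left_diff_distrib)
qed

lemma fourier_coeff_LP:
  "fourier_coeff (LP L B t) n * complex_of_real ((2 * pi) ^ CARD('d)) = (\<integral>(s, x). (\<kappa> L (t - s) * ch (- n) x) * B s x \<partial>spacetime)"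
proof -
  have "(\<integral>(s, x). (\<kappa> L (t - s) * ch (- n) x) * B s x \<partial>spacetime) = (\<integral>x. \<integral>s. (\<kappa> L (t - s) * ch (- n) x) * B s x \<partial>lborel \<partial>torus)"
    using ST.integral_snd[OF symbol_B_integrable[of L t "- n"]] by simp
  also have "\<dots> = (\<integral>x. LP L B t x * ch (- n) x \<partial>torus)"
    unfolding Pt_dy_def integral_mult_left_zero[symmetric]
    by (intro Bochner_Integration.integral_cong refl) (simp add: mult_ac)
  finally show ?thesis by (simp add: fourier_coeff_alt)
qed

text \<open>
  Up to the normalisation, the Fourier coefficient number \<open>n\<close> of the time-mollified
  function at time \<open>t\<close>.
\<close>

definition \<Phi> :: "int ^ 'd \<Rightarrow> nat \<Rightarrow> real \<Rightarrow> complex" where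
  "\<Phi> n N t = (\<integral>(s, x). (kernel_at N (t - s) * ch (- n) x) * B s x \<partial>spacetime)"

lemma sum_fourier_coeff_LP:
  "(\<Sum>L\<le>N. fourier_coeff (LP L B t) n) * complex_of_real ((2 * pi) ^ CARD('d)) = \<Phi> n N t"
proof -
  have "(\<Sum>L\<le>N. fourier_coeff (LP L B t) n) * complex_of_real ((2 * pi) ^ CARD('d))
      = (\<integral>p. (\<Sum>L\<le>N. (case p of (s, x) \<Rightarrow> (\<kappa> L (t - s) * ch (- n) x) * B s x)) \<partial>spacetime)"
    unfolding sum_distrib_right fourier_coeff_LP
    by (rule Bochner_Integration.integral_sum[symmetric]) (rule symbol_B_integrable)
  also have "\<dots> = \<Phi> n N t"
    unfolding \<Phi>_def
    by (intro Bochner_Integration.integral_cong refl)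
       (auto simp: sum_inverse_fourier_symbol[symmetric] sum_distrib_right)
  finally show ?thesis .
qed

lemma \<Phi>_window:
  "(\<integral>t. indicator {a<..b} t * \<Phi> n N t \<partial>lborel)
    = (\<integral>(s, x). (\<integral>t. indicator {a<..b} t * kernel_at N (t - s) \<partial>lborel) * ch (- n) x * B s x \<partial>spacetime)"
proof -
  let ?f = "\<lambda>t (s, x). indicator {a<..b} t * ((kernel_at N (t - s) * ch (- n) x) * B s x)"
  obtain C where C: "0 \<le> C" "\<And>s. (\<integral>\<^sup>+t. indicator {a<..b} t * ennreal (cmod (kernel_at N (t - s))) \<partial>lborel) \<le> ennreal (C / (1 + s\<^sup>2) ^ m)"
    using kernel_at_window_bound[of a b m] by blast
  have meas: "(\<lambda>(t, s, x). indicator {a<..b} t * ((kernel_at N (t - s) * ch (- n) x) * B s x)) \<in> borel_measurable (lborel \<Otimes>\<^sub>M spacetime)"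
    by (rule measurable_lborel_ST) measurable
  have int: "integrable (lborel \<Otimes>\<^sub>M spacetime) (\<lambda>(t, p). ?f t p)"
  proof (rule integrableI_bounded)
    show m': "(\<lambda>(t, p). ?f t p) \<in> borel_measurable (lborel \<Otimes>\<^sub>M spacetime)" using meas by (simp add: case_prod_beta')
    have mm: "(\<lambda>q. ennreal (norm (case q of (t, p) \<Rightarrow> ?f t p))) \<in> borel_measurable (lborel \<Otimes>\<^sub>M spacetime)"
      by (rule measurable_compose[OF m']) simp
    have "(\<integral>\<^sup>+q. ennreal (norm (case q of (t, p) \<Rightarrow> ?f t p)) \<partial>(lborel \<Otimes>\<^sub>M spacetime))
        = (\<integral>\<^sup>+p. \<integral>\<^sup>+t. ennreal (norm (?f t p)) \<partial>lborel \<partial>spacetime)"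
      using lborel_ST.nn_integral_snd[OF mm] by simp
    also have "\<dots> \<le> (\<integral>\<^sup>+p. ennreal C * ennreal (norm (case p of (s, x) \<Rightarrow> B s x / complex_of_real ((1 + s\<^sup>2) ^ m))) \<partial>spacetime)"
    proof (intro nn_integral_mono, clarify)
      fix s :: real and x :: "real ^ 'd"
      have "(\<integral>\<^sup>+t. ennreal (norm (indicator {a<..b} t * ((kernel_at N (t - s) * ch (- n) x) * B s x))) \<partial>lborel)
          = (\<integral>\<^sup>+t. (indicator {a<..b} t * ennreal (cmod (kernel_at N (t - s)))) * ennreal (cmod (B s x)) \<partial>lborel)"
        by (intro nn_integral_cong) (auto simp: norm_mult ennreal_mult indicator_def)
      also have "\<dots> = (\<integral>\<^sup>+t. indicator {a<..b} t * ennreal (cmod (kernel_at N (t - s))) \<partial>lborel) * ennreal (cmod (B s x))"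
        by (rule nn_integral_multc) measurable
      also have "\<dots> \<le> ennreal (C / (1 + s\<^sup>2) ^ m) * ennreal (cmod (B s x))" by (intro mult_right_mono C) auto
      also have "\<dots> = ennreal C * ennreal (norm (B s x / complex_of_real ((1 + s\<^sup>2) ^ m)))"
        unfolding norm_divide norm_weight using C(1) weight_pos[of s]
        by (subst (1 2) ennreal_mult[symmetric]) (auto simp: less_imp_le)
      finally show "(\<integral>\<^sup>+t. ennreal (norm (indicator {a<..b} t * ((kernel_at N (t - s) * ch (- n) x) * B s x))) \<partial>lborel)
        \<le> ennreal C * ennreal (norm (B s x / complex_of_real ((1 + s\<^sup>2) ^ m)))" .
    qed
    also have "\<dots> = ennreal C * (\<integral>\<^sup>+p. ennreal (norm (case p of (s, x) \<Rightarrow> B s x / complex_of_real ((1 + s\<^sup>2) ^ m))) \<partial>spacetime)"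
      by (rule nn_integral_cmult) (use B_weighted in simp)
    also have "\<dots> < \<infinity>"
      using B_weighted unfolding integrable_iff_bounded by (simp add: ennreal_mult_less_top)
    finally show "(\<integral>\<^sup>+q. ennreal (norm (case q of (t, p) \<Rightarrow> ?f t p)) \<partial>(lborel \<Otimes>\<^sub>M spacetime)) < \<infinity>" .
  qed
  have "(\<integral>t. indicator {a<..b} t * \<Phi> n N t \<partial>lborel) = (\<integral>t. \<integral>p. ?f t p \<partial>spacetime \<partial>lborel)"
    unfolding \<Phi>_def integral_mult_right_zero[symmetric] by (simp add: case_prod_beta')
  also have "\<dots> = (\<integral>p. \<integral>t. ?f t p \<partial>lborel \<partial>spacetime)"
    using lborel_ST.Fubini_integral[OF int] by simp
  also have "\<dots> = (\<integral>(s, x). (\<integral>t. indicator {a<..b} t * kernel_at N (t - s) \<partial>lborel) * ch (- n) x * B s x \<partial>spacetime)"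
  proof (intro Bochner_Integration.integral_cong refl, clarify)
    fix s :: real and x :: "real ^ 'd"
    have "(\<integral>t. indicator {a<..b} t * ((kernel_at N (t - s) * ch (- n) x) * B s x) \<partial>lborel)
        = (\<integral>t. (indicator {a<..b} t * kernel_at N (t - s)) * (ch (- n) x * B s x) \<partial>lborel)"
      by (simp add: mult_ac)
    also have "\<dots> = (\<integral>t. indicator {a<..b} t * kernel_at N (t - s) \<partial>lborel) * (ch (- n) x * B s x)"
      by (rule integral_mult_left_zero)
    finally show "(\<integral>t. indicator {a<..b} t * ((kernel_at N (t - s) * ch (- n) x) * B s x) \<partial>lborel)
        = (\<integral>t. indicator {a<..b} t * kernel_at N (t - s) \<partial>lborel) * ch (- n) x * B s x"
      by (simp add: mult.assoc)
  qed
  finally show ?thesis .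
qed

text \<open>
  Tested against intervals in time, the mollified Fourier coefficients converge to those of
  \<open>B\<close>; the dominating function is the integrable function in the definition of
  temperedness.
\<close>

lemma \<Phi>_window_tendsto:
  "(\<lambda>N. \<integral>t. indicator {a<..b} t * \<Phi> n N t \<partial>lborel)
    \<longlonglongrightarrow> (\<integral>(s, x). indicator {a<..b} s * ch (- n) x * B s x \<partial>spacetime)"
proof -
  obtain C where C: "0 \<le> C" "\<And>N s. (\<integral>\<^sup>+t. indicator {a<..b} t * ennreal (cmod (kernel_at N (t - s))) \<partial>lborel) \<le> ennreal (C / (1 + s\<^sup>2) ^ m)"
    using kernel_at_window_bound[of a b m] by blast
  have h: "cmod (\<integral>t. indicator {a<..b} t * kernel_at N (t - s) \<partial>lborel) \<le> C / (1 + s\<^sup>2) ^ m" for N s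
  proof -
    have "ennreal (cmod (\<integral>t. indicator {a<..b} t * kernel_at N (t - s) \<partial>lborel)) \<le> (\<integral>\<^sup>+t. ennreal (cmod (indicator {a<..b} t * kernel_at N (t - s))) \<partial>lborel)"
      by (rule norm_integral_le_nn_integral)
    also have "\<dots> = (\<integral>\<^sup>+t. indicator {a<..b} t * ennreal (cmod (kernel_at N (t - s))) \<partial>lborel)"
      by (intro nn_integral_cong) (auto simp: indicator_def)
    also have "\<dots> \<le> ennreal (C / (1 + s\<^sup>2) ^ m)" by (rule C)
    finally show ?thesis using C(1) weight_pos[of s] by (simp add: less_imp_le)
  qed
  show ?thesis
    unfolding \<Phi>_window
  proof (rule integral_dominated_convergence)
  show "integrable spacetime (\<lambda>p. norm (C *\<^sub>R (case p of (s, x) \<Rightarrow> B s x / complex_of_real ((1 + s\<^sup>2) ^ m))))"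
    by (intro integrable_norm integrable_scaleR_right B_weighted)
  have hm [measurable]: "(\<lambda>s. \<integral>t. indicator {a<..b} t * kernel_at N (t - s) \<partial>lborel) \<in> borel_measurable borel" for N
    by (intro lborel.borel_measurable_lebesgue_integral) measurable
  show "(\<lambda>(s, x). (\<integral>t. indicator {a<..b} t * kernel_at N (t - s) \<partial>lborel) * ch (- n) x * B s x) \<in> borel_measurable spacetime" for N
    by (rule measurable_ST) measurable
  show "(\<lambda>(s, x). indicator {a<..b} s * ch (- n) x * B s x) \<in> borel_measurable spacetime"
    by (rule measurable_ST) measurable
  show "AE p in spacetime. norm (case p of (s, x) \<Rightarrow> (\<integral>t. indicator {a<..b} t * kernel_at N (t - s) \<partial>lborel) * ch (- n) x * B s x)
      \<le> norm (C *\<^sub>R (case p of (s, x) \<Rightarrow> B s x / complex_of_real ((1 + s\<^sup>2) ^ m)))" for N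
  proof (intro AE_I2, clarify)
    fix s :: real and x :: "real ^ 'd"
    have "cmod (\<integral>t. indicator {a<..b} t * kernel_at N (t - s) \<partial>lborel) * cmod (B s x) \<le> C / (1 + s\<^sup>2) ^ m * cmod (B s x)"
      by (intro mult_right_mono h) simp
    then show "cmod ((\<integral>t. indicator {a<..b} t * kernel_at N (t - s) \<partial>lborel) * ch (- n) x * B s x) \<le> norm (C *\<^sub>R (B s x / complex_of_real ((1 + s\<^sup>2) ^ m)))"
      using C(1) by (simp only: norm_mult norm_scaleR norm_divide norm_weight norm_ch mult_1_right abs_of_nonneg times_divide_eq_left times_divide_eq_right)
  qed
  show "AE p in spacetime. (\<lambda>N. case p of (s, x) \<Rightarrow> (\<integral>t. indicator {a<..b} t * kernel_at N (t - s) \<partial>lborel) * ch (- n) x * B s x)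
      \<longlonglongrightarrow> (case p of (s, x) \<Rightarrow> indicator {a<..b} s * ch (- n) x * B s x)"
    using AE_ST_fst_neq[of a] AE_ST_fst_neq[of b]
  proof eventually_elim
    case (elim p)
    then show ?case
      by (cases p) (auto intro!: tendsto_intros kernel_at_window_tendsto)
  qed
  qed
qed

text \<open>
  Joint blocks are grouped by the larger of the two indices. A group then has spatial frequencies
  at most \<open>2\<^sup>k\<close> and decay in \<open>k\<close> at the smaller of the two
  regularities.
\<close>

definition I :: "nat \<Rightarrow> (nat \<times> nat) set" where
  "I k = {(j, L). max j L = k}"

lemma I_subset: "I k \<subseteq> {..k} \<times> {..k}" by (auto simp: I_def)

lemma finite_I [simp]: "finite (I k)" using finite_subset[OF I_subset] by simp

definition U :: "nat \<Rightarrow> real \<Rightarrow> real ^ 'd \<Rightarrow> complex" where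
  "U k t x = (\<Sum>(j, L)\<in>I k. P_dy j (LP L B t) x)"

definition c :: "nat \<Rightarrow> int ^ 'd \<Rightarrow> real \<Rightarrow> complex" where
  "c k n t = (\<Sum>(j, L)\<in>I k. if n \<in> shell j then fourier_coeff (LP L B t) n else 0)"

lemma U_eq_trig: "U k t x = (\<Sum>n\<in>freq_cube (2 ^ k). c k n t * ch n x)"
proof -
  have "P_dy j (LP L B t) x = (\<Sum>n\<in>freq_cube (2 ^ k). (if n \<in> shell j then fourier_coeff (LP L B t) n else 0) * ch n x)"
    if "(j, L) \<in> I k" for j L
  proof -
    have "shell j \<subseteq> freq_cube (2 ^ k)" using that by (intro shell_subset) (auto simp: I_def)
    then show ?thesis
      unfolding P_dy_eq by (intro sum.mono_neutral_cong_left) auto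
  qed
  then have "U k t x = (\<Sum>(j, L)\<in>I k. \<Sum>n\<in>freq_cube (2 ^ k). (if n \<in> shell j then fourier_coeff (LP L B t) n else 0) * ch n x)"
    unfolding U_def by (intro sum.cong) auto
  also have "\<dots> = (\<Sum>n\<in>freq_cube (2 ^ k). \<Sum>(j, L)\<in>I k. (if n \<in> shell j then fourier_coeff (LP L B t) n else 0) * ch n x)"
    by (simp only: case_prod_beta') (rule sum.swap)
  finally show ?thesis unfolding c_def by (simp add: sum_distrib_right case_prod_beta')
qed

lemma sum_U: "(\<Sum>k\<le>N. U k t x) = (\<Sum>n\<in>freq_cube (2 ^ N). (\<Sum>L\<le>N. fourier_coeff (LP L B t) n) * ch n x)"
proof -
  have "(\<Sum>k\<le>N. U k t x) = (\<Sum>k\<in>{..N}. \<Sum>p\<in>{p \<in> {..N} \<times> {..N}. max (fst p) (snd p) = k}. P_dy (fst p) (LP (snd p) B t) x)"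
  proof (intro sum.cong refl)
    fix k assume "k \<in> {..N}"
    then have "I k = {p \<in> {..N} \<times> {..N}. max (fst p) (snd p) = k}" by (auto simp: I_def)
    then show "U k t x = (\<Sum>p\<in>{p \<in> {..N} \<times> {..N}. max (fst p) (snd p) = k}. P_dy (fst p) (LP (snd p) B t) x)"
      by (simp add: U_def case_prod_beta')
  qed
  also have "\<dots> = (\<Sum>p\<in>{..N} \<times> {..N}. P_dy (fst p) (LP (snd p) B t) x)"
    by (rule sum.group) auto
  also have "\<dots> = (\<Sum>j\<le>N. \<Sum>L\<le>N. P_dy j (LP L B t) x)"
    by (simp add: sum.cartesian_product case_prod_beta')
  also have "\<dots> = (\<Sum>L\<le>N. \<Sum>j\<le>N. P_dy j (LP L B t) x)" by (rule sum.swap)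
  also have "\<dots> = (\<Sum>L\<le>N. \<Sum>n\<in>freq_cube (2 ^ N). fourier_coeff (LP L B t) n * ch n x)"
    by (simp add: sum_P_dy P_le_eq)
  also have "\<dots> = (\<Sum>n\<in>freq_cube (2 ^ N). (\<Sum>L\<le>N. fourier_coeff (LP L B t) n) * ch n x)"
    by (subst sum.swap) (simp add: sum_distrib_right)
  finally show ?thesis .
qed

definition \<sigma> :: real where "\<sigma> = min \<theta> s"

sublocale trig: trig_blocks U c r "poly_exp_const \<sigma> * \<beta>" "\<sigma> / 2"
proof
  have \<sigma>: "0 < \<sigma>" using \<theta> s by (simp add: \<sigma>_def)
  show "U k t x = (\<Sum>n\<in>freq_cube (2 ^ k). c k n t * ch n x)" for k t x by (rule U_eq_trig)
  show "c k n \<in> borel_measurable borel" for k n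
    unfolding c_def[abs_def] case_prod_beta'
    using fourier_coeff_measurable[OF jointly_measurable_LP] by (intro borel_measurable_sum) auto
  show "1 < r" by (rule r)
  show "0 \<le> poly_exp_const \<sigma> * \<beta>" using \<beta> poly_exp_const_pos[OF \<sigma>] by simp
  show "0 < \<sigma> / 2" using \<sigma> by simp
  fix k
  have b: "Lnorm r spacetime (\<lambda>(t, x). ennreal (cmod (P_dy (fst i) (LP (snd i) B t) x))) \<le> ennreal (\<beta> * (2 powr (- \<sigma>)) ^ k)" if "i \<in> I k" for i
  proof -
    obtain j L where i: "i = (j, L)" by (cases i)
    have "(2 powr (- \<theta>)) ^ j * (2 powr (- s)) ^ L = 2 powr (- (\<theta> * real j + s * real L))"
      by (simp add: powr_realpow[symmetric] powr_powr powr_add[symmetric] mult.commute)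
    also have "\<dots> \<le> 2 powr (- (\<sigma> * real k))"
    proof -
      have "\<sigma> * real k \<le> \<theta> * real j + s * real L"
      proof (cases "j = k")
        case True
        have "\<sigma> * real k \<le> \<theta> * real k" by (intro mult_right_mono) (auto simp: \<sigma>_def)
        then show ?thesis using True s by (simp add: add_increasing2)
      next
        case False
        then have "L = k" using that by (auto simp: i I_def max_def split: if_splits)
        have "\<sigma> * real k \<le> s * real k" by (intro mult_right_mono) (auto simp: \<sigma>_def)
        then show ?thesis using \<open>L = k\<close> \<theta> by (simp add: add_increasing)
      qed
      then show ?thesis by simp
    qed
    also have "\<dots> = (2 powr (- \<sigma>)) ^ k"
      by (simp add: powr_realpow[symmetric] powr_powr)
    finally have "\<beta> * ((2 powr (- \<theta>)) ^ j * (2 powr (- s)) ^ L) \<le> \<beta> * (2 powr (- \<sigma>)) ^ k" using \<beta> by (intro mult_left_mono)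
    then show ?thesis using blocks[of j L] by (simp add: i mult.assoc) (meson ennreal_leI order_trans)
  qed
  have meas: "(\<lambda>(t, x). ennreal (cmod (P_dy (fst i) (LP (snd i) B t) x))) \<in> borel_measurable spacetime" for i :: "nat \<times> nat"
  proof (rule measurable_ST)
    note jointly_measurableD[OF jointly_measurable_P_dy[OF jointly_measurable_LP], measurable]
    show "(\<lambda>(t, x). ennreal (cmod (P_dy (fst i) (LP (snd i) B t) x))) \<in> borel_measurable (borel \<Otimes>\<^sub>M borel)" by measurable
  qed
  have "Lnorm r spacetime (\<lambda>(t, x). ennreal (cmod (U k t x))) \<le> Lnorm r spacetime (\<lambda>p. \<Sum>i\<in>I k. (case p of (t, x) \<Rightarrow> ennreal (cmod (P_dy (fst i) (LP (snd i) B t) x))))"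
  proof (rule Lnorm_mono)
    fix p :: "real \<times> (real ^ 'd)"
    obtain t x where p: "p = (t, x)" by (cases p)
    have "cmod (U k t x) \<le> (\<Sum>i\<in>I k. cmod (P_dy (fst i) (LP (snd i) B t) x))"
      unfolding U_def case_prod_beta' by (rule norm_sum)
    then show "(case p of (t, x) \<Rightarrow> ennreal (cmod (U k t x))) \<le> (\<Sum>i\<in>I k. (case p of (t, x) \<Rightarrow> ennreal (cmod (P_dy (fst i) (LP (snd i) B t) x))))"
      by (simp add: p ennreal_leI)
  qed (use r in simp)
  also have "\<dots> \<le> ennreal (real (card (I k)) powr (1 + 1 / r) * (\<beta> * (2 powr (- \<sigma>)) ^ k))"
    using r \<beta> meas b by (intro Lnorm_sum_le) auto
  also have "\<dots> \<le> ennreal (poly_exp_const \<sigma> * \<beta> * (2 powr (- (\<sigma> / 2))) ^ k)"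
  proof (rule ennreal_leI)
    have ne: "(k, k) \<in> I k" by (simp add: I_def)
    then have c1: "1 \<le> card (I k)" by (metis Suc_leI One_nat_def card_gt_0_iff empty_iff finite_I)
    have "card (I k) \<le> (k + 1)\<^sup>2"
      using card_mono[OF _ I_subset[of k]] by (simp add: power2_eq_square)
    then have c2: "real (card (I k)) \<le> (real (k + 1))\<^sup>2" by (metis of_nat_le_iff of_nat_power)
    have "real (card (I k)) powr (1 + 1 / r) \<le> real (card (I k)) powr 2"
      using r c1 by (intro powr_mono) (auto simp: field_simps)
    also have "\<dots> = (real (card (I k)))\<^sup>2" using c1 by simp
    also have "\<dots> \<le> ((real (k + 1))\<^sup>2)\<^sup>2" using c2 by (intro power_mono) auto
    also have "\<dots> = real (k + 1) ^ 4" by (simp flip: power_mult)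
    finally have "real (card (I k)) powr (1 + 1 / r) * (\<beta> * (2 powr (- \<sigma>)) ^ k) \<le> real (k + 1) ^ 4 * (\<beta> * (2 powr (- \<sigma>)) ^ k)"
      using \<beta> by (intro mult_right_mono) auto
    also have "\<dots> = \<beta> * (real (k + 1) ^ 4 * (2 powr (- \<sigma>)) ^ k)" by (simp add: mult_ac)
    also have "\<dots> \<le> \<beta> * (poly_exp_const \<sigma> * (2 powr (- (\<sigma> / 2))) ^ k)"
      by (intro mult_left_mono poly_exp_bound \<sigma> \<beta>)
    finally show "real (card (I k)) powr (1 + 1 / r) * (\<beta> * (2 powr (- \<sigma>)) ^ k) \<le> poly_exp_const \<sigma> * \<beta> * (2 powr (- (\<sigma> / 2))) ^ k"
      by (simp add: mult_ac)
  qed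
  finally show "Lnorm r spacetime (\<lambda>(t, x). ennreal (cmod (U k t x))) \<le> ennreal (poly_exp_const \<sigma> * \<beta> * (2 powr (- (\<sigma> / 2))) ^ k)" .
qed

lemma major_window_integrable: "integrable spacetime (\<lambda>(t, x). indicator {-K..K} t * enn2real (trig.major t x))"
proof (rule integrableI_bounded)
  note trig.major_meas[measurable]
  show "(\<lambda>(t, x). indicator {-K..K} t * enn2real (trig.major t x)) \<in> borel_measurable spacetime"
    by (rule measurable_ST) measurable
  define q' where "q' = r / (r - 1)"
  have q': "1 < q'" "1 / r + 1 / q' = 1" using r by (auto simp: q'_def field_simps)
  have m1: "(\<lambda>(t, x). trig.major t x) \<in> borel_measurable spacetime" by (rule measurable_ST) measurable
  have m2: "(\<lambda>(t, x). indicator {-K..K} t) \<in> borel_measurable (spacetime :: (real \<times> (real ^ 'd)) measure)" by (rule measurable_ST) measurable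
  have "(\<integral>\<^sup>+p. ennreal (norm (case p of (t, x) \<Rightarrow> indicator {-K..K} t * enn2real (trig.major t x))) \<partial>spacetime)
      \<le> (\<integral>\<^sup>+p. (case p of (t, x) \<Rightarrow> trig.major t x) * (case p of (t, x) \<Rightarrow> indicator {-K..K} t) \<partial>spacetime)"
    by (intro nn_integral_mono) (auto simp: indicator_def intro!: ennreal_enn2real_le)
  also have "\<dots> \<le> Lnorm r spacetime (\<lambda>(t, x). trig.major t x) * Lnorm q' spacetime (\<lambda>(t, x::real^'d). indicator {-K..K} t)"
    by (intro nn_integral_Hoelder r q' m1 m2)
  also have "\<dots> < \<infinity>"
  proof -
    have "Lnorm q' spacetime (\<lambda>(t, x::real^'d). indicator {-K..K} t) = Lnorm q' lborel (\<lambda>t. Lnorm q' (torus :: (real^'d) measure) (\<lambda>_. indicator {-K..K} t))"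
      using q' by (intro Lnorm_ST) auto
    also have "\<dots> \<le> Lnorm q' lborel (\<lambda>t. ennreal (torus_volume TYPE('d)) * indicator {-K..K} t)"
      using q' by (intro Lnorm_mono Lnorm_torus_const_le) auto
    also have "\<dots> = ennreal (torus_volume TYPE('d)) * Lnorm q' lborel (indicator {-K..K})"
      using q' by (intro Lnorm_cmult) auto
    also have "Lnorm q' lborel (indicator {-K..K}) = ennpow (emeasure lborel {-K..K}) (1 / q')"
    proof -
      have "(\<integral>\<^sup>+t. ennpow (indicator {-K..K} t) q' \<partial>lborel) = (\<integral>\<^sup>+t. indicator {-K..K} t \<partial>lborel)"
        by (intro nn_integral_cong) (auto simp: indicator_def ennpow_def)
      then show ?thesis by (simp add: Lnorm_def)
    qed
    also have "ennreal (torus_volume TYPE('d)) * \<dots> < \<infinity>"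
    proof -
      have "ennpow (emeasure lborel {-K..K}) (1 / q') < \<infinity>"
        using emeasure_lborel_cbox_finite[of "-K" K] by (auto simp: less_top[symmetric])
      then show ?thesis by (simp only: infinity_ennreal_def ennreal_mult_less_top ennreal_less_top simp_thms)
    qed
    finally have "Lnorm q' spacetime (\<lambda>(t, x::real^'d). indicator {-K..K} t) < \<infinity>" .
    moreover have "Lnorm r spacetime (\<lambda>(t, x). trig.major t x) < \<infinity>"
      using trig.Lnorm_major by (auto simp: less_top[symmetric] top_unique)
    ultimately show ?thesis by (auto simp: ennreal_mult_less_top)
  qed
  finally show "(\<integral>\<^sup>+p. ennreal (norm (case p of (t, x) \<Rightarrow> indicator {-K..K} t * enn2real (trig.major t x))) \<partial>spacetime) < \<infinity>" .
qed

lemma fourier_coeff_sum_U: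
  assumes "n \<in> freq_cube (2 ^ N)"
  shows "(\<integral>x. (\<Sum>k\<le>N. U k t x) * ch (- n) x \<partial>torus) = \<Phi> n N t"
proof -
  have "fourier_coeff (\<lambda>x. \<Sum>k\<le>N. U k t x) n = (\<Sum>L\<le>N. fourier_coeff (LP L B t) n)"
    unfolding sum_U using assms by (simp add: fourier_coeff_trig)
  then have "fourier_coeff (\<lambda>x. \<Sum>k\<le>N. U k t x) n * complex_of_real ((2 * pi) ^ CARD('d)) = \<Phi> n N t"
    by (simp only: sum_fourier_coeff_LP)
  moreover have "fourier_coeff f n * complex_of_real ((2 * pi) ^ CARD('d)) = (\<integral>x. f x * ch (- n) x \<partial>torus)" for f :: "real ^ 'd \<Rightarrow> complex"
    by (simp add: fourier_coeff_alt)
  ultimately show ?thesis by simp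
qed

lemma cmod_sum_U_le: "trig.major t x < \<infinity> \<Longrightarrow> cmod (\<Sum>k\<le>N. U k t x) \<le> enn2real (trig.major t x)"
proof -
  assume fin: "trig.major t x < \<infinity>"
  have "ennreal (cmod (\<Sum>k\<le>N. U k t x)) \<le> ennreal (\<Sum>k\<le>N. cmod (U k t x))" by (intro ennreal_leI norm_sum)
  also have "\<dots> = (\<Sum>k\<le>N. ennreal (cmod (U k t x)))" by simp
  also have "\<dots> \<le> trig.major t x"
    unfolding trig.major_def by (intro sum_le_suminf) auto
  finally have "enn2real (ennreal (cmod (\<Sum>k\<le>N. U k t x))) \<le> enn2real (trig.major t x)"
    using fin by (intro enn2real_mono) auto
  then show ?thesis by simp
qed

lemma window_subset: "{a<..b} \<subseteq> {- (\<bar>a\<bar> + \<bar>b\<bar>)..\<bar>a\<bar> + \<bar>b\<bar>}" for a b :: real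
  by auto

text \<open>
  The partial sums of the grouped blocks have the same Fourier coefficients as the time-mollified
  function, and they are dominated by the sum of the absolute values of the blocks, which is
  integrable on bounded time intervals.
\<close>

lemma series_window_tendsto:
  "(\<lambda>N. \<integral>t. indicator {a<..b} t * \<Phi> n N t \<partial>lborel)
    \<longlonglongrightarrow> (\<integral>(s, x). indicator {a<..b} s * ch (- n) x * trig.series s x \<partial>spacetime)"
proof -
  note trig.series_meas[measurable] trig.U_meas[measurable] trig.major_meas[measurable]
  define K where "K = \<bar>a\<bar> + \<bar>b\<bar>"
  have ind: "indicator {a<..b} t \<le> (indicator {-K..K} t :: real)" for t
    using window_subset[of a b] by (auto simp: indicator_def K_def)
  have dom: "cmod (indicator {a<..b} t * ch (- n) x * z) \<le> indicator {-K..K} t * enn2real (trig.major t x)"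
    if "cmod z \<le> enn2real (trig.major t x)" for t x z
    using mult_mono[OF ind[of t] that] by (auto simp: norm_mult indicator_def split: if_splits)
  have meas: "(\<lambda>(t, x). indicator {a<..b} t * ch (- n) x * (\<Sum>k\<le>N. U k t x)) \<in> borel_measurable spacetime" for N
    by (rule measurable_ST) measurable
  have AE_dom: "AE p in spacetime. norm (case p of (t, x) \<Rightarrow> indicator {a<..b} t * ch (- n) x * (\<Sum>k\<le>N. U k t x))
      \<le> (case p of (t, x) \<Rightarrow> indicator {-K..K} t * enn2real (trig.major t x))" for N
    using trig.AE_major_finite by eventually_elim (auto intro!: dom cmod_sum_U_le)
  have int: "integrable spacetime (\<lambda>(t, x). indicator {a<..b} t * ch (- n) x * (\<Sum>k\<le>N. U k t x))" for N
  proof (rule Bochner_Integration.integrable_bound[OF major_window_integrable[of K] meas])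
    show "AE p in spacetime. norm (case p of (t, x) \<Rightarrow> indicator {a<..b} t * ch (- n) x * (\<Sum>k\<le>N. U k t x))
      \<le> norm (case p of (t, x) \<Rightarrow> indicator {-K..K} t * enn2real (trig.major t x))"
      using AE_dom[of N] by eventually_elim (auto intro: order_trans[OF _ abs_ge_self])
  qed
  have eq: "(\<integral>(t, x). indicator {a<..b} t * ch (- n) x * (\<Sum>k\<le>N. U k t x) \<partial>spacetime) = (\<integral>t. indicator {a<..b} t * \<Phi> n N t \<partial>lborel)"
    if "n \<in> freq_cube (2 ^ N)" for N
  proof -
    have "(\<integral>(t, x). indicator {a<..b} t * ch (- n) x * (\<Sum>k\<le>N. U k t x) \<partial>spacetime)
        = (\<integral>t. \<integral>x. indicator {a<..b} t * ch (- n) x * (\<Sum>k\<le>N. U k t x) \<partial>torus \<partial>lborel)"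
      using ST.integral_fst'[OF int[of N]] by simp
    also have "\<dots> = (\<integral>t. indicator {a<..b} t * \<Phi> n N t \<partial>lborel)"
      unfolding fourier_coeff_sum_U[OF that, symmetric] integral_mult_right_zero[symmetric]
      by (intro Bochner_Integration.integral_cong refl) (simp add: mult_ac)
    finally show ?thesis .
  qed
  have "(\<lambda>N. \<integral>(t, x). indicator {a<..b} t * ch (- n) x * (\<Sum>k\<le>N. U k t x) \<partial>spacetime)
      \<longlonglongrightarrow> (\<integral>(s, x). indicator {a<..b} s * ch (- n) x * trig.series s x \<partial>spacetime)"
  proof (rule integral_dominated_convergence)
    show "integrable spacetime (\<lambda>(t, x). indicator {-K..K} t * enn2real (trig.major t x))"
      by (rule major_window_integrable)
    show "(\<lambda>(t, x). indicator {a<..b} t * ch (- n) x * trig.series t x) \<in> borel_measurable spacetime"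
      by (rule measurable_ST) measurable
    show "AE p in spacetime. (\<lambda>N. case p of (t, x) \<Rightarrow> indicator {a<..b} t * ch (- n) x * (\<Sum>k\<le>N. U k t x))
        \<longlonglongrightarrow> (case p of (t, x) \<Rightarrow> indicator {a<..b} t * ch (- n) x * trig.series t x)"
      using trig.AE_series_sums
    proof eventually_elim
      case (elim p)
      then have "(\<lambda>N. \<Sum>k\<le>N. U k (fst p) (snd p)) \<longlonglongrightarrow> trig.series (fst p) (snd p)"
        by (simp add: sums_def_le)
      then show ?case by (cases p) (auto intro!: tendsto_intros)
    qed
  qed (use meas AE_dom in auto)
  moreover obtain N0 where N0: "n \<in> freq_cube (2 ^ N0)"
  proof -
    define N where "N = nat (\<Sum>i\<in>UNIV. \<bar>n $ i\<bar>)"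
    have "\<bar>n $ i\<bar> \<le> int N" for i
      using member_le_sum[of i UNIV "\<lambda>i. \<bar>n $ i\<bar>"] by (simp add: N_def sum_nonneg)
    then have "n \<in> freq_cube N" by (simp add: freq_cube_def)
    moreover have "N \<le> 2 ^ N" by (rule less_imp_le[OF less_exp])
    ultimately have "n \<in> freq_cube (2 ^ N)" using freq_cube_mono[of N "2 ^ N"] by blast
    then show thesis by (rule that)
  qed
  have "\<forall>\<^sub>F N in sequentially. (\<integral>(t, x). indicator {a<..b} t * ch (- n) x * (\<Sum>k\<le>N. U k t x) \<partial>spacetime) = (\<integral>t. indicator {a<..b} t * \<Phi> n N t \<partial>lborel)"
    unfolding eventually_sequentially
  proof (intro exI allI impI eq)
    fix N assume "N0 \<le> N"
    then have "(2::nat) ^ N0 \<le> 2 ^ N" by (intro power_increasing) auto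
    then show "n \<in> freq_cube (2 ^ N)" using N0 freq_cube_mono by blast
  qed
  ultimately show ?thesis by (rule Lim_transform_eventually)
qed

lemma B_eq_series_window: "(\<integral>(s, x). indicator {a<..b} s * ch (- n) x * B s x \<partial>spacetime)
    = (\<integral>(s, x). indicator {a<..b} s * ch (- n) x * trig.series s x \<partial>spacetime)"
  by (rule LIMSEQ_unique[OF \<Phi>_window_tendsto series_window_tendsto])

text \<open>
  Both functions have the same Fourier coefficients in \<open>x\<close> when tested against time
  intervals, hence for almost every time, and uniqueness applies to their difference cut off in
  time. The Besov norm by itself only bounds the blocks; this identifies \<open>B\<close> with
  their sum.
\<close>

theorem AE_B_eq_series: "AE p in spacetime. B (fst p) (snd p) = trig.series (fst p) (snd p)"
proof -
  note trig.series_meas[measurable] trig.major_meas[measurable]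
  have "AE p in spacetime. \<bar>fst p\<bar> \<le> real k \<longrightarrow> B (fst p) (snd p) = trig.series (fst p) (snd p)" for k :: nat
  proof -
    define K where "K = real k + 1"
    have K: "0 < K" by (simp add: K_def)
    define R where "R t x = indicator {-K..K} t * (B t x - trig.series t x)" for t x
    have Rm [measurable]: "(\<lambda>(t, x). R t x) \<in> borel_measurable (borel \<Otimes>\<^sub>M borel)"
      unfolding R_def by measurable
    have Rj: "jointly_measurable R" using Rm by (simp only: borel_prod)
    have iB: "integrable spacetime (\<lambda>(t, x). (indicator {-K..K} t * ch n x) * B t x)" for n by (rule integrable_B_window)
    have iS: "integrable spacetime (\<lambda>(t, x). (indicator {-K..K} t * ch n x) * trig.series t x)" for n
    proof (rule Bochner_Integration.integrable_bound[OF major_window_integrable[of K]])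
      show "(\<lambda>(t, x). (indicator {-K..K} t * ch n x) * trig.series t x) \<in> borel_measurable spacetime"
        by (rule measurable_ST) measurable
      show "AE p in spacetime. norm (case p of (t, x) \<Rightarrow> (indicator {-K..K} t * ch n x) * trig.series t x)
        \<le> norm (case p of (t, x) \<Rightarrow> indicator {-K..K} t * enn2real (trig.major t x))"
        using trig.AE_major_finite
      proof eventually_elim
        case (elim p)
        obtain t x where p: "p = (t, x)" by (cases p)
        have "enn2real (ennreal (cmod (trig.series t x))) \<le> enn2real (trig.major t x)"
          using elim by (intro enn2real_mono trig.series_le_major) (simp add: p)
        then show ?case by (simp add: p norm_mult indicator_def)
      qed
    qed
    have Rint: "integrable spacetime (\<lambda>(t, x). R t x)"
      using Bochner_Integration.integrable_diff[OF iB[of 0] iS[of 0]]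
      by (simp add: R_def[abs_def] case_prod_beta' right_diff_distrib)
    have zero: "AE t in lborel. fourier_coeff (R t) n = 0" for n
    proof (rule AE_zero_if_interval_integrals_zero[where K=K])
      have "integrable lborel (\<lambda>t. \<integral>x. R t x * ch (- n) x \<partial>torus)"
      proof -
        have "integrable spacetime (\<lambda>(t, x). R t x * ch (- n) x)"
          using Bochner_Integration.integrable_diff[OF iB[of "- n"] iS[of "- n"]]
          by (simp add: R_def[abs_def] case_prod_beta' algebra_simps)
        from ST.integrable_fst'[OF this] show ?thesis by simp
      qed
      then show "integrable lborel (\<lambda>t. fourier_coeff (R t) n)"
        unfolding fourier_coeff_alt by (rule integrable_divide)
      show "fourier_coeff (R t) n = 0" if "K < \<bar>t\<bar>" for t
        using that by (simp add: fourier_coeff_alt R_def indicator_def abs_le_iff split: if_splits) (auto simp: abs_if split: if_splits)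
      fix a b :: real
      \<comment> \<open>The cutoff only shortens the interval, up to the single time \<open>- K\<close>.\<close>
      define a' where "a' = max a (- K)"
      define b' where "b' = min b K"
      have ab: "{a'<..b'} \<subseteq> {-K..K}" by (auto simp: a'_def b'_def)
      have cmp: "cmod (indicator {a'<..b'} t * y * z) \<le> cmod (indicator {-K..K} t * y * z)" for t y z
      proof (cases "t \<in> {a'<..b'}")
        case True
        then have "t \<in> {-K..K}" using ab by blast
        then show ?thesis using True by simp
      qed simp
      have i1: "integrable spacetime (\<lambda>(t, x). indicator {a'<..b'} t * ch (- n) x * B t x)"
      proof (rule Bochner_Integration.integrable_bound[OF iB[of "- n"]])
        show "(\<lambda>(t, x). indicator {a'<..b'} t * ch (- n) x * B t x) \<in> borel_measurable spacetime" by (rule measurable_ST) measurable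
        show "AE p in spacetime. norm (case p of (t, x) \<Rightarrow> indicator {a'<..b'} t * ch (- n) x * B t x)
            \<le> norm (case p of (t, x) \<Rightarrow> indicator {-K..K} t * ch (- n) x * B t x)"
          by (intro AE_I2) (simp only: case_prod_beta' cmp)
      qed
      have i2: "integrable spacetime (\<lambda>(t, x). indicator {a'<..b'} t * ch (- n) x * trig.series t x)"
      proof (rule Bochner_Integration.integrable_bound[OF iS[of "- n"]])
        show "(\<lambda>(t, x). indicator {a'<..b'} t * ch (- n) x * trig.series t x) \<in> borel_measurable spacetime" by (rule measurable_ST) measurable
        show "AE p in spacetime. norm (case p of (t, x) \<Rightarrow> indicator {a'<..b'} t * ch (- n) x * trig.series t x)
            \<le> norm (case p of (t, x) \<Rightarrow> indicator {-K..K} t * ch (- n) x * trig.series t x)"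
          by (intro AE_I2) (simp only: case_prod_beta' cmp)
      qed
      have i3: "integrable spacetime (\<lambda>(t, x). indicator {a'<..b'} t * ch (- n) x * (B t x - trig.series t x))"
        using Bochner_Integration.integrable_diff[OF i1 i2] by (simp add: case_prod_beta' right_diff_distrib)
      have "(\<integral>t. indicator {a<..b} t * (\<integral>x. R t x * ch (- n) x \<partial>torus) \<partial>lborel)
          = (\<integral>t. \<integral>x. indicator {a'<..b'} t * ch (- n) x * (B t x - trig.series t x) \<partial>torus \<partial>lborel)"
      proof (rule integral_cong_AE)
        have m1: "(\<lambda>(t, x). R t x * ch (- n) x) \<in> borel_measurable (lborel \<Otimes>\<^sub>M torus)"
          by (rule measurable_ST) measurable
        show "(\<lambda>t. indicator {a<..b} t * (\<integral>x. R t x * ch (- n) x \<partial>torus)) \<in> borel_measurable lborel"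
          using torus.borel_measurable_lebesgue_integral[OF m1] by (intro borel_measurable_times) auto
        have m2: "(\<lambda>(t, x). indicator {a'<..b'} t * ch (- n) x * (B t x - trig.series t x)) \<in> borel_measurable (lborel \<Otimes>\<^sub>M torus)"
          by (rule measurable_ST) measurable
        show "(\<lambda>t. \<integral>x. indicator {a'<..b'} t * ch (- n) x * (B t x - trig.series t x) \<partial>torus) \<in> borel_measurable lborel"
          by (rule torus.borel_measurable_lebesgue_integral[OF m2])
        show "AE t in lborel. indicator {a<..b} t * (\<integral>x. R t x * ch (- n) x \<partial>torus)
            = (\<integral>x. indicator {a'<..b'} t * ch (- n) x * (B t x - trig.series t x) \<partial>torus)"
          using AE_lborel_singleton[of "- K"]
        proof eventually_elim
          case (elim t)
          then have "indicator {a<..b} t * indicator {-K..K} t = (indicator {a'<..b'} t :: complex)"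
            by (auto simp: indicator_def a'_def b'_def)
          then have "indicator {a<..b} t * (R t x * ch (- n) x) = indicator {a'<..b'} t * ch (- n) x * (B t x - trig.series t x)" for x
            by (simp add: R_def mult_ac)
          then show ?case by (simp only: integral_mult_right_zero[symmetric])
        qed
      qed
      also have "\<dots> = (\<integral>(t, x). indicator {a'<..b'} t * ch (- n) x * (B t x - trig.series t x) \<partial>spacetime)"
        using ST.integral_fst'[OF i3] by simp
      also have "\<dots> = (\<integral>(t, x). indicator {a'<..b'} t * ch (- n) x * B t x \<partial>spacetime) - (\<integral>(t, x). indicator {a'<..b'} t * ch (- n) x * trig.series t x \<partial>spacetime)"
        using Bochner_Integration.integral_diff[OF i1 i2] by (simp add: case_prod_beta' right_diff_distrib)
      also have "\<dots> = 0" by (simp add: B_eq_series_window)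
      finally show "(\<integral>t. indicator {a<..b} t * fourier_coeff (R t) n \<partial>lborel) = 0"
        by (simp add: fourier_coeff_alt)
    qed
    have "AE p in spacetime. (case p of (t, x) \<Rightarrow> R t x) = 0"
      by (rule AE_zero_if_fourier_zero[OF Rj Rint _ K zero]) (auto simp: R_def indicator_def)
    then show ?thesis
    proof eventually_elim
      case (elim p)
      then show ?case by (cases p) (auto simp: R_def K_def indicator_def abs_le_iff split: if_splits)
    qed
  qed
  then have "AE p in spacetime. \<forall>k::nat. \<bar>fst p\<bar> \<le> real k \<longrightarrow> B (fst p) (snd p) = trig.series (fst p) (snd p)"
    unfolding AE_all_countable by blast
  then show ?thesis
  proof eventually_elim
    case (elim p)
    then show ?case using real_arch_simple[of "\<bar>fst p\<bar>"] by blast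
  qed
qed

end

section \<open>Random series with Gaussian coefficients\<close>

lemma nn_integral_lborel_shift_complex:
  fixes f :: "complex \<Rightarrow> ennreal"
  assumes [measurable]: "f \<in> borel_measurable borel"
  shows "(\<integral>\<^sup>+z. f (z + a) \<partial>lborel) = (\<integral>\<^sup>+z. f z \<partial>lborel)"
proof -
  have "(\<integral>\<^sup>+z. f z \<partial>lborel) = (\<integral>\<^sup>+z. f z \<partial>(distr lborel borel ((+) a)))"
    by (simp add: lborel_distr_plus)
  also have "\<dots> = (\<integral>\<^sup>+z. f (z + a) \<partial>lborel)"
    by (subst nn_integral_distr) (auto simp: add.commute)
  finally show ?thesis ..
qed

text \<open>
  Completing the square in the density turns the integral into a translate of the total mass.
\<close>

lemma gaussian_exp_moment:
  assumes "prob_space M" and X: "standard_complex_gaussian M X"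
  shows "(\<integral>\<^sup>+\<omega>. ennreal (exp (Re (c * X \<omega>))) \<partial>M) = ennreal (exp ((cmod c)\<^sup>2 / 4))"
proof -
  interpret prob_space M by fact
  let ?f = "\<lambda>z. ennreal (exp (- (cmod z)\<^sup>2) / pi)"
  have D: "distributed M lborel X ?f" using X by (simp add: standard_complex_gaussian_def)
  have one: "(\<integral>\<^sup>+z. ?f z \<partial>lborel) = 1"
    using distributed_nn_integral[OF D, of "\<lambda>_. 1"] by (simp add: emeasure_space_1)
  \<comment> \<open>The centre of the translated Gaussian.\<close>
  define a where "a = cnj c / 2"
  have sq: "- (cmod z)\<^sup>2 + Re (c * z) = - (cmod (z - a))\<^sup>2 + (cmod c)\<^sup>2 / 4" for z
    unfolding cmod_power2 by (simp add: a_def power2_eq_square field_simps)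
  have "(\<integral>\<^sup>+\<omega>. ennreal (exp (Re (c * X \<omega>))) \<partial>M) = (\<integral>\<^sup>+z. ?f z * ennreal (exp (Re (c * z))) \<partial>lborel)"
    by (rule distributed_nn_integral[OF D, symmetric]) measurable
  also have "\<dots> = (\<integral>\<^sup>+z. ennreal (exp ((cmod c)\<^sup>2 / 4)) * ?f (z + - a) \<partial>lborel)"
  proof (intro nn_integral_cong)
    fix z :: complex
    have "exp (- (cmod z)\<^sup>2) / pi * exp (Re (c * z)) = exp (- (cmod z)\<^sup>2 + Re (c * z)) / pi" by (simp only: exp_add) simp
    also have "\<dots> = exp ((cmod c)\<^sup>2 / 4) * (exp (- (cmod (z + - a))\<^sup>2) / pi)"
      unfolding sq exp_add by simp
    finally show "?f z * ennreal (exp (Re (c * z))) = ennreal (exp ((cmod c)\<^sup>2 / 4)) * ?f (z + - a)"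
      by (subst (1 2) ennreal_mult[symmetric]) auto
  qed
  also have "\<dots> = ennreal (exp ((cmod c)\<^sup>2 / 4)) * (\<integral>\<^sup>+z. ?f (z + - a) \<partial>lborel)"
    by (rule nn_integral_cmult) measurable
  also have "(\<integral>\<^sup>+z. ?f (z + - a) \<partial>lborel) = 1"
    using nn_integral_lborel_shift_complex[of ?f "- a"] one by simp
  finally show ?thesis by simp
qed

locale gaussian_family = prob_space M for M :: "'w measure" +
  fixes g :: "int ^ 'd \<Rightarrow> 'w \<Rightarrow> complex"
  assumes indep: "indep_vars (\<lambda>_. borel) g UNIV"
    and gauss: "\<And>n. standard_complex_gaussian M (g n)"
begin

lemma g_meas [measurable]: "g n \<in> borel_measurable M"
  using indep by (auto simp: indep_vars_def)

lemma exp_moment_sum: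
  assumes "finite A"
  shows "(\<integral>\<^sup>+\<omega>. ennreal (exp (Re (\<Sum>n\<in>A. c n * g n \<omega>))) \<partial>M) = ennreal (exp ((\<Sum>n\<in>A. (cmod (c n))\<^sup>2) / 4))"
proof -
  have "indep_vars (\<lambda>_. borel) (\<lambda>n \<omega>. ennreal (exp (Re (c n * g n \<omega>)))) A"
    by (rule indep_vars_compose2[OF indep_vars_subset[OF indep]]) auto
  then have "(\<integral>\<^sup>+\<omega>. (\<Prod>n\<in>A. ennreal (exp (Re (c n * g n \<omega>)))) \<partial>M) = (\<Prod>n\<in>A. \<integral>\<^sup>+\<omega>. ennreal (exp (Re (c n * g n \<omega>))) \<partial>M)"
    by (intro indep_vars_nn_integral assms) auto
  also have "\<dots> = (\<Prod>n\<in>A. ennreal (exp ((cmod (c n))\<^sup>2 / 4)))"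
    by (intro prod.cong refl gaussian_exp_moment[OF prob_space_axioms gauss])
  also have "\<dots> = ennreal (\<Prod>n\<in>A. exp ((cmod (c n))\<^sup>2 / 4))"
    by (simp add: prod_ennreal)
  also have "(\<Prod>n\<in>A. exp ((cmod (c n))\<^sup>2 / 4)) = exp ((\<Sum>n\<in>A. (cmod (c n))\<^sup>2) / 4)"
    by (simp add: exp_sum[OF assms] sum_divide_distrib)
  finally have "(\<integral>\<^sup>+\<omega>. ennreal (\<Prod>n\<in>A. exp (Re (c n * g n \<omega>))) \<partial>M) = ennreal (exp ((\<Sum>n\<in>A. (cmod (c n))\<^sup>2) / 4))"
    by (simp only: prod_ennreal exp_ge_zero)
  then show ?thesis
    by (simp only: Re_sum exp_sum[OF assms])
qed

text \<open>
  Reduces exponential moments of the modulus to those of real linear functionals, which are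
  explicit.
\<close>

lemma exp_norm_le:
  "exp (cmod z) \<le> (exp (Re (2 * z)) + exp (Re (- 2 * z)) + exp (Re (- 2 * \<i> * z)) + exp (Re (2 * \<i> * z))) / 2"
proof -
  have e: "exp (2 * \<bar>r\<bar>) \<le> exp (2 * r) + exp (- 2 * r)" for r :: real by (cases "0 \<le> r") auto
  have "exp (cmod z) \<le> exp (\<bar>Re z\<bar> + \<bar>Im z\<bar>)" by (simp add: cmod_le)
  also have "\<dots> = exp \<bar>Re z\<bar> * exp \<bar>Im z\<bar>" by (rule exp_add)
  also have "\<dots> \<le> ((exp \<bar>Re z\<bar>)\<^sup>2 + (exp \<bar>Im z\<bar>)\<^sup>2) / 2"
    using sum_squares_bound[of "exp \<bar>Re z\<bar>" "exp \<bar>Im z\<bar>"] by simp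
  also have "\<dots> = (exp (2 * \<bar>Re z\<bar>) + exp (2 * \<bar>Im z\<bar>)) / 2" by (simp add: exp_double)
  also have "\<dots> \<le> ((exp (2 * Re z) + exp (- 2 * Re z)) + (exp (2 * Im z) + exp (- 2 * Im z))) / 2"
    using e[of "Re z"] e[of "Im z"] by simp
  finally show ?thesis by simp
qed

lemma exp_norm_moment:
  assumes "finite A"
  shows "(\<integral>\<^sup>+\<omega>. ennreal (exp (cmod (\<Sum>n\<in>A. c n * g n \<omega>))) \<partial>M) \<le> ennreal (2 * exp (\<Sum>n\<in>A. (cmod (c n))\<^sup>2))"
proof -
  let ?S = "\<lambda>\<omega>. \<Sum>n\<in>A. c n * g n \<omega>"
  let ?E = "ennreal (exp (\<Sum>n\<in>A. (cmod (c n))\<^sup>2))"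
  have mom: "(\<integral>\<^sup>+\<omega>. ennreal (exp (Re (l * ?S \<omega>))) \<partial>M) = ?E" if l: "cmod l = 2" for l
  proof -
    have "(\<integral>\<^sup>+\<omega>. ennreal (exp (Re (\<Sum>n\<in>A. (l * c n) * g n \<omega>))) \<partial>M) = ennreal (exp ((\<Sum>n\<in>A. (cmod (l * c n))\<^sup>2) / 4))"
      by (rule exp_moment_sum[OF assms])
    also have "(\<Sum>n\<in>A. (cmod (l * c n))\<^sup>2) / 4 = (\<Sum>n\<in>A. (cmod (c n))\<^sup>2)"
      by (simp add: norm_mult power_mult_distrib l sum_divide_distrib)
    finally show ?thesis by (simp only: mult.assoc sum_distrib_left[symmetric])
  qed
  have "(\<integral>\<^sup>+\<omega>. ennreal (exp (cmod (?S \<omega>))) \<partial>M)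
      \<le> (\<integral>\<^sup>+\<omega>. ennreal (1 / 2) * (((ennreal (exp (Re (2 * ?S \<omega>))) + ennreal (exp (Re (- 2 * ?S \<omega>)))) + ennreal (exp (Re (- 2 * \<i> * ?S \<omega>)))) + ennreal (exp (Re (2 * \<i> * ?S \<omega>)))) \<partial>M)"
  proof (intro nn_integral_mono)
    fix \<omega>
    have "ennreal (exp (cmod (?S \<omega>))) \<le> ennreal (1 / 2 * (((exp (Re (2 * ?S \<omega>)) + exp (Re (- 2 * ?S \<omega>))) + exp (Re (- 2 * \<i> * ?S \<omega>))) + exp (Re (2 * \<i> * ?S \<omega>))))"
      using exp_norm_le[of "?S \<omega>"] by (intro ennreal_leI) simp
    also have "\<dots> = ennreal (1 / 2) * (((ennreal (exp (Re (2 * ?S \<omega>))) + ennreal (exp (Re (- 2 * ?S \<omega>)))) + ennreal (exp (Re (- 2 * \<i> * ?S \<omega>)))) + ennreal (exp (Re (2 * \<i> * ?S \<omega>))))"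
      by (simp only: ennreal_mult ennreal_plus exp_ge_zero add_nonneg_nonneg zero_le_divide_1_iff zero_le_numeral)
    finally show "ennreal (exp (cmod (?S \<omega>))) \<le> ennreal (1 / 2) * (((ennreal (exp (Re (2 * ?S \<omega>))) + ennreal (exp (Re (- 2 * ?S \<omega>)))) + ennreal (exp (Re (- 2 * \<i> * ?S \<omega>)))) + ennreal (exp (Re (2 * \<i> * ?S \<omega>))))" .
  qed
  also have "\<dots> = ennreal (1 / 2) * (((?E + ?E) + ?E) + ?E)"
    by (subst nn_integral_cmult, measurable, subst nn_integral_add, measurable, subst nn_integral_add, measurable, subst nn_integral_add, measurable)
       (simp only: mom norm_mult norm_minus_cancel norm_numeral norm_ii mult_1_right)
  also have "\<dots> = ennreal (1 / 2 * (((exp (\<Sum>n\<in>A. (cmod (c n))\<^sup>2) + exp (\<Sum>n\<in>A. (cmod (c n))\<^sup>2)) + exp (\<Sum>n\<in>A. (cmod (c n))\<^sup>2)) + exp (\<Sum>n\<in>A. (cmod (c n))\<^sup>2)))"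
    by (simp only: ennreal_mult ennreal_plus exp_ge_zero add_nonneg_nonneg zero_le_divide_1_iff zero_le_numeral)
  finally show ?thesis by simp
qed

end

text \<open>
  The \<open>q\<close>-th moment through an exponential moment with the growth
  \<open>\<mu>\<^sup>q\<close>: above the level \<open>\<mu> \<ge> q\<close> the power grows more
  slowly than the exponential. The level will depend on the dyadic index.
\<close>

lemma powr_le_exp_excess:
  fixes u \<mu> q :: real
  assumes "0 \<le> u" "0 < q" "q \<le> \<mu>"
  shows "u powr q \<le> \<mu> powr q * (1 + exp (u - \<mu>))"
proof (cases "u \<le> \<mu>")
  case True
  then have "u powr q \<le> \<mu> powr q" using assms by (intro powr_mono2) auto
  also have "\<dots> \<le> \<mu> powr q * (1 + exp (u - \<mu>))" by (simp add: distrib_left)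
  finally show ?thesis .
next
  case False
  have pos: "0 < \<mu>" "0 < u / \<mu>" using assms False by auto
  have "q * ln (u / \<mu>) \<le> q * (u / \<mu> - 1)" using pos assms by (intro mult_left_mono ln_le_minus_one) auto
  also have "\<dots> = (q / \<mu>) * (u - \<mu>)" using pos by (simp add: field_simps)
  also have "\<dots> \<le> 1 * (u - \<mu>)" using assms False pos by (intro mult_right_mono) auto
  finally have "(u / \<mu>) powr q \<le> exp (u - \<mu>)" using pos by (simp add: powr_def)
  then have "\<mu> powr q * (u / \<mu>) powr q \<le> \<mu> powr q * (1 + exp (u - \<mu>))" by (intro mult_left_mono) auto
  moreover have "\<mu> powr q * (u / \<mu>) powr q = u powr q" using pos assms by (simp add: powr_mult[symmetric])
  ultimately show ?thesis by simp
qed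

lemma nn_integral_window_const:
  "(\<integral>\<^sup>+(t, x). indicator {-1..1} t * e \<partial>(spacetime :: (real \<times> (real ^ 'd)) measure)) = ennreal (2 * torus_volume TYPE('d)) * e"
proof -
  have "(\<integral>\<^sup>+(t, x). indicator {-1..1} t * e \<partial>(spacetime :: (real \<times> (real ^ 'd)) measure))
      = (\<integral>\<^sup>+t. \<integral>\<^sup>+x. indicator {-1..1} t * e \<partial>(torus :: (real ^ 'd) measure) \<partial>(lborel :: real measure))"
    by (rule nn_integral_ST) measurable
  also have "\<dots> = (\<integral>\<^sup>+t. (e * ennreal (torus_volume TYPE('d))) * indicator {-1..1} t \<partial>(lborel :: real measure))"
    unfolding nn_integral_const emeasure_torus_volume by (simp only: mult_ac)
  also have "\<dots> = (e * ennreal (torus_volume TYPE('d))) * emeasure lborel {-1..1::real}"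
    by (rule nn_integral_cmult_indicator) simp
  also have "\<dots> = ennreal (2 * torus_volume TYPE('d)) * e"
    using torus_volume_ge_1[where 'd='d] by (simp add: ennreal_mult mult_ac)
  finally show ?thesis .
qed

definition random_const :: "'d::finite itself \<Rightarrow> real \<Rightarrow> real" where
  "random_const D \<gamma> = (2 * torus_volume D + 1) * poly_exp_const \<gamma>"

lemma random_const_pos: "0 < \<gamma> \<Longrightarrow> 0 < random_const TYPE('d::finite) \<gamma>"
  using poly_exp_const_pos[of \<gamma>] torus_volume_ge_1[where 'd='d] by (simp add: random_const_def)

text \<open>
  Coefficients that have \<open>\<gamma>\<close> derivatives in the sense of variances, uniformly
  over the dyadic blocks.
\<close>

locale gaussian_series = gaussian_family M g for M :: "'w measure" and g :: "int ^ 'd \<Rightarrow> 'w \<Rightarrow> complex" +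
  fixes b :: "int ^ 'd \<Rightarrow> complex" and \<gamma> V :: real
  assumes \<gamma>: "0 < \<gamma>"
    and var: "\<And>j. (\<Sum>n\<in>shell j. (2 powr (\<gamma> * real j) * cmod (b n))\<^sup>2) \<le> V"
begin

definition phase :: "int ^ 'd \<Rightarrow> real \<Rightarrow> complex" where
  "phase n t = cis (- t * (norm (rvec n))\<^sup>2)"

lemma phase_meas [measurable]: "phase n \<in> borel_measurable borel"
  unfolding phase_def[abs_def] cis_conv_exp by measurable

lemma norm_phase [simp]: "cmod (phase n t) = 1" by (simp add: phase_def)

text \<open>
  The dyadic block number \<open>j\<close> of the linear evolution of the random data.
\<close>

definition F :: "'w \<Rightarrow> nat \<Rightarrow> real \<Rightarrow> real ^ 'd \<Rightarrow> complex" where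
  "F \<omega> j t x = (\<Sum>n\<in>shell j. b n * phase n t * ch n x * g n \<omega>)"

definition X :: "nat \<Rightarrow> 'w \<Rightarrow> real \<Rightarrow> real ^ 'd \<Rightarrow> real" where
  "X j \<omega> t x = 2 powr (\<gamma> * real j) * cmod (F \<omega> j t x)"

text \<open>
  A single random variable that controls all blocks at once. The weights
  \<open>2\<^sup>-\<^sup>j\<close> make its expectation finite and cost a factor
  \<open>2\<^sup>j\<close> in the exponential integral of block \<open>j\<close>, which amounts to
  a term linear in \<open>j\<close> in the norm of the block.
\<close>

definition Y :: "'w \<Rightarrow> ennreal" where
  "Y \<omega> = (\<Sum>j. ennreal ((1 / 2) ^ j) * (\<integral>\<^sup>+(t, x). indicator {-1..1} t * ennreal (exp (X j \<omega> t x)) \<partial>spacetime))"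

lemma F_meas: "(\<lambda>(\<omega>, t, x). F \<omega> j t x) \<in> borel_measurable (M \<Otimes>\<^sub>M (borel \<Otimes>\<^sub>M borel))"
  unfolding F_def by measurable

lemma expX_meas: "(\<lambda>(\<omega>, t, x). indicator {-1..1} t * ennreal (exp (X j \<omega> t x))) \<in> borel_measurable (M \<Otimes>\<^sub>M (spacetime :: (real \<times> (real ^ 'd)) measure))"
proof -
  have p: "(\<lambda>p. p) \<in> measurable (spacetime :: (real \<times> (real ^ 'd)) measure) (borel \<Otimes>\<^sub>M borel)"
    unfolding borel_prod by (rule measurable_spacetime) simp
  have "fst \<in> measurable (M \<Otimes>\<^sub>M (spacetime :: (real \<times> (real ^ 'd)) measure)) M"
    by (rule measurable_fst)
  moreover have "snd \<in> measurable (M \<Otimes>\<^sub>M (spacetime :: (real \<times> (real ^ 'd)) measure)) (borel \<Otimes>\<^sub>M borel)"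
    by (rule measurable_compose[OF measurable_snd p])
  ultimately have "(\<lambda>q. (fst q, snd q)) \<in> measurable (M \<Otimes>\<^sub>M (spacetime :: (real \<times> (real ^ 'd)) measure)) (M \<Otimes>\<^sub>M (borel \<Otimes>\<^sub>M borel))"
    by (rule measurable_Pair)
  then have id: "(\<lambda>q. q) \<in> measurable (M \<Otimes>\<^sub>M (spacetime :: (real \<times> (real ^ 'd)) measure)) (M \<Otimes>\<^sub>M (borel \<Otimes>\<^sub>M borel))" by simp
  define G where "G q = (case q of (\<omega>, t, x) \<Rightarrow> F \<omega> j t x)" for q
  have [measurable]: "G \<in> borel_measurable (M \<Otimes>\<^sub>M (borel \<Otimes>\<^sub>M borel))"
    unfolding G_def[abs_def] by (rule F_meas)
  have "(\<lambda>q. indicator {-1..1} (fst (snd q)) * ennreal (exp (2 powr (\<gamma> * real j) * cmod (G q)))) \<in> borel_measurable (M \<Otimes>\<^sub>M (borel \<Otimes>\<^sub>M borel))"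
    by measurable
  from measurable_compose[OF id this]
  have "(\<lambda>q. indicator {-1..1} (fst (snd q)) * ennreal (exp (2 powr (\<gamma> * real j) * cmod (G q)))) \<in> borel_measurable (M \<Otimes>\<^sub>M (spacetime :: (real \<times> (real ^ 'd)) measure))" .
  moreover have "(\<lambda>q. indicator {-1..1} (fst (snd q)) * ennreal (exp (2 powr (\<gamma> * real j) * cmod (G q)))) = (\<lambda>(\<omega>, t, x). indicator {-1..1} t * ennreal (exp (X j \<omega> t x)))"
    by (rule ext) (simp only: case_prod_beta' G_def X_def)
  ultimately show ?thesis by (simp only:)
qed

lemma window_meas: "(\<lambda>\<omega>. \<integral>\<^sup>+(t, x). indicator {-1..1} t * ennreal (exp (X j \<omega> t x)) \<partial>spacetime) \<in> borel_measurable M"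
  by (rule ST.borel_measurable_nn_integral) (rule expX_meas)

lemma window_cmult_meas: "(\<lambda>\<omega>. c * (\<integral>\<^sup>+(t, x). indicator {-1..1} t * ennreal (exp (X j \<omega> t x)) \<partial>spacetime)) \<in> borel_measurable M"
  by (rule borel_measurable_times_ennreal[OF borel_measurable_const window_meas])

lemma Y_meas: "Y \<in> borel_measurable M"
  unfolding Y_def[abs_def] by (rule borel_measurable_suminf_order) (rule window_cmult_meas)

lemma X_exp_moment: "(\<integral>\<^sup>+\<omega>. ennreal (exp (X j \<omega> t x)) \<partial>M) \<le> ennreal (2 * exp V)"
proof -
  let ?c = "\<lambda>n. complex_of_real (2 powr (\<gamma> * real j)) * (b n * phase n t * ch n x)"
  have "X j \<omega> t x = cmod (\<Sum>n\<in>shell j. ?c n * g n \<omega>)" for \<omega>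
  proof -
    have "(\<Sum>n\<in>shell j. ?c n * g n \<omega>) = complex_of_real (2 powr (\<gamma> * real j)) * F \<omega> j t x"
      by (simp add: F_def sum_distrib_left mult.assoc)
    then show ?thesis by (simp add: X_def norm_mult)
  qed
  then have "(\<integral>\<^sup>+\<omega>. ennreal (exp (X j \<omega> t x)) \<partial>M) \<le> ennreal (2 * exp (\<Sum>n\<in>shell j. (cmod (?c n))\<^sup>2))"
    using exp_norm_moment[of "shell j" ?c] by simp
  also have "(\<Sum>n\<in>shell j. (cmod (?c n))\<^sup>2) = (\<Sum>n\<in>shell j. (2 powr (\<gamma> * real j) * cmod (b n))\<^sup>2)"
    by (simp add: norm_mult)
  also have "ennreal (2 * exp \<dots>) \<le> ennreal (2 * exp V)" using var[of j] by (intro ennreal_leI) simp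
  finally show ?thesis .
qed

lemma Y_expectation: "(\<integral>\<^sup>+\<omega>. Y \<omega> \<partial>M) \<le> ennreal (8 * torus_volume TYPE('d) * exp V)"
proof -
  interpret MST: pair_sigma_finite M "spacetime :: (real \<times> (real ^ 'd)) measure"
    by (intro pair_sigma_finite.intro ST.sigma_finite_measure_axioms sigma_finite_measure_axioms)
  have Vp: "0 \<le> torus_volume TYPE('d)" using torus_volume_ge_1[where 'd='d] by simp
  have one: "(\<integral>\<^sup>+\<omega>. (\<integral>\<^sup>+(t, x). indicator {-1..1} t * ennreal (exp (X j \<omega> t x)) \<partial>spacetime) \<partial>M) \<le> ennreal (4 * torus_volume TYPE('d) * exp V)" for j
  proof -
    have "(\<integral>\<^sup>+\<omega>. (\<integral>\<^sup>+p. (case p of (t, x) \<Rightarrow> indicator {-1..1} t * ennreal (exp (X j \<omega> t x))) \<partial>spacetime) \<partial>M)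
        = (\<integral>\<^sup>+p. (\<integral>\<^sup>+\<omega>. (case p of (t, x) \<Rightarrow> indicator {-1..1} t * ennreal (exp (X j \<omega> t x))) \<partial>M) \<partial>spacetime)"
      by (rule MST.Fubini'[symmetric]) (use expX_meas in \<open>simp add: case_prod_beta'\<close>)
    also have "\<dots> \<le> (\<integral>\<^sup>+(t, x). indicator {-1..1} t * ennreal (2 * exp V) \<partial>(spacetime :: (real \<times> (real ^ 'd)) measure))"
    proof (intro nn_integral_mono, clarify)
      fix t :: real and x :: "real ^ 'd"
      have "(\<lambda>\<omega>. F \<omega> j t x) \<in> borel_measurable M" unfolding F_def by measurable
      then have "(\<lambda>\<omega>. ennreal (exp (X j \<omega> t x))) \<in> borel_measurable M" unfolding X_def by measurable
      then have "(\<integral>\<^sup>+\<omega>. indicator {-1..1} t * ennreal (exp (X j \<omega> t x)) \<partial>M) = indicator {-1..1} t * (\<integral>\<^sup>+\<omega>. ennreal (exp (X j \<omega> t x)) \<partial>M)"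
        by (rule nn_integral_cmult)
      also have "\<dots> \<le> indicator {-1..1} t * ennreal (2 * exp V)" by (intro mult_left_mono X_exp_moment) simp
      finally show "(\<integral>\<^sup>+\<omega>. indicator {-1..1} t * ennreal (exp (X j \<omega> t x)) \<partial>M) \<le> indicator {-1..1} t * ennreal (2 * exp V)" .
    qed
    also have "\<dots> = ennreal (2 * torus_volume TYPE('d)) * ennreal (2 * exp V)" by (rule nn_integral_window_const)
    also have "\<dots> = ennreal (4 * torus_volume TYPE('d) * exp V)" using Vp by (subst ennreal_mult[symmetric]) (auto simp: mult_ac)
    finally show ?thesis .
  qed
  have "(\<integral>\<^sup>+\<omega>. Y \<omega> \<partial>M) = (\<Sum>j. \<integral>\<^sup>+\<omega>. ennreal ((1 / 2) ^ j) * (\<integral>\<^sup>+(t, x). indicator {-1..1} t * ennreal (exp (X j \<omega> t x)) \<partial>spacetime) \<partial>M)"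
    unfolding Y_def
    by (rule nn_integral_suminf) (rule window_cmult_meas)
  also have "\<dots> = (\<Sum>j. ennreal ((1 / 2) ^ j) * (\<integral>\<^sup>+\<omega>. (\<integral>\<^sup>+(t, x). indicator {-1..1} t * ennreal (exp (X j \<omega> t x)) \<partial>spacetime) \<partial>M))"
    by (intro suminf_cong nn_integral_cmult window_meas)
  also have "\<dots> \<le> (\<Sum>j. ennreal ((1 / 2) ^ j) * ennreal (4 * torus_volume TYPE('d) * exp V))"
    by (intro suminf_le mult_left_mono one) auto
  also have "\<dots> = ennreal 2 * ennreal (4 * torus_volume TYPE('d) * exp V)"
  proof -
    have "(\<lambda>j. (1 / 2 :: real) ^ j) sums 2" using geometric_sums[of "1 / 2 :: real"] by simp
    then have "(\<Sum>j. ennreal ((1 / 2) ^ j)) = ennreal 2" by (intro suminf_ennreal_eq) auto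
    then show ?thesis by simp
  qed
  also have "\<dots> = ennreal (8 * torus_volume TYPE('d) * exp V)" using Vp by (subst ennreal_mult[symmetric]) auto
  finally show ?thesis .
qed

definition good :: "real \<Rightarrow> 'w set" where
  "good l = {\<omega> \<in> space M. Y \<omega> \<le> ennreal (exp l)}"

lemma good_sets: "good l \<in> sets M"
  unfolding good_def using Y_meas by measurable

lemma measure_not_good: "measure M (space M - good l) \<le> 8 * torus_volume TYPE('d) * exp V * exp (- l)"
proof -
  have "space M - good l \<subseteq> {\<omega> \<in> space M. 1 \<le> ennreal (exp (- l)) * Y \<omega>}"
  proof
    fix \<omega> assume w: "\<omega> \<in> space M - good l"
    then have "ennreal (exp l) \<le> Y \<omega>" by (auto simp: good_def)
    then have "ennreal (exp (- l)) * ennreal (exp l) \<le> ennreal (exp (- l)) * Y \<omega>" by (intro mult_left_mono) auto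
    moreover have "ennreal (exp (- l)) * ennreal (exp l) = 1"
      by (subst ennreal_mult[symmetric]) (auto simp: exp_minus)
    ultimately show "\<omega> \<in> {\<omega> \<in> space M. 1 \<le> ennreal (exp (- l)) * Y \<omega>}" using w by simp
  qed
  then have "emeasure M (space M - good l) \<le> emeasure M {\<omega> \<in> space M. 1 \<le> ennreal (exp (- l)) * Y \<omega>}"
    using Y_meas by (intro emeasure_mono) (auto, measurable)
  also have "\<dots> \<le> ennreal (exp (- l)) * (\<integral>\<^sup>+\<omega>. Y \<omega> * indicator (space M) \<omega> \<partial>M)"
    using nn_integral_Markov_inequality[of Y "space M" M "ennreal (exp (- l))"] Y_meas by simp
  also have "(\<integral>\<^sup>+\<omega>. Y \<omega> * indicator (space M) \<omega> \<partial>M) = (\<integral>\<^sup>+\<omega>. Y \<omega> \<partial>M)"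
    by (intro nn_integral_cong) auto
  also have "ennreal (exp (- l)) * \<dots> \<le> ennreal (exp (- l)) * ennreal (8 * torus_volume TYPE('d) * exp V)"
    by (intro mult_left_mono Y_expectation) auto
  also have "\<dots> = ennreal (8 * torus_volume TYPE('d) * exp V * exp (- l))"
    using torus_volume_ge_1[where 'd='d] by (subst ennreal_mult[symmetric]) (auto simp: mult_ac)
  finally show ?thesis
    using torus_volume_ge_1[where 'd='d] by (simp add: emeasure_eq_measure)
qed

definition windowed_block :: "'w \<Rightarrow> nat \<Rightarrow> real \<Rightarrow> real ^ 'd \<Rightarrow> complex" where
  "windowed_block \<omega> j t x = indicator {-1..1} t * F \<omega> j t x"

definition windowed_coeff :: "'w \<Rightarrow> nat \<Rightarrow> int ^ 'd \<Rightarrow> real \<Rightarrow> complex" where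
  "windowed_coeff \<omega> j n t = indicator {-1..1} t * (if n \<in> shell j then b n * phase n t * g n \<omega> else 0)"

text \<open>
  On the good set the exponential integral of block \<open>j\<close> is at most \<open>exp (l +
  j)\<close>. Comparing the \<open>q\<close>-th power with the exponential at this level bounds
  the block by a multiple of \<open>(l + j) 2\<^sup>-\<^sup>\<gamma>\<^sup>j\<close>, and half of
  the decay pays for the factor \<open>j\<close>. The dependence on \<open>l\<close> is linear,
  which is what makes a small power of \<open>1 / T\<close> admissible.
\<close>

lemma good_trig_blocks:
  assumes q: "1 < q" and l: "q \<le> l" and \<omega>: "\<omega> \<in> good l"
  shows "trig_blocks (windowed_block \<omega>) (windowed_coeff \<omega>) q (l * random_const TYPE('d) \<gamma>) (\<gamma> / 2)"
proof
  let ?V = "torus_volume TYPE('d)"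
  have Vp: "1 \<le> ?V" by (rule torus_volume_ge_1)
  show "windowed_block \<omega> j t x = (\<Sum>n\<in>freq_cube (2 ^ j). windowed_coeff \<omega> j n t * ch n x)" for j t x
  proof -
    have "F \<omega> j t x = (\<Sum>n\<in>freq_cube (2 ^ j). (if n \<in> shell j then b n * phase n t * g n \<omega> else 0) * ch n x)"
      unfolding F_def using shell_subset[OF order_refl, of j]
      by (intro sum.mono_neutral_cong_left) (auto simp: mult_ac)
    then show ?thesis by (simp add: windowed_block_def windowed_coeff_def sum_distrib_left mult.assoc)
  qed
  show "windowed_coeff \<omega> j n \<in> borel_measurable borel" for j n unfolding windowed_coeff_def[abs_def] by measurable
  show "1 < q" by (rule q)
  show "0 \<le> l * random_const TYPE('d) \<gamma>" using q l random_const_pos[OF \<gamma>, where 'd='d] by simp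
  show "0 < \<gamma> / 2" using \<gamma> by simp
  fix j
  \<comment> \<open>The level at which the power is compared with the exponential.\<close>
  define \<mu> where "\<mu> = l + real j"
  have \<mu>: "q \<le> \<mu>" "0 < \<mu>" using q l by (auto simp: \<mu>_def)
  have [measurable]: "(\<lambda>(t, x). F \<omega> j t x) \<in> borel_measurable (borel \<Otimes>\<^sub>M borel)" unfolding F_def by measurable
  have Xm [measurable]: "(\<lambda>(t, x). X j \<omega> t x) \<in> borel_measurable (borel \<Otimes>\<^sub>M borel)" unfolding X_def by measurable
  let ?E = "\<integral>\<^sup>+(t, x). indicator {-1..1} t * ennreal (exp (X j \<omega> t x)) \<partial>spacetime"
  have E: "?E \<le> ennreal (exp \<mu>)"
  proof -
    have "ennreal ((1 / 2) ^ j) * ?E \<le> Y \<omega>"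
      unfolding Y_def using sum_le_suminf[of "\<lambda>j. ennreal ((1 / 2) ^ j) * (\<integral>\<^sup>+(t, x). indicator {-1..1} t * ennreal (exp (X j \<omega> t x)) \<partial>spacetime)" "{j}"] by simp
    also have "\<dots> \<le> ennreal (exp l)" using \<omega> by (simp add: good_def)
    finally have "ennreal (2 ^ j) * (ennreal ((1 / 2) ^ j) * ?E) \<le> ennreal (2 ^ j) * ennreal (exp l)" by (intro mult_left_mono) auto
    moreover have "ennreal (2 ^ j) * (ennreal ((1 / 2) ^ j) * ?E) = ?E"
      unfolding mult.assoc[symmetric] by (subst ennreal_mult[symmetric]) (auto simp: power_divide)
    moreover have "ennreal (2 ^ j) * ennreal (exp l) \<le> ennreal (exp \<mu>)"
    proof -
      have "(2::real) ^ j \<le> exp 1 ^ j" using exp_ge_add_one_self[of 1] by (intro power_mono) auto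
      then have "2 ^ j * exp l \<le> exp (real j) * exp l" by (intro mult_right_mono) (auto simp: exp_of_nat_mult[symmetric] mult.commute)
      then have "2 ^ j * exp l \<le> exp \<mu>" by (simp add: \<mu>_def exp_add mult.commute)
      then show ?thesis by (subst ennreal_mult[symmetric]) (auto intro: ennreal_leI)
    qed
    ultimately show ?thesis by simp
  qed
  have "(\<integral>\<^sup>+p. ennpow (case p of (t, x) \<Rightarrow> indicator {-1..1} t * ennreal (X j \<omega> t x)) q \<partial>spacetime)
      \<le> (\<integral>\<^sup>+p. (case p of (t, x) \<Rightarrow> indicator {-1..1} t * ennreal (\<mu> powr q)) + ennreal (\<mu> powr q * exp (- \<mu>)) * (case p of (t, x) \<Rightarrow> indicator {-1..1} t * ennreal (exp (X j \<omega> t x))) \<partial>spacetime)"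
  proof (intro nn_integral_mono, clarify)
    fix t :: real and x :: "real ^ 'd"
    have "0 \<le> X j \<omega> t x" by (simp add: X_def)
    then have "ennpow (ennreal (X j \<omega> t x)) q \<le> ennreal (\<mu> powr q * (1 + exp (X j \<omega> t x - \<mu>)))"
      using q \<mu> by (simp add: ennpow_ennreal ennreal_leI powr_le_exp_excess)
    also have "\<mu> powr q * (1 + exp (X j \<omega> t x - \<mu>)) = \<mu> powr q + \<mu> powr q * exp (- \<mu>) * exp (X j \<omega> t x)"
      by (simp add: exp_diff exp_minus divide_inverse distrib_left mult_ac)
    also have "ennreal \<dots> = ennreal (\<mu> powr q) + ennreal (\<mu> powr q * exp (- \<mu>)) * ennreal (exp (X j \<omega> t x))"
      by (subst ennreal_plus) (auto simp: ennreal_mult)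
    finally show "ennpow (indicator {-1..1} t * ennreal (X j \<omega> t x)) q \<le> indicator {-1..1} t * ennreal (\<mu> powr q) + ennreal (\<mu> powr q * exp (- \<mu>)) * (indicator {-1..1} t * ennreal (exp (X j \<omega> t x)))"
      by (auto simp: indicator_def)
  qed
  also have "\<dots> = (\<integral>\<^sup>+(t, x). indicator {-1..1} t * ennreal (\<mu> powr q) \<partial>(spacetime :: (real \<times> (real ^ 'd)) measure)) + ennreal (\<mu> powr q * exp (- \<mu>)) * ?E"
  proof -
    have 1: "(\<lambda>(t, x). indicator {-1..1} t * ennreal (\<mu> powr q)) \<in> borel_measurable (spacetime :: (real \<times> (real ^ 'd)) measure)"
      by (rule measurable_ST) measurable
    have 2: "(\<lambda>(t, x). indicator {-1..1} t * ennreal (exp (X j \<omega> t x))) \<in> borel_measurable spacetime"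
      by (rule measurable_ST) measurable
    show ?thesis
      by (subst nn_integral_add[OF 1 borel_measurable_times_ennreal[OF borel_measurable_const 2]]) (simp only: nn_integral_cmult[OF 2])
  qed
  also have "\<dots> \<le> ennreal (2 * ?V) * ennreal (\<mu> powr q) + ennreal (\<mu> powr q * exp (- \<mu>)) * ennreal (exp \<mu>)"
    unfolding nn_integral_window_const by (intro add_left_mono mult_left_mono E) auto
  also have "\<dots> = ennreal (\<mu> powr q * (2 * ?V + 1))"
  proof -
    have "ennreal (2 * ?V) * ennreal (\<mu> powr q) + ennreal (\<mu> powr q * exp (- \<mu>)) * ennreal (exp \<mu>) = ennreal (2 * ?V * \<mu> powr q + \<mu> powr q * exp (- \<mu>) * exp \<mu>)"
      using Vp by (subst ennreal_plus) (auto simp: ennreal_mult)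
    also have "2 * ?V * \<mu> powr q + \<mu> powr q * exp (- \<mu>) * exp \<mu> = \<mu> powr q * (2 * ?V + 1)"
      by (simp add: exp_minus algebra_simps)
    finally show ?thesis .
  qed
  finally have I: "(\<integral>\<^sup>+p. ennpow (case p of (t, x) \<Rightarrow> indicator {-1..1} t * ennreal (X j \<omega> t x)) q \<partial>spacetime) \<le> ennreal (\<mu> powr q * (2 * ?V + 1))" .
  have "Lnorm q spacetime (\<lambda>(t, x). indicator {-1..1} t * ennreal (X j \<omega> t x)) \<le> ennpow (ennreal (\<mu> powr q * (2 * ?V + 1))) (1 / q)"
    unfolding Lnorm_def using q by (intro ennpow_mono I) auto
  also have "\<dots> = ennreal (\<mu> * (2 * ?V + 1) powr (1 / q))"
    using q \<mu> Vp by (simp add: ennpow_ennreal powr_mult powr_powr)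
  also have "\<dots> \<le> ennreal ((l * real (j + 1)) * (2 * ?V + 1))"
  proof (intro ennreal_leI mult_mono)
    have "1 * real j \<le> l * real j" using q l by (intro mult_right_mono) auto
    then show "\<mu> \<le> l * real (j + 1)" by (simp add: \<mu>_def distrib_left)
    have "(2 * ?V + 1) powr (1 / q) \<le> (2 * ?V + 1) powr 1" using q Vp by (intro powr_mono) auto
    then show "(2 * ?V + 1) powr (1 / q) \<le> 2 * ?V + 1" using Vp by simp
  qed (use q l Vp in auto)
  finally have LX: "Lnorm q spacetime (\<lambda>(t, x). indicator {-1..1} t * ennreal (X j \<omega> t x)) \<le> ennreal ((l * real (j + 1)) * (2 * ?V + 1))" .
  have "Lnorm q spacetime (\<lambda>(t, x). ennreal (cmod (windowed_block \<omega> j t x))) = Lnorm q spacetime (\<lambda>p. ennreal (2 powr (- (\<gamma> * real j))) * (case p of (t, x) \<Rightarrow> indicator {-1..1} t * ennreal (X j \<omega> t x)))"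
  proof -
    have "ennreal (cmod (windowed_block \<omega> j t x)) = ennreal (2 powr (- (\<gamma> * real j))) * (indicator {-1..1} t * ennreal (X j \<omega> t x))" for t x
    proof (cases "t \<in> {-1..1::real}")
      case True
      have "ennreal (2 powr (- (\<gamma> * real j))) * ennreal (X j \<omega> t x) = ennreal (cmod (F \<omega> j t x))"
        by (subst ennreal_mult[symmetric]) (auto simp: X_def powr_minus)
      then show ?thesis using True by (simp add: windowed_block_def)
    qed (simp add: windowed_block_def)
    then show ?thesis by (simp add: case_prod_beta')
  qed
  also have "\<dots> = ennreal (2 powr (- (\<gamma> * real j))) * Lnorm q spacetime (\<lambda>(t, x). indicator {-1..1} t * ennreal (X j \<omega> t x))"
  proof (rule Lnorm_cmult)
    show "(\<lambda>(t, x). indicator {-1..1} t * ennreal (X j \<omega> t x)) \<in> borel_measurable spacetime" by (rule measurable_ST) measurable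
  qed (use q in simp)
  also have "\<dots> \<le> ennreal (2 powr (- (\<gamma> * real j))) * ennreal ((l * real (j + 1)) * (2 * ?V + 1))"
    by (intro mult_left_mono LX) auto
  also have "\<dots> \<le> ennreal (l * random_const TYPE('d) \<gamma> * (2 powr (- (\<gamma> / 2))) ^ j)"
  proof -
    have e: "2 powr (- (\<gamma> * real j)) = (2 powr (- \<gamma>)) ^ j" by (simp add: powr_realpow[symmetric] powr_powr)
    have "real (j + 1) \<le> real (j + 1) ^ 4" by (rule self_le_power) auto
    then have "real (j + 1) * (2 powr (- \<gamma>)) ^ j \<le> real (j + 1) ^ 4 * (2 powr (- \<gamma>)) ^ j" by (intro mult_right_mono) auto
    also have "\<dots> \<le> poly_exp_const \<gamma> * (2 powr (- (\<gamma> / 2))) ^ j" by (rule poly_exp_bound[OF \<gamma>])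
    finally have "(l * (2 * ?V + 1)) * (real (j + 1) * (2 powr (- \<gamma>)) ^ j) \<le> (l * (2 * ?V + 1)) * (poly_exp_const \<gamma> * (2 powr (- (\<gamma> / 2))) ^ j)"
      using q l Vp by (intro mult_left_mono) auto
    then have "2 powr (- (\<gamma> * real j)) * ((l * real (j + 1)) * (2 * ?V + 1)) \<le> l * random_const TYPE('d) \<gamma> * (2 powr (- (\<gamma> / 2))) ^ j"
      unfolding e random_const_def by (simp add: mult_ac)
    then show ?thesis using q l Vp by (subst ennreal_mult[symmetric]) (auto intro: ennreal_leI)
  qed
  finally show "Lnorm q spacetime (\<lambda>(t, x). ennreal (cmod (windowed_block \<omega> j t x))) \<le> ennreal (l * random_const TYPE('d) \<gamma> * (2 powr (- (\<gamma> / 2))) ^ j)" .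
qed

text \<open>
  The partial sums over cubes are the partial sums over blocks, and the latter converge absolutely
  almost everywhere.
\<close>

lemma AE_schroedinger_eq_series:
  assumes q: "1 < q" and l: "q \<le> l" and \<omega>: "\<omega> \<in> good l"
  shows "AE p in spacetime. \<bar>fst p\<bar> \<le> 1 \<longrightarrow>
    schroedinger (\<lambda>n. b n * g n \<omega>) (fst p) (snd p) = trig_blocks.series (windowed_block \<omega>) (fst p) (snd p)"
proof -
  interpret T: trig_blocks "windowed_block \<omega>" "windowed_coeff \<omega>" q "l * random_const TYPE('d) \<gamma>" "\<gamma> / 2"
    by (rule good_trig_blocks[OF assms])
  have partial: "(\<Sum>n\<in>freq_cube (2 ^ J). (b n * g n \<omega>) * cis (x \<bullet> rvec n - t * (norm (rvec n))\<^sup>2)) = (\<Sum>j\<le>J. F \<omega> j t x)" for J t x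
  proof -
    let ?h = "\<lambda>n. b n * phase n t * ch n x * g n \<omega>"
    have "(\<Sum>j\<le>J. sum ?h (shell j)) = sum ?h (freq_cube (2 ^ J))"
    proof (induction J)
      case (Suc J)
      have "freq_cube (2 ^ J) \<subseteq> (freq_cube (2 ^ Suc J) :: (int ^ 'd) set)" by (rule freq_cube_mono) simp
      then show ?case using Suc by (simp add: shell_def sum_diff)
    qed (simp add: shell_def)
    moreover have "(b n * g n \<omega>) * cis (x \<bullet> rvec n - t * (norm (rvec n))\<^sup>2) = ?h n" for n
    proof -
      have "cis (x \<bullet> rvec n - t * (norm (rvec n))\<^sup>2) = phase n t * ch n x"
        by (simp add: phase_def ch_def cis_mult)
      then show ?thesis by (simp add: mult_ac)
    qed
    ultimately show ?thesis unfolding F_def by (simp only:)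
  qed
  show ?thesis using T.AE_series_sums
  proof eventually_elim
    case (elim p)
    show ?case
    proof
      assume t: "\<bar>fst p\<bar> \<le> 1"
      then have "windowed_block \<omega> j (fst p) (snd p) = F \<omega> j (fst p) (snd p)" for j
        by (auto simp: windowed_block_def indicator_def abs_le_iff)
      then have "(\<lambda>J. \<Sum>j\<le>J. F \<omega> j (fst p) (snd p)) \<longlonglongrightarrow> T.series (fst p) (snd p)"
        using elim by (simp add: sums_def_le)
      then show "schroedinger (\<lambda>n. b n * g n \<omega>) (fst p) (snd p) = T.series (fst p) (snd p)"
        unfolding schroedinger_def partial by (rule limI)
    qed
  qed
qed

end

section \<open>Pairing with a product of two series\<close>

lemma Lnorm_time_window:
  assumes "0 < q" "0 \<le> T"
  shows "Lnorm q (spacetime :: (real \<times> (real ^ 'd)) measure) (\<lambda>(t, x). indicator {-T..T} t) = ennreal ((2 * T * torus_volume TYPE('d)) powr (1 / q))"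
proof -
  have "(\<integral>\<^sup>+p. ennpow (case p of (t, x) \<Rightarrow> indicator {-T..T} t) q \<partial>(spacetime :: (real \<times> (real ^ 'd)) measure))
      = (\<integral>\<^sup>+(t, x). indicator {-T..T} t \<partial>(spacetime :: (real \<times> (real ^ 'd)) measure))"
    by (intro nn_integral_cong) (auto simp: indicator_def ennpow_def)
  also have "\<dots> = (\<integral>\<^sup>+t. \<integral>\<^sup>+x. indicator {-T..T} t \<partial>(torus :: (real ^ 'd) measure) \<partial>lborel)"
    by (rule nn_integral_ST) measurable
  also have "\<dots> = (\<integral>\<^sup>+t. ennreal (torus_volume TYPE('d)) * indicator {-T..T} t \<partial>lborel)"
    unfolding nn_integral_const emeasure_torus_volume by (simp only: mult_ac)
  also have "\<dots> = ennreal (torus_volume TYPE('d)) * emeasure lborel {-T..T}"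
    by (rule nn_integral_cmult_indicator) simp
  also have "\<dots> = ennreal (2 * T * torus_volume TYPE('d))"
    using assms torus_volume_ge_1[where 'd='d] by (simp add: ennreal_mult[symmetric] mult_ac)
  finally show ?thesis
    using assms torus_volume_ge_1[where 'd='d] by (simp add: Lnorm_def ennpow_ennreal)
qed

text \<open>
  The weight in the pairing is the product of a time window and two series of positive regularity.
  The exponent \<open>m\<close> occurs twice: once for the window and once for the first series.
\<close>

locale two_series =
  T1: trig_blocks U1 c1 m A1 \<theta>1 + T2: trig_blocks U2 c2 r A2 \<theta>2
  for U1 :: "nat \<Rightarrow> real \<Rightarrow> real ^ 'd \<Rightarrow> complex" and c1 m A1 \<theta>1
    and U2 :: "nat \<Rightarrow> real \<Rightarrow> real ^ 'd \<Rightarrow> complex" and c2 r A2 \<theta>2 +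
  fixes T p s :: real
  assumes T: "0 < T" and p: "0 < p" and exponents: "1 / p + 1 / m + 1 / m + 1 / r = 1"
    and s: "0 < s" "s \<le> 1" "(real CARD('d) + 1) * s < \<theta>1" "(real CARD('d) + 1) * s < \<theta>2"
begin

definition w :: "real \<Rightarrow> real ^ 'd \<Rightarrow> complex" where
  "w t x = indicator {-T..T} t * T1.series t x * cnj (T2.series t x)"

definition bound :: real where
  "bound = (2 * T * torus_volume TYPE('d)) powr (1 / m) * (block_const TYPE('d) m \<theta>1 s * A1) * (block_const TYPE('d) r \<theta>2 s * A2)"

lemma exponents_pos: "0 < m" "0 < r" using T1.q T2.q by auto

lemma block_const_nonneg: "0 \<le> block_const TYPE('d) m \<theta>1 s * A1" "0 \<le> block_const TYPE('d) r \<theta>2 s * A2"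
  "0 \<le> block_const TYPE('d) m \<theta>1 s" "0 \<le> block_const TYPE('d) r \<theta>2 s"
proof -
  have k: "0 \<le> bernstein_const TYPE('d)" by (simp add: bernstein_const_def)
  have g: "0 \<le> geom_const (2 powr e) q" if "e < 0" "0 < q" for e q
    using geom_const_pos[of "2 powr e" q] powr_less_mono[of e 0 2] that by (simp add: less_imp_le)
  show "0 \<le> block_const TYPE('d) m \<theta>1 s * A1" "0 \<le> block_const TYPE('d) r \<theta>2 s * A2"
  "0 \<le> block_const TYPE('d) m \<theta>1 s" "0 \<le> block_const TYPE('d) r \<theta>2 s"
    unfolding block_const_def using k s exponents_pos T1.A T2.A T1.\<theta> T2.\<theta>
    by (auto intro!: mult_nonneg_nonneg add_nonneg_nonneg g)
qed

lemma bound_nonneg: "0 \<le> bound"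
  unfolding bound_def by (rule mult_nonneg_nonneg[OF mult_nonneg_nonneg[OF _ block_const_nonneg(1)] block_const_nonneg(2)]) simp

lemma w_meas [measurable]: "(\<lambda>(t, x). w t x) \<in> borel_measurable (borel \<Otimes>\<^sub>M borel)"
proof -
  have [measurable]: "cnj \<in> borel_measurable borel"
    by (intro borel_measurable_continuous_onI continuous_intros)
  note T1.series_meas[measurable] T2.series_meas[measurable]
  show ?thesis unfolding w_def by measurable
qed

lemma w_periodic: "x_periodic (w t)"
  by (simp add: x_periodic_def w_def x_periodicD[OF T1.x_periodic_series] x_periodicD[OF T2.x_periodic_series])

text \<open>
  Translates of the two series have the same norms, so the bound is uniform in \<open>y\<close>
  and \<open>z\<close>.
\<close>

lemma shifted_Hoelder:
  assumes h: "(\<lambda>(t, x). h t x) \<in> borel_measurable (borel \<Otimes>\<^sub>M borel)"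
    and f: "(\<lambda>(t, x). f t x) \<in> borel_measurable (borel \<Otimes>\<^sub>M borel)" "\<And>t. x_periodic (f t)" "Lnorm m spacetime (\<lambda>(t, x). f t x) \<le> ennreal a"
    and g: "(\<lambda>(t, x). g t x) \<in> borel_measurable (borel \<Otimes>\<^sub>M borel)" "\<And>t. x_periodic (g t)" "Lnorm r spacetime (\<lambda>(t, x). g t x) \<le> ennreal b"
    and H: "Lnorm p spacetime (\<lambda>(t, x). h t x) \<le> ennreal e" and nn: "0 \<le> a" "0 \<le> b" "0 \<le> e"
  shows "(\<integral>\<^sup>+(t, x). h t x * (indicator {-T..T} t * (f t (x + z) * g t (x + y))) \<partial>(spacetime :: (real \<times> (real ^ 'd)) measure))
    \<le> ennreal (e * ((2 * T * torus_volume TYPE('d)) powr (1 / m) * a * b))"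
proof -
  note h[measurable] f(1)[measurable] g(1)[measurable]
  let ?x = "\<lambda>(t, x::real^'d). indicator {-T..T} t :: ennreal"
  have mh: "(\<lambda>(t, x). h t x) \<in> borel_measurable spacetime" by (rule measurable_ST) measurable
  have mx: "?x \<in> borel_measurable spacetime" by (rule measurable_ST) measurable
  have mf: "(\<lambda>(t, x). f t (x + z)) \<in> borel_measurable spacetime" by (rule measurable_ST) measurable
  have mg: "(\<lambda>(t, x). g t (x + y)) \<in> borel_measurable spacetime" by (rule measurable_ST) measurable
  have "(\<integral>\<^sup>+q. (case q of (t, x) \<Rightarrow> h t x) * (?x q * ((case q of (t, x) \<Rightarrow> f t (x + z)) * (case q of (t, x) \<Rightarrow> g t (x + y)))) \<partial>spacetime)
      \<le> Lnorm p spacetime (\<lambda>(t, x). h t x) * (Lnorm m spacetime ?x * (Lnorm m spacetime (\<lambda>(t, x). f t (x + z)) * Lnorm r spacetime (\<lambda>(t, x). g t (x + y))))"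
    by (rule nn_integral_Hoelder4[OF p exponents_pos(1) exponents_pos(1) exponents_pos(2) exponents mh mx mf mg])
  also have "Lnorm m spacetime (\<lambda>(t, x). f t (x + z)) = Lnorm m spacetime (\<lambda>(t, x). f t x)"
    by (rule Lnorm_ST_shift[OF f(1) exponents_pos(1) f(2)])
  also have "Lnorm r spacetime (\<lambda>(t, x). g t (x + y)) = Lnorm r spacetime (\<lambda>(t, x). g t x)"
    by (rule Lnorm_ST_shift[OF g(1) exponents_pos(2) g(2)])
  also have "Lnorm m spacetime ?x = ennreal ((2 * T * torus_volume TYPE('d)) powr (1 / m))"
    using exponents_pos T by (intro Lnorm_time_window) auto
  also have "Lnorm p spacetime (\<lambda>(t, x). h t x) * (ennreal ((2 * T * torus_volume TYPE('d)) powr (1 / m)) * (Lnorm m spacetime (\<lambda>(t, x). f t x) * Lnorm r spacetime (\<lambda>(t, x). g t x)))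
      \<le> ennreal e * (ennreal ((2 * T * torus_volume TYPE('d)) powr (1 / m)) * (ennreal a * ennreal b))"
    by (intro mult_mono H f g) auto
  also have "\<dots> = ennreal (e * ((2 * T * torus_volume TYPE('d)) powr (1 / m) * a * b))"
    using nn by (simp add: ennreal_mult mult.assoc)
  finally show ?thesis by (simp add: case_prod_beta')
qed

lemma w_le: "ennreal (cmod (w t x)) \<le> indicator {-T..T} t * (T1.major t x * T2.major t x)"
proof -
  have "ennreal (cmod (w t x)) = indicator {-T..T} t * (ennreal (cmod (T1.series t x)) * ennreal (cmod (T2.series t x)))"
    by (auto simp: w_def norm_mult ennreal_mult indicator_def)
  also have "\<dots> \<le> indicator {-T..T} t * (T1.major t x * T2.major t x)"
    by (intro mult_left_mono mult_mono T1.series_le_major T2.series_le_major) auto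
  finally show ?thesis .
qed

text \<open>
  The product rule for differences, with the differences dominated by those of the blocks. It lets
  Hoelder's inequality act on each factor separately.
\<close>

lemma w_diff_le: "ennreal (cmod (w t x - w t (x + y)))
  \<le> indicator {-T..T} t * (T1.major_diff y t x * T2.major t (x + y)) + indicator {-T..T} t * (T1.major t x * T2.major_diff y t x)"
proof (cases "t \<in> {-T..T}")
  case True
  let ?f = "T1.series t" and ?g = "T2.series t"
  have "w t x - w t (x + y) = (?f x - ?f (x + y)) * cnj (?g (x + y)) + ?f x * cnj (?g x - ?g (x + y))"
    using True by (simp add: w_def algebra_simps)
  then have "cmod (w t x - w t (x + y)) \<le> cmod (?f x - ?f (x + y)) * cmod (?g (x + y)) + cmod (?f x) * cmod (?g x - ?g (x + y))"
    by (metis norm_triangle_ineq norm_mult complex_mod_cnj)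
  then have "ennreal (cmod (w t x - w t (x + y))) \<le> ennreal (cmod (?f x - ?f (x + y))) * ennreal (cmod (?g (x + y))) + ennreal (cmod (?f x)) * ennreal (cmod (?g x - ?g (x + y)))"
    by (simp add: ennreal_mult[symmetric] ennreal_plus[symmetric] ennreal_leI del: ennreal_plus)
  also have "\<dots> \<le> T1.major_diff y t x * T2.major t (x + y) + T1.major t x * T2.major_diff y t x"
    by (intro add_mono mult_mono T1.series_shift_diff_le T2.series_shift_diff_le T1.series_le_major T2.series_le_major) auto
  finally show ?thesis using True by simp
qed (simp add: w_def)

lemma weighted_w_diff:
  assumes h [measurable]: "(\<lambda>(t, x). h t x) \<in> borel_measurable (borel \<Otimes>\<^sub>M borel)"
    and H: "Lnorm p spacetime (\<lambda>(t, x). h t x) \<le> ennreal e" "0 \<le> e"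
  shows "(\<integral>\<^sup>+(t, x). h t x * ennreal (cmod (w t (x + z) - w t (x + y + z))) \<partial>spacetime) \<le> ennreal (2 * e * bound * phase_dist y powr s)"
proof -
  note T1.major_meas[measurable] T2.major_meas[measurable] T1.major_diff_meas[measurable] T2.major_diff_meas[measurable]
  let ?c1 = "block_const TYPE('d) m \<theta>1 s * A1" and ?c2 = "block_const TYPE('d) r \<theta>2 s * A2"
  let ?a = "\<lambda>(t, x). h t x * (indicator {-T..T} t * (T1.major_diff y t (x + z) * T2.major t (x + (y + z))))"
  let ?b = "\<lambda>(t, x). h t x * (indicator {-T..T} t * (T1.major t (x + z) * T2.major_diff y t (x + z)))"
  have ma: "?a \<in> borel_measurable spacetime" by (rule measurable_ST) measurable
  have mb: "?b \<in> borel_measurable spacetime" by (rule measurable_ST) measurable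
  have "(\<integral>\<^sup>+(t, x). h t x * ennreal (cmod (w t (x + z) - w t (x + y + z))) \<partial>spacetime) \<le> (\<integral>\<^sup>+q. ?a q + ?b q \<partial>spacetime)"
  proof (intro nn_integral_mono)
    fix q :: "real \<times> (real ^ 'd)"
    obtain t x where q: "q = (t, x)" by (cases q)
    have "h t x * ennreal (cmod (w t (x + z) - w t ((x + z) + y))) \<le> h t x * (indicator {-T..T} t * (T1.major_diff y t (x + z) * T2.major t ((x + z) + y)) + indicator {-T..T} t * (T1.major t (x + z) * T2.major_diff y t (x + z)))"
      by (intro mult_left_mono w_diff_le) auto
    then show "(case q of (t, x) \<Rightarrow> h t x * ennreal (cmod (w t (x + z) - w t (x + y + z)))) \<le> ?a q + ?b q"
      by (simp add: q distrib_left add.assoc add.commute[of z y])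
  qed
  also have "\<dots> = (\<integral>\<^sup>+q. ?a q \<partial>spacetime) + (\<integral>\<^sup>+q. ?b q \<partial>spacetime)"
    by (rule nn_integral_add[OF ma mb])
  also have "\<dots> \<le> ennreal (e * ((2 * T * torus_volume TYPE('d)) powr (1 / m) * (?c1 * phase_dist y powr s) * ?c2)) + ennreal (e * ((2 * T * torus_volume TYPE('d)) powr (1 / m) * ?c1 * (?c2 * phase_dist y powr s)))"
    using block_const_nonneg
    by (intro add_mono shifted_Hoelder h H T1.x_periodic_major T2.x_periodic_major T1.x_periodic_major_diff T2.x_periodic_major_diff
        T1.Lnorm_major_diff T2.Lnorm_major_diff T1.Lnorm_major_le_block_const T2.Lnorm_major_le_block_const s T1.major_meas T2.major_meas T1.major_diff_meas T2.major_diff_meas)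
       auto
  also have "\<dots> = ennreal (2 * e * bound * phase_dist y powr s)"
  proof -
    have "0 \<le> e * ((2 * T * torus_volume TYPE('d)) powr (1 / m) * (?c1 * phase_dist y powr s) * ?c2)"
      using H block_const_nonneg T1.A T2.A by (intro mult_nonneg_nonneg) auto
    moreover have "0 \<le> e * ((2 * T * torus_volume TYPE('d)) powr (1 / m) * ?c1 * (?c2 * phase_dist y powr s))"
      using H block_const_nonneg T1.A T2.A by (intro mult_nonneg_nonneg) auto
    ultimately show ?thesis
      by (simp add: ennreal_plus[symmetric] bound_def mult_ac del: ennreal_plus)
  qed
  finally show ?thesis .
qed

theorem estimate:
  assumes u: "jointly_measurable u" "integrable spacetime (\<lambda>(t, x). u t x)"
    and \<sigma>: "\<sigma> < s / 2" and Z: "0 \<le> Z"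
    and uj: "\<And>j. Lnorm p spacetime (\<lambda>(t, x). ennreal (cmod (P_dy j (u t) x))) \<le> ennreal (Z * 2 powr (real j * \<sigma>))"
    and uw: "integrable spacetime (\<lambda>(t, x). u t x * w t x)"
  shows "cmod (\<integral>(t, x). u t x * w t x \<partial>spacetime) \<le> pairing_const TYPE('d) s \<sigma> * (2 * Z * bound)"
proof -
  let ?K = "(2 * T * torus_volume TYPE('d)) powr (1 / p)"
  note T1.major_meas[measurable] T2.major_meas[measurable]
  have Pm: "(\<lambda>(t, x). ennreal (cmod (P_dy j (u t) x))) \<in> borel_measurable (borel \<Otimes>\<^sub>M borel)" for j
  proof -
    note jointly_measurableD[OF jointly_measurable_P_dy[OF u(1)], measurable]
    show ?thesis by measurable
  qed
  interpret fourier_pairing u w "2 * Z * bound" "2 * ?K * bound" s \<sigma>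
  proof
    show "jointly_measurable w" using w_meas by (simp only: borel_prod)
    show "x_periodic (w t)" for t by (rule w_periodic)
    show "0 \<le> 2 * Z * bound" "0 \<le> 2 * ?K * bound" using Z bound_nonneg by auto
    show "(\<integral>\<^sup>+(t, x). ennreal (cmod (P_dy 0 (u t) x)) * ennreal (cmod (w t (x + z))) \<partial>spacetime) \<le> ennreal (2 * Z * bound)" for z
    proof -
      have "(\<integral>\<^sup>+(t, x). ennreal (cmod (P_dy 0 (u t) x)) * ennreal (cmod (w t (x + z))) \<partial>spacetime)
          \<le> (\<integral>\<^sup>+(t, x). ennreal (cmod (P_dy 0 (u t) x)) * (indicator {-T..T} t * (T1.major t (x + z) * T2.major t (x + z))) \<partial>spacetime)"
        by (intro nn_integral_mono) (auto intro!: mult_left_mono w_le)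
      also have "\<dots> \<le> ennreal (Z * ((2 * T * torus_volume TYPE('d)) powr (1 / m) * (block_const TYPE('d) m \<theta>1 s * A1) * (block_const TYPE('d) r \<theta>2 s * A2)))"
        using uj[of 0] Z block_const_nonneg
        by (intro shifted_Hoelder Pm T1.major_meas T2.major_meas T1.x_periodic_major T2.x_periodic_major T1.Lnorm_major_le_block_const T2.Lnorm_major_le_block_const s) auto
      also have "\<dots> \<le> ennreal (2 * Z * bound)"
        unfolding bound_def[symmetric] using mult_nonneg_nonneg[OF Z bound_nonneg] by (intro ennreal_leI) linarith
      finally show ?thesis .
    qed
    show "(\<integral>\<^sup>+(t, x). ennreal (cmod (P_dy j (u t) x)) * ennreal (cmod (w t (x + z) - w t (x + y + z))) \<partial>spacetime)
        \<le> ennreal (2 * Z * bound * 2 powr (real j * \<sigma>) * phase_dist y powr s)" for j z y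
    proof -
      have "(\<integral>\<^sup>+(t, x). ennreal (cmod (P_dy j (u t) x)) * ennreal (cmod (w t (x + z) - w t (x + y + z))) \<partial>spacetime)
          \<le> ennreal (2 * (Z * 2 powr (real j * \<sigma>)) * bound * phase_dist y powr s)"
        using Z by (intro weighted_w_diff Pm uj) auto
      then show ?thesis by (simp add: mult_ac)
    qed
    show "(\<integral>\<^sup>+(t, x). ennreal (cmod (w t x - w t (x + z))) \<partial>(spacetime :: (real \<times> (real ^ 'd)) measure)) \<le> ennreal (2 * ?K * bound * phase_dist z powr s)" for z
    proof -
      have e: "ennreal (cmod (w t x - w t (x + z))) = indicator {-T..T} t * ennreal (cmod (w t (x + 0) - w t (x + z + 0)))" for t x
        by (auto simp: w_def indicator_def)
      have "(\<integral>\<^sup>+(t, x). indicator {-T..T} t * ennreal (cmod (w t (x + 0) - w t (x + z + 0))) \<partial>(spacetime :: (real \<times> (real ^ 'd)) measure)) \<le> ennreal (2 * ?K * bound * phase_dist z powr s)"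
        using p T by (intro weighted_w_diff[of "\<lambda>t x. indicator {-T..T} t"]) (measurable, simp_all add: Lnorm_time_window)
      then show ?thesis unfolding e .
    qed
  qed (use u s \<sigma> in auto)
  show ?thesis by (rule estimate[OF uw])
qed

end

section \<open>Random data, Besov norms and the Strichartz norm\<close>

text \<open>
  The coefficient at the frequency zero equals one, for every exponent.
\<close>

lemma sobolev_norm_data_ge_1:
  fixes a \<delta> :: real
  shows "1 \<le> sobolev_norm e (data_coeff a \<delta> :: int ^ 'd \<Rightarrow> complex)"
proof -
  let ?f = "\<lambda>n :: int ^ 'd. ennreal (japanese n powr (2 * e) * (cmod (data_coeff a \<delta> n))\<^sup>2)"
  have "1 = ?f 0" by (simp add: japanese_def data_coeff_def)
  also have "\<dots> = (\<Sum>n\<in>{0}. ?f n)" by simp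
  also have "\<dots> \<le> (\<Sum>\<^sub>\<infinity>n\<in>UNIV. ?f n)"
    unfolding nonneg_infsum_complete[of UNIV ?f, OF zero_le] by (rule SUP_upper) simp
  finally have "ennpow 1 (1 / 2) \<le> sobolev_norm e (data_coeff a \<delta> :: int ^ 'd \<Rightarrow> complex)"
    unfolding sobolev_norm_def by (intro ennpow_mono) auto
  then show ?thesis by (simp add: ennpow_def)
qed

lemma japanese_ge_1: "1 \<le> japanese n"
  by (simp add: japanese_def)

lemma japanese_ge_shell:
  assumes "n \<in> shell j" "0 < j"
  shows "2 ^ (j - 1) \<le> japanese n"
proof -
  have "n \<notin> freq_cube (2 ^ (j - 1))" using assms by (simp add: shell_def)
  then obtain i where i: "int (2 ^ (j - 1)) < \<bar>n $ i\<bar>" by (auto simp: freq_cube_def not_le)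
  then have "real_of_int (int (2 ^ (j - 1))) < real_of_int \<bar>n $ i\<bar>" by (simp only: of_int_less_iff)
  then have "2 ^ (j - 1) \<le> \<bar>rvec n $ i\<bar>" by (simp add: rvec_def)
  also have "\<dots> \<le> norm (rvec n)" by (rule component_le_norm_cart)
  also have "\<dots> \<le> japanese n" unfolding japanese_def by (intro real_le_rsqrt) auto
  finally show ?thesis .
qed

definition data_variance :: "'d::finite itself \<Rightarrow> real \<Rightarrow> real" where
  "data_variance D s = 3 ^ CARD('d) * 2 powr (real CARD('d) + 2 * s)"

text \<open>
  A shell contains of the order of \<open>2\<^sup>j\<^sup>d\<close> frequencies, each with
  variance of the order of
  \<open>2\<^sup>-\<^sup>j\<^sup>(\<^sup>d\<^sup>+\<^sup>2\<^sup>s\<^sup>'\<^sup>)\<close>. The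
  data have every regularity below \<open>s'\<close>, in each Lebesgue space.
\<close>

lemma data_coeff_variance:
  fixes a \<delta> \<gamma> :: real
  defines "s' \<equiv> s_crit TYPE('d::finite) a - \<delta>"
  assumes \<gamma>: "0 < \<gamma>" "\<gamma> \<le> s'"
  shows "(\<Sum>n\<in>(shell j :: (int ^ 'd) set). (2 powr (\<gamma> * real j) * cmod (data_coeff a \<delta> n))\<^sup>2) \<le> data_variance TYPE('d) s'"
proof -
  let ?f = "\<lambda>n :: int ^ 'd. (2 powr (\<gamma> * real j) * cmod (data_coeff a \<delta> n))\<^sup>2"
  let ?d = "real CARD('d)"
  have e: "- dimn TYPE('d) / 2 - s_crit TYPE('d) a + \<delta> = - (?d / 2 + s')" by (simp add: s'_def)
  have cm: "cmod (data_coeff a \<delta> n) = japanese n powr (- (?d / 2 + s'))" for n :: "int ^ 'd"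
    unfolding data_coeff_def e by simp
  have V1: "3 ^ CARD('d) \<le> data_variance TYPE('d) s'"
    using \<gamma> ge_one_powr_ge_zero[of 2 "?d + 2 * s'"] by (simp add: data_variance_def)
  show ?thesis
  proof (cases "j = 0")
    case True
    have "(\<Sum>n\<in>shell j. ?f n) \<le> (\<Sum>n\<in>(shell j :: (int ^ 'd) set). 1)"
    proof (intro sum_mono)
      fix n :: "int ^ 'd"
      have "japanese n powr (- (?d / 2 + s')) \<le> japanese n powr 0"
        using \<gamma> japanese_ge_1[of n] by (intro powr_mono) auto
      then have "cmod (data_coeff a \<delta> n) \<le> 1" using japanese_ge_1[of n] by (simp add: cm)
      then show "?f n \<le> 1" using True by (simp add: power_le_one)
    qed
    also have "\<dots> = 3 ^ CARD('d)" using True by (simp add: shell_def card_freq_cube)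
    finally show ?thesis using V1 by linarith
  next
    case False
    have "?f n \<le> 2 powr (2 * \<gamma> * real j) * 2 powr (- ((real j - 1) * (?d + 2 * s')))" if "n \<in> shell j" for n :: "int ^ 'd"
    proof -
      have "2 ^ (j - 1) \<le> japanese n" using that False by (intro japanese_ge_shell) auto
      then have "2 powr (real j - 1) \<le> japanese n" using False by (simp add: powr_realpow[symmetric] of_nat_diff)
      then have "japanese n powr (- (?d / 2 + s')) \<le> (2 powr (real j - 1)) powr (- (?d / 2 + s'))"
        using \<gamma> by (intro powr_mono2') auto
      then have "cmod (data_coeff a \<delta> n) \<le> 2 powr (- ((real j - 1) * (?d / 2 + s')))"
        by (simp only: cm powr_powr mult_minus_right)
      then have "(cmod (data_coeff a \<delta> n))\<^sup>2 \<le> (2 powr (- ((real j - 1) * (?d / 2 + s'))))\<^sup>2" by (intro power_mono) auto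
      also have "\<dots> = 2 powr (- ((real j - 1) * (?d + 2 * s')))"
        by (simp add: power2_eq_square powr_add[symmetric] algebra_simps)
      finally have "(2 powr (\<gamma> * real j))\<^sup>2 * (cmod (data_coeff a \<delta> n))\<^sup>2 \<le> (2 powr (\<gamma> * real j))\<^sup>2 * 2 powr (- ((real j - 1) * (?d + 2 * s')))"
        by (intro mult_left_mono) auto
      moreover have "(2 powr (\<gamma> * real j))\<^sup>2 = 2 powr (2 * \<gamma> * real j)"
        by (simp add: power2_eq_square powr_add[symmetric] mult.assoc)
      ultimately show ?thesis by (simp add: power_mult_distrib)
    qed
    then have "(\<Sum>n\<in>shell j. ?f n) \<le> (\<Sum>n\<in>(shell j :: (int ^ 'd) set). 2 powr (2 * \<gamma> * real j) * 2 powr (- ((real j - 1) * (?d + 2 * s'))))"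
      by (intro sum_mono)
    also have "\<dots> = real (card (shell j :: (int ^ 'd) set)) * (2 powr (2 * \<gamma> * real j) * 2 powr (- ((real j - 1) * (?d + 2 * s'))))"
      by simp
    also have "\<dots> \<le> (3 ^ CARD('d) * 2 powr (real j * ?d)) * (2 powr (2 * \<gamma> * real j) * 2 powr (- ((real j - 1) * (?d + 2 * s'))))"
    proof (intro mult_right_mono)
      have "card (shell j :: (int ^ 'd) set) \<le> card (freq_cube (2 ^ j) :: (int ^ 'd) set)"
        by (intro card_mono) (auto simp: shell_def)
      then have "real (card (shell j :: (int ^ 'd) set)) \<le> (1 + 2 * 2 ^ j) ^ CARD('d)"
        unfolding card_freq_cube by (simp add: of_nat_le_iff[symmetric, where 'a=real] del: of_nat_le_iff)
      also have "\<dots> \<le> (3 * 2 ^ j) ^ CARD('d)" using one_le_power[of "2::real" j] by (intro power_mono) auto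
      also have "\<dots> = 3 ^ CARD('d) * 2 powr (real j * ?d)"
        by (simp add: power_mult_distrib powr_realpow[symmetric] powr_powr)
      finally show "real (card (shell j :: (int ^ 'd) set)) \<le> 3 ^ CARD('d) * 2 powr (real j * ?d)" .
    qed auto
    also have "\<dots> = 3 ^ CARD('d) * 2 powr (?d + 2 * s' + real j * (2 * \<gamma> - 2 * s'))"
      by (simp add: powr_add[symmetric] mult.assoc) (simp add: algebra_simps)
    also have "\<dots> \<le> data_variance TYPE('d) s'"
    proof -
      have "real j * (2 * \<gamma> - 2 * s') \<le> 0" using \<gamma> by (intro mult_nonneg_nonpos) auto
      then show ?thesis unfolding data_variance_def by (intro mult_left_mono powr_mono) auto
    qed
    finally show ?thesis .
  qed
qed

lemma member_le_seqnorm: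
  assumes "0 < r"
  shows "f j \<le> seqnorm (ennreal r) f" "f j \<le> seqnorm \<infinity> f"
proof -
  have "ennpow (ennpow (f j) r) (1 / r) \<le> ennpow (\<Sum>j. ennpow (f j) r) (1 / r)"
    using assms sum_le_suminf[of "\<lambda>j. ennpow (f j) r" "{j}"] by (intro ennpow_mono[of "ennpow (f j) r"]) auto
  then show "f j \<le> seqnorm (ennreal r) f" using assms by (simp add: seqnorm_def)
  show "f j \<le> seqnorm \<infinity> f" by (simp add: seqnorm_def SUP_upper)
qed

lemma ennreal_mult_le_cancel:
  assumes "ennreal (2 powr a) * x \<le> y"
  shows "x \<le> ennreal (2 powr (- a)) * y"
proof -
  have "ennreal (2 powr (- a)) * (ennreal (2 powr a) * x) \<le> ennreal (2 powr (- a)) * y" using assms by (intro mult_left_mono) auto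
  moreover have "ennreal (2 powr (- a)) * (ennreal (2 powr a) * x) = x"
    unfolding mult.assoc[symmetric] by (subst ennreal_mult[symmetric]) (auto simp: powr_add[symmetric])
  ultimately show ?thesis by simp
qed

lemma Lx_P_dy_le_besov_x:
  "Lx r (P_dy j f) \<le> ennreal (2 powr (- (\<theta> * real j))) * besov_x \<theta> r \<infinity> f"
proof (cases j)
  case 0
  then show ?thesis by (simp add: besov_x_def add_increasing)
next
  case (Suc i)
  have "ennreal ((2 ^ Suc i) powr \<theta>) * Lx r (P_dy (Suc i) f) \<le> seqnorm \<infinity> (\<lambda>j. ennreal ((2 ^ Suc j) powr \<theta>) * Lx r (P_dy (Suc j) f))"
    by (rule member_le_seqnorm(2)[of 1]) simp
  also have "\<dots> \<le> besov_x \<theta> r \<infinity> f" by (simp add: besov_x_def add_increasing2)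
  finally have "ennreal (2 powr (\<theta> * real j)) * Lx r (P_dy j f) \<le> besov_x \<theta> r \<infinity> f"
    unfolding Suc by (simp add: powr_realpow[symmetric] powr_powr mult.commute del: power_Suc of_nat_Suc)
  then show ?thesis by (rule ennreal_mult_le_cancel)
qed

lemma LtE_Pt_dy_le_besov_t:
  assumes "0 < r"
  shows "LtE r E (Pt_dy \<eta> L B) \<le> ennreal (2 powr (- (s * real L))) * besov_t \<eta> s r (ennreal r) E B"
proof (cases L)
  case 0
  then show ?thesis by (simp add: besov_t_def add_increasing)
next
  case (Suc i)
  have "ennreal ((2 ^ Suc i) powr s) * LtE r E (Pt_dy \<eta> (Suc i) B) \<le> seqnorm (ennreal r) (\<lambda>j. ennreal ((2 ^ Suc j) powr s) * LtE r E (Pt_dy \<eta> (Suc j) B))"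
    using assms by (rule member_le_seqnorm(1))
  also have "\<dots> \<le> besov_t \<eta> s r (ennreal r) E B" by (simp add: besov_t_def add_increasing2)
  finally have "ennreal (2 powr (s * real L)) * LtE r E (Pt_dy \<eta> L B) \<le> besov_t \<eta> s r (ennreal r) E B"
    unfolding Suc by (simp add: powr_realpow[symmetric] powr_powr mult.commute del: power_Suc of_nat_Suc)
  then show ?thesis by (rule ennreal_mult_le_cancel)
qed

lemma jointly_measurable_Pt_dy:
  assumes \<eta>: "LP_cutoff \<eta>" and B: "jointly_measurable B"
  shows "jointly_measurable (Pt_dy \<eta> L B)"
proof -
  interpret lp_cutoff \<eta> by standard (rule \<eta>)
  note jointly_measurableD[OF B, measurable]
  have "(\<lambda>(p, s). inverse_fourier (LP_symbol \<eta> L) (fst p - s) * B s (snd p)) \<in> borel_measurable ((borel \<Otimes>\<^sub>M borel) \<Otimes>\<^sub>M lborel)"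
    by measurable
  then have "(\<lambda>p. \<integral>s. inverse_fourier (LP_symbol \<eta> L) (fst p - s) * B s (snd p) \<partial>lborel) \<in> borel_measurable (borel \<Otimes>\<^sub>M borel)"
    by (rule lborel.borel_measurable_lebesgue_integral)
  then show ?thesis unfolding borel_prod by (simp add: Pt_dy_def[abs_def] case_prod_beta')
qed

text \<open>
  A single joint block is one term in each of the two sequence norms.
\<close>

lemma Lnorm_block_le_besov:
  assumes \<eta>: "LP_cutoff \<eta>" and B: "jointly_measurable B" and r: "0 < r"
    and \<beta>: "besov_t \<eta> s r (ennreal r) (besov_x \<theta> r \<infinity>) B = ennreal \<beta>" "0 \<le> \<beta>"
  shows "Lnorm r spacetime (\<lambda>(t, x). ennreal (cmod (P_dy j (Pt_dy \<eta> L B t) x)))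
      \<le> ennreal (\<beta> * (2 powr (- \<theta>)) ^ j * (2 powr (- s)) ^ L)"
proof -
  have jm: "jointly_measurable (\<lambda>t. P_dy j (Pt_dy \<eta> L B t))"
    by (intro jointly_measurable_P_dy jointly_measurable_Pt_dy \<eta> B)
  let ?E = "besov_x \<theta> r \<infinity> :: (real ^ 'a \<Rightarrow> complex) \<Rightarrow> ennreal"
  have "Lnorm r spacetime (\<lambda>(t, x). ennreal (cmod (P_dy j (Pt_dy \<eta> L B t) x))) = Lnorm r lborel (\<lambda>t. Lx r (P_dy j (Pt_dy \<eta> L B t)))"
    using LtE_Lx_eq[OF jm r] by (simp add: LtE_def)
  also have "\<dots> \<le> ennreal (2 powr (- (\<theta> * real j))) * LtE r ?E (Pt_dy \<eta> L B)"
  proof -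
    have m: "(\<lambda>t. Lx r (P_dy j (Pt_dy \<eta> L B t))) \<in> borel_measurable lborel"
    proof -
      note jointly_measurableD[OF jm, measurable]
      have "(\<lambda>(t, x). ennpow (ennreal (cmod (P_dy j (Pt_dy \<eta> L B t) x))) r) \<in> borel_measurable (lborel \<Otimes>\<^sub>M torus)"
        by (rule measurable_ST) measurable
      then show ?thesis unfolding Lx_def Lnorm_def by (intro ennpow_measurable torus.borel_measurable_nn_integral)
    qed
    have "Lnorm r lborel (\<lambda>t. ennreal (2 powr (\<theta> * real j)) * Lx r (P_dy j (Pt_dy \<eta> L B t))) \<le> LtE r ?E (Pt_dy \<eta> L B)"
      unfolding LtE_def
    proof (rule Lnorm_mono[OF r])
      fix t
      have "ennreal (2 powr (\<theta> * real j)) * Lx r (P_dy j (Pt_dy \<eta> L B t)) \<le> ennreal (2 powr (\<theta> * real j)) * (ennreal (2 powr (- (\<theta> * real j))) * ?E (Pt_dy \<eta> L B t))"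
        by (intro mult_left_mono Lx_P_dy_le_besov_x) auto
      also have "\<dots> = ?E (Pt_dy \<eta> L B t)"
        unfolding mult.assoc[symmetric] by (subst ennreal_mult[symmetric]) (auto simp: powr_add[symmetric])
      finally show "ennreal (2 powr (\<theta> * real j)) * Lx r (P_dy j (Pt_dy \<eta> L B t)) \<le> ?E (Pt_dy \<eta> L B t)" .
    qed
    then show ?thesis unfolding Lnorm_cmult[OF r m] by (rule ennreal_mult_le_cancel)
  qed
  also have "\<dots> \<le> ennreal (2 powr (- (\<theta> * real j))) * (ennreal (2 powr (- (s * real L))) * ennreal \<beta>)"
    unfolding \<beta>(1)[symmetric] by (intro mult_left_mono LtE_Pt_dy_le_besov_t r) auto
  also have "\<dots> = ennreal (\<beta> * (2 powr (- \<theta>)) ^ j * (2 powr (- s)) ^ L)"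
    using \<beta>(2) by (simp add: ennreal_mult[symmetric] powr_realpow[symmetric] powr_powr mult_ac)
  finally show ?thesis .
qed

lemma fourier_coeff_cmult: "fourier_coeff (\<lambda>x. c * f x) n = c * fourier_coeff f n"
  by (simp add: fourier_coeff_def mult.assoc)

lemma P_dy_cmult: "P_dy j (\<lambda>x. c * f x) x = c * P_dy j f x"
  by (simp add: P_dy_eq fourier_coeff_cmult sum_distrib_left mult.assoc)

lemma ex_freq_cube: "\<exists>J. n \<in> freq_cube (2 ^ J)"
proof
  let ?J = "nat (\<Sum>i\<in>UNIV. \<bar>n $ i\<bar>)"
  have "\<bar>n $ i\<bar> \<le> int (2 ^ ?J)" for i
  proof -
    have "\<bar>n $ i\<bar> \<le> (\<Sum>i\<in>UNIV. \<bar>n $ i\<bar>)" by (rule member_le_sum) auto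
    also have "\<dots> = int ?J" by (simp add: sum_nonneg)
    also have "\<dots> \<le> int (2 ^ ?J)" using less_exp[of ?J] by (simp only: of_nat_le_iff less_imp_le)
    finally show ?thesis .
  qed
  then show "n \<in> freq_cube (2 ^ ?J)" by (simp add: freq_cube_def)
qed

text \<open>
  Settles the case in which the norm of \<open>v\<close> vanishes while the norm of
  \<open>B\<close> is infinite.
\<close>

lemma AE_zero_if_blocks_zero:
  fixes u :: "real \<Rightarrow> real ^ 'd \<Rightarrow> complex"
  assumes u: "jointly_measurable u" "integrable spacetime (\<lambda>(t, x). u t x)"
    and supp: "\<And>t x. K < \<bar>t\<bar> \<Longrightarrow> u t x = 0" and K: "0 < K" and p: "0 < p"
    and zero: "\<And>j. Lnorm p spacetime (\<lambda>(t, x). ennreal (cmod (P_dy j (u t) x))) = 0"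
  shows "AE q in spacetime. (case q of (t, x) \<Rightarrow> u t x) = 0"
proof (rule AE_zero_if_fourier_zero[OF u supp K])
  have "AE t in lborel. AE x in torus. P_dy j (u t) x = 0" for j
  proof -
    note jointly_measurableD[OF jointly_measurable_P_dy[OF u(1)], measurable]
    have "(\<lambda>(t, x). ennreal (cmod (P_dy j (u t) x))) \<in> borel_measurable spacetime"
      by (rule measurable_ST) measurable
    from zero[of j, unfolded Lnorm_eq_0_iff[OF p this]]
    have "AE q in spacetime. P_dy j (u (fst q)) (snd q) = 0" by (simp add: case_prod_beta')
    from ST.AE_pair[OF this] show ?thesis by simp
  qed
  then have AE: "AE t in lborel. \<forall>j. AE x in torus. P_dy j (u t) x = 0"
    by (simp add: AE_all_countable)
  fix n :: "int ^ 'd"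
  obtain J where J: "n \<in> freq_cube (2 ^ J)" using ex_freq_cube by blast
  show "AE t in lborel. fourier_coeff (u t) n = 0"
    using AE
  proof eventually_elim
    case (elim t)
    then have "AE x in torus. \<forall>j. P_dy j (u t) x = 0" by (simp add: AE_all_countable)
    then have "AE x in torus. P_le (2 ^ J) (u t) x * cis (- (x \<bullet> rvec n)) = 0"
      by eventually_elim (simp add: sum_P_dy[symmetric])
    then have "fourier_coeff (P_le (2 ^ J) (u t)) n = 0"
      unfolding fourier_coeff_def by (simp add: integral_eq_zero_AE)
    moreover have "fourier_coeff (P_le (2 ^ J) (u t)) n = fourier_coeff (u t) n"
      using J fourier_coeff_trig[OF finite_freq_cube, where k=n] by (simp add: P_le_eq[abs_def])
    ultimately show ?case by simp
  qed
qed

locale time_cutoffs =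
  fixes \<psi> \<psi>' :: "real \<Rightarrow> real"
  assumes \<psi>: "smooth \<psi>" "closure {t. \<psi> t \<noteq> 0} \<subseteq> {-1..1}"
    and \<psi>': "\<And>t. t \<in> closure {t. \<psi> t \<noteq> 0} \<Longrightarrow> \<psi>' t = 1"
begin

lemma \<psi>_continuous: "continuous_on UNIV \<psi>"
  using \<psi>(1)[unfolded smooth_def, rule_format, of 0] by (simp add: differentiable_imp_continuous_on)

lemma \<psi>_meas [measurable]: "\<psi> \<in> borel_measurable borel"
  by (rule borel_measurable_continuous_onI[OF \<psi>_continuous])

lemma \<psi>_outside: "1 < \<bar>t\<bar> \<Longrightarrow> \<psi> t = 0"
  using \<psi>(2) closure_subset[of "{t. \<psi> t \<noteq> 0}"] by fastforce

lemma \<psi>'_eq_1: "\<psi> t \<noteq> 0 \<Longrightarrow> \<psi>' t = 1"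
  using \<psi>' closure_subset[of "{t. \<psi> t \<noteq> 0}"] by auto

lemma \<psi>_bounded: "\<exists>C\<ge>1. \<forall>t. (\<psi> t)\<^sup>2 \<le> C"
proof -
  have "bounded (\<psi> ` {-1..1})"
    by (intro compact_imp_bounded compact_continuous_image continuous_on_subset[OF \<psi>_continuous]) auto
  then obtain C where C: "\<And>t. t \<in> {-1..1} \<Longrightarrow> \<bar>\<psi> t\<bar> \<le> C" unfolding bounded_iff by fastforce
  have "(\<psi> t)\<^sup>2 \<le> max 1 (C\<^sup>2)" for t
  proof (cases "\<bar>t\<bar> \<le> 1")
    case True
    then have "t \<in> {-1..1}" by auto
    then have "\<bar>\<psi> t\<bar>\<^sup>2 \<le> C\<^sup>2" by (intro power_mono C) auto
    then show ?thesis by (simp add: le_max_iff_disj)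
  qed (simp add: \<psi>_outside)
  then show ?thesis by (intro exI[of _ "max 1 (C\<^sup>2)"]) auto
qed

definition C\<psi> :: real where "C\<psi> = (SOME C. 1 \<le> C \<and> (\<forall>t. (\<psi> t)\<^sup>2 \<le> C))"

lemma C\<psi>: "1 \<le> C\<psi>" "(\<psi> t)\<^sup>2 \<le> C\<psi>"
  using someI_ex[OF \<psi>_bounded] unfolding C\<psi>_def by auto

definition windowed :: "(real \<Rightarrow> real ^ 'd \<Rightarrow> complex) \<Rightarrow> real \<Rightarrow> real ^ 'd \<Rightarrow> complex" where
  "windowed v t x = complex_of_real ((\<psi> t)\<^sup>2) * v t x"

lemma windowed_outside: "1 < \<bar>t\<bar> \<Longrightarrow> windowed v t x = 0"
  by (simp add: windowed_def \<psi>_outside)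

lemma jointly_measurable_windowed:
  assumes "jointly_measurable v"
  shows "jointly_measurable (windowed v)"
proof -
  note jointly_measurableD[OF assms, measurable]
  have "(\<lambda>(t, x). windowed v t x) \<in> borel_measurable (borel \<Otimes>\<^sub>M borel)"
    unfolding windowed_def by measurable
  then show ?thesis by (simp only: borel_prod)
qed

lemma P_dy_windowed: "P_dy j (windowed v t) x = complex_of_real ((\<psi> t)\<^sup>2) * P_dy j (v t) x"
  unfolding windowed_def[abs_def] by (rule P_dy_cmult)

lemma integrable_windowed:
  fixes v :: "real \<Rightarrow> real ^ 'd \<Rightarrow> complex"
  assumes v: "jointly_measurable v" "locally_integrable_in_time v"
  shows "integrable spacetime (\<lambda>(t, x). windowed v t x)"
proof (rule Bochner_Integration.integrable_bound)
  let ?v = "\<lambda>q. indicator ({-1..1} \<times> UNIV) q *\<^sub>R (case q of (t, x) \<Rightarrow> v t x)"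
  show "integrable spacetime (\<lambda>q. C\<psi> *\<^sub>R ?v q)"
    using v(2) unfolding locally_integrable_in_time_def set_integrable_def by (intro integrable_scaleR_right) blast
  show "(\<lambda>(t, x). windowed v t x) \<in> borel_measurable spacetime"
    using jointly_measurableD[OF jointly_measurable_windowed[OF v(1)]] by (rule measurable_ST)
  show "AE q in spacetime. norm (case q of (t, x) \<Rightarrow> windowed v t x) \<le> norm (C\<psi> *\<^sub>R ?v q)"
  proof (rule AE_I2)
    fix q :: "real \<times> (real ^ 'd)"
    obtain t x where q: "q = (t, x)" by (cases q)
    show "norm (case q of (t, x) \<Rightarrow> windowed v t x) \<le> norm (C\<psi> *\<^sub>R ?v q)"
    proof (cases "\<bar>t\<bar> \<le> 1")
      case True
      then have "(t, x) \<in> {-1..1} \<times> UNIV" by auto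
      moreover have "(\<psi> t)\<^sup>2 * cmod (v t x) \<le> C\<psi> * cmod (v t x)" by (intro mult_right_mono C\<psi>) auto
      ultimately show ?thesis using C\<psi>(1) by (simp add: q windowed_def norm_mult norm_power del: mem_Sigma_iff)
    qed (simp add: q windowed_outside)
  qed
qed

text \<open>
  At the left endpoint \<open>q = p\<close> of the range in the Strichartz part the spatial
  exponent equals \<open>p\<close> too, so this single term of the norm is a norm on space-time.
  Where the first cutoff does not vanish the second one is one, so it may be inserted.
\<close>

lemma Lnorm_P_dy_windowed_le:
  fixes v :: "real \<Rightarrow> real ^ 'd \<Rightarrow> complex"
  assumes v: "jointly_measurable v" and \<sigma>: "0 < \<sigma>" "\<sigma> < 1 / 8"
  defines "p \<equiv> p_exp TYPE('d) \<sigma>"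
  shows "Lnorm p spacetime (\<lambda>(t, x). ennreal (cmod (P_dy j (windowed v t) x)))
    \<le> ennreal (2 powr (real j * \<sigma>)) * (ennreal C\<psi> * Z_norm \<eta> \<psi> \<psi>' \<sigma> 0 v)"
proof -
  let ?d = "real CARD('d)"
  have d: "1 \<le> ?d" using one_le_card_finite[where 'a='d] by simp
  have pos: "0 < ?d / 2 - \<sigma>" using d \<sigma> by linarith
  have p: "0 < p" unfolding p_def p_exp_def using pos d by (intro divide_pos_pos) auto
  have inv: "2 / p = 2 * (?d / 2 - \<sigma>) / (?d + 2)" by (simp add: p_def p_exp_def)
  have "?d / 2 - \<sigma> - 2 / p = (?d / 2 - \<sigma>) * (?d / (?d + 2))"
    unfolding inv using d by (simp add: field_simps)
  then have r: "r_exp TYPE('d) \<sigma> p = p"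
    unfolding r_exp_def p_def p_exp_def using d pos by (simp add: field_simps)
  have p_le: "p \<le> 1 / \<sigma>"
  proof -
    have "\<sigma> * (?d + 3) \<le> 1 / 8 * (?d + 3)" using \<sigma> d by (intro mult_right_mono) auto
    also have "\<dots> \<le> ?d / 2" using d by simp
    finally have "(?d + 2) * \<sigma> \<le> 1 * (?d / 2 - \<sigma>)" by (simp add: algebra_simps)
    then show ?thesis unfolding p_def p_exp_def using pos \<sigma> by (simp add: divide_le_eq pos_le_divide_eq field_simps)
  qed
  let ?a = "LtE p (Lx p) (\<lambda>t x. complex_of_real (\<psi>' t) * P_dy j (v t) x)"
  let ?term = "\<lambda>q j. ennreal ((2 ^ j) powr (2 * (0 - \<sigma>))) * (LtE q (Lx (r_exp TYPE('d) \<sigma> q)) (\<lambda>t x. complex_of_real (\<psi>' t) * P_dy j (v t) x))\<^sup>2"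
  have "ennreal (2 powr (- (real j * \<sigma>))) * ?a = ennpow (?term p j) (1 / 2)"
  proof -
    have "?term p j = (ennreal (2 powr (- (real j * \<sigma>))) * ?a)\<^sup>2"
      unfolding r power_mult_distrib
      by (simp add: ennreal_power powr_realpow[symmetric] powr_powr powr_power mult_ac)
    then show ?thesis by (simp add: ennpow_2[symmetric] ennpow_ennpow)
  qed
  also have "\<dots> \<le> ennpow (\<Sum>j. ?term p j) (1 / 2)"
    using sum_le_suminf[of "?term p" "{j}"] by (intro ennpow_mono[of "?term p j"]) auto
  also have "\<dots> \<le> Z_strichartz \<psi>' \<sigma> 0 v"
    unfolding Z_strichartz_def using p_le by (intro SUP_upper) (auto simp: p_def)
  also have "\<dots> \<le> Z_norm \<eta> \<psi> \<psi>' \<sigma> 0 v" by (simp add: Z_norm_def)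
  finally have "?a \<le> ennreal (2 powr (real j * \<sigma>)) * Z_norm \<eta> \<psi> \<psi>' \<sigma> 0 v"
    using ennreal_mult_le_cancel[of "- (real j * \<sigma>)" ?a] by simp
  then have Z: "ennreal C\<psi> * ?a \<le> ennreal (2 powr (real j * \<sigma>)) * (ennreal C\<psi> * Z_norm \<eta> \<psi> \<psi>' \<sigma> 0 v)"
    by (simp add: mult.left_commute mult_left_mono)
  note Pm = jointly_measurable_P_dy[OF v, of j]
  note jointly_measurableD[OF Pm, measurable]
  define h where "h t x = (if \<psi> t = 0 then 0 else P_dy j (v t) x)" for t x
  have h_meas: "(\<lambda>(t, x). h t x) \<in> borel_measurable (borel \<Otimes>\<^sub>M borel)"
    unfolding h_def by measurable
  then have hj: "jointly_measurable h" by (simp only: borel_prod)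
  note h_meas[measurable]
  have hm: "(\<lambda>(t, x). ennreal (cmod (h t x))) \<in> borel_measurable spacetime"
    by (rule measurable_ST) measurable
  have "Lnorm p spacetime (\<lambda>(t, x). ennreal (cmod (P_dy j (windowed v t) x)))
      \<le> Lnorm p spacetime (\<lambda>q. ennreal C\<psi> * (case q of (t, x) \<Rightarrow> ennreal (cmod (h t x))))"
  proof (rule Lnorm_mono[OF p])
    fix q :: "real \<times> (real ^ 'd)"
    obtain t x where q: "q = (t, x)" by (cases q)
    have "(\<psi> t)\<^sup>2 * cmod (P_dy j (v t) x) \<le> C\<psi> * cmod (h t x)"
      using C\<psi>(2)[of t] by (auto simp: h_def intro!: mult_right_mono)
    then show "(case q of (t, x) \<Rightarrow> ennreal (cmod (P_dy j (windowed v t) x))) \<le> ennreal C\<psi> * (case q of (t, x) \<Rightarrow> ennreal (cmod (h t x)))"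
      using C\<psi>(1) by (simp add: q P_dy_windowed norm_mult norm_power ennreal_mult[symmetric] ennreal_leI)
  qed
  also have "\<dots> = ennreal C\<psi> * Lnorm p spacetime (\<lambda>(t, x). ennreal (cmod (h t x)))"
    by (rule Lnorm_cmult[OF p hm])
  also have "Lnorm p spacetime (\<lambda>(t, x). ennreal (cmod (h t x))) = LtE p (Lx p) h"
    by (rule LtE_Lx_eq[OF hj p, symmetric])
  also have "ennreal C\<psi> * LtE p (Lx p) h \<le> ennreal C\<psi> * ?a"
    unfolding LtE_def Lx_def
    by (intro mult_left_mono Lnorm_mono p) (auto simp: h_def \<psi>'_eq_1)
  also note Z
  finally show ?thesis .
qed

end

section \<open>The trilinear estimate\<close>

lemma schroedinger_meas:
  fixes c :: "int ^ 'd \<Rightarrow> complex"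
  shows "(\<lambda>(t, x). schroedinger c t x) \<in> borel_measurable (borel \<Otimes>\<^sub>M borel)"
proof -
  have "(\<lambda>q :: real \<times> (real ^ 'd). \<Sum>n\<in>freq_cube (2 ^ j). c n * cis (snd q \<bullet> rvec n - fst q * (norm (rvec n))\<^sup>2)) \<in> borel_measurable (borel \<Otimes>\<^sub>M borel)" for j
    unfolding borel_prod by (intro borel_measurable_continuous_onI continuous_intros)
  then show ?thesis unfolding schroedinger_def case_prod_beta' by (rule borel_measurable_lim_metric)
qed

text \<open>
  Products of extended numbers satisfy \<open>0 \<infinity> = 0\<close>; if one of the norms is
  infinite, the right-hand side of the estimate is infinite unless another norm vanishes.
\<close>

lemma ennreal_zero_or_top_cases:
  fixes Z b K :: ennreal
  assumes "0 < K"
  obtains (fin) "Z < \<infinity>" "b < \<infinity>" | (Z0) "Z = 0" | (b0) "b = 0" | (top) "K * Z * b = \<infinity>"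
proof (cases "Z = 0 \<or> b = 0 \<or> (Z < \<infinity> \<and> b < \<infinity>)")
  case False
  then have "Z = \<infinity> \<or> b = \<infinity>" by (auto simp: less_top[symmetric])
  then have "K * Z * b = \<infinity>" using False assms by (auto simp: ennreal_mult_eq_top_iff)
  then show thesis by (rule top)
qed (use that in blast)

definition (in gaussian_series) estimate_const :: "real \<Rightarrow> real \<Rightarrow> real \<Rightarrow> real \<Rightarrow> real \<Rightarrow> real \<Rightarrow> real" where
  "estimate_const \<sigma> m r \<beta> s C = pairing_const TYPE('d) s \<sigma> * (2 * C * (2 * torus_volume TYPE('d)) powr (1 / m)
     * (block_const TYPE('d) m (\<gamma> / 2) s * random_const TYPE('d) \<gamma>) * (block_const TYPE('d) r (\<beta> / 2) s * poly_exp_const \<beta>))"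

text \<open>
  The integrand is the complex conjugate of \<open>u w\<close>, where \<open>u\<close> is
  \<open>v\<close> with its cutoff and \<open>w\<close> is the product of the time window, the
  random series and the conjugate of the Besov function. If \<open>u w\<close> is not integrable,
  the integral is zero by convention.
\<close>

lemma (in gaussian_series) random_trilinear_estimate:
  fixes v B :: "real \<Rightarrow> real ^ 'd \<Rightarrow> complex" and \<psi> \<psi>' \<eta> :: "real \<Rightarrow> real"
  assumes cutoffs: "time_cutoffs \<psi> \<psi>'" and \<eta>: "LP_cutoff \<eta>"
    and v: "jointly_measurable v" "locally_integrable_in_time v"
    and B: "jointly_measurable B" "tempered_in_time B"
    and r: "1 < r" and \<theta>: "0 < \<theta>" and \<tau>: "0 < \<tau>" and m: "1 < m" and p: "0 < p"
    and exponents: "1 / p + 1 / m + 1 / m + 1 / r = 1"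
    and s: "0 < s" "s \<le> 1" "(real CARD('d) + 1) * s < \<gamma> / 2" "(real CARD('d) + 1) * s < min \<theta> \<tau> / 2"
    and \<sigma>: "\<sigma> < s / 2" and T: "0 < T" and T1: "T \<le> 1" and l: "m \<le> l" and \<omega>: "\<omega> \<in> good l"
    and Z: "\<And>j. Lnorm p spacetime (\<lambda>(t, x). ennreal (cmod (P_dy j (time_cutoffs.windowed \<psi> v t) x)))
      \<le> ennreal (2 powr (real j * \<sigma>)) * (ennreal C * Z)" and C: "1 \<le> C"
  shows "ennreal (cmod (\<integral>(t, x). complex_of_real ((\<psi> t)\<^sup>2) * cnj (indicator {-T..T} t * schroedinger (\<lambda>n. b n * g n \<omega>) t x * v t x) * B t x \<partial>spacetime))
    \<le> ennreal ((1 + \<bar>estimate_const \<sigma> m r (min \<theta> \<tau>) s C\<bar>) * (T powr (1 / m) * l)) * Z * besov_t \<eta> \<tau> r (ennreal r) (besov_x \<theta> r \<infinity>) B"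
    (is "ennreal (cmod (integral\<^sup>L _ (\<lambda>(t, x). ?F t x))) \<le> ennreal ?K * Z * ?b")
proof -
  interpret time_cutoffs \<psi> \<psi>' by (rule cutoffs)
  let ?u = "windowed v"
  note B_meas[measurable] = jointly_measurableD[OF B(1)]
  note v_meas[measurable] = jointly_measurableD[OF v(1)]
  note u = jointly_measurable_windowed[OF v(1)] integrable_windowed[OF v]
  note u_meas[measurable] = jointly_measurableD[OF u(1)]
  note schroedinger_meas[where c = "\<lambda>n. b n * g n \<omega>", measurable]
  have cnj_meas [measurable]: "cnj \<in> borel_measurable borel"
    by (intro borel_measurable_continuous_onI continuous_intros)
  have F_meas: "(\<lambda>(t, x). ?F t x) \<in> borel_measurable spacetime"
    by (rule measurable_ST) measurable
  have l_pos: "0 < l" using m l by linarith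
  have K: "0 < ?K" using T l_pos by (intro mult_pos_pos) auto
  \<comment> \<open>Covers the two degenerate cases in which one of the two norms vanishes.\<close>
  have trivial: ?thesis if "AE q in spacetime. (case q of (t, x) \<Rightarrow> ?F t x) = 0"
    using integral_eq_zero_AE[OF that] by simp
  from K have "0 < ennreal ?K" by simp
  then show ?thesis
  proof (cases rule: ennreal_zero_or_top_cases[of "ennreal ?K" Z ?b])
    case Z0
    have "Lnorm p spacetime (\<lambda>(t, x). ennreal (cmod (P_dy j (?u t) x))) = 0" for j
      using Z[of j] Z0 by simp
    from AE_zero_if_blocks_zero[OF u windowed_outside zero_less_one p this]
    have "AE q in spacetime. (case q of (t, x) \<Rightarrow> ?u t x) = 0" by blast
    then have "AE q in spacetime. (case q of (t, x) \<Rightarrow> ?F t x) = 0"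
      by eventually_elim (auto simp: windowed_def)
    then show ?thesis by (rule trivial)
  next
    case b0
    interpret Bf: besov_function \<eta> B r \<theta> \<tau> 0
    proof
      show "LP_cutoff \<eta>" by (rule \<eta>)
      show "Lnorm r spacetime (\<lambda>(t, x). ennreal (cmod (P_dy j (Pt_dy \<eta> L B t) x))) \<le> ennreal (0 * (2 powr (- \<theta>)) ^ j * (2 powr (- \<tau>)) ^ L)" for j L
        using Lnorm_block_le_besov[OF \<eta> B(1), of r \<tau> \<theta> 0 j L] r b0 by simp
    qed (use B r \<theta> \<tau> in auto)
    have "Lnorm r spacetime (\<lambda>(t, x). Bf.trig.major t x) = 0" using Bf.trig.Lnorm_major by simp
    moreover have "(\<lambda>(t, x). Bf.trig.major t x) \<in> borel_measurable spacetime"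
      by (rule measurable_ST[OF Bf.trig.major_meas])
    ultimately have "AE q in spacetime. (case q of (t, x) \<Rightarrow> Bf.trig.major t x) = 0"
      using r by (subst (asm) Lnorm_eq_0_iff) auto
    then have "AE q in spacetime. (case q of (t, x) \<Rightarrow> ?F t x) = 0"
      using Bf.AE_B_eq_series
    proof eventually_elim
      case (elim q)
      obtain t x where q: "q = (t, x)" by (cases q)
      have "ennreal (cmod (B t x)) \<le> 0" using elim Bf.trig.series_le_major[of t x] by (simp add: q)
      then show ?case by (simp add: q)
    qed
    then show ?thesis by (rule trivial)
  next
    case fin
    obtain z where z: "Z = ennreal z" "0 \<le> z" using fin by (cases Z) auto
    obtain \<beta> where \<beta>: "?b = ennreal \<beta>" "0 \<le> \<beta>" using fin by (cases ?b) auto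
    interpret Bf: besov_function \<eta> B r \<theta> \<tau> \<beta>
    proof
      show "LP_cutoff \<eta>" by (rule \<eta>)
      show "Lnorm r spacetime (\<lambda>(t, x). ennreal (cmod (P_dy j (Pt_dy \<eta> L B t) x))) \<le> ennreal (\<beta> * (2 powr (- \<theta>)) ^ j * (2 powr (- \<tau>)) ^ L)" for j L
        using Lnorm_block_le_besov[OF \<eta> B(1) _ \<beta>, of j L] r by simp
    qed (use B r \<theta> \<tau> \<beta> in auto)
    interpret R: trig_blocks "windowed_block \<omega>" "windowed_coeff \<omega>" m "l * random_const TYPE('d) \<gamma>" "\<gamma> / 2"
      by (rule good_trig_blocks[OF m l \<omega>])
    interpret two_series "windowed_block \<omega>" "windowed_coeff \<omega>" m "l * random_const TYPE('d) \<gamma>" "\<gamma> / 2" Bf.U Bf.c r "poly_exp_const Bf.\<sigma> * \<beta>" "Bf.\<sigma> / 2" T p s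
      by standard (use T p exponents s in \<open>auto simp: Bf.\<sigma>_def\<close>)
    note w_meas[measurable]
    have "(\<integral>(t, x). ?F t x \<partial>spacetime) = (\<integral>q. cnj (case q of (t, x) \<Rightarrow> ?u t x * w t x) \<partial>spacetime)"
    proof (rule Bochner_Integration.integral_cong_AE)
      show "(\<lambda>(t, x). ?F t x) \<in> borel_measurable spacetime" by (rule F_meas)
      have "(\<lambda>(t, x). cnj (?u t x * w t x)) \<in> borel_measurable spacetime"
        by (rule measurable_ST) measurable
      then show "(\<lambda>q. cnj (case q of (t, x) \<Rightarrow> ?u t x * w t x)) \<in> borel_measurable spacetime"
        by (simp add: case_prod_beta')
      show "AE q in spacetime. (case q of (t, x) \<Rightarrow> ?F t x) = cnj (case q of (t, x) \<Rightarrow> ?u t x * w t x)"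
        using Bf.AE_B_eq_series AE_schroedinger_eq_series[OF m l \<omega>]
      proof eventually_elim
        case (elim q)
        obtain t x where q: "q = (t, x)" by (cases q)
        show ?case
        proof (cases "t \<in> {-T..T}")
          case True
          then have "\<bar>t\<bar> \<le> 1" using T1 by auto
          then have "schroedinger (\<lambda>n. b n * g n \<omega>) t x = R.series t x" using elim(2) by (simp add: q)
          moreover have "B t x = Bf.trig.series t x" using elim(1) by (simp add: q)
          ultimately show ?thesis using True by (simp add: q windowed_def w_def mult_ac)
        qed (simp add: q w_def)
      qed
    qed
    then have eq: "cmod (\<integral>(t, x). ?F t x \<partial>spacetime) = cmod (\<integral>(t, x). ?u t x * w t x \<partial>spacetime)"
      by simp
    have bound_eq: "pairing_const TYPE('d) s \<sigma> * (2 * (C * z) * bound)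
        = estimate_const \<sigma> m r (min \<theta> \<tau>) s C * (T powr (1 / m) * l) * z * \<beta>"
      unfolding bound_def unfolding estimate_const_def Bf.\<sigma>_def using T torus_volume_ge_1[where 'd='d]
      by (simp add: powr_mult mult_ac)
    have "cmod (\<integral>(t, x). ?u t x * w t x \<partial>spacetime) \<le> estimate_const \<sigma> m r (min \<theta> \<tau>) s C * (T powr (1 / m) * l) * z * \<beta>
        \<or> (\<integral>(t, x). ?u t x * w t x \<partial>spacetime) = 0"
    proof (cases "integrable spacetime (\<lambda>(t, x). ?u t x * w t x)")
      case True
      have "Lnorm p spacetime (\<lambda>(t, x). ennreal (cmod (P_dy j (?u t) x))) \<le> ennreal (C * z * 2 powr (real j * \<sigma>))" for j
        using Z[of j] C z by (simp add: ennreal_mult[symmetric] mult_ac)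
      from estimate[OF u \<sigma> _ this True] show ?thesis using C z by (simp add: bound_eq)
    qed (simp add: not_integrable_integral_eq)
    moreover have "estimate_const \<sigma> m r (min \<theta> \<tau>) s C * (T powr (1 / m) * l) * z * \<beta> \<le> ?K * z * \<beta>"
      using l_pos z \<beta> by (intro mult_right_mono) auto
    moreover have "0 \<le> ?K * z * \<beta>" using l_pos K z \<beta> by (intro mult_nonneg_nonneg) auto
    ultimately have "cmod (\<integral>(t, x). ?F t x \<partial>spacetime) \<le> ?K * z * \<beta>"
      unfolding eq by auto
    then show ?thesis
      unfolding z \<beta> using z(2) \<beta>(2) less_imp_le[OF K] by (simp only: ennreal_mult[symmetric] ennreal_leI mult_nonneg_nonneg)
  next
    case top
    then show ?thesis by simp
  qed
qed

text \<open>
  Small \<open>T\<close> means large \<open>T\<^sup>-\<^sup>k\<close>; every largeness requirement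
  on the level of the good set is expressed in this way.
\<close>

lemma eventually_powr_minus_gt:
  fixes L k :: real
  assumes "0 < k"
  shows "eventually (\<lambda>T :: real. 0 < T \<and> T < 1 \<and> L < T powr (- k)) (at_right 0)"
proof (rule eventually_at_rightI)
  let ?L = "max 1 L"
  show "0 < ?L powr (- (1 / k))" by simp
  fix T :: real assume T: "T \<in> {0<..<?L powr (- (1 / k))}"
  have "?L = (?L powr (- (1 / k))) powr (- k)" using assms by (simp add: powr_powr)
  also have "\<dots> < T powr (- k)" using T assms by (intro powr_less_mono2_neg) auto
  finally have "L < T powr (- k)" by simp
  moreover have "?L powr (- (1 / k)) \<le> ?L powr 0" using assms by (intro powr_mono) auto
  moreover have "?L powr 0 = 1"
  proof -
    have "?L \<noteq> 0" using max.cobounded1[of 1 L] by linarith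
    then show ?thesis by simp
  qed
  ultimately show "0 < T \<and> T < 1 \<and> L < T powr (- k)" using T by auto
qed

theorem lemma3p15:
  fixes M :: "'w measure"
    and g :: "int ^ 'd::finite \<Rightarrow> 'w \<Rightarrow> complex"
    and a :: real
    and \<psi> \<psi>' \<eta> :: "real \<Rightarrow> real"
  assumes "a > 4 / real CARD('d)"
    and "0 < s_crit TYPE('d) a" and "s_crit TYPE('d) a < 1 + a"
    and "prob_space M"
    and "prob_space.indep_vars M (\<lambda>_. borel) g UNIV"
    and "\<And>n. standard_complex_gaussian M (g n)"
    and "smooth \<psi>" and "closure {t. \<psi> t \<noteq> 0} \<subseteq> {-1..1}"
    and "smooth \<psi>'" and "compact (closure {t. \<psi>' t \<noteq> 0})"
    and "\<And>t. t \<in> closure {t. \<psi> t \<noteq> 0} \<Longrightarrow> \<psi>' t = 1"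
    and "LP_cutoff \<eta>"
  shows "\<exists>\<delta>\<^sub>0>0.
    \<forall>\<^sub>F \<sigma>4 :: real in at_right 0. \<forall>\<^sub>F \<sigma>3 :: real in at_right 0. \<forall>\<^sub>F \<sigma>2 :: real in at_right 0.
    \<forall>\<^sub>F \<sigma>1 :: real in at_right 0. \<forall>\<^sub>F \<sigma> :: real in at_right 0.
    \<forall>\<delta>. 0 < \<delta> \<and> \<delta> < \<delta>\<^sub>0 \<longrightarrow>
    (\<forall>\<epsilon>>0. \<exists>\<kappa> \<kappa>' C c :: real.
       0 < \<kappa> \<and> \<kappa> < 1 \<and> 0 < \<kappa>' \<and> \<kappa>' < 1 \<and> C > 0 \<and> c > 0 \<and>
       (\<forall>\<^sub>F T in at_right 0. \<exists>\<Omega>\<^sub>T \<in> sets M.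
          measure M (space M - \<Omega>\<^sub>T) < exp (- c * T powr (- \<kappa>')) \<and>
          (\<forall>\<omega>\<in>\<Omega>\<^sub>T. \<forall>v B :: real \<Rightarrow> real ^ 'd \<Rightarrow> complex.
             spacetime_function v \<and> locally_integrable_in_time v \<and>
             spacetime_function B \<and> tempered_in_time B \<longrightarrow>
             ennreal (cmod (\<integral>(t, x).
                 complex_of_real ((\<psi> t)\<^sup>2) *
                 cnj (indicator {-T..T} t *
                      schroedinger (\<lambda>n. data_coeff a \<delta> n * g n \<omega>) t x * v t x) *
                 B t x \<partial>spacetime))
             \<le> ennreal (C * T powr \<kappa>) *
                sobolev_norm (\<epsilon> - \<sigma>) (data_coeff a \<delta> :: int ^ 'd \<Rightarrow> complex) *
                Z_norm \<eta> \<psi> \<psi>' \<sigma> 0 v *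
                besov_t \<eta> (1 / r0_exp TYPE('d) \<sigma>2 \<sigma>3 - 1 / q0_exp TYPE('d) \<sigma>3)
                  (r0_exp TYPE('d) \<sigma>2 \<sigma>3) (ennreal (r0_exp TYPE('d) \<sigma>2 \<sigma>3))
                  (besov_x (theta_exp TYPE('d) \<sigma>2 \<sigma>3) (r0_exp TYPE('d) \<sigma>2 \<sigma>3) \<infinity>) B)))"
proof -
  let ?d = "real CARD('d)"
  have d: "1 \<le> ?d" using one_le_card_finite[where 'a='d] by simp
  \<comment> \<open>The loss \<open>\<delta>\<close> is below \<open>s_crit / 2\<close>, so the data retain more than this regularity.\<close>
  define \<gamma> where "\<gamma> = s_crit TYPE('d) a / 4"
  have \<gamma>: "0 < \<gamma>" using assms(2) by (simp add: \<gamma>_def)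
  define regularity where "regularity \<sigma>2 \<sigma>3 = min (theta_exp TYPE('d) \<sigma>2 \<sigma>3) (1 / r0_exp TYPE('d) \<sigma>2 \<sigma>3 - 1 / q0_exp TYPE('d) \<sigma>3)" for \<sigma>2 \<sigma>3
  \<comment> \<open>The regularity of the product: small enough for the crude Bernstein inequality in both factors. The loss \<open>\<sigma>\<close> is then chosen below half of it.\<close>
  define s where "s \<sigma>2 \<sigma>3 = min 1 (min (\<gamma> / 2) (regularity \<sigma>2 \<sigma>3 / 2) / (2 * (?d + 1)))" for \<sigma>2 \<sigma>3
  have r0_inv: "1 / r0_exp TYPE('d) \<sigma>2 \<sigma>3 = (2 + \<sigma>3 + \<sigma>2) / (?d + 2)" for \<sigma>2 \<sigma>3
    by (simp add: r0_exp_def)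
  have q0_inv: "1 / q0_exp TYPE('d) \<sigma>3 = (2 + \<sigma>3) / (?d + 2)" for \<sigma>3
    by (simp add: q0_exp_def)
  have \<theta>_eq: "theta_exp TYPE('d) \<sigma>2 \<sigma>3 = \<sigma>3 + ?d * \<sigma>2 / (?d + 2)" for \<sigma>2 \<sigma>3
  proof -
    have "theta_exp TYPE('d) \<sigma>2 \<sigma>3 = 2 * (1 / q0_exp TYPE('d) \<sigma>3) + ?d * (1 / r0_exp TYPE('d) \<sigma>2 \<sigma>3) - 2"
      by (simp add: theta_exp_def)
    also have "\<dots> = \<sigma>3 + ?d * \<sigma>2 / (?d + 2)"
    proof -
      have "2 * ((2 + \<sigma>3) / D) + (D - 2) * ((2 + \<sigma>3 + \<sigma>2) / D) - 2 = \<sigma>3 + (D - 2) * \<sigma>2 / D" if "D \<noteq> 0" for D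
        using that by (simp add: field_simps)
      from this[of "?d + 2"] show ?thesis unfolding q0_inv r0_inv using d by simp
    qed
    finally show ?thesis .
  qed
  have \<theta>: "0 < theta_exp TYPE('d) \<sigma>2 \<sigma>3" and \<tau>: "0 < 1 / r0_exp TYPE('d) \<sigma>2 \<sigma>3 - 1 / q0_exp TYPE('d) \<sigma>3"
    if "0 < \<sigma>3" "0 < \<sigma>2" for \<sigma>2 \<sigma>3
    unfolding \<theta>_eq r0_inv q0_inv using that d by (simp_all add: add_pos_pos diff_divide_distrib[symmetric])
  have s_pos: "0 < s \<sigma>2 \<sigma>3" if "0 < \<sigma>3" "0 < \<sigma>2" for \<sigma>2 \<sigma>3
    unfolding s_def regularity_def using \<theta>[OF that] \<tau>[OF that] \<gamma> d by simp

  have claim: "\<exists>\<kappa> \<kappa>' C c :: real.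
       0 < \<kappa> \<and> \<kappa> < 1 \<and> 0 < \<kappa>' \<and> \<kappa>' < 1 \<and> C > 0 \<and> c > 0 \<and>
       (\<forall>\<^sub>F T in at_right 0. \<exists>\<Omega>\<^sub>T \<in> sets M.
          measure M (space M - \<Omega>\<^sub>T) < exp (- c * T powr (- \<kappa>')) \<and>
          (\<forall>\<omega>\<in>\<Omega>\<^sub>T. \<forall>v B :: real \<Rightarrow> real ^ 'd \<Rightarrow> complex.
             spacetime_function v \<and> locally_integrable_in_time v \<and>
             spacetime_function B \<and> tempered_in_time B \<longrightarrow>
             ennreal (cmod (\<integral>(t, x).
                 complex_of_real ((\<psi> t)\<^sup>2) *
                 cnj (indicator {-T..T} t *
                      schroedinger (\<lambda>n. data_coeff a \<delta> n * g n \<omega>) t x * v t x) *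
                 B t x \<partial>spacetime))
             \<le> ennreal (C * T powr \<kappa>) *
                sobolev_norm (\<epsilon> - \<sigma>) (data_coeff a \<delta> :: int ^ 'd \<Rightarrow> complex) *
                Z_norm \<eta> \<psi> \<psi>' \<sigma> 0 v *
                besov_t \<eta> (1 / r0_exp TYPE('d) \<sigma>2 \<sigma>3 - 1 / q0_exp TYPE('d) \<sigma>3)
                  (r0_exp TYPE('d) \<sigma>2 \<sigma>3) (ennreal (r0_exp TYPE('d) \<sigma>2 \<sigma>3))
                  (besov_x (theta_exp TYPE('d) \<sigma>2 \<sigma>3) (r0_exp TYPE('d) \<sigma>2 \<sigma>3) \<infinity>) B))"
    if \<sigma>3: "0 < \<sigma>3" "\<sigma>3 < 1 / 4" and \<sigma>2: "0 < \<sigma>2" "\<sigma>2 < 1 / 4"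
      and \<sigma>: "0 < \<sigma>" "\<sigma> < min (1 / 8) (s \<sigma>2 \<sigma>3 / 2)"
      and \<delta>: "0 < \<delta>" "\<delta> < s_crit TYPE('d) a / 2" for \<sigma>3 \<sigma>2 \<sigma> \<delta> \<epsilon>
  proof -
    define p where "p = p_exp TYPE('d) \<sigma>"
    define r where "r = r0_exp TYPE('d) \<sigma>2 \<sigma>3"
    define \<tau>' where "\<tau>' = 1 / r0_exp TYPE('d) \<sigma>2 \<sigma>3 - 1 / q0_exp TYPE('d) \<sigma>3"
    define \<theta>' where "\<theta>' = theta_exp TYPE('d) \<sigma>2 \<sigma>3"
    define s' where "s' = s \<sigma>2 \<sigma>3"
    \<comment> \<open>The exponent left over for the window and for the random series, in equal shares.\<close>
    define m where "m = 2 / (1 - 1 / p - 1 / r)"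
    have p_inv: "1 / p = (?d / 2 - \<sigma>) / (?d + 2)" by (simp add: p_def p_exp_def)
    have pos: "0 < ?d / 2 - \<sigma>" using d \<sigma> by linarith
    have p: "0 < p" unfolding p_def p_exp_def using pos d by (intro divide_pos_pos) auto
    have "2 + \<sigma>3 + \<sigma>2 < ?d + 2" using d \<sigma>2 \<sigma>3 by linarith
    then have r: "1 < r" unfolding r_def r0_exp_def using \<sigma>2 \<sigma>3 by (simp add: less_divide_eq)
    have rest: "1 - 1 / p - 1 / r = (?d / 2 + \<sigma> - \<sigma>3 - \<sigma>2) / (?d + 2)"
    proof -
      have "1 - x / D - y / D = (D - x - y) / D" if "D \<noteq> 0" for x y D :: real
        using that by (simp add: diff_divide_distrib)
      from this[of "?d + 2" "?d / 2 - \<sigma>" "2 + \<sigma>3 + \<sigma>2"]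
      have "1 - 1 / p - 1 / r = (?d + 2 - (?d / 2 - \<sigma>) - (2 + \<sigma>3 + \<sigma>2)) / (?d + 2)"
        unfolding p_inv r_def r0_inv using d by simp
      also have "?d + 2 - (?d / 2 - \<sigma>) - (2 + \<sigma>3 + \<sigma>2) = ?d / 2 + \<sigma> - \<sigma>3 - \<sigma>2" by simp
      finally show ?thesis .
    qed
    have rest_pos: "0 < 1 - 1 / p - 1 / r"
      unfolding rest using d \<sigma> \<sigma>2 \<sigma>3 by (intro divide_pos_pos) linarith+
    have "0 < 1 / p" "0 < 1 / r" using p r by auto
    then have "1 - 1 / p - 1 / r < 1" by linarith
    then have m: "2 < m" unfolding m_def using divide_strict_left_mono[of "1 - 1 / p - 1 / r" 1 2] rest_pos by simp
    have m_inv: "1 / m = (1 - 1 / p - 1 / r) / 2" by (simp add: m_def)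
    have exponents: "1 / p + 1 / m + 1 / m + 1 / r = 1" unfolding m_inv by (simp add: field_simps)
    have s: "0 < s'" "s' \<le> 1" "(?d + 1) * s' < \<gamma> / 2" "(?d + 1) * s' < min \<theta>' \<tau>' / 2"
    proof -
      let ?w = "min (\<gamma> / 2) (regularity \<sigma>2 \<sigma>3 / 2)"
      show "0 < s'" "s' \<le> 1" using s_pos \<sigma>2 \<sigma>3 by (auto simp: s'_def s_def)
      have w: "0 < ?w" using \<gamma> \<theta>[OF \<sigma>3(1) \<sigma>2(1)] \<tau>[OF \<sigma>3(1) \<sigma>2(1)] by (simp add: regularity_def)
      have "(?d + 1) * s' \<le> (?d + 1) * (?w / (2 * (?d + 1)))"
        using d by (intro mult_left_mono) (auto simp: s'_def s_def)
      also have "\<dots> = ?w / 2" using d by (simp add: field_simps)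
      finally have "(?d + 1) * s' < ?w" using w by linarith
      then show "(?d + 1) * s' < \<gamma> / 2" "(?d + 1) * s' < min \<theta>' \<tau>' / 2"
        by (auto simp: regularity_def \<theta>'_def \<tau>'_def)
    qed
    define V where "V = data_variance TYPE('d) (s_crit TYPE('d) a - \<delta>)"
    interpret gaussian_series M g "data_coeff a \<delta>" \<gamma> V
    proof (intro gaussian_series.intro gaussian_family.intro gaussian_family_axioms.intro gaussian_series_axioms.intro assms)
      show "0 < \<gamma>" by (rule \<gamma>)
      show "(\<Sum>n\<in>(shell j :: (int ^ 'd) set). (2 powr (\<gamma> * real j) * cmod (data_coeff a \<delta> n))\<^sup>2) \<le> V" for j
        unfolding V_def using \<delta> assms(2) by (intro data_coeff_variance \<gamma>) (auto simp: \<gamma>_def)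
    qed
    have cutoffs: "time_cutoffs \<psi> \<psi>'" by (intro time_cutoffs.intro assms)
    interpret cut: time_cutoffs \<psi> \<psi>' by (rule cutoffs)
    \<comment> \<open>The window yields \<open>T\<^sup>1\<^sup>/\<^sup>m\<close>; half of it is spent on the level \<open>T\<^sup>-\<^sup>\<kappa>\<close> of the good set and half is kept.\<close>
    define \<kappa> where "\<kappa> = 1 / (2 * m)"
    have \<kappa>: "0 < \<kappa>" "\<kappa> < 1" using m by (auto simp: \<kappa>_def divide_less_eq)
    define C where "C = 1 + \<bar>estimate_const \<sigma> m r (min \<theta>' \<tau>') s' cut.C\<psi>\<bar>"
    have C: "0 < C" by (simp add: C_def)
    define A where "A = 8 * torus_volume TYPE('d) * exp V"
    have A: "0 < A" using torus_volume_ge_1[where 'd='d] by (simp add: A_def)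
    have "\<forall>\<^sub>F T :: real in at_right 0. 0 < T \<and> T < 1 \<and> max m (2 * ln A) < T powr (- \<kappa>)"
      by (rule eventually_powr_minus_gt[OF \<kappa>(1)])
    then have "\<forall>\<^sub>F T in at_right 0. \<exists>\<Omega>\<^sub>T \<in> sets M.
          measure M (space M - \<Omega>\<^sub>T) < exp (- (1 / 2) * T powr (- \<kappa>)) \<and>
          (\<forall>\<omega>\<in>\<Omega>\<^sub>T. \<forall>v B :: real \<Rightarrow> real ^ 'd \<Rightarrow> complex.
             spacetime_function v \<and> locally_integrable_in_time v \<and>
             spacetime_function B \<and> tempered_in_time B \<longrightarrow>
             ennreal (cmod (\<integral>(t, x).
                 complex_of_real ((\<psi> t)\<^sup>2) *
                 cnj (indicator {-T..T} t *
                      schroedinger (\<lambda>n. data_coeff a \<delta> n * g n \<omega>) t x * v t x) *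
                 B t x \<partial>spacetime))
             \<le> ennreal (C * T powr \<kappa>) *
                sobolev_norm (\<epsilon> - \<sigma>) (data_coeff a \<delta> :: int ^ 'd \<Rightarrow> complex) *
                Z_norm \<eta> \<psi> \<psi>' \<sigma> 0 v * besov_t \<eta> \<tau>' r (ennreal r) (besov_x \<theta>' r \<infinity>) B)"
    proof eventually_elim
      case (elim T)
      define l where "l = T powr (- \<kappa>)"
      have T: "0 < T" "T \<le> 1" and l: "m \<le> l" "2 * ln A < l" using elim by (auto simp: l_def)
      show ?case
      proof (intro bexI[of _ "good l"] conjI ballI allI impI good_sets)
        have "A < exp (l / 2)" using l(2) A by (subst ln_less_cancel_iff[symmetric]) auto
        then have "A * exp (- l) < exp (l / 2) * exp (- l)" by (intro mult_strict_right_mono) auto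
        also have "\<dots> = exp (- (1 / 2) * l)" by (simp add: exp_add[symmetric])
        finally show "measure M (space M - good l) < exp (- (1 / 2) * T powr (- \<kappa>))"
          using measure_not_good[of l] by (simp add: A_def l_def)
      next
        fix \<omega> and v B :: "real \<Rightarrow> real ^ 'd \<Rightarrow> complex"
        assume \<omega>: "\<omega> \<in> good l" and vB: "spacetime_function v \<and> locally_integrable_in_time v \<and> spacetime_function B \<and> tempered_in_time B"
        let ?S = "sobolev_norm (\<epsilon> - \<sigma>) (data_coeff a \<delta> :: int ^ 'd \<Rightarrow> complex)"
        let ?Z = "Z_norm \<eta> \<psi> \<psi>' \<sigma> 0 v" and ?b = "besov_t \<eta> \<tau>' r (ennreal r) (besov_x \<theta>' r \<infinity>) B"
        have v: "jointly_measurable v" "locally_integrable_in_time v" and B: "jointly_measurable B" "tempered_in_time B"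
          using vB by (auto simp: spacetime_function_def)
        have "T powr (1 / m) * l = T powr \<kappa>" unfolding l_def powr_add[symmetric] by (simp add: \<kappa>_def field_simps)
        then have K: "(1 + \<bar>estimate_const \<sigma> m r (min \<theta>' \<tau>') s' cut.C\<psi>\<bar>) * (T powr (1 / m) * l) = C * T powr \<kappa>"
          by (simp add: C_def)
        have blocks: "Lnorm p spacetime (\<lambda>(t, x). ennreal (cmod (P_dy j (cut.windowed v t) x))) \<le> ennreal (2 powr (real j * \<sigma>)) * (ennreal cut.C\<psi> * ?Z)" for j
          unfolding p_def by (rule cut.Lnorm_P_dy_windowed_le[OF v(1)]) (use \<sigma> in auto)
        have "ennreal (cmod (\<integral>(t, x). complex_of_real ((\<psi> t)\<^sup>2) * cnj (indicator {-T..T} t * schroedinger (\<lambda>n. data_coeff a \<delta> n * g n \<omega>) t x * v t x) * B t x \<partial>spacetime))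
            \<le> ennreal (C * T powr \<kappa>) * ?Z * ?b"
          unfolding K[symmetric]
        proof (rule random_trilinear_estimate[OF cutoffs assms(12) v B r _ _ _ p exponents s _ T(1) T(2) l(1) \<omega> blocks cut.C\<psi>(1)])
          show "0 < \<theta>'" "0 < \<tau>'" using \<theta> \<tau> \<sigma>2 \<sigma>3 by (auto simp: \<theta>'_def \<tau>'_def)
          show "1 < m" using m by simp
          show "\<sigma> < s' / 2" using \<sigma> by (simp add: s'_def)
        qed
        also have "\<dots> \<le> ennreal (C * T powr \<kappa>) * ?S * ?Z * ?b"
        proof (intro mult_right_mono)
          have "ennreal (C * T powr \<kappa>) * 1 \<le> ennreal (C * T powr \<kappa>) * ?S"
            by (intro mult_left_mono sobolev_norm_data_ge_1) auto
          then show "ennreal (C * T powr \<kappa>) \<le> ennreal (C * T powr \<kappa>) * ?S" by simp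
        qed auto
        finally show "ennreal (cmod (\<integral>(t, x). complex_of_real ((\<psi> t)\<^sup>2) * cnj (indicator {-T..T} t * schroedinger (\<lambda>n. data_coeff a \<delta> n * g n \<omega>) t x * v t x) * B t x \<partial>spacetime))
            \<le> ennreal (C * T powr \<kappa>) * ?S * ?Z * ?b" .
      qed
    qed
    then show ?thesis
      unfolding \<tau>'_def \<theta>'_def r_def using \<kappa> C
      by (intro exI[of _ \<kappa>] exI[of _ C] exI[of _ "1 / 2 :: real"] conjI) auto
  qed
  show ?thesis
    \<comment> \<open>The thresholds of the nested quantifiers, from the outside in.\<close>
    apply (rule exI[of _ "s_crit TYPE('d) a / 2"], rule conjI)
    subgoal using assms(2) by simp
    apply (rule always_eventually, rule allI)
    apply (rule eventually_at_rightI[of 0 "1 / 4"])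
     apply (rule eventually_at_rightI[of 0 "1 / 4"])
      apply (rule always_eventually, rule allI)
      subgoal for \<sigma>4 \<sigma>3 \<sigma>2 \<sigma>1
        apply (rule eventually_at_rightI[of 0 "min (1 / 8) (s \<sigma>2 \<sigma>3 / 2)"])
        subgoal for \<sigma>
          by (intro allI impI claim) auto
        subgoal using s_pos[of \<sigma>3 \<sigma>2] by simp
        done
     apply simp_all
    done
qed

end
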